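(* Let $p$ be a prime, $q=p^e$ with $e\ge1$, let $R$ be a normal integral $F$-finite $\mathbb F_p$-algebra with field of fractions $K$, and let $\phi\colon F^e_*R\to R$ be a surjective $R$-linear map. Let $R\subset S$ be a finite extension with $S$ a normal integral domain with field of fractions $L$, and let $\psi\colon F^e_*S\to S$ be an $S$-linear map extending $\phi$ (which forces $L/K$ to be separable); let $\mathrm{Tr}\colon S\to R$ be the restriction of $\mathrm{Tr}_{L/K}$. Then the following statements are equivalent: (a) $S/R$ is tamely ramified over every $\mathfrak p\in\mathrm{Schpec}(R,\phi)$. (b) $(R,\phi)\subset(S,\psi)$ is fibered and $\mathrm{Tr}(\tau_{\mathfrak q}(S,\psi))=\tau_{\mathfrak q\cap R}(R,\phi)$ for all $\mathfrak q\in\mathrm{Schpec}(S,\psi)$. (c) $(R,\phi)\subset(S,\psi)$ is fibered and $\mathrm{Tr}(\tau_{\mathfrak q}(S,\psi))=\tau_{\mathfrak q\cap R}(R,\phi)$ for all $\mathfrak q\in\mathrm{Schpec}(S,\psi)$ of height $\ge2$. These conditions imply that $\mathrm{Tr}\colon S\to R$ is surjective, and the converse holds if $L/K$ is Galois.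
   Context: All rings are noetherian. $F^e_*R$ is $R$ viewed as an $R$-module via the $e$-th Frobenius $r\mapsto r^q$; $R$ is $F$-finite if $F_*R$ is finitely generated. "$\psi$ extends $\phi$" means $\psi(F^e_*r)=\phi(F^e_*r)$ for all $r\in R$. A $\phi$-ideal is an ideal $\mathfrak a\subset R$ with $\phi(F^e_*\mathfrak a)\subset\mathfrak a$. $\mathrm{Schpec}(R,\phi)$ is the set of centers of $F$-purity of $(R,\phi)$: prime $\phi$-ideals $\mathfrak p$ with $\phi(F^e_*R)\not\subset\mathfrak p$ (the latter is automatic here since $\phi$ is surjective). For $\mathfrak p\in\mathrm{Schpec}(R,\phi)$, the test ideal along $\mathfrak p$, $\tau_{\mathfrak p}(R,\phi)$, is the smallest $\phi$-ideal of $R$ not contained in $\mathfrak p$ (it exists). Same notions for $(S,\psi)$. Fibered: $(R,\phi)\subset(S,\psi)$ is fibered if $\mathrm{Schpec}(S,\psi)=\{\mathfrak q\in\operatorname{Spec}S\mid \mathfrak q\cap R\in\mathrm{Schpec}(R,\phi)\}$. (This is one of several equivalent conditions defining "fibered" in this setting.) Tame ramification: for $\mathfrak p\in\operatorname{Spec}R$ set $\mathfrak p^{\mathrm{Tr}}=\{s\in S\mid\mathrm{Tr}(sS)\subset\mathfrak p\}$; $S/R$ is tamely ramified over $\mathfrak p$ if $\mathfrak p^{\mathrm{Tr}}=\sqrt{\mathfrak pS}$. *)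

theory Defs
  imports "HOL-Algebra.Algebra" "HOL-Library.Extended_Nat"
begin

text \<open>
  All rings and fields of the statement are carried by subsets of one ambient field \<open>L\<close>:
  a subring \<open>A\<close> of \<open>L\<close> is the structure \<open>L\<lparr>carrier := A\<rparr>\<close>, as in \<^const>\<open>subring\<close>.
\<close>

text \<open>A ring as a module over itself, or over any of its subrings.\<close>

definition mult_module :: "('a, 'm) ring_scheme \<Rightarrow> ('a, 'a) module"
  where "mult_module B =
    \<lparr>carrier = carrier B, monoid.mult = monoid.mult B, one = one B, ring.zero = ring.zero B, add = add B,
     smult = (\<lambda>r x. r \<otimes>\<^bsub>B\<^esub> x)\<rparr>"

text \<open>
  The module \<open>F\<^sup>e\<^sub>*A\<close>, for \<open>q = p\<^sup>e\<close>: the elements are those of \<open>A\<close> (the decoration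
  \<open>F\<^sup>e\<^sub>*r\<close> is dropped), and \<open>r\<close> acts as multiplication by \<open>r\<^sup>q\<close>.
\<close>

definition frobenius_pushforward :: "nat \<Rightarrow> ('a, 'm) ring_scheme \<Rightarrow> ('a, 'a) module"
  where "frobenius_pushforward q A =
    \<lparr>carrier = carrier A, monoid.mult = monoid.mult A, one = one A, ring.zero = ring.zero A, add = add A,
     smult = (\<lambda>r x. (r [^]\<^bsub>A\<^esub> q) \<otimes>\<^bsub>A\<^esub> x)\<rparr>"

definition finitely_generated_module :: "('r, 'm) ring_scheme \<Rightarrow> ('r, 'x, 'n) module_scheme \<Rightarrow> bool"
  where "finitely_generated_module A M \<longleftrightarrow>
    (\<exists>G \<subseteq> carrier M. finite G \<and>
      carrier M = {(\<Oplus>\<^bsub>M\<^esub>x\<in>G. c x \<odot>\<^bsub>M\<^esub> x) | c. c \<in> G \<rightarrow> carrier A})"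

definition linear_maps ::
    "('r, 'm) ring_scheme \<Rightarrow> ('r, 'x, 'n) module_scheme \<Rightarrow> ('r, 'y, 'k) module_scheme \<Rightarrow> ('x \<Rightarrow> 'y) set"
  where "linear_maps A M N =
    {f \<in> carrier M \<rightarrow> carrier N.
       (\<forall>x\<in>carrier M. \<forall>y\<in>carrier M. f (x \<oplus>\<^bsub>M\<^esub> y) = f x \<oplus>\<^bsub>N\<^esub> f y) \<and>
       (\<forall>r\<in>carrier A. \<forall>x\<in>carrier M. f (r \<odot>\<^bsub>M\<^esub> x) = r \<odot>\<^bsub>N\<^esub> f x)}"

definition F_finite :: "nat \<Rightarrow> ('a, 'm) ring_scheme \<Rightarrow> bool"
  where "F_finite p A \<longleftrightarrow> finitely_generated_module A (frobenius_pushforward p A)"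

definition fraction_field_in :: "('a, 'm) ring_scheme \<Rightarrow> 'a set \<Rightarrow> 'a set"
  where "fraction_field_in L A = {a \<otimes>\<^bsub>L\<^esub> inv\<^bsub>L\<^esub> b | a b. a \<in> A \<and> b \<in> A \<and> b \<noteq> \<zero>\<^bsub>L\<^esub>}"

text \<open>Polynomials of HOL-Algebra are coefficient lists, the leading coefficient first.\<close>

definition integral_over :: "('a, 'm) ring_scheme \<Rightarrow> 'a set \<Rightarrow> 'a \<Rightarrow> bool"
  where "integral_over L A x \<longleftrightarrow>
    (\<exists>f \<in> carrier (A[X]\<^bsub>L\<^esub>). f \<noteq> [] \<and> hd f = \<one>\<^bsub>L\<^esub> \<and> ring.eval L f x = \<zero>\<^bsub>L\<^esub>)"

definition normal_subring :: "('a, 'm) ring_scheme \<Rightarrow> 'a set \<Rightarrow> bool"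
  where "normal_subring L A \<longleftrightarrow> (\<forall>x \<in> fraction_field_in L A. integral_over L A x \<longrightarrow> x \<in> A)"

definition is_basis :: "('a, 'm) ring_scheme \<Rightarrow> 'a set \<Rightarrow> 'a list \<Rightarrow> bool"
  where "is_basis L K us \<longleftrightarrow>
    set us \<subseteq> carrier L \<and> ring.independent L K us \<and> ring.Span L K us = carrier L"

definition coordinates :: "('a, 'm) ring_scheme \<Rightarrow> 'a set \<Rightarrow> 'a list \<Rightarrow> 'a \<Rightarrow> 'a list"
  where "coordinates L K us x =
    (THE ks. set ks \<subseteq> K \<and> length ks = length us \<and> ring.combine L ks us = x)"

text \<open>
  \<open>Tr\<^bsub>L/K\<^esub> x\<close>: the trace of the matrix of multiplication by \<open>x\<close> in some (equivalently, any)
  \<open>K\<close>-basis of \<open>L\<close>. Unspecified if \<open>L\<close> is not finite-dimensional over \<open>K\<close>.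
\<close>

definition field_trace :: "('a, 'm) ring_scheme \<Rightarrow> 'a set \<Rightarrow> 'a \<Rightarrow> 'a"
  where "field_trace L K x =
    (let us = (SOME us. is_basis L K us)
     in \<Oplus>\<^bsub>L\<^esub>i\<in>{..<length us}. coordinates L K us (x \<otimes>\<^bsub>L\<^esub> us ! i) ! i)"

definition finite_galois :: "('a, 'm) ring_scheme \<Rightarrow> 'a set \<Rightarrow> bool"
  where "finite_galois L K \<longleftrightarrow>
    subfield K L \<and> ring.finite_dimension L K (carrier L) \<and>
    {x \<in> carrier L. \<forall>\<sigma> \<in> ring_iso L L. (\<forall>k\<in>K. \<sigma> k = k) \<longrightarrow> \<sigma> x = x} = K"

definition radical :: "('a, 'm) ring_scheme \<Rightarrow> 'a set \<Rightarrow> 'a set"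
  where "radical A I = {x \<in> carrier A. \<exists>n::nat. x [^]\<^bsub>A\<^esub> n \<in> I}"

definition height :: "('a, 'm) ring_scheme \<Rightarrow> 'a set \<Rightarrow> enat"
  where "height A \<qq> =
    Sup {enat n | n. \<exists>c :: nat \<Rightarrow> 'a set.
      (\<forall>i\<le>n. primeideal (c i) A) \<and> (\<forall>i<n. c i \<subset> c (Suc i)) \<and> c n = \<qq>}"

definition phi_ideal :: "('a, 'm) ring_scheme \<Rightarrow> ('a \<Rightarrow> 'a) \<Rightarrow> 'a set \<Rightarrow> bool"
  where "phi_ideal A \<phi> \<aa> \<longleftrightarrow> ideal \<aa> A \<and> \<phi> ` \<aa> \<subseteq> \<aa>"

definition Schpec :: "('a, 'm) ring_scheme \<Rightarrow> ('a \<Rightarrow> 'a) \<Rightarrow> 'a set set"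
  where "Schpec A \<phi> = {\<pp>. primeideal \<pp> A \<and> phi_ideal A \<phi> \<pp> \<and> \<not> \<phi> ` carrier A \<subseteq> \<pp>}"

text \<open>Sets are ordered by inclusion, so \<open>LEAST\<close> is the smallest such ideal (when it exists).\<close>

definition test_ideal_along :: "('a, 'm) ring_scheme \<Rightarrow> ('a \<Rightarrow> 'a) \<Rightarrow> 'a set \<Rightarrow> 'a set"
  where "test_ideal_along A \<phi> \<pp> = (LEAST \<aa>. phi_ideal A \<phi> \<aa> \<and> \<not> \<aa> \<subseteq> \<pp>)"

definition fibered ::
    "('a, 'm) ring_scheme \<Rightarrow> ('a \<Rightarrow> 'a) \<Rightarrow> ('a, 'm) ring_scheme \<Rightarrow> ('a \<Rightarrow> 'a) \<Rightarrow> bool"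
  where "fibered A \<phi> B \<psi> \<longleftrightarrow>
    Schpec B \<psi> = {\<qq>. primeideal \<qq> B \<and> \<qq> \<inter> carrier A \<in> Schpec A \<phi>}"

definition trace_ideal :: "('a, 'm) ring_scheme \<Rightarrow> ('a \<Rightarrow> 'a) \<Rightarrow> 'a set \<Rightarrow> 'a set"
  where "trace_ideal B Tr \<pp> = {s \<in> carrier B. \<forall>t \<in> carrier B. Tr (s \<otimes>\<^bsub>B\<^esub> t) \<in> \<pp>}"

definition tamely_ramified_over :: "('a, 'm) ring_scheme \<Rightarrow> ('a \<Rightarrow> 'a) \<Rightarrow> 'a set \<Rightarrow> bool"
  where "tamely_ramified_over B Tr \<pp> \<longleftrightarrow> trace_ideal B Tr \<pp> = radical B (Idl\<^bsub>B\<^esub> \<pp>)"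

end

theory Submission imports Defs
begin

text \<open>
  For a prime \<open>P\<close> of \<open>R\<close> let \<open>P\<^sup>T\<^sup>r\<close> (\<open>trace_colon P\<close>) be the ideal of all \<open>s \<in> S\<close> with \<open>Tr (s S) \<subseteq> P\<close>. The reason for the theorem is that the
  trace commutes with the given maps, \<open>Tr \<circ> \<psi> = \<phi> \<circ> Tr\<close> (\<open>psi_Tr\<close>). Hence \<open>Tr I\<close> is a \<open>\<phi>\<close>-ideal for every \<open>\<psi>\<close>-ideal \<open>I\<close>
  (\<open>trace_image_compatible\<close>), and \<open>P\<^sup>T\<^sup>r\<close> is a \<open>\<psi>\<close>-ideal for every \<open>\<phi>\<close>-ideal \<open>P\<close> (\<open>trace_colon_compatible\<close>). Such ideals are radical because
  \<open>\<phi>\<close> and \<open>\<psi>\<close> are surjective, and they are called compatible below. It follows that \<open>\<surd>(P S) \<subseteq> P\<^sup>T\<^sup>r\<close> always holds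
  (\<open>radical_subset_trace_colon\<close>), and \<open>Tr \<tau>\<^sub>Q \<subseteq> \<tau>\<^bsub>Q \<inter> R\<^esub>\<close> as well (\<open>trace_test_ideal_subset\<close>). Since \<open>\<surd>(P S)\<close> is the intersection of the
  primes over \<open>P\<close> (\<open>radical_of_extended\<close>, where normality of \<open>R\<close> is used), tameness over \<open>P\<close> says that \<open>P\<^sup>T\<^sup>r \<subseteq> Q\<close> for every prime \<open>Q\<close> of \<open>S\<close>
  over \<open>P\<close>.

  From (a) to (b): between \<open>P\<^sup>T\<^sup>r\<close> and such a \<open>Q\<close> there is a center, which equals \<open>Q\<close> by incomparability, so the extension is fibered
  (\<open>tame_imp_fibers\<close>). Moreover \<open>\<tau>\<^sub>Q\<close> is not contained in \<open>Q\<close>, hence not in \<open>P\<^sup>T\<^sup>r\<close>, so \<open>Tr \<tau>\<^sub>Q\<close> is a \<open>\<phi>\<close>-ideal not contained in \<open>P\<close> and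
  therefore contains \<open>\<tau>\<^sub>P\<close> (\<open>tame_imp_trace\<close>).

  From (c) to (a): if \<open>P\<^sup>T\<^sup>r\<close> is not contained in \<open>Q\<close>, then \<open>\<tau>\<^sub>Q \<subseteq> P\<^sup>T\<^sup>r\<close> by minimality, so \<open>Tr \<tau>\<^sub>Q \<subseteq> P\<close>, and \<open>Tr \<tau>\<^sub>Q\<close> cannot be \<open>\<tau>\<^sub>P\<close>
  (\<open>trace_fiber\<close>). This settles primes \<open>Q\<close> of height at least two. For \<open>Q = 0\<close> the claim is that the trace form is non-degenerate.
  For \<open>Q\<close> of height one, being a center already suffices (\<open>trace_colon_height_one\<close>). The localisations at \<open>P\<close> and \<open>Q\<close> are discrete
  valuation rings, and the inverse different is controlled by the facts that \<open>\<psi>\<close> preserves \<open>Q\<close> and that surjectivity of \<open>\<phi>\<close> allows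
  only poles of order less than \<open>q\<close>. The argument iterates one inequality along powers of \<open>q\<close> and uses that an element
  whose \<open>q\<^sup>k\<close>-th powers have a common denominator is integral (\<open>almost_integral\<close>); ramification indices do not appear.

  If \<open>Tr\<close> were not onto, a center \<open>P\<close> would contain \<open>Tr S\<close>, and \<open>1 \<in> P\<^sup>T\<^sup>r\<close> contradicts (a). If \<open>L/K\<close> is Galois and \<open>Tr\<close> is onto,
  then \<open>P\<^sup>T\<^sup>r\<close> is Galois stable with \<open>P\<^sup>T\<^sup>r \<inter> K = P\<close>, and the polynomial whose roots are the conjugates of \<open>s \<in> P\<^sup>T\<^sup>r\<close> shows that a power
  of \<open>s\<close> lies in \<open>P S\<close> (\<open>galois_tame\<close>).

  Three inputs are established along the way. Test ideals exist because there are only finitely many centers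
  (\<open>finite_centers\<close>), so that intersecting centers gives the smallest compatible ideal not contained in \<open>P\<close>. The identity
  \<open>Tr \<circ> \<psi> = \<phi> \<circ> Tr\<close> holds because \<open>\<psi>\<close> extends to \<open>L\<close> and acts entrywise on matrices written in the \<open>q\<close>-th powers of a
  basis (\<open>Psi_Tr\<close>); these are a basis since the existence of \<open>\<psi>\<close> forces \<open>L/K\<close> to be separable (\<open>indep_frobenius\<close>). For the same
  reason the trace is not zero (\<open>Tr_functional\<close>).
\<close>

section \<open>Finite sums and elimination of unknowns\<close>

context ring begin

primrec nsum :: "(nat \<Rightarrow> 'a) \<Rightarrow> nat \<Rightarrow> 'a" where
  "nsum f 0 = \<zero>" |
  "nsum f (Suc n) = nsum f n \<oplus> f n"

lemma nsum_closed [simp]: "(\<And>i. i < n \<Longrightarrow> f i \<in> carrier R) \<Longrightarrow> nsum f n \<in> carrier R"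
  by (induction n) auto

lemma nsum_cong: "(\<And>i. i < n \<Longrightarrow> f i = g i) \<Longrightarrow> nsum f n = nsum g n"
  by (induction n) auto

lemma nsum_in:
  assumes "\<zero> \<in> N" "\<And>x y. x \<in> N \<Longrightarrow> y \<in> N \<Longrightarrow> x \<oplus> y \<in> N" "\<And>i. i < n \<Longrightarrow> f i \<in> N"
  shows "nsum f n \<in> N"
  using assms(3) by (induction n) (auto simp: assms(1,2))

lemma nsum_zero [simp]: "(\<And>i. i < n \<Longrightarrow> f i = \<zero>) \<Longrightarrow> nsum f n = \<zero>"
  by (induction n) auto

lemma nsum_add:
  "(\<And>i. i < n \<Longrightarrow> f i \<in> carrier R) \<Longrightarrow> (\<And>i. i < n \<Longrightarrow> g i \<in> carrier R) \<Longrightarrow>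
    nsum (\<lambda>i. f i \<oplus> g i) n = nsum f n \<oplus> nsum g n"
proof (induction n)
  case (Suc n)
  have c: "nsum f n \<in> carrier R" "nsum g n \<in> carrier R" "f n \<in> carrier R" "g n \<in> carrier R"
    using Suc.prems by auto
  show ?case using Suc c by (simp add: a_ac)
qed simp

lemma nsum_ldistr:
  "a \<in> carrier R \<Longrightarrow> (\<And>i. i < n \<Longrightarrow> f i \<in> carrier R) \<Longrightarrow>
    a \<otimes> nsum f n = nsum (\<lambda>i. a \<otimes> f i) n"
  by (induction n) (auto simp: r_distr)

lemma nsum_rdistr:
  "a \<in> carrier R \<Longrightarrow> (\<And>i. i < n \<Longrightarrow> f i \<in> carrier R) \<Longrightarrow>
    nsum f n \<otimes> a = nsum (\<lambda>i. f i \<otimes> a) n"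
  by (induction n) (auto simp: l_distr)

lemma nsum_neg:
  "(\<And>i. i < n \<Longrightarrow> f i \<in> carrier R) \<Longrightarrow> \<ominus> nsum f n = nsum (\<lambda>i. \<ominus> f i) n"
  by (induction n) (auto simp: minus_add)

lemma nsum_swap:
  "(\<And>i j. i < m \<Longrightarrow> j < n \<Longrightarrow> f i j \<in> carrier R) \<Longrightarrow>
    nsum (\<lambda>i. nsum (f i) n) m = nsum (\<lambda>j. nsum (\<lambda>i. f i j) m) n"
proof (induction m)
  case (Suc m)
  then show ?case by (simp add: nsum_add)
qed simp

lemma nsum_map:
  assumes "h \<zero> = \<zero>"
    "\<And>x y. x \<in> carrier R \<Longrightarrow> y \<in> carrier R \<Longrightarrow> h (x \<oplus> y) = h x \<oplus> h y"
  shows "(\<And>i. i < n \<Longrightarrow> f i \<in> carrier R) \<Longrightarrow> h (nsum f n) = nsum (\<lambda>i. h (f i)) n"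
  by (induction n) (auto simp: assms)

lemma nsum_delta:
  assumes "j < n" "a \<in> carrier R"
  shows "nsum (\<lambda>i. if i = j then a else \<zero>) n = a"
  using assms(1)
proof (induction n)
  case (Suc n)
  show ?case
  proof (cases "j = n")
    case True
    then show ?thesis using assms(2) by simp
  next
    case False
    then show ?thesis using Suc assms(2) by simp
  qed
qed simp

lemma nsum_finsum:
  "(\<And>i. i < n \<Longrightarrow> f i \<in> carrier R) \<Longrightarrow> (\<Oplus>i\<in>{..<n}. f i) = nsum f n"
proof (induction n)
  case (Suc n)
  have *: "(\<Oplus>i\<in>{..<Suc n}. f i) = f n \<oplus> (\<Oplus>i\<in>{..<n}. f i)"
    unfolding lessThan_Suc using Suc.prems by (subst finsum_insert) auto
  also have "\<dots> = nsum f n \<oplus> f n" using Suc by (simp add: a_comm)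
  finally show ?case by simp
qed simp

end

context cring begin

text \<open>Gaussian elimination without division: multiplying row \<open>i\<close> by the pivot \<open>A n n\<close> and subtracting a
  multiple of row \<open>n\<close> removes the unknown \<open>g n\<close>. This replaces Cramer's rule, hence determinants, in two
  arguments that differ only in what survives the multiplications. For integral dependence, \<open>M d\<close> is
  the set of monic polynomial values of degree \<open>d\<close> and \<open>I d\<close> the values of lower degree; for the lemma
  of Nakayama, \<open>M d\<close> is the complement of a prime and \<open>I d\<close> the prime itself.\<close>

lemma elimination:
  assumes M: "\<And>d. M d \<subseteq> carrier R" "\<And>d. I d \<subseteq> carrier R"
    and N: "N \<subseteq> carrier R" "\<zero> \<in> N" "\<And>x y. x \<in> N \<Longrightarrow> y \<in> N \<Longrightarrow> x \<oplus> y \<in> N"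
    "\<And>x. x \<in> N \<Longrightarrow> \<ominus> x \<in> N" "\<And>d a x. a \<in> M d \<union> I d \<Longrightarrow> x \<in> N \<Longrightarrow> a \<otimes> x \<in> N"
    and M0: "M 0 \<noteq> {}"
    and MM: "\<And>c d a b. a \<in> M c \<Longrightarrow> b \<in> M d \<Longrightarrow> a \<otimes> b \<in> M (c + d)"
    and MI: "\<And>c d a b. a \<in> M c \<Longrightarrow> b \<in> I d \<Longrightarrow> a \<otimes> b \<in> I (c + d)"
    and II: "\<And>c d a b. a \<in> I c \<Longrightarrow> b \<in> I d \<Longrightarrow> a \<otimes> b \<in> I (c + d)"
    and M_I: "\<And>d a b. a \<in> M d \<Longrightarrow> b \<in> I d \<Longrightarrow> a \<oplus> b \<in> M d"
    and I_I: "\<And>d a b. a \<in> I d \<Longrightarrow> b \<in> I d \<Longrightarrow> a \<oplus> b \<in> I d"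
    and I_neg: "\<And>d a. a \<in> I d \<Longrightarrow> \<ominus> a \<in> I d"
  shows "(\<And>i. i < n \<Longrightarrow> g i \<in> carrier R) \<Longrightarrow>
    (\<And>i. i < n \<Longrightarrow> A i i \<in> M d) \<Longrightarrow>
    (\<And>i j. i < n \<Longrightarrow> j < n \<Longrightarrow> i \<noteq> j \<Longrightarrow> A i j \<in> I d) \<Longrightarrow>
    (\<And>i. i < n \<Longrightarrow> nsum (\<lambda>j. A i j \<otimes> g j) n \<in> N) \<Longrightarrow>
    \<exists>d'. \<exists>m \<in> M d'. \<forall>i<n. m \<otimes> g i \<in> N"
proof (induction n arbitrary: A d)
  case 0
  then show ?case using M0 by auto
next
  case (Suc n)
  have g: "g i \<in> carrier R" if "i < Suc n" for i using Suc.prems(1) that .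
  have Ac: "A i j \<in> carrier R" if "i < Suc n" "j < Suc n" for i j
    using Suc.prems(2,3) that M by (cases "i = j") blast+
  have Nc: "x \<in> N \<Longrightarrow> x \<in> carrier R" for x using N(1) by blast
  let ?B = "\<lambda>i j. A n n \<otimes> A i j \<ominus> A i n \<otimes> A n j"
  have row: "nsum (\<lambda>j. ?B i j \<otimes> g j) n \<in> N" if i: "i < n" for i
  proof -
    have c: "A i n \<in> carrier R" "A n n \<in> carrier R" "g n \<in> carrier R" using Ac g i by auto
    have "nsum (\<lambda>j. ?B i j \<otimes> g j) n =
        nsum (\<lambda>j. A n n \<otimes> (A i j \<otimes> g j) \<oplus> (\<ominus> A i n) \<otimes> (A n j \<otimes> g j)) n"
    proof (rule nsum_cong)
      fix j assume j: "j < n"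
      have cc: "A i j \<in> carrier R" "A n j \<in> carrier R" "g j \<in> carrier R"
        using Ac g i j by auto
      show "?B i j \<otimes> g j = A n n \<otimes> (A i j \<otimes> g j) \<oplus> (\<ominus> A i n) \<otimes> (A n j \<otimes> g j)"
        using c cc by algebra
    qed
    also have "\<dots> = A n n \<otimes> nsum (\<lambda>j. A i j \<otimes> g j) n \<oplus> (\<ominus> A i n) \<otimes> nsum (\<lambda>j. A n j \<otimes> g j) n"
      using c Ac g i by (simp add: nsum_add nsum_ldistr)
    also have "\<dots> = A n n \<otimes> nsum (\<lambda>j. A i j \<otimes> g j) (Suc n) \<oplus> \<ominus> (A i n \<otimes> nsum (\<lambda>j. A n j \<otimes> g j) (Suc n))"
    proof -
      have "a \<otimes> s \<oplus> (\<ominus> b) \<otimes> t = a \<otimes> (s \<oplus> b \<otimes> h) \<oplus> \<ominus> (b \<otimes> (t \<oplus> a \<otimes> h))"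
        if "a \<in> carrier R" "b \<in> carrier R" "s \<in> carrier R" "t \<in> carrier R" "h \<in> carrier R"
        for a b s t h
        using that by algebra
      then show ?thesis unfolding nsum.simps using c Ac g i by simp
    qed
    also have "\<dots> \<in> N"
      using N(3,4) N(5)[of "A n n" d] N(5)[of "A i n" d] Suc.prems(2)[of n] Suc.prems(3)[of i n]
        Suc.prems(4)[of i] Suc.prems(4)[of n] i by auto
    finally show ?thesis .
  qed
  have "\<exists>d'. \<exists>m \<in> M d'. \<forall>i<n. m \<otimes> g i \<in> N"
  proof (rule Suc.IH[of ?B "d + d"])
    show "g i \<in> carrier R" if "i < n" for i using g that by simp
    show "?B i i \<in> M (d + d)" if "i < n" for i
      unfolding a_minus_def
      by (intro M_I MM I_neg II) (use Suc.prems(2,3) that in auto)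
    show "?B i j \<in> I (d + d)" if "i < n" "j < n" "i \<noteq> j" for i j
      unfolding a_minus_def
      by (intro I_I MI I_neg II) (use Suc.prems(2,3) that in auto)
    show "nsum (\<lambda>j. ?B i j \<otimes> g j) n \<in> N" if "i < n" for i using row that .
  qed
  then obtain d' m where m: "m \<in> M d'" "\<And>i. i < n \<Longrightarrow> m \<otimes> g i \<in> N" by blast
  have mc: "m \<in> carrier R" using m M by blast
  have Ann: "A n n \<in> M d" "A n n \<in> carrier R" using Suc.prems(2) Ac by auto
  have "m \<otimes> A n n \<otimes> g i \<in> N" if i: "i < Suc n" for i
  proof (cases "i = n")
    case True
    let ?s = "nsum (\<lambda>j. A n j \<otimes> g j) n"
    have s: "?s \<in> carrier R" using Ac g by auto
    have "m \<otimes> ?s = nsum (\<lambda>j. A n j \<otimes> (m \<otimes> g j)) n"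
      using mc Ac g by (subst nsum_ldistr) (auto intro!: nsum_cong simp: m_lcomm)
    also have "\<dots> \<in> N"
    proof (rule nsum_in[OF N(2,3)])
      fix i assume i: "i < n"
      then have "A n i \<in> I d" using Suc.prems(3) by simp
      then show "A n i \<otimes> (m \<otimes> g i) \<in> N" using N(5)[of _ d] m(2)[OF i] by simp
    qed
    finally have 1: "m \<otimes> ?s \<in> N" .
    have 2: "m \<otimes> nsum (\<lambda>j. A n j \<otimes> g j) (Suc n) \<in> N"
      using N(5) m(1) Suc.prems(4) by blast
    have "m \<otimes> A n n \<otimes> g n = m \<otimes> nsum (\<lambda>j. A n j \<otimes> g j) (Suc n) \<oplus> \<ominus> (m \<otimes> ?s)"
    proof -
      have *: "m \<otimes> a \<otimes> h = m \<otimes> (s \<oplus> a \<otimes> h) \<oplus> \<ominus> (m \<otimes> s)"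
        if "a \<in> carrier R" "h \<in> carrier R" "s \<in> carrier R" for a h s
        using that mc by algebra
      show ?thesis using *[OF Ann(2) g[of n] s] by simp
    qed
    then show ?thesis using 1 2 N(3,4) True by simp
  next
    case False
    then have "m \<otimes> g i \<in> N" using m(2) i by simp
    then have "A n n \<otimes> (m \<otimes> g i) \<in> N" using N(5)[of _ d] Ann(1) by blast
    moreover have "A n n \<otimes> (m \<otimes> g i) = m \<otimes> A n n \<otimes> g i"
      using mc Ann(2) g[OF i] by algebra
    ultimately show ?thesis by simp
  qed
  then show ?case using MM[OF m(1) Ann(1)] by blast
qed

text \<open>The values at \<open>x\<close>, in Horner form, of the monic polynomials of degree \<open>n\<close> with all other
  coefficients in \<open>C\<close>, and below those of the polynomials of degree less than \<open>n\<close>. Taking values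
  instead of polynomials allows \<open>C\<close> to be an ideal as well as a ring.\<close>

primrec Mon :: "'a \<Rightarrow> 'a set \<Rightarrow> nat \<Rightarrow> 'a set" where
  "Mon x C 0 = {\<one>}" |
  "Mon x C (Suc n) = {x \<otimes> m \<oplus> c | m c. m \<in> Mon x C n \<and> c \<in> C}"

primrec Pol :: "'a \<Rightarrow> 'a set \<Rightarrow> nat \<Rightarrow> 'a set" where
  "Pol x C 0 = {\<zero>}" |
  "Pol x C (Suc n) = {x \<otimes> m \<oplus> c | m c. m \<in> Pol x C n \<and> c \<in> C}"

lemma MonI: "m \<in> Mon x C n \<Longrightarrow> c \<in> C \<Longrightarrow> x \<otimes> m \<oplus> c \<in> Mon x C (Suc n)"
  by auto

lemma PolI: "m \<in> Pol x C n \<Longrightarrow> c \<in> C \<Longrightarrow> x \<otimes> m \<oplus> c \<in> Pol x C (Suc n)"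
  by auto

lemma Mon_mono: "C \<subseteq> D \<Longrightarrow> Mon x C n \<subseteq> Mon x D n"
  by (induction n) auto

text \<open>A ring without unit, so that ideals are included.\<close>

definition subrng :: "'a set \<Rightarrow> bool" where
  "subrng C \<longleftrightarrow> C \<subseteq> carrier R \<and> \<zero> \<in> C \<and>
    (\<forall>a\<in>C. \<forall>b\<in>C. a \<oplus> b \<in> C \<and> a \<otimes> b \<in> C) \<and> (\<forall>a\<in>C. \<ominus> a \<in> C)"

context
  fixes x C
  assumes x: "x \<in> carrier R" and subrng: "subrng C"
begin

lemma C: "C \<subseteq> carrier R" "\<zero> \<in> C"
    "\<And>a b. a \<in> C \<Longrightarrow> b \<in> C \<Longrightarrow> a \<oplus> b \<in> C" "\<And>a b. a \<in> C \<Longrightarrow> b \<in> C \<Longrightarrow> a \<otimes> b \<in> C"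
    "\<And>a. a \<in> C \<Longrightarrow> \<ominus> a \<in> C"
  using subrng by (auto simp: subrng_def)

lemma C_carr: "c \<in> C \<Longrightarrow> c \<in> carrier R" using C(1) by blast

lemma Mon_closed: "m \<in> Mon x C n \<Longrightarrow> m \<in> carrier R"
  using x C(1) by (induction n arbitrary: m) (auto simp: subset_iff)

lemma Pol_closed: "m \<in> Pol x C n \<Longrightarrow> m \<in> carrier R"
  using x C(1) by (induction n arbitrary: m) (auto simp: subset_iff)

lemma Pol_add: "a \<in> Pol x C n \<Longrightarrow> b \<in> Pol x C n \<Longrightarrow> a \<oplus> b \<in> Pol x C n"
proof (induction n arbitrary: a b)
  case (Suc n)
  then obtain m c m' c' where e: "a = x \<otimes> m \<oplus> c" "b = x \<otimes> m' \<oplus> c'" "m \<in> Pol x C n"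
    "m' \<in> Pol x C n" "c \<in> C" "c' \<in> C" by auto
  have "a \<oplus> b = x \<otimes> (m \<oplus> m') \<oplus> (c \<oplus> c')"
    using e x Pol_closed[OF e(3)] Pol_closed[OF e(4)] C_carr[OF e(5)] C_carr[OF e(6)]
    by algebra
  then show ?case using PolI[OF Suc.IH[OF e(3,4)] C(3)[OF e(5,6)]] by simp
qed simp

lemma Mon_Pol: "a \<in> Mon x C n \<Longrightarrow> b \<in> Pol x C n \<Longrightarrow> a \<oplus> b \<in> Mon x C n"
proof (induction n arbitrary: a b)
  case (Suc n)
  then obtain m c m' c' where e: "a = x \<otimes> m \<oplus> c" "b = x \<otimes> m' \<oplus> c'" "m \<in> Mon x C n"
    "m' \<in> Pol x C n" "c \<in> C" "c' \<in> C" by auto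
  have "a \<oplus> b = x \<otimes> (m \<oplus> m') \<oplus> (c \<oplus> c')"
    using e x Mon_closed[OF e(3)] Pol_closed[OF e(4)] C_carr[OF e(5)] C_carr[OF e(6)]
    by algebra
  then show ?case using MonI[OF Suc.IH[OF e(3,4)] C(3)[OF e(5,6)]] by simp
qed simp

lemma Pol_neg: "a \<in> Pol x C n \<Longrightarrow> \<ominus> a \<in> Pol x C n"
proof (induction n arbitrary: a)
  case (Suc n)
  then obtain m c where e: "a = x \<otimes> m \<oplus> c" "m \<in> Pol x C n" "c \<in> C" by auto
  have "\<ominus> a = x \<otimes> (\<ominus> m) \<oplus> (\<ominus> c)"
    using e x Pol_closed[OF e(2)] C_carr[OF e(3)] by algebra
  then show ?case using PolI[OF Suc.IH[OF e(2)] C(5)[OF e(3)]] by simp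
qed simp

lemma Pol_scale: "c \<in> C \<Longrightarrow> a \<in> Pol x C n \<Longrightarrow> c \<otimes> a \<in> Pol x C n"
proof (induction n arbitrary: a)
  case (Suc n)
  then obtain m d where e: "a = x \<otimes> m \<oplus> d" "m \<in> Pol x C n" "d \<in> C" by auto
  have "c \<otimes> a = x \<otimes> (c \<otimes> m) \<oplus> c \<otimes> d"
    using e x Pol_closed[OF e(2)] C_carr[OF e(3)] C_carr[OF Suc.prems(1)] by algebra
  then show ?case using PolI[OF Suc.IH[OF Suc.prems(1) e(2)] C(4)[OF Suc.prems(1) e(3)]] by simp
qed (use C_carr in auto)

lemma Mon_scale: "c \<in> C \<Longrightarrow> a \<in> Mon x C n \<Longrightarrow> c \<otimes> a \<in> Pol x C (Suc n)"
proof (induction n arbitrary: a)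
  case 0
  have "c = x \<otimes> \<zero> \<oplus> c" using C_carr[OF 0(1)] x by simp
  then show ?case using 0 C_carr[OF 0(1)] by auto
next
  case (Suc n)
  then obtain m d where e: "a = x \<otimes> m \<oplus> d" "m \<in> Mon x C n" "d \<in> C" by auto
  have "c \<otimes> a = x \<otimes> (c \<otimes> m) \<oplus> c \<otimes> d"
    using e x Mon_closed[OF e(2)] C_carr[OF e(3)] C_carr[OF Suc.prems(1)] by algebra
  then show ?case using PolI[OF Suc.IH[OF Suc.prems(1) e(2)] C(4)[OF Suc.prems(1) e(3)]] by simp
qed

lemma Pol_Suc: "a \<in> Pol x C n \<Longrightarrow> x \<otimes> a \<in> Pol x C (Suc n)"
  using PolI[OF _ C(2), of a x n] Pol_closed x by simp

lemma Mon_Suc: "a \<in> Mon x C n \<Longrightarrow> x \<otimes> a \<in> Mon x C (Suc n)"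
  using MonI[OF _ C(2), of a x n] Mon_closed x by simp

lemma Pol_mono1: "a \<in> Pol x C n \<Longrightarrow> a \<in> Pol x C (Suc n)"
proof (induction n arbitrary: a)
  case 0
  then show ?case using Pol_Suc[of \<zero> 0] x by simp
next
  case (Suc n)
  then obtain m c where e: "a = x \<otimes> m \<oplus> c" "m \<in> Pol x C n" "c \<in> C" by auto
  then show ?case using Suc.IH[OF e(2)] unfolding Pol.simps(2)[of x C "Suc n"] by blast
qed

lemma Pol_mono: "a \<in> Pol x C m \<Longrightarrow> m \<le> n \<Longrightarrow> a \<in> Pol x C n"
  by (induction n) (use Pol_mono1 le_Suc_eq in auto)

lemma Mon_Mon: "a \<in> Mon x C m \<Longrightarrow> b \<in> Mon x C n \<Longrightarrow> a \<otimes> b \<in> Mon x C (m + n)"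
proof (induction m arbitrary: a)
  case 0
  then show ?case using Mon_closed by auto
next
  case (Suc m)
  then obtain a' c where e: "a = x \<otimes> a' \<oplus> c" "a' \<in> Mon x C m" "c \<in> C" by auto
  have "a \<otimes> b = x \<otimes> (a' \<otimes> b) \<oplus> c \<otimes> b"
    using e x Mon_closed[OF e(2)] Mon_closed[OF Suc.prems(2)] C_carr[OF e(3)] by algebra
  moreover have "c \<otimes> b \<in> Pol x C (Suc (m + n))"
    by (rule Pol_mono[OF Mon_scale[OF e(3) Suc.prems(2)]]) simp
  moreover have "x \<otimes> (a' \<otimes> b) \<in> Mon x C (Suc (m + n))"
    using Mon_Suc Suc.IH e Suc.prems by blast
  ultimately show ?case using Mon_Pol[of _ "Suc (m + n)"] by simp
qed

lemma Pol_times: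
  assumes "b \<in> Mon x C n \<union> Pol x C n"
  shows "a \<in> Pol x C m \<Longrightarrow> a \<otimes> b \<in> Pol x C (m + n)"
proof (induction m arbitrary: a)
  case 0
  have "b \<in> carrier R" using assms Pol_closed Mon_closed by blast
  then show ?case using Pol_mono[of \<zero> 0 n] 0 by simp
next
  case (Suc m)
  then obtain a' c where e: "a = x \<otimes> a' \<oplus> c" "a' \<in> Pol x C m" "c \<in> C" by auto
  have b: "b \<in> carrier R" using assms Pol_closed Mon_closed by blast
  have 1: "a \<otimes> b = x \<otimes> (a' \<otimes> b) \<oplus> c \<otimes> b"
    using e x Pol_closed[OF e(2)] b C_carr[OF e(3)] by algebra
  have "c \<otimes> b \<in> Pol x C (Suc n)"
    using Mon_scale[OF e(3)] Pol_mono1[OF Pol_scale[OF e(3)]] assms by blast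
  then have 2: "c \<otimes> b \<in> Pol x C (Suc (m + n))" by (rule Pol_mono) simp
  have "x \<otimes> (a' \<otimes> b) \<in> Pol x C (Suc (m + n))"
    using Pol_Suc Suc.IH e Suc.prems by blast
  then show ?case unfolding 1 using Pol_add[OF _ 2] by (simp del: Pol.simps)
qed

text \<open>The determinant trick: if \<open>x\<close> acts on generators through a matrix over \<open>C\<close>, then eliminating them
  from the system \<open>(x - c) g = 0\<close> leaves a monic polynomial in \<open>x\<close>.\<close>

lemma Mon_elimination:
  assumes g: "\<And>i. i < n \<Longrightarrow> g i \<in> carrier R" and c: "\<And>i j. i < n \<Longrightarrow> j < n \<Longrightarrow> c i j \<in> C"
    and e: "\<And>i. i < n \<Longrightarrow> x \<otimes> g i = nsum (\<lambda>j. c i j \<otimes> g j) n"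
  shows "\<exists>d. \<exists>m \<in> Mon x C d. \<forall>i<n. m \<otimes> g i = \<zero>"
proof -
  have cc: "c i j \<in> carrier R" if "i < n" "j < n" for i j using c[OF that] C(1) by blast
  have PM: "a \<otimes> b \<in> Pol x C (k + l)" if "a \<in> Mon x C k" "b \<in> Pol x C l" for a b k l
    using Pol_times[of a k b l] that Mon_closed Pol_closed by (metis UnI1 add.commute m_comm)
  let ?A = "\<lambda>i j. if i = j then x \<otimes> \<one> \<oplus> \<ominus> c i j else x \<otimes> \<zero> \<oplus> \<ominus> c i j"
  have "\<exists>d. \<exists>m \<in> Mon x C d. \<forall>i<n. m \<otimes> g i \<in> {\<zero>}"
  proof (rule elimination[where M = "Mon x C" and I = "Pol x C" and A = ?A and d = 1 and N = "{\<zero>}"])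
    show "nsum (\<lambda>j. ?A i j \<otimes> g j) n \<in> {\<zero>}" if i: "i < n" for i
    proof -
      have "nsum (\<lambda>j. ?A i j \<otimes> g j) n
          = nsum (\<lambda>j. (if j = i then x \<otimes> g i else \<zero>) \<oplus> \<ominus> (c i j \<otimes> g j)) n"
      proof (rule nsum_cong)
        fix j assume j: "j < n"
        show "?A i j \<otimes> g j = (if j = i then x \<otimes> g i else \<zero>) \<oplus> \<ominus> (c i j \<otimes> g j)"
          using cc[OF i j] g[OF i] g[OF j] x by (auto, algebra+)
      qed
      also have "\<dots> = nsum (\<lambda>j. (if j = i then x \<otimes> g i else \<zero>)) n \<oplus> nsum (\<lambda>j. \<ominus> (c i j \<otimes> g j)) n"
        using cc[OF i] g x i by (intro nsum_add) auto
      also have "\<dots> = x \<otimes> g i \<oplus> \<ominus> nsum (\<lambda>j. c i j \<otimes> g j) n"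
        using nsum_delta[OF i, of "x \<otimes> g i"] g x i cc by (simp add: nsum_neg)
      also have "\<dots> = \<zero>" using e[OF i] g[OF i] x by (metis m_closed r_neg)
      finally show ?thesis by simp
    qed
  qed (use g c C(5) Mon_closed Pol_closed Mon_Mon PM Pol_times Mon_Pol Pol_add Pol_neg in auto)
  then show ?thesis by simp
qed

end

lemma Mon_exp:
  assumes "m \<in> Mon x C n" "x \<in> carrier R" "C \<subseteq> carrier R"
  shows "\<exists>f. set f \<subseteq> C \<and> length f = n \<and> m = eval (\<one> # f) x"
  using assms(1)
proof (induction n arbitrary: m)
  case (Suc n)
  then obtain m' c where e: "m = x \<otimes> m' \<oplus> c" "m' \<in> Mon x C n" "c \<in> C" by auto
  obtain f where f: "set f \<subseteq> C" "length f = n" "m' = eval (\<one> # f) x" using Suc.IH e by blast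
  have fc: "set (\<one> # f) \<subseteq> carrier R" "c \<in> carrier R" using f(1) e(3) assms(3) by auto
  have "eval ((\<one> # f) @ [c]) x = eval (\<one> # f) x \<otimes> x \<oplus> c"
    using eval_append_aux[OF fc assms(2)] .
  moreover have "eval (\<one> # f) x \<in> carrier R" using eval_in_carrier[OF fc(1) assms(2)] .
  ultimately have "m = eval (\<one> # (f @ [c])) x" using e(1) f(3) assms(2) by (simp add: m_comm)
  then show ?case using e(3) f by (intro exI[of _ "f @ [c]"]) auto
qed simp

end

section \<open>Subrings of a field and their ideals\<close>

locale ambient_field = field L for L (structure)

context ambient_field
begin

definition is_ideal :: "'a set \<Rightarrow> 'a set \<Rightarrow> bool" where
  "is_ideal A I \<longleftrightarrow> I \<subseteq> A \<and> \<zero> \<in> I \<and> (\<forall>x\<in>I. \<forall>y\<in>I. x \<oplus> y \<in> I) \<and> (\<forall>a\<in>A. \<forall>x\<in>I. a \<otimes> x \<in> I)"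

definition is_prime :: "'a set \<Rightarrow> 'a set \<Rightarrow> bool" where
  "is_prime A P \<longleftrightarrow> is_ideal A P \<and> \<one> \<notin> P \<and> (\<forall>a\<in>A. \<forall>b\<in>A. a \<otimes> b \<in> P \<longrightarrow> a \<in> P \<or> b \<in> P)"

lemma inv_nz [simp]: "x \<in> carrier L \<Longrightarrow> x \<noteq> \<zero> \<Longrightarrow> inv x \<in> carrier L"
  by (simp add: field_Units)
lemma inv_l [simp]: "x \<in> carrier L \<Longrightarrow> x \<noteq> \<zero> \<Longrightarrow> inv x \<otimes> x = \<one>"
  by (simp add: field_Units)
lemma inv_r [simp]: "x \<in> carrier L \<Longrightarrow> x \<noteq> \<zero> \<Longrightarrow> x \<otimes> inv x = \<one>"
  by (simp add: field_Units)
lemma mult_nz: "x \<in> carrier L \<Longrightarrow> y \<in> carrier L \<Longrightarrow> x \<noteq> \<zero> \<Longrightarrow> y \<noteq> \<zero> \<Longrightarrow> x \<otimes> y \<noteq> \<zero>"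
  using integral by blast
lemma inv_not_zero: "x \<in> carrier L \<Longrightarrow> x \<noteq> \<zero> \<Longrightarrow> inv x \<noteq> \<zero>"
  by (metis inv_l l_null zero_not_one)
lemma pow_nz: "x \<in> carrier L \<Longrightarrow> x \<noteq> \<zero> \<Longrightarrow> x [^] (n::nat) \<noteq> \<zero>"
  by (induction n) (auto simp: mult_nz)

end

locale subring_in = ambient_field +
  fixes A
  assumes A: "subring A L"
begin

lemma A_carr [simp]: "x \<in> A \<Longrightarrow> x \<in> carrier L"
  using subringE(1)[OF A] by blast
lemma A_zero [simp]: "\<zero> \<in> A" and A_one [simp]: "\<one> \<in> A"
  and A_add [simp]: "x \<in> A \<Longrightarrow> y \<in> A \<Longrightarrow> x \<oplus> y \<in> A"
  and A_mult [simp]: "x \<in> A \<Longrightarrow> y \<in> A \<Longrightarrow> x \<otimes> y \<in> A"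
  and A_neg [simp]: "x \<in> A \<Longrightarrow> \<ominus> x \<in> A"
  using subringE[OF A] by auto
lemma A_minus [simp]: "x \<in> A \<Longrightarrow> y \<in> A \<Longrightarrow> x \<ominus> y \<in> A"
  by (simp add: a_minus_def)
lemma A_pow [simp]: "x \<in> A \<Longrightarrow> x [^] (n::nat) \<in> A"
  by (induction n) auto
lemma A_nsum [simp]: "(\<And>i. i < n \<Longrightarrow> f i \<in> A) \<Longrightarrow> nsum f n \<in> A"
  by (rule nsum_in) auto

lemma A_ring: "ring (L\<lparr>carrier := A\<rparr>)" and A_cring: "cring (L\<lparr>carrier := A\<rparr>)"
proof -
  have "domain (L\<lparr>carrier := A\<rparr>)" using subdomain_is_domain[OF subdomainI'[OF A]] .
  then show "cring (L\<lparr>carrier := A\<rparr>)" by (rule domain.axioms)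
  then show "ring (L\<lparr>carrier := A\<rparr>)" by (rule cring.axioms)
qed

lemma A_a_inv: "x \<in> A \<Longrightarrow> \<ominus>\<^bsub>L\<lparr>carrier := A\<rparr>\<^esub> x = \<ominus> x"
  by (rule abelian_group.minus_equality[OF ring.is_abelian_group[OF A_ring]])
    (simp_all add: l_neg)

lemma A_npow: "x [^]\<^bsub>L\<lparr>carrier := A\<rparr>\<^esub> (n::nat) = x [^] n"
  by (induction n) (simp_all add: nat_pow_def)

context
  fixes I assumes I: "is_ideal A I"
begin
lemma I_A: "x \<in> I \<Longrightarrow> x \<in> A" and I_zero: "\<zero> \<in> I"
  and I_add: "x \<in> I \<Longrightarrow> y \<in> I \<Longrightarrow> x \<oplus> y \<in> I"
  and I_l: "a \<in> A \<Longrightarrow> x \<in> I \<Longrightarrow> a \<otimes> x \<in> I"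
  using I unfolding is_ideal_def by auto
lemma I_carr: "x \<in> I \<Longrightarrow> x \<in> carrier L" using I_A by simp
lemma I_r: "a \<in> A \<Longrightarrow> x \<in> I \<Longrightarrow> x \<otimes> a \<in> I"
  using I_l I_carr A_carr by (metis m_comm)
lemma I_neg: "x \<in> I \<Longrightarrow> \<ominus> x \<in> I"
  using I_l[of "\<ominus> \<one>" x] I_carr by (simp add: l_minus)
lemma I_minus: "x \<in> I \<Longrightarrow> y \<in> I \<Longrightarrow> x \<ominus> y \<in> I"
  by (simp add: a_minus_def I_add I_neg)
lemma I_nsum: "(\<And>i. i < n \<Longrightarrow> f i \<in> I) \<Longrightarrow> nsum f n \<in> I"
  by (rule nsum_in) (auto simp: I_zero I_add)
lemma I_pow: "x \<in> I \<Longrightarrow> 0 < n \<Longrightarrow> x [^] (n::nat) \<in> I"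
  using I_l I_A by (cases n) auto
lemma I_add_cancel: "x \<in> carrier L \<Longrightarrow> y \<in> I \<Longrightarrow> x \<oplus> y \<in> I \<Longrightarrow> x \<in> I"
proof -
  assume a: "x \<in> carrier L" "y \<in> I" "x \<oplus> y \<in> I"
  then have "x = (x \<oplus> y) \<oplus> \<ominus> y" using I_carr[of y] by algebra
  then show ?thesis using I_add[OF a(3) I_neg[OF a(2)]] by simp
qed
end

lemma is_idealI:
  assumes "I \<subseteq> A" "\<zero> \<in> I" "\<And>x y. x \<in> I \<Longrightarrow> y \<in> I \<Longrightarrow> x \<oplus> y \<in> I"
    "\<And>a x. a \<in> A \<Longrightarrow> x \<in> I \<Longrightarrow> a \<otimes> x \<in> I"
  shows "is_ideal A I"
  using assms unfolding is_ideal_def by auto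

lemma is_ideal_whole: "is_ideal A A" by (rule is_idealI) auto
lemma is_ideal_zero: "is_ideal A {\<zero>}" by (rule is_idealI) auto
lemma is_ideal_one: "is_ideal A I \<Longrightarrow> \<one> \<in> I \<Longrightarrow> I = A"
  using I_A I_r[of I _ \<one>] by force

lemma is_ideal_Inter:
  assumes "\<F> \<noteq> {}" "\<And>I. I \<in> \<F> \<Longrightarrow> is_ideal A I"
  shows "is_ideal A (\<Inter>\<F>)"
proof (rule is_idealI)
  show "\<Inter>\<F> \<subseteq> A" using assms unfolding is_ideal_def by blast
qed (use assms(2) in \<open>simp_all add: is_ideal_def\<close>)

lemma ideal_iff: "ideal I (L\<lparr>carrier := A\<rparr>) \<longleftrightarrow> is_ideal A I"
proof
  assume i: "ideal I (L\<lparr>carrier := A\<rparr>)"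
  show "is_ideal A I"
    using additive_subgroup.a_subset[OF ideal.axioms(1)[OF i]]
      additive_subgroup.zero_closed[OF ideal.axioms(1)[OF i]]
      additive_subgroup.a_closed[OF ideal.axioms(1)[OF i]] ideal.I_l_closed[OF i]
    by (intro is_idealI) auto
next
  assume I: "is_ideal A I"
  have g: "group (add_monoid (L\<lparr>carrier := A\<rparr>))"
    using abelian_group.a_group[OF ring.is_abelian_group[OF A_ring]] .
  show "ideal I (L\<lparr>carrier := A\<rparr>)"
  proof (rule idealI)
    show "subgroup I (add_monoid (L\<lparr>carrier := A\<rparr>))"
    proof (rule group.subgroupI[OF g])
      show "inv\<^bsub>add_monoid (L\<lparr>carrier := A\<rparr>)\<^esub> a \<in> I" if "a \<in> I" for a
        using A_a_inv[of a] I_neg[OF I that] I_A[OF I that] by (simp add: a_inv_def)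
    qed (use I_A[OF I] I_zero[OF I] I_add[OF I] in auto)
  qed (use A_ring I_l[OF I] I_r[OF I] in auto)
qed

lemma prime_iff: "primeideal I (L\<lparr>carrier := A\<rparr>) \<longleftrightarrow> is_prime A I"
proof
  assume p: "primeideal I (L\<lparr>carrier := A\<rparr>)"
  have i: "is_ideal A I" using ideal_iff primeideal.axioms(1)[OF p] by simp
  then show "is_prime A I"
    using primeideal.I_prime[OF p] primeideal.I_notcarr[OF p] is_ideal_one[OF i]
    unfolding is_prime_def by auto
next
  assume p: "is_prime A I"
  then have i: "is_ideal A I" unfolding is_prime_def by simp
  have "I \<noteq> A" using p unfolding is_prime_def by auto
  then show "primeideal I (L\<lparr>carrier := A\<rparr>)"
    using p A_cring ideal_iff i unfolding is_prime_def
    by (intro primeidealI) auto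
qed

lemma prime_ideal: "is_prime A P \<Longrightarrow> is_ideal A P"
  and prime_one: "is_prime A P \<Longrightarrow> \<one> \<notin> P"
  and prime_mult: "is_prime A P \<Longrightarrow> a \<in> A \<Longrightarrow> b \<in> A \<Longrightarrow> a \<otimes> b \<in> P \<Longrightarrow> a \<in> P \<or> b \<in> P"
  unfolding is_prime_def by auto

lemma prime_pow: "is_prime A P \<Longrightarrow> a \<in> A \<Longrightarrow> a [^] (n::nat) \<in> P \<Longrightarrow> a \<in> P"
proof (induction n)
  case 0
  then show ?case using prime_one by auto
next
  case (Suc n)
  then show ?case using prime_mult[of P "a [^] n" a] by auto
qed

lemma is_primeI:
  assumes "is_ideal A P" "\<one> \<notin> P" "\<And>a b. a \<in> A \<Longrightarrow> b \<in> A \<Longrightarrow> a \<otimes> b \<in> P \<Longrightarrow> a \<notin> P \<Longrightarrow> b \<notin> P \<Longrightarrow> False"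
  shows "is_prime A P"
  using assms unfolding is_prime_def by blast

lemma zero_prime: "is_prime A {\<zero>}"
  by (rule is_primeI) (use is_ideal_zero integral_iff in auto)

definition colon :: "'a set \<Rightarrow> 'a \<Rightarrow> 'a set" where
  "colon I u = {z \<in> A. z \<otimes> u \<in> I}"

lemma colon_ideal:
  assumes "is_ideal A I" "u \<in> A" shows "is_ideal A (colon I u)"
  by (rule is_idealI)
    (use assms I_zero[OF assms(1)] I_add[OF assms(1)] I_l[OF assms(1)] in
      \<open>auto simp: colon_def l_distr m_assoc\<close>)

lemma colon_subset: "is_ideal A I \<Longrightarrow> u \<in> A \<Longrightarrow> I \<subseteq> colon I u"
  using I_r I_A by (auto simp: colon_def)

lemma adjoin_ideal:
  assumes "is_ideal A I" "u \<in> A"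
  shows "is_ideal A {i \<oplus> a \<otimes> u | i a. i \<in> I \<and> a \<in> A}" (is "is_ideal A ?J")
    and "I \<subseteq> {i \<oplus> a \<otimes> u | i a. i \<in> I \<and> a \<in> A}"
    and "u \<in> {i \<oplus> a \<otimes> u | i a. i \<in> I \<and> a \<in> A}"
proof -
  note I = assms(1)
  have carr: "i \<in> I \<Longrightarrow> i \<in> carrier L" for i using I_carr[OF I] .
  show "is_ideal A ?J"
  proof (rule is_idealI)
    show "?J \<subseteq> A" using assms I_A[OF I] by auto
    have "\<zero> = \<zero> \<oplus> \<zero> \<otimes> u" using assms(2) by simp
    then show "\<zero> \<in> ?J" using I_zero[OF I] A_zero by blast
    show "x \<oplus> y \<in> ?J" if "x \<in> ?J" "y \<in> ?J" for x y
    proof -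
      obtain i a where e1: "x = i \<oplus> a \<otimes> u" "i \<in> I" "a \<in> A" using \<open>x \<in> ?J\<close> by blast
      obtain j b where e2: "y = j \<oplus> b \<otimes> u" "j \<in> I" "b \<in> A" using \<open>y \<in> ?J\<close> by blast
      note e = e1(1) e2(1) e1(2) e2(2) e1(3) e2(3)
      have "x \<oplus> y = (i \<oplus> j) \<oplus> (a \<oplus> b) \<otimes> u"
        using e carr[OF e(3)] carr[OF e(4)] A_carr[OF e(5)] A_carr[OF e(6)] A_carr[OF assms(2)]
        by algebra
      then show ?thesis using I_add[OF I e(3,4)] A_add[OF e(5,6)] by blast
    qed
    show "b \<otimes> x \<in> ?J" if b: "b \<in> A" and "x \<in> ?J" for b x
    proof -
      obtain i a where e: "x = i \<oplus> a \<otimes> u" "i \<in> I" "a \<in> A" using \<open>x \<in> ?J\<close> by blast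
      have "b \<otimes> x = b \<otimes> i \<oplus> (b \<otimes> a) \<otimes> u"
        using e carr[OF e(2)] A_carr[OF e(3)] A_carr[OF assms(2)] A_carr[OF b] by algebra
      then show ?thesis using I_l[OF I b e(2)] A_mult[OF b e(3)] by blast
    qed
  qed
  show "I \<subseteq> ?J"
  proof
    fix i assume i: "i \<in> I"
    have "i = i \<oplus> \<zero> \<otimes> u" using carr[OF i] assms(2) by simp
    then show "i \<in> ?J" using i A_zero by blast
  qed
  have "u = \<zero> \<oplus> \<one> \<otimes> u" using assms(2) by simp
  then show "u \<in> ?J" using I_zero[OF I] A_one by blast
qed

definition lincombs :: "(nat \<Rightarrow> 'a) \<Rightarrow> nat \<Rightarrow> 'a set" where
  "lincombs g n = {nsum (\<lambda>i. c i \<otimes> g i) n | c. \<forall>i<n. c i \<in> A}"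

lemma lincombs_ideal:
  assumes g: "\<And>i. i < n \<Longrightarrow> g i \<in> A"
  shows "is_ideal A (lincombs g n)"
  proof (rule is_idealI)
    show "lincombs g n \<subseteq> A" using g unfolding lincombs_def by auto
    have "\<zero> = nsum (\<lambda>i. \<zero> \<otimes> g i) n" using g by (intro nsum_zero[symmetric]) simp
    then show "\<zero> \<in> lincombs g n" unfolding lincombs_def using A_zero by (intro CollectI exI[of _ "\<lambda>_. \<zero>"]) simp
    show "x \<oplus> y \<in> lincombs g n" if "x \<in> lincombs g n" "y \<in> lincombs g n" for x y
    proof -
      obtain c where c: "x = nsum (\<lambda>i. c i \<otimes> g i) n" "\<forall>i<n. c i \<in> A"
        using \<open>x \<in> lincombs g n\<close> unfolding lincombs_def by blast
      obtain d where d: "y = nsum (\<lambda>i. d i \<otimes> g i) n" "\<forall>i<n. d i \<in> A"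
        using \<open>y \<in> lincombs g n\<close> unfolding lincombs_def by blast
      have "x \<oplus> y = nsum (\<lambda>i. (c i \<oplus> d i) \<otimes> g i) n"
        unfolding c d using c(2) d(2) g
        by (subst nsum_add[symmetric]) (auto intro!: nsum_cong simp: l_distr)
      moreover have "\<forall>i<n. c i \<oplus> d i \<in> A" using c d by simp
      ultimately show ?thesis unfolding lincombs_def by (intro CollectI exI[of _ "\<lambda>i. c i \<oplus> d i"]) simp
    qed
    show "a \<otimes> x \<in> lincombs g n" if a: "a \<in> A" and "x \<in> lincombs g n" for a x
    proof -
      obtain c where c: "x = nsum (\<lambda>i. c i \<otimes> g i) n" "\<forall>i<n. c i \<in> A"
        using \<open>x \<in> lincombs g n\<close> unfolding lincombs_def by blast
      have "a \<otimes> x = nsum (\<lambda>i. (a \<otimes> c i) \<otimes> g i) n"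
        unfolding c using c(2) g a
        by (subst nsum_ldistr) (auto intro!: nsum_cong simp: m_assoc)
      moreover have "\<forall>i<n. a \<otimes> c i \<in> A" using c a by simp
      ultimately show ?thesis unfolding lincombs_def by (intro CollectI exI[of _ "\<lambda>i. a \<otimes> c i"]) simp
    qed
  qed
end

locale noetherian_in = subring_in +
  assumes noeth: "noetherian_ring (L\<lparr>carrier := A\<rparr>)"
begin

text \<open>The noetherian condition in the form used below. It is stated for ideals as sets of the ambient
  field, which lets ideals of several subrings be compared directly.\<close>

lemma maximal_ideal_in:
  assumes ne: "\<F> \<noteq> {}" and idl: "\<F> \<subseteq> {I. is_ideal A I}"
  shows "\<exists>M\<in>\<F>. \<forall>J\<in>\<F>. M \<subseteq> J \<longrightarrow> J = M"
proof -
  show ?thesis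
  proof (rule subset_Zorn)
    fix C assume C: "subset.chain \<F> C"
    show "\<exists>U\<in>\<F>. \<forall>J\<in>C. J \<subseteq> U"
    proof (cases "C = {}")
      case True
      then show ?thesis using ne by blast
    next
      case False
      have "subset.chain {I. ideal I (L\<lparr>carrier := A\<rparr>)} C"
        using C idl unfolding subset_chain_def ideal_iff by auto
      from noetherian_ring.ideal_chain_is_trivial[OF noeth False this] have U: "\<Union>C \<in> C" .
      moreover have "\<Union>C \<in> \<F>" using U C unfolding subset_chain_def by blast
      ultimately show ?thesis by (intro bexI[of _ "\<Union>C"]) auto
    qed
  qed
qed

lemma ideal_fg:
  assumes I: "is_ideal A I"
  obtains g n where "\<And>i. i < n \<Longrightarrow> g i \<in> I"
    "\<And>x. x \<in> I \<Longrightarrow> \<exists>c. (\<forall>i<n. c i \<in> A) \<and> x = nsum (\<lambda>i. c i \<otimes> g i) n"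
proof -
  let ?F = "{lincombs g n | g n. \<forall>i<n. g i \<in> I}"
  have "lincombs (\<lambda>_. \<zero>) 0 \<in> ?F" by blast
  then have ne: "?F \<noteq> {}" by blast
  have idl: "?F \<subseteq> {J. is_ideal A J}"
  proof
    fix J assume "J \<in> ?F"
    then obtain g n where "J = lincombs g n" "\<forall>i<n. g i \<in> I" by blast
    then show "J \<in> {J. is_ideal A J}" using lincombs_ideal[of n g] I_A[OF I] by blast
  qed
  obtain M where M: "M \<in> ?F" "\<And>J. J \<in> ?F \<Longrightarrow> M \<subseteq> J \<Longrightarrow> J = M"
    using maximal_ideal_in[OF ne idl] by meson
  then obtain g n where g: "M = lincombs g n" "\<forall>i<n. g i \<in> I" by blast
  have gA: "\<forall>i<n. g i \<in> A" using g(2) I_A[OF I] by blast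
  have "\<exists>c. (\<forall>i<n. c i \<in> A) \<and> x = nsum (\<lambda>i. c i \<otimes> g i) n" if x: "x \<in> I" for x
  proof -
    have xA: "x \<in> A" using I_A[OF I x] .
    let ?g = "g(n := x)"
    have "lincombs ?g (Suc n) \<in> ?F" using g(2) x by (intro CollectI exI[of _ ?g] exI[of _ "Suc n"]) auto
    moreover have "M \<subseteq> lincombs ?g (Suc n)"
    proof
      fix y assume "y \<in> M"
      then obtain c where c: "y = nsum (\<lambda>i. c i \<otimes> g i) n" "\<forall>i<n. c i \<in> A"
        unfolding g lincombs_def by blast
      have "nsum (\<lambda>i. (c(n := \<zero>)) i \<otimes> ?g i) n = y" unfolding c by (rule nsum_cong) auto
      moreover have "y \<in> carrier L" using c gA by simp
      ultimately have "y = nsum (\<lambda>i. (c(n := \<zero>)) i \<otimes> ?g i) (Suc n)" using xA by simp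
      moreover have "\<forall>i<Suc n. (c(n := \<zero>)) i \<in> A" using c by auto
      ultimately show "y \<in> lincombs ?g (Suc n)" unfolding lincombs_def by blast
    qed
    ultimately have "lincombs ?g (Suc n) = M" by (rule M(2))
    moreover have "x \<in> lincombs ?g (Suc n)"
    proof -
      let ?c = "(\<lambda>_. \<zero>)(n := \<one>)"
      have "nsum (\<lambda>i. ?c i \<otimes> ?g i) n = \<zero>" using gA by (intro nsum_zero) auto
      then have "x = nsum (\<lambda>i. ?c i \<otimes> ?g i) (Suc n)" using xA by simp
      moreover have "\<forall>i<Suc n. ?c i \<in> A" by simp
      ultimately show ?thesis unfolding lincombs_def by blast
    qed
    ultimately show ?thesis unfolding g(1) lincombs_def by blast
  qed
  then show ?thesis using that g(2) by blast
qed

text \<open>An ideal maximal among those disjoint from the multiplicative set \<open>W\<close> is prime; the maximal one exists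
  by the noetherian condition.\<close>

lemma prime_avoiding:
  assumes I: "is_ideal A I" and disj: "I \<inter> W = {}"
    and W: "\<one> \<in> W" "\<And>a b. a \<in> W \<Longrightarrow> b \<in> W \<Longrightarrow> a \<otimes> b \<in> W"
  obtains P where "is_prime A P" "I \<subseteq> P" "P \<inter> W = {}"
proof -
  let ?F = "{J. is_ideal A J \<and> I \<subseteq> J \<and> J \<inter> W = {}}"
  have "I \<in> ?F" using I disj by simp
  then have ne: "?F \<noteq> {}" by blast
  have idl: "?F \<subseteq> {J. is_ideal A J}" by blast
  obtain P where P: "P \<in> ?F" and mx: "\<And>J. J \<in> ?F \<Longrightarrow> P \<subseteq> J \<Longrightarrow> J = P"
    using maximal_ideal_in[OF ne idl] by meson
  have Pi: "is_ideal A P" using P by simp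
  have meet: "\<exists>i a. i \<in> P \<and> a \<in> A \<and> i \<oplus> a \<otimes> u \<in> W" if "u \<in> A" "u \<notin> P" for u
  proof (rule ccontr)
    let ?J = "{i \<oplus> a \<otimes> u | i a. i \<in> P \<and> a \<in> A}"
    assume "\<not> ?thesis"
    then have "?J \<inter> W = {}" by blast
    then have "?J = P" using mx[of ?J] adjoin_ideal[OF Pi that(1)] P by blast
    then show False using adjoin_ideal(3)[OF Pi that(1)] that(2) by simp
  qed
  have "is_prime A P"
  proof (rule is_primeI[OF Pi])
    show "\<one> \<notin> P" using P W(1) by blast
    fix a b assume ab: "a \<in> A" "b \<in> A" "a \<otimes> b \<in> P" "a \<notin> P" "b \<notin> P"
    obtain i c where 1: "i \<in> P" "c \<in> A" "i \<oplus> c \<otimes> a \<in> W" using meet[of a] ab by blast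
    obtain j d where 2: "j \<in> P" "d \<in> A" "j \<oplus> d \<otimes> b \<in> W" using meet[of b] ab by blast
    have carr: "i \<in> carrier L" "j \<in> carrier L" using I_carr[OF Pi] 1(1) 2(1) by auto
    have "(i \<oplus> c \<otimes> a) \<otimes> (j \<oplus> d \<otimes> b) = (j \<oplus> d \<otimes> b) \<otimes> i \<oplus> (c \<otimes> a) \<otimes> (j \<oplus> d \<otimes> b)"
      using carr ab(1,2) 1(2) 2(2) by (simp add: l_distr m_comm)
    also have "(c \<otimes> a) \<otimes> (j \<oplus> d \<otimes> b) = (c \<otimes> a) \<otimes> j \<oplus> (c \<otimes> d) \<otimes> (a \<otimes> b)"
      using carr ab(1,2) 1(2) 2(2) by (simp add: r_distr m_ac)
    finally have eq: "(i \<oplus> c \<otimes> a) \<otimes> (j \<oplus> d \<otimes> b) =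
        (j \<oplus> d \<otimes> b) \<otimes> i \<oplus> ((c \<otimes> a) \<otimes> j \<oplus> (c \<otimes> d) \<otimes> (a \<otimes> b))" .
    have "(j \<oplus> d \<otimes> b) \<otimes> i \<in> P" "(c \<otimes> a) \<otimes> j \<in> P" "(c \<otimes> d) \<otimes> (a \<otimes> b) \<in> P"
      using ab(1-3) 1(1,2) 2(1,2) I_A[OF Pi 2(1)] by (auto intro!: I_l[OF Pi])
    then have "(i \<oplus> c \<otimes> a) \<otimes> (j \<oplus> d \<otimes> b) \<in> P"
      unfolding eq by (intro I_add[OF Pi])
    then show False using W(2)[OF 1(3) 2(3)] P by blast
  qed
  moreover have "I \<subseteq> P" "P \<inter> W = {}" using P by simp_all
  ultimately show ?thesis by (rule that)
qed

end

section \<open>The Frobenius of a field of positive characteristic\<close>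

context ring begin

abbreviation nat_multiple :: "nat \<Rightarrow> 'a \<Rightarrow> 'a" (infixl "\<star>" 75) where
  "k \<star> x \<equiv> add_pow R k x"

lemma nsum_shift: "(\<And>i. i < Suc n \<Longrightarrow> f i \<in> carrier R) \<Longrightarrow> nsum f (Suc n) = f 0 \<oplus> nsum (\<lambda>i. f (Suc i)) n"
proof (induction n)
  case 0
  then show ?case by simp
next
  case (Suc n)
  have c: "f 0 \<in> carrier R" "nsum (\<lambda>i. f (Suc i)) n \<in> carrier R" "f (Suc n) \<in> carrier R"
    using Suc.prems by auto
  have "nsum f (Suc (Suc n)) = (f 0 \<oplus> nsum (\<lambda>i. f (Suc i)) n) \<oplus> f (Suc n)"
    using Suc by simp
  then show ?case using c by (simp add: a_assoc)
qed

lemma pascal: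
  fixes c :: "nat \<Rightarrow> nat \<Rightarrow> 'a"
  assumes c: "\<And>i j. c i j \<in> carrier R"
  shows "nsum (\<lambda>j. (m choose j) \<star> c (Suc (m - j)) j) (Suc m) \<oplus>
      nsum (\<lambda>j. (m choose j) \<star> c (m - j) (Suc j)) (Suc m)
    = nsum (\<lambda>j. (Suc m choose j) \<star> c (Suc m - j) j) (Suc (Suc m))"
proof -
  have "nsum (\<lambda>j. (m choose j) \<star> c (Suc (m - j)) j) (Suc m)
     = nsum (\<lambda>j. (m choose j) \<star> c (Suc m - j) j) (Suc m)"
    by (rule nsum_cong) (simp add: Suc_diff_le)
  also have "\<dots> = nsum (\<lambda>j. (m choose j) \<star> c (Suc m - j) j) (Suc (Suc m))"
    using c by (simp add: binomial_eq_0)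
  also have "\<dots> = (m choose 0) \<star> c (Suc m) 0 \<oplus> nsum (\<lambda>j. (m choose Suc j) \<star> c (m - j) (Suc j)) (Suc m)"
    using c by (subst nsum_shift) auto
  finally have 1: "nsum (\<lambda>j. (m choose j) \<star> c (Suc (m - j)) j) (Suc m) =
     c (Suc m) 0 \<oplus> nsum (\<lambda>j. (m choose Suc j) \<star> c (m - j) (Suc j)) (Suc m)"
    using c by (simp del: nsum.simps)
  have "nsum (\<lambda>j. (Suc m choose j) \<star> c (Suc m - j) j) (Suc (Suc m))
    = c (Suc m) 0 \<oplus> nsum (\<lambda>j. (Suc m choose Suc j) \<star> c (m - j) (Suc j)) (Suc m)"
    using c by (subst nsum_shift) (auto simp del: nsum.simps)
  also have "nsum (\<lambda>j. (Suc m choose Suc j) \<star> c (m - j) (Suc j)) (Suc m)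
     = nsum (\<lambda>j. (m choose Suc j) \<star> c (m - j) (Suc j) \<oplus> (m choose j) \<star> c (m - j) (Suc j)) (Suc m)"
    using c by (intro nsum_cong) (simp add: add.nat_pow_mult add.commute)
  also have "\<dots> = nsum (\<lambda>j. (m choose Suc j) \<star> c (m - j) (Suc j)) (Suc m)
     \<oplus> nsum (\<lambda>j. (m choose j) \<star> c (m - j) (Suc j)) (Suc m)"
    using c by (intro nsum_add) auto
  finally show ?thesis unfolding 1 using c by (simp add: a_assoc del: nsum.simps)
qed

end

context cring begin

text \<open>\<open>wsum F u v k m a b\<close> is the sum of \<open>F (a u\<^sub>w) (b v\<^sub>w)\<close> over all words \<open>w\<close> of length \<open>m\<close> in \<open>k\<close> letters,
  where \<open>u\<^sub>w\<close> and \<open>v\<^sub>w\<close> are the products along \<open>w\<close>.\<close>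

primrec wsum :: "('a \<Rightarrow> 'a \<Rightarrow> 'a) \<Rightarrow> (nat \<Rightarrow> 'a) \<Rightarrow> (nat \<Rightarrow> 'a) \<Rightarrow> nat \<Rightarrow> nat \<Rightarrow> 'a \<Rightarrow> 'a \<Rightarrow> 'a" where
  "wsum F u v k 0 a b = F a b" |
  "wsum F u v k (Suc m) a b = nsum (\<lambda>i. wsum F u v k m (a \<otimes> u i) (b \<otimes> v i)) k"

context
  fixes F :: "'a \<Rightarrow> 'a \<Rightarrow> 'a" and u v :: "nat \<Rightarrow> 'a" and n :: nat
  assumes F: "\<And>a b. a \<in> carrier R \<Longrightarrow> b \<in> carrier R \<Longrightarrow> F a b \<in> carrier R"
    and u: "\<And>i. i < n \<Longrightarrow> u i \<in> carrier R" and v: "\<And>i. i < n \<Longrightarrow> v i \<in> carrier R"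
begin

lemma wsum_closed [simp]:
  "k \<le> n \<Longrightarrow> a \<in> carrier R \<Longrightarrow> b \<in> carrier R \<Longrightarrow> wsum F u v k m a b \<in> carrier R"
  by (induction m arbitrary: a b) (auto simp: F u v intro!: nsum_closed)

text \<open>Words are grouped by the number of occurrences of the last letter.\<close>

lemma wsum_binomial:
  assumes "k < n"
  shows "a \<in> carrier R \<Longrightarrow> b \<in> carrier R \<Longrightarrow> wsum F u v (Suc k) m a b =
    nsum (\<lambda>j. (m choose j) \<star> wsum F u v k (m - j) (a \<otimes> u k [^] j) (b \<otimes> v k [^] j)) (Suc m)"
proof (induction m arbitrary: a b)
  case 0
  then show ?case using F by simp
next
  case (Suc m)
  have uk: "u k \<in> carrier R" "v k \<in> carrier R" using u v assms by auto
  have ui: "u i \<in> carrier R" "v i \<in> carrier R" if "i < k" for i using u v assms that by auto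
  define c where "c i j = wsum F u v k i (a \<otimes> u k [^] j) (b \<otimes> v k [^] j)" for i j :: nat
  have c: "c i j \<in> carrier R" for i j unfolding c_def using Suc.prems uk assms by (intro wsum_closed) auto
  have mc: "a \<otimes> u i \<otimes> u k [^] j = a \<otimes> u k [^] j \<otimes> u i" "b \<otimes> v i \<otimes> v k [^] j = b \<otimes> v k [^] j \<otimes> v i"
    if "i < k" for i and j :: nat
    using Suc.prems uk ui[OF that] by (simp_all add: m_ac)
  have "nsum (\<lambda>i. wsum F u v (Suc k) m (a \<otimes> u i) (b \<otimes> v i)) k =
    nsum (\<lambda>i. nsum (\<lambda>j. (m choose j) \<star> wsum F u v k (m - j) (a \<otimes> u k [^] j \<otimes> u i) (b \<otimes> v k [^] j \<otimes> v i)) (Suc m)) k"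
  proof (rule nsum_cong)
    fix i assume i: "i < k"
    show "wsum F u v (Suc k) m (a \<otimes> u i) (b \<otimes> v i) =
        nsum (\<lambda>j. (m choose j) \<star> wsum F u v k (m - j) (a \<otimes> u k [^] j \<otimes> u i) (b \<otimes> v k [^] j \<otimes> v i)) (Suc m)"
      using Suc.IH[of "a \<otimes> u i" "b \<otimes> v i"] Suc.prems ui[OF i] mc[OF i] by simp
  qed
  also have "\<dots> = nsum (\<lambda>j. nsum (\<lambda>i. (m choose j) \<star> wsum F u v k (m - j) (a \<otimes> u k [^] j \<otimes> u i) (b \<otimes> v k [^] j \<otimes> v i)) k) (Suc m)"
    using Suc.prems uk ui assms by (intro nsum_swap) auto
  also have "\<dots> = nsum (\<lambda>j. (m choose j) \<star> c (Suc (m - j)) j) (Suc m)"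
  proof (rule nsum_cong)
    fix j
    have hz: "(m choose j) \<star> \<zero> = \<zero>" by simp
    have hadd: "(m choose j) \<star> (x \<oplus> y) = (m choose j) \<star> x \<oplus> (m choose j) \<star> y"
      if "x \<in> carrier R" "y \<in> carrier R" for x y
      using that by (simp add: add.nat_pow_distrib)
    show "nsum (\<lambda>i. (m choose j) \<star> wsum F u v k (m - j) (a \<otimes> u k [^] j \<otimes> u i) (b \<otimes> v k [^] j \<otimes> v i)) k =
      (m choose j) \<star> c (Suc (m - j)) j"
      unfolding c_def wsum.simps using Suc.prems uk ui assms
      by (intro nsum_map[where h = "\<lambda>x. (m choose j) \<star> x", OF hz hadd, symmetric]) auto
  qed
  finally have 1: "nsum (\<lambda>i. wsum F u v (Suc k) m (a \<otimes> u i) (b \<otimes> v i)) k =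
    nsum (\<lambda>j. (m choose j) \<star> c (Suc (m - j)) j) (Suc m)" .
  have 2: "wsum F u v (Suc k) m (a \<otimes> u k) (b \<otimes> v k) =
    nsum (\<lambda>j. (m choose j) \<star> c (m - j) (Suc j)) (Suc m)"
    unfolding c_def using Suc.IH[of "a \<otimes> u k" "b \<otimes> v k"] Suc.prems uk
    by (simp add: m_assoc m_comm[of "u k"] m_comm[of "v k"])
  have "wsum F u v (Suc k) (Suc m) a b = nsum (\<lambda>i. wsum F u v (Suc k) m (a \<otimes> u i) (b \<otimes> v i)) k \<oplus>
      wsum F u v (Suc k) m (a \<otimes> u k) (b \<otimes> v k)"
    by (simp only: wsum.simps(2) nsum.simps)
  also have "\<dots> = nsum (\<lambda>j. (Suc m choose j) \<star> c (Suc m - j) j) (Suc (Suc m))"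
    unfolding 1 2 by (rule pascal[OF c])
  finally show ?case unfolding c_def .
qed

text \<open>The summand depends on a word only up to order, so the multinomial coefficients kill every word of
  length \<open>p\<close> that is not constant. Besides the additivity of the Frobenius this yields
  \<open>different_nonzero\<close> below, where \<open>F\<close> is not a function of the product of its arguments.\<close>

lemma wsum_prime:
  assumes p: "Factorial_Ring.prime (p::nat)" and ch: "p \<star> \<one> = \<zero>"
  shows "k \<le> n \<Longrightarrow> a \<in> carrier R \<Longrightarrow> b \<in> carrier R \<Longrightarrow>
    wsum F u v k p a b = nsum (\<lambda>i. F (a \<otimes> u i [^] p) (b \<otimes> v i [^] p)) k"
proof (induction k)
  case 0
  obtain m where "p = Suc m" using prime_gt_0_nat[OF p] gr0_conv_Suc by blast
  then show ?case by simp
next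
  case (Suc k)
  have uk: "u k \<in> carrier R" "v k \<in> carrier R" using u v Suc.prems by auto
  obtain m where m: "p = Suc m" using prime_gt_0_nat[OF p] gr0_conv_Suc by blast
  let ?t = "\<lambda>j. (p choose j) \<star> wsum F u v k (p - j) (a \<otimes> u k [^] j) (b \<otimes> v k [^] j)"
  have tc: "?t j \<in> carrier R" for j using Suc.prems uk by simp
  have van: "(p choose j) \<star> x = \<zero>" if "0 < j" "j < p" "x \<in> carrier R" for x j
  proof -
    have "p dvd (p choose j)" using p that by (intro dvd_choose_prime) auto
    then obtain d where "p choose j = p * d" by blast
    moreover have "p \<star> x = \<zero>"
      using add_pow_ldistr[of \<one> x p] that(3) ch by simp
    ultimately show ?thesis using that(3) by (metis add.nat_pow_one add.nat_pow_pow)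
  qed
  have "wsum F u v (Suc k) p a b = nsum ?t (Suc p)"
    using wsum_binomial[of k a b p] Suc.prems by simp
  also have "\<dots> = nsum ?t p \<oplus> ?t p" by simp
  also have "nsum ?t p = ?t 0 \<oplus> nsum (\<lambda>j. ?t (Suc j)) m"
    unfolding m using tc by (intro nsum_shift) (auto simp: m)
  also have "nsum (\<lambda>j. ?t (Suc j)) m = \<zero>"
    using Suc.prems uk by (intro nsum_zero van) (auto simp: m)
  finally have eq: "wsum F u v (Suc k) p a b = ?t 0 \<oplus> \<zero> \<oplus> ?t p" .
  have "F (a \<otimes> u i [^] p) (b \<otimes> v i [^] p) \<in> carrier R" if "i < k" for i
    using Suc.prems u[of i] v[of i] that by (intro F) auto
  then have "nsum (\<lambda>i. F (a \<otimes> u i [^] p) (b \<otimes> v i [^] p)) k \<in> carrier R" by simp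
  then show ?case using Suc eq F uk by simp
qed

end

lemma frobenius_nsum:
  assumes p: "Factorial_Ring.prime (p::nat)" and ch: "p \<star> \<one> = \<zero>"
    and u: "\<And>i. i < n \<Longrightarrow> u i \<in> carrier R"
  shows "nsum u n [^] p = nsum (\<lambda>i. u i [^] p) n"
proof -
  have *: "wsum (\<lambda>a b. a) u u n m a b = a \<otimes> nsum u n [^] m" if "a \<in> carrier R" for m a b
    using that
  proof (induction m arbitrary: a b)
    case (Suc m)
    have "wsum (\<lambda>a b. a) u u n (Suc m) a b = nsum (\<lambda>i. u i \<otimes> (a \<otimes> nsum u n [^] m)) n"
      unfolding wsum.simps using Suc u by (intro nsum_cong) (auto simp: m_ac)
    also have "\<dots> = nsum u n \<otimes> (a \<otimes> nsum u n [^] m)"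
      using Suc.prems u by (intro nsum_rdistr[symmetric]) auto
    finally show ?case using Suc.prems u by (simp add: m_ac)
  qed simp
  have "wsum (\<lambda>a b. a) u u n p \<one> \<one> = nsum (\<lambda>i. \<one> \<otimes> u i [^] p) n"
    using u by (intro wsum_prime[where n = n and F = "\<lambda>a b. a", OF _ _ _ p ch]) auto
  also have "\<dots> = nsum (\<lambda>i. u i [^] p) n" using u by (intro nsum_cong) simp
  finally show ?thesis using * u by simp
qed

end

locale frobenius_field = ambient_field +
  fixes p e q :: nat
  assumes p: "Factorial_Ring.prime p" and e: "1 \<le> e" and q: "q = p ^ e"
    and ch: "add_pow L p \<one> = \<zero>"
begin

lemma q_ge2: "2 \<le> q"
proof -
  have "p ^ 1 \<le> p ^ e" using e prime_gt_0_nat[OF p] by (intro power_increasing) auto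
  then show ?thesis using prime_ge_2_nat[OF p] q by simp
qed

lemma q_pos [simp]: "0 < q" and q_Suc: "q = Suc (q - 1)" and q_gt1: "0 < q - 1"
  using q_ge2 by auto

lemma power_p_nsum:
  "(\<And>i. i < n \<Longrightarrow> u i \<in> carrier L) \<Longrightarrow> nsum u n [^] (p ^ k) = nsum (\<lambda>i. u i [^] (p ^ k)) n"
proof (induction k)
  case (Suc k)
  have "nsum u n [^] (p ^ Suc k) = (nsum u n [^] (p ^ k)) [^] p"
    using Suc.prems by (simp add: nat_pow_pow mult.commute)
  also have "\<dots> = nsum (\<lambda>i. (u i [^] (p ^ k)) [^] p) n"
    using Suc frobenius_nsum[OF p ch, of n "\<lambda>i. u i [^] (p ^ k)"] by simp
  also have "\<dots> = nsum (\<lambda>i. u i [^] (p ^ Suc k)) n"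
    using Suc.prems by (intro nsum_cong) (simp add: nat_pow_pow mult.commute)
  finally show ?case .
qed (simp cong: nsum_cong)

lemma power_p_add:
  "x \<in> carrier L \<Longrightarrow> y \<in> carrier L \<Longrightarrow> (x \<oplus> y) [^] (p ^ k) = x [^] (p ^ k) \<oplus> y [^] (p ^ k)"
  using power_p_nsum[of "Suc (Suc 0)" "\<lambda>i. if i = 0 then x else y" k] by simp

lemma frob_nsum: "(\<And>i. i < n \<Longrightarrow> u i \<in> carrier L) \<Longrightarrow> nsum u n [^] q = nsum (\<lambda>i. u i [^] q) n"
  unfolding q by (rule power_p_nsum)

lemma frob_add: "x \<in> carrier L \<Longrightarrow> y \<in> carrier L \<Longrightarrow> (x \<oplus> y) [^] q = x [^] q \<oplus> y [^] q"
  unfolding q by (rule power_p_add)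

lemma frob_split: "x \<in> carrier L \<Longrightarrow> x [^] q = x \<otimes> x [^] (q - 1)"
proof -
  assume x: "x \<in> carrier L"
  have "x [^] Suc (q - 1) = x [^] (q - 1) \<otimes> x" by (rule nat_pow_Suc)
  then show ?thesis using q_Suc x m_comm[of "x [^] (q - 1)" x] by (simp del: nat_pow_Suc)
qed

lemma frob_zero [simp]: "\<zero> [^] q = \<zero>"
  using frob_split[of \<zero>] by simp

lemma frob_neg: "x \<in> carrier L \<Longrightarrow> (\<ominus> x) [^] q = \<ominus> (x [^] q)"
proof -
  assume x: "x \<in> carrier L"
  then have "(\<ominus> x) [^] q \<oplus> x [^] q = \<zero>" using frob_add[of "\<ominus> x" x] by (simp add: l_neg)
  from minus_equality[OF this] x show ?thesis by simp
qed

lemma frob_minus: "x \<in> carrier L \<Longrightarrow> y \<in> carrier L \<Longrightarrow> (x \<ominus> y) [^] q = x [^] q \<ominus> y [^] q"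
  by (simp add: a_minus_def frob_add frob_neg)

lemma frob_mult: "x \<in> carrier L \<Longrightarrow> y \<in> carrier L \<Longrightarrow> (x \<otimes> y) [^] q = x [^] q \<otimes> y [^] q"
  by (rule pow_mult_distrib) (auto intro: m_comm)

end

section \<open>Compatible ideals and centers\<close>

text \<open>The \<open>f\<close> of the locale is a \<open>q\<close>-inverse-linear map \<open>F\<^sup>e\<^sub>*A \<rightarrow> A\<close>. By \<open>f_lin\<close>, having \<open>1\<close> in its image amounts to
  surjectivity.\<close>

locale frobenius_split = frobenius_field + noetherian_in +
  fixes f :: "'a \<Rightarrow> 'a"
  assumes f_closed [simp]: "x \<in> A \<Longrightarrow> f x \<in> A"
    and f_add: "x \<in> A \<Longrightarrow> y \<in> A \<Longrightarrow> f (x \<oplus> y) = f x \<oplus> f y"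
    and f_lin: "r \<in> A \<Longrightarrow> x \<in> A \<Longrightarrow> f (r [^] q \<otimes> x) = r \<otimes> f x"
    and f_one: "\<exists>x\<in>A. f x = \<one>"
begin

lemma f_zero [simp]: "f \<zero> = \<zero>"
  using f_lin[of \<zero> \<zero>] by simp

lemma f_surj: "r \<in> A \<Longrightarrow> \<exists>x\<in>A. f (r [^] q \<otimes> x) = r"
  using f_one f_lin[of r] by force

definition compatible :: "'a set \<Rightarrow> bool" where
  "compatible I \<longleftrightarrow> is_ideal A I \<and> (\<forall>x\<in>I. f x \<in> I)"

definition centers :: "'a set set" where
  "centers = {P. is_prime A P \<and> compatible P}"

lemma compatible_ideal: "compatible I \<Longrightarrow> is_ideal A I"
  and compatible_f: "compatible I \<Longrightarrow> x \<in> I \<Longrightarrow> f x \<in> I"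
  unfolding compatible_def by auto

lemma centersD: "P \<in> centers \<Longrightarrow> is_prime A P" "P \<in> centers \<Longrightarrow> compatible P"
  unfolding centers_def by auto

text \<open>If \<open>f x\<^sub>0 = 1\<close> then \<open>f (x\<^sup>q x\<^sub>0) = x\<close>, so \<open>x\<^sup>q \<in> I\<close> forces \<open>x \<in> I\<close>: compatible ideals are radical.\<close>

lemma compatible_root:
  assumes I: "compatible I" and x: "x \<in> A" "x [^] q \<in> I"
  shows "x \<in> I"
proof -
  obtain y where y: "y \<in> A" "f (x [^] q \<otimes> y) = x" using f_surj[OF x(1)] by blast
  have "x [^] q \<otimes> y \<in> I" using I_r[OF compatible_ideal[OF I] y(1) x(2)] .
  then show ?thesis using compatible_f[OF I] y(2) by fastforce
qed

lemma compatible_radical: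
  assumes I: "compatible I" and x: "x \<in> A" "x [^] (n::nat) \<in> I"
  shows "x \<in> I"
proof -
  have roots: "x [^] (q ^ k) \<in> I \<Longrightarrow> x \<in> I" for k
  proof (induction k)
    case (Suc k)
    have "(x [^] (q ^ k)) [^] q \<in> I" using Suc.prems x(1) by (simp add: nat_pow_pow mult.commute)
    from compatible_root[OF I _ this] have "x [^] (q ^ k) \<in> I" using x(1) by simp
    then show ?case by (rule Suc.IH)
  qed (use x in simp)
  have "n < 2 ^ n" by (rule less_exp)
  also have "(2::nat) ^ n \<le> q ^ n" using q_ge2 by (rule power_mono) simp
  finally have "n \<le> q ^ n" by simp
  then have "x [^] (q ^ n) = x [^] (q ^ n - n) \<otimes> x [^] n"
    using x(1) by (simp add: nat_pow_mult)
  then have "x [^] (q ^ n) \<in> I" using I_l[OF compatible_ideal[OF I] _ x(2)] x(1) by simp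
  then show ?thesis by (rule roots)
qed

text \<open>\<open>f z u = f (z u\<^sup>q)\<close>, and \<open>u\<^sup>q\<close> is a multiple of \<open>u\<close>.\<close>

lemma colon_compatible:
  assumes I: "compatible I" and u: "u \<in> A"
  shows "compatible (colon I u)"
  unfolding compatible_def
proof (intro conjI ballI)
  show "is_ideal A (colon I u)" using colon_ideal compatible_ideal[OF I] u by blast
  fix z assume z: "z \<in> colon I u"
  then have zA: "z \<in> A" and zu: "z \<otimes> u \<in> I" by (auto simp: colon_def)
  have "u [^] q \<otimes> z = u [^] (q - 1) \<otimes> (z \<otimes> u)"
    using frob_split[of u] u zA by (simp add: m_ac)
  then have "u [^] q \<otimes> z \<in> I" using I_l[OF compatible_ideal[OF I] _ zu] u by simp
  then have "f (u [^] q \<otimes> z) \<in> I" by (rule compatible_f[OF I])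
  then have "f z \<otimes> u \<in> I" using f_lin[OF u zA] u zA by (simp add: m_comm)
  then show "f z \<in> colon I u" using zA by (simp add: colon_def)
qed

lemma compatible_whole: "compatible A"
  unfolding compatible_def using is_ideal_whole by simp

lemma compatible_zero: "compatible {\<zero>}"
  unfolding compatible_def using is_ideal_zero by simp

lemma compatible_Inter:
  assumes "\<F> \<noteq> {}" "\<And>I. I \<in> \<F> \<Longrightarrow> compatible I"
  shows "compatible (\<Inter>\<F>)"
  unfolding compatible_def
proof (intro conjI ballI)
  show "is_ideal A (\<Inter>\<F>)" by (rule is_ideal_Inter[OF assms(1)]) (use assms(2) compatible_ideal in blast)
qed (use assms(2) compatible_f in blast)

text \<open>A compatible ideal maximal among those avoiding \<open>x\<close> is prime: if \<open>a b \<in> P\<close>, then the colon ideals of \<open>P\<close> are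
  compatible and larger, so they contain \<open>x\<close>, and one arrives at \<open>x\<^sup>2 \<in> P\<close>, whereas \<open>P\<close> is radical.\<close>

lemma center_avoiding:
  assumes I: "compatible I" and x: "x \<in> A" "x \<notin> I"
  obtains P where "P \<in> centers" "I \<subseteq> P" "x \<notin> P"
proof -
  let ?F = "{J. compatible J \<and> I \<subseteq> J \<and> x \<notin> J}"
  have "I \<in> ?F" using I x by simp
  then have ne: "?F \<noteq> {}" by blast
  have idl: "?F \<subseteq> {J. is_ideal A J}" using compatible_ideal by blast
  obtain P where P: "P \<in> ?F" and mx: "\<And>J. J \<in> ?F \<Longrightarrow> P \<subseteq> J \<Longrightarrow> J = P"
    using maximal_ideal_in[OF ne idl] by meson
  have Pc: "compatible P" and IP: "I \<subseteq> P" and xP: "x \<notin> P" using P by simp_all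
  note Pi = compatible_ideal[OF Pc]
  have big: "x \<in> colon P u" if "u \<in> A" "v \<in> A" "v \<otimes> u \<in> P" "v \<notin> P" for u v
  proof (rule ccontr)
    assume "x \<notin> colon P u"
    then have "colon P u \<in> ?F" using colon_compatible[OF Pc that(1)] colon_subset[OF Pi that(1)] IP by simp
    then have "colon P u = P" using mx colon_subset[OF Pi that(1)] by simp
    moreover have "v \<in> colon P u" using that by (simp add: colon_def)
    ultimately show False using that(4) by simp
  qed
  have "is_prime A P"
  proof (rule is_primeI[OF Pi])
    show "\<one> \<notin> P"
      using is_ideal_one[OF Pi] xP x(1) by blast
    fix a b assume ab: "a \<in> A" "b \<in> A" "a \<otimes> b \<in> P" "a \<notin> P" "b \<notin> P"
    have 1: "x \<otimes> b \<in> P" using big[OF ab(2) ab(1) ab(3) ab(4)] by (simp add: colon_def)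
    then have "b \<otimes> x \<in> P" using ab(2) x(1) by (simp add: m_comm)
    then have "x \<otimes> x \<in> P" using big[OF x(1) ab(2) _ ab(5)] by (simp add: colon_def)
    then have "x [^] (2::nat) \<in> P" using x(1) by (simp add: numeral_2_eq_2)
    then show False using compatible_radical[OF Pc x(1)] xP by blast
  qed
  then have "P \<in> centers" using Pc by (simp add: centers_def)
  then show ?thesis using IP xP by (rule that)
qed

text \<open>A compatible ideal maximal among those between \<open>I\<close> and \<open>Q\<close> is prime. Colon ideals of \<open>P\<close> by elements
  outside \<open>Q\<close> stay inside \<open>Q\<close>, hence equal \<open>P\<close> by maximality.\<close>

lemma center_between:
  assumes I: "compatible I" and Q: "is_prime A Q" and IQ: "I \<subseteq> Q"
  obtains P where "P \<in> centers" "I \<subseteq> P" "P \<subseteq> Q"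
proof -
  let ?F = "{J. compatible J \<and> I \<subseteq> J \<and> J \<subseteq> Q}"
  have "I \<in> ?F" using I IQ by simp
  then have ne: "?F \<noteq> {}" by blast
  have idl: "?F \<subseteq> {J. is_ideal A J}" using compatible_ideal by blast
  obtain P where P: "P \<in> ?F" and mx: "\<And>J. J \<in> ?F \<Longrightarrow> P \<subseteq> J \<Longrightarrow> J = P"
    using maximal_ideal_in[OF ne idl] by meson
  have Pc: "compatible P" and IP: "I \<subseteq> P" and PQ: "P \<subseteq> Q" using P by simp_all
  note Pi = compatible_ideal[OF Pc]
  have col: "colon P w = P" if "w \<in> A" "colon P w \<subseteq> Q" for w
    using mx[of "colon P w"] colon_compatible[OF Pc that(1)] colon_subset[OF Pi that(1)] IP that by blast
  have "is_prime A P"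
  proof (rule is_primeI[OF Pi])
    show "\<one> \<notin> P" using prime_one[OF Q] PQ by blast
    fix a b assume ab: "a \<in> A" "b \<in> A" "a \<otimes> b \<in> P" "a \<notin> P" "b \<notin> P"
    have "a \<in> colon P b" using ab by (simp add: colon_def)
    then have "\<not> colon P b \<subseteq> Q" using col[OF ab(2)] ab(4) by blast
    then obtain w where w: "w \<in> A" "w \<otimes> b \<in> P" "w \<notin> Q" by (auto simp: colon_def)
    have "colon P w \<subseteq> Q"
    proof
      fix z assume "z \<in> colon P w"
      then have "z \<in> A" "z \<otimes> w \<in> Q" using PQ by (auto simp: colon_def)
      then show "z \<in> Q" using prime_mult[OF Q] w by blast
    qed
    then have "colon P w = P" using col w by simp
    moreover have "b \<in> colon P w" using w ab(2) by (simp add: colon_def m_comm)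
    ultimately show False using ab(5) by simp
  qed
  then have "P \<in> centers" using Pc by (simp add: centers_def)
  then show ?thesis using IP PQ by (rule that)
qed

end

section \<open>Finiteness of the set of centers, and test ideals\<close>

locale F_finite_split = frobenius_split +
  assumes F_gen: "\<exists>n g. (\<forall>i<n. g i \<in> A) \<and>
    (\<forall>x\<in>A. \<exists>a. (\<forall>i<n. a i \<in> A) \<and> x = nsum (\<lambda>i. a i [^] q \<otimes> g i) n)"
begin

context
  fixes Q assumes Q: "Q \<in> centers"
begin

lemma Q_prime: "is_prime A Q" and Q_compat: "compatible Q" and Q_ideal: "is_ideal A Q"
  using centersD[OF Q] compatible_ideal by auto

definition eqm :: "'a \<Rightarrow> 'a \<Rightarrow> bool" where "eqm x y \<longleftrightarrow> x \<ominus> y \<in> Q"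

lemma eqm_refl: "x \<in> A \<Longrightarrow> eqm x x"
  using I_zero[OF Q_ideal] by (simp add: eqm_def a_minus_def r_neg)

lemma eqm_sym: "x \<in> A \<Longrightarrow> y \<in> A \<Longrightarrow> eqm x y \<Longrightarrow> eqm y x"
proof -
  assume a: "x \<in> A" "y \<in> A" "eqm x y"
  have "y \<ominus> x = \<ominus> (x \<ominus> y)" using A_carr[OF a(1)] A_carr[OF a(2)] by algebra
  then show ?thesis using a I_neg[OF Q_ideal] by (simp add: eqm_def)
qed

lemma eqm_trans: "x \<in> A \<Longrightarrow> y \<in> A \<Longrightarrow> z \<in> A \<Longrightarrow> eqm x y \<Longrightarrow> eqm y z \<Longrightarrow> eqm x z"
proof -
  assume a: "x \<in> A" "y \<in> A" "z \<in> A" "eqm x y" "eqm y z"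
  have "x \<ominus> z = (x \<ominus> y) \<oplus> (y \<ominus> z)" using A_carr[OF a(1)] A_carr[OF a(2)] A_carr[OF a(3)] by algebra
  then show ?thesis using a I_add[OF Q_ideal] by (simp add: eqm_def)
qed

lemma eqm_add: "x \<in> A \<Longrightarrow> y \<in> A \<Longrightarrow> x' \<in> A \<Longrightarrow> y' \<in> A \<Longrightarrow> eqm x y \<Longrightarrow> eqm x' y' \<Longrightarrow> eqm (x \<oplus> x') (y \<oplus> y')"
proof -
  assume a: "x \<in> A" "y \<in> A" "x' \<in> A" "y' \<in> A" "eqm x y" "eqm x' y'"
  have "(x \<oplus> x') \<ominus> (y \<oplus> y') = (x \<ominus> y) \<oplus> (x' \<ominus> y')"
    using A_carr[OF a(1)] A_carr[OF a(2)] A_carr[OF a(3)] A_carr[OF a(4)] by algebra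
  then show ?thesis using a I_add[OF Q_ideal] by (simp add: eqm_def)
qed

lemma eqm_minus: "x \<in> A \<Longrightarrow> y \<in> A \<Longrightarrow> x' \<in> A \<Longrightarrow> y' \<in> A \<Longrightarrow> eqm x y \<Longrightarrow> eqm x' y' \<Longrightarrow> eqm (x \<ominus> x') (y \<ominus> y')"
proof -
  assume a: "x \<in> A" "y \<in> A" "x' \<in> A" "y' \<in> A" "eqm x y" "eqm x' y'"
  have "(x \<ominus> x') \<ominus> (y \<ominus> y') = (x \<ominus> y) \<ominus> (x' \<ominus> y')"
    using A_carr[OF a(1)] A_carr[OF a(2)] A_carr[OF a(3)] A_carr[OF a(4)] by algebra
  then show ?thesis using a I_minus[OF Q_ideal] by (simp add: eqm_def)
qed

lemma eqm_mult: "x \<in> A \<Longrightarrow> y \<in> A \<Longrightarrow> c \<in> A \<Longrightarrow> eqm x y \<Longrightarrow> eqm (c \<otimes> x) (c \<otimes> y)"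
proof -
  assume a: "x \<in> A" "y \<in> A" "c \<in> A" "eqm x y"
  have "c \<otimes> x \<ominus> c \<otimes> y = c \<otimes> (x \<ominus> y)"
    using A_carr[OF a(1)] A_carr[OF a(2)] A_carr[OF a(3)] by algebra
  then show ?thesis using a I_l[OF Q_ideal] by (simp add: eqm_def)
qed

lemma eqm_frob: "x \<in> A \<Longrightarrow> y \<in> A \<Longrightarrow> eqm x y \<Longrightarrow> eqm (x [^] q) (y [^] q)"
  using I_pow[OF Q_ideal, of "x \<ominus> y" q] by (simp add: eqm_def frob_minus)

lemma f_minus: "x \<in> A \<Longrightarrow> y \<in> A \<Longrightarrow> f (x \<ominus> y) = f x \<ominus> f y"
proof -
  assume a: "x \<in> A" "y \<in> A"
  have "x = (x \<ominus> y) \<oplus> y" using A_carr[OF a(1)] A_carr[OF a(2)] by algebra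
  then have 1: "f x = f (x \<ominus> y) \<oplus> f y" using f_add[of "x \<ominus> y" y] a by simp
  have c: "f x \<in> carrier L" "f y \<in> carrier L" "f (x \<ominus> y) \<in> carrier L" using a by simp_all
  have "(u \<oplus> v) \<ominus> v = u" if "u \<in> carrier L" "v \<in> carrier L" for u v using that by algebra
  then show ?thesis using c 1 by metis
qed

lemma eqm_zero: "x \<in> A \<Longrightarrow> eqm x \<zero> \<longleftrightarrow> x \<in> Q"
  by (simp add: eqm_def a_minus_def)

lemma eqm_nsum:
  "(\<And>i. i < n \<Longrightarrow> u i \<in> A) \<Longrightarrow> (\<And>i. i < n \<Longrightarrow> v i \<in> A) \<Longrightarrow> (\<And>i. i < n \<Longrightarrow> eqm (u i) (v i)) \<Longrightarrow>
    eqm (nsum u n) (nsum v n)"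
  by (induction n) (auto intro!: eqm_add eqm_refl)

lemma f_nsum: "(\<And>i. i < n \<Longrightarrow> u i \<in> A) \<Longrightarrow> f (nsum u n) = nsum (\<lambda>i. f (u i)) n"
  by (induction n) (auto simp: f_add)

text \<open>Families that are biorthogonal modulo \<open>Q\<close>, up to the factor \<open>c\<close>, for the form \<open>f (x y)\<close>. The factor \<open>c\<close> stands for the
  passage to the fraction field of \<open>A/Q\<close>, over which the form is non-degenerate.\<close>

definition biorth :: "nat \<Rightarrow> (nat \<Rightarrow> 'a) \<Rightarrow> (nat \<Rightarrow> 'a) \<Rightarrow> 'a \<Rightarrow> bool" where
  "biorth n x y c \<longleftrightarrow> c \<in> A \<and> c \<notin> Q \<and> (\<forall>i<n. x i \<in> A \<and> y i \<in> A) \<and>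
    (\<forall>i<n. \<forall>j<n. eqm (f (x i \<otimes> y j)) (if i = j then c else \<zero>))"

text \<open>What remains of \<open>c\<^sup>q z\<close> after subtracting its expansion along the family \<open>x\<close>. It lies in \<open>Q\<close> for all \<open>z\<close> exactly
  when the family spans \<open>F\<^sup>e\<^sub>*(A/Q)\<close> after inverting \<open>c\<close>.\<close>

definition residual :: "nat \<Rightarrow> (nat \<Rightarrow> 'a) \<Rightarrow> (nat \<Rightarrow> 'a) \<Rightarrow> 'a \<Rightarrow> 'a \<Rightarrow> 'a" where
  "residual n x y c z = c [^] q \<otimes> z \<ominus> nsum (\<lambda>i. f (z \<otimes> y i) [^] q \<otimes> x i) n"

lemma biorth_swap: "biorth n x y c \<Longrightarrow> biorth n y x c"
  unfolding biorth_def by (metis (full_types) A_carr m_comm)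

lemma biorthD: 
  assumes "biorth n x y c"
  shows "c \<in> A" "c \<notin> Q" "\<And>i. i < n \<Longrightarrow> x i \<in> A" "\<And>i. i < n \<Longrightarrow> y i \<in> A"
    "\<And>i j. i < n \<Longrightarrow> j < n \<Longrightarrow> eqm (f (x i \<otimes> y j)) (if i = j then c else \<zero>)"
  using assms unfolding biorth_def by blast+

lemma f_residual:
  assumes b: "biorth n x y c" and z: "z \<in> A" and w: "w \<in> A"
  shows "residual n x y c z \<in> A"
    and "f (residual n x y c z \<otimes> w) = c \<otimes> f (z \<otimes> w) \<ominus> nsum (\<lambda>i. f (z \<otimes> y i) \<otimes> f (x i \<otimes> w)) n"
proof -
  note B = biorthD[OF b]
  show "residual n x y c z \<in> A" unfolding residual_def using B z by simp
  have s: "nsum (\<lambda>i. f (z \<otimes> y i) [^] q \<otimes> x i) n \<in> A" using B z by simp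
  have "residual n x y c z \<otimes> w = c [^] q \<otimes> z \<otimes> w \<ominus> nsum (\<lambda>i. f (z \<otimes> y i) [^] q \<otimes> x i) n \<otimes> w"
    unfolding residual_def using A_carr[OF s] A_carr[OF w] A_carr[OF z] A_carr[OF B(1)]
    by (simp add: a_minus_def l_distr l_minus)
  also have "nsum (\<lambda>i. f (z \<otimes> y i) [^] q \<otimes> x i) n \<otimes> w = nsum (\<lambda>i. f (z \<otimes> y i) [^] q \<otimes> (x i \<otimes> w)) n"
    using B z w by (subst nsum_rdistr) (auto intro!: nsum_cong simp: m_assoc)
  finally have 1: "residual n x y c z \<otimes> w = c [^] q \<otimes> (z \<otimes> w) \<ominus> nsum (\<lambda>i. f (z \<otimes> y i) [^] q \<otimes> (x i \<otimes> w)) n"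
    using B(1) z w by (simp add: m_assoc)
  have "f (nsum (\<lambda>i. f (z \<otimes> y i) [^] q \<otimes> (x i \<otimes> w)) n) = nsum (\<lambda>i. f (z \<otimes> y i) \<otimes> f (x i \<otimes> w)) n"
    using B z w by (subst f_nsum) (auto intro!: nsum_cong simp: f_lin)
  then show "f (residual n x y c z \<otimes> w) = c \<otimes> f (z \<otimes> w) \<ominus> nsum (\<lambda>i. f (z \<otimes> y i) \<otimes> f (x i \<otimes> w)) n"
    unfolding 1 using B z w by (subst f_minus) (auto simp: f_lin)
qed

lemma f_residual_y:
  assumes b: "biorth n x y c" and z: "z \<in> A" and j: "j < n"
  shows "f (residual n x y c z \<otimes> y j) \<in> Q"
proof -
  note B = biorthD[OF b]
  have "eqm (nsum (\<lambda>i. f (z \<otimes> y i) \<otimes> f (x i \<otimes> y j)) n)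
      (nsum (\<lambda>i. f (z \<otimes> y i) \<otimes> (if i = j then c else \<zero>)) n)"
    using B z j by (intro eqm_nsum eqm_mult) auto
  also have "nsum (\<lambda>i. f (z \<otimes> y i) \<otimes> (if i = j then c else \<zero>)) n =
     nsum (\<lambda>i. if i = j then f (z \<otimes> y j) \<otimes> c else \<zero>) n"
    using B z by (intro nsum_cong) auto
  also have "\<dots> = f (z \<otimes> y j) \<otimes> c" using B z j by (intro nsum_delta) auto
  finally have 1: "eqm (nsum (\<lambda>i. f (z \<otimes> y i) \<otimes> f (x i \<otimes> y j)) n) (f (z \<otimes> y j) \<otimes> c)" .
  have "eqm (c \<otimes> f (z \<otimes> y j) \<ominus> nsum (\<lambda>i. f (z \<otimes> y i) \<otimes> f (x i \<otimes> y j)) n)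
     (c \<otimes> f (z \<otimes> y j) \<ominus> f (z \<otimes> y j) \<otimes> c)"
    using B z j 1 by (intro eqm_minus eqm_refl) auto
  then have "eqm (f (residual n x y c z \<otimes> y j)) \<zero>"
    unfolding f_residual(2)[OF b z B(4)[OF j]] using B z j by (simp add: m_comm a_minus_def r_neg)
  then show ?thesis using eqm_zero f_residual(1)[OF b z] B(4)[OF j] z by simp
qed

lemma f_residual_orth:
  assumes b: "biorth n x y c" and z: "z \<in> A" and w: "w \<in> A"
    and o: "\<And>i. i < n \<Longrightarrow> f (x i \<otimes> w) \<in> Q"
  shows "eqm (c \<otimes> f (z \<otimes> w)) (f (residual n x y c z \<otimes> w))"
proof -
  note B = biorthD[OF b]
  have "nsum (\<lambda>i. f (z \<otimes> y i) \<otimes> f (x i \<otimes> w)) n \<in> Q"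
    using B z o by (intro I_nsum[OF Q_ideal] I_l[OF Q_ideal]) auto
  moreover have "t \<ominus> (t \<ominus> s) = s" if "t \<in> carrier L" "s \<in> carrier L" for t s
    using that by algebra
  ultimately show ?thesis unfolding f_residual(2)[OF b z w] eqm_def using B z w by simp
qed

text \<open>A Gram-Schmidt step. If the residual \<open>x'\<close> of \<open>h\<close> is not in \<open>Q\<close>, then surjectivity of \<open>f\<close> provides \<open>w\<close> with
  \<open>f (x' w) = x'\<close>, and the residual \<open>y'\<close> of \<open>w\<close> for the swapped families pairs with \<open>x'\<close> to an element outside \<open>Q\<close>.
  The new family consists of \<open>x, x'\<close> and suitable multiples of \<open>y, y'\<close>.\<close>

lemma biorth_extend:
  assumes b: "biorth n x y c" and G: "\<And>g. g \<in> G \<Longrightarrow> g \<in> A \<and> residual n x y c g \<in> Q" and h: "h \<in> A"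
  shows "\<exists>n x y c. biorth n x y c \<and> (\<forall>g\<in>insert h G. residual n x y c g \<in> Q)"
proof (cases "residual n x y c h \<in> Q")
  case True
  then show ?thesis using b G by blast
next
  case False
  note B = biorthD[OF b]
  define x' where "x' = residual n x y c h"
  have x': "x' \<in> A" "x' \<notin> Q" using False f_residual(1)[OF b h h] by (auto simp: x'_def)
  obtain w0 where w0: "w0 \<in> A" "f (x' [^] q \<otimes> w0) = x'" using f_surj[OF x'(1)] by blast
  \<comment> \<open>so that x' w = x'^q w0, which f sends to x'\<close>
  define w where "w = x' [^] (q - 1) \<otimes> w0"
  have w: "w \<in> A" "f (x' \<otimes> w) = x'"
    using w0 x' frob_split[of x'] by (auto simp: w_def m_assoc)
  define y' where "y' = residual n y x c w"
  have y': "y' \<in> A" using f_residual(1)[OF biorth_swap[OF b] w(1) w(1)] by (simp add: y'_def)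
  define d where "d = f (x' \<otimes> y')"
  have d: "d \<in> A" using x' y' by (simp add: d_def)
  have x'y: "f (x' \<otimes> y i) \<in> Q" if "i < n" for i
    using f_residual_y[OF b h that] by (simp add: x'_def)
  have xy': "f (x i \<otimes> y') \<in> Q" if "i < n" for i
    using f_residual_y[OF biorth_swap[OF b] w(1) that] B(3)[OF that] y' by (simp add: y'_def m_comm)
  have "eqm (c \<otimes> f (w \<otimes> x')) (f (residual n y x c w \<otimes> x'))"
    using x'y B x' by (intro f_residual_orth[OF biorth_swap[OF b] w(1) x'(1)]) (simp add: m_comm)
  then have "eqm (c \<otimes> x') d"
    using w x' y' by (simp add: d_def y'_def[symmetric] m_comm)
  moreover have "c \<otimes> x' \<notin> Q" using B x' prime_mult[OF Q_prime] by blast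
  ultimately have dQ: "d \<notin> Q"
    using eqm_zero eqm_trans[of "c \<otimes> x'" d \<zero>] B(1) x'(1) d by fastforce
  \<comment> \<open>the factors make all diagonal values equal to c d; they are q-th powers so that f is linear in c and d\<close>
  define Y where "Y i = (if i < n then d [^] q \<otimes> y i else c [^] q \<otimes> y')" for i
  let ?X = "x(n := x')"
  have bi: "biorth (Suc n) ?X Y (c \<otimes> d)"
    unfolding biorth_def
  proof (intro conjI allI impI)
    show "c \<otimes> d \<in> A" using B d by simp
    show "c \<otimes> d \<notin> Q" using B d dQ prime_mult[OF Q_prime] by blast
    show "?X i \<in> A" if "i < Suc n" for i using B x' that by auto
    show "Y i \<in> A" if "i < Suc n" for i using B d y' that by (auto simp: Y_def)
    have lc: "f (u \<otimes> (r [^] q \<otimes> v)) = r \<otimes> f (u \<otimes> v)" if "u \<in> A" "v \<in> A" "r \<in> A" for u v r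
      using f_lin[of r "u \<otimes> v"] that by (simp add: m_lcomm)
    fix i j assume ij: "i < Suc n" "j < Suc n"
    consider "i < n" "j < n" | "i < n" "j = n" | "i = n" "j < n" | "i = n" "j = n" using ij by linarith
    then show "eqm (f (?X i \<otimes> Y j)) (if i = j then c \<otimes> d else \<zero>)"
    proof cases
      case 1
      then have "eqm (d \<otimes> f (x i \<otimes> y j)) (d \<otimes> (if i = j then c else \<zero>))"
        using B d by (intro eqm_mult) auto
      then show ?thesis using 1 B d lc by (auto simp: Y_def m_comm)
    next
      case 2
      then show ?thesis using xy' B y' lc I_l[OF Q_ideal] eqm_zero by (simp add: Y_def)
    next
      case 3
      then show ?thesis using x'y B x' d lc I_l[OF Q_ideal] eqm_zero by (simp add: Y_def)
    next
      case 4
      then show ?thesis using B x' y' lc d eqm_refl by (simp add: Y_def d_def)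
    qed
  qed
  have res: "residual (Suc n) ?X Y (c \<otimes> d) z =
      d [^] q \<otimes> residual n x y c z \<ominus> (c \<otimes> f (z \<otimes> y')) [^] q \<otimes> x'" if z: "z \<in> A" for z
  proof -
    have lc: "f (u \<otimes> (r [^] q \<otimes> v)) = r \<otimes> f (u \<otimes> v)" if "u \<in> A" "v \<in> A" "r \<in> A" for u v r
      using f_lin[of r "u \<otimes> v"] that by (simp add: m_lcomm)
    let ?s = "nsum (\<lambda>i. f (z \<otimes> y i) [^] q \<otimes> x i) n"
    have "nsum (\<lambda>i. f (z \<otimes> Y i) [^] q \<otimes> ?X i) n = nsum (\<lambda>i. d [^] q \<otimes> (f (z \<otimes> y i) [^] q \<otimes> x i)) n"
      using B z d lc by (intro nsum_cong) (simp add: Y_def frob_mult m_assoc)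
    also have "\<dots> = d [^] q \<otimes> ?s" using B z d by (intro nsum_ldistr[symmetric]) auto
    finally have "residual (Suc n) ?X Y (c \<otimes> d) z = (c \<otimes> d) [^] q \<otimes> z \<ominus>
        (d [^] q \<otimes> ?s \<oplus> (c \<otimes> f (z \<otimes> y')) [^] q \<otimes> x')"
      unfolding residual_def using lc z B y' by (simp add: Y_def)
    moreover have "(c' \<otimes> d') \<otimes> z' \<ominus> (d' \<otimes> s' \<oplus> t') = d' \<otimes> (c' \<otimes> z' \<ominus> s') \<ominus> t'"
      if "c' \<in> carrier L" "d' \<in> carrier L" "z' \<in> carrier L" "s' \<in> carrier L" "t' \<in> carrier L"
      for c' d' z' s' t' using that by algebra
    ultimately show ?thesis unfolding residual_def using B z d x' y' by (simp add: frob_mult)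
  qed
  have orth: "eqm (c \<otimes> f (z \<otimes> y')) (f (residual n x y c z \<otimes> y'))" if "z \<in> A" for z
    using f_residual_orth[OF b that y' xy'] .
  have "residual (Suc n) ?X Y (c \<otimes> d) g \<in> Q" if "g \<in> insert h G" for g
  proof (cases "g = h")
    case True
    have "eqm d (c \<otimes> f (h \<otimes> y'))"
      using eqm_sym orth[OF h] B h y' d by (simp add: x'_def d_def)
    then have "eqm (d [^] q) ((c \<otimes> f (h \<otimes> y')) [^] q)" using B h y' d by (intro eqm_frob) auto
    then have "eqm (x' \<otimes> d [^] q) (x' \<otimes> (c \<otimes> f (h \<otimes> y')) [^] q)"
      using B h y' d x' by (intro eqm_mult) auto
    then show ?thesis using res[OF h] True B h y' d x' by (simp add: eqm_def x'_def[symmetric] m_comm)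
  next
    case False
    then have g: "g \<in> A" "residual n x y c g \<in> Q" using that G by auto
    have "residual n x y c g \<otimes> y' \<in> Q" using I_r[OF Q_ideal y' g(2)] .
    then have "f (residual n x y c g \<otimes> y') \<in> Q" using compatible_f[OF Q_compat] by blast
    then have "c \<otimes> f (g \<otimes> y') \<in> Q"
      using orth[OF g(1)] eqm_zero eqm_trans[of "c \<otimes> f (g \<otimes> y')" "f (residual n x y c g \<otimes> y')" \<zero>]
        B(1) g(1) y' f_residual(1)[OF b g(1) y'] by fastforce
    then have "(c \<otimes> f (g \<otimes> y')) [^] q \<in> Q" by (rule I_pow[OF Q_ideal]) simp
    then show ?thesis unfolding res[OF g(1)] using d g x'
      by (intro I_minus[OF Q_ideal] I_l[OF Q_ideal] I_r[OF Q_ideal]) auto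
  qed
  then show ?thesis using bi by blast
qed

lemma exists_biorth:
  "\<exists>n x y c. biorth n x y c \<and> (\<forall>z\<in>A. residual n x y c z \<in> Q)"
proof -
  obtain N g where g: "\<And>i. i < N \<Longrightarrow> g i \<in> A"
    and gen: "\<And>x. x \<in> A \<Longrightarrow> \<exists>a. (\<forall>i<N. a i \<in> A) \<and> x = nsum (\<lambda>i. a i [^] q \<otimes> g i) N"
    using F_gen by blast
  have "k \<le> N \<Longrightarrow> \<exists>n x y c. biorth n x y c \<and> (\<forall>h\<in>g ` {..<k}. residual n x y c h \<in> Q)" for k
  proof (induction k)
    case 0
    have "biorth 0 x x \<one>" for x :: "nat \<Rightarrow> 'a" using prime_one[OF Q_prime] by (simp add: biorth_def)
    then show ?case by (auto intro!: exI[of _ "0::nat"])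
  next
    case (Suc k)
    then obtain n x y c where b: "biorth n x y c" "\<forall>h\<in>g ` {..<k}. residual n x y c h \<in> Q" by auto
    have "\<exists>n x y c. biorth n x y c \<and> (\<forall>h\<in>insert (g k) (g ` {..<k}). residual n x y c h \<in> Q)"
      by (rule biorth_extend[OF b(1)]) (use b(2) g Suc.prems in auto)
    then show ?case by (simp add: lessThan_Suc)
  qed
  then obtain n x y c where b: "biorth n x y c" "\<forall>h\<in>g ` {..<N}. residual n x y c h \<in> Q" by blast
  note B = biorthD[OF b(1)]
  have "residual n x y c z \<in> Q" if z: "z \<in> A" for z
  proof -
    obtain a where a: "\<forall>i<N. a i \<in> A" "z = nsum (\<lambda>i. a i [^] q \<otimes> g i) N" using gen[OF z] by blast
    have "residual n x y c z = nsum (\<lambda>k. a k [^] q \<otimes> residual n x y c (g k)) N"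
    proof -
      have "f (z \<otimes> y i) = nsum (\<lambda>k. a k \<otimes> f (g k \<otimes> y i)) N" if i: "i < n" for i
      proof -
        have "z \<otimes> y i = nsum (\<lambda>k. a k [^] q \<otimes> (g k \<otimes> y i)) N"
          unfolding a(2) using a(1) g B(4)[OF i]
          by (subst nsum_rdistr) (auto intro!: nsum_cong simp: m_assoc)
        then show ?thesis using a(1) g B(4)[OF i] by (simp add: f_nsum f_lin cong: nsum_cong)
      qed
      then have "f (z \<otimes> y i) [^] q \<otimes> x i = nsum (\<lambda>k. a k [^] q \<otimes> (f (g k \<otimes> y i) [^] q \<otimes> x i)) N" if i: "i < n" for i
        using i a(1) g B(3,4)[OF i] by (simp add: frob_nsum nsum_rdistr frob_mult m_assoc cong: nsum_cong)
      then have "nsum (\<lambda>i. f (z \<otimes> y i) [^] q \<otimes> x i) n =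
          nsum (\<lambda>i. nsum (\<lambda>k. a k [^] q \<otimes> (f (g k \<otimes> y i) [^] q \<otimes> x i)) N) n"
        by (rule nsum_cong)
      also have "\<dots> = nsum (\<lambda>k. nsum (\<lambda>i. a k [^] q \<otimes> (f (g k \<otimes> y i) [^] q \<otimes> x i)) n) N"
        using a(1) g B by (intro nsum_swap) auto
      also have "\<dots> = nsum (\<lambda>k. a k [^] q \<otimes> nsum (\<lambda>i. f (g k \<otimes> y i) [^] q \<otimes> x i) n) N"
        using a(1) g B by (intro nsum_cong nsum_ldistr[symmetric]) auto
      finally have 1: "nsum (\<lambda>i. f (z \<otimes> y i) [^] q \<otimes> x i) n =
        nsum (\<lambda>k. a k [^] q \<otimes> nsum (\<lambda>i. f (g k \<otimes> y i) [^] q \<otimes> x i) n) N" .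
      have 2: "c [^] q \<otimes> z = nsum (\<lambda>k. a k [^] q \<otimes> (c [^] q \<otimes> g k)) N"
        unfolding a(2) using a(1) g B(1) by (subst nsum_ldistr) (auto intro!: nsum_cong simp: m_lcomm)
      have "u \<otimes> (v \<ominus> w) = u \<otimes> v \<oplus> \<ominus> (u \<otimes> w)" if "u \<in> carrier L" "v \<in> carrier L" "w \<in> carrier L" for u v w
        using that by algebra
      then have "nsum (\<lambda>k. a k [^] q \<otimes> residual n x y c (g k)) N =
          nsum (\<lambda>k. a k [^] q \<otimes> (c [^] q \<otimes> g k) \<oplus>
            \<ominus> (a k [^] q \<otimes> nsum (\<lambda>i. f (g k \<otimes> y i) [^] q \<otimes> x i) n)) N"
        unfolding residual_def using a(1) g B by (intro nsum_cong) simp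
      also have "\<dots> = c [^] q \<otimes> z \<ominus> nsum (\<lambda>i. f (z \<otimes> y i) [^] q \<otimes> x i) n"
        unfolding 1 2 a_minus_def using a(1) g B by (simp add: nsum_add nsum_neg)
      finally show ?thesis unfolding residual_def by simp
    qed
    also have "\<dots> \<in> Q" using b(2) a(1) by (intro I_nsum[OF Q_ideal] I_l[OF Q_ideal]) auto
    finally show ?thesis .
  qed
  then show ?thesis using b(1) by blast
qed

end
end

context F_finite_split
begin

text \<open>Let \<open>c\<close> come from biorthogonal families spanning \<open>F\<^sup>e\<^sub>*(A/Q)\<close> after inverting \<open>c\<close>, and let \<open>P \<supset> Q\<close> be a center with
  \<open>c \<notin> P\<close>. The expansion of \<open>z \<in> P\<close> has coefficients \<open>f (z y\<^sub>i) \<in> P\<close> raised to the power \<open>q\<close>, so \<open>c\<^sup>q P \<subseteq> P\<^sup>2 + Q\<close>.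
  By Nakayama (\<open>elimination\<close>) some \<open>u \<notin> P\<close> has \<open>u P \<subseteq> Q\<close>, which contradicts \<open>P \<noteq> Q\<close>. Thus \<open>c\<close> lies in
  every center strictly above \<open>Q\<close>, and every compatible ideal is an intersection of centers.\<close>

lemma test_element:
  assumes Q: "Q \<in> centers"
  shows "\<exists>c\<in>A. c \<notin> Q \<and> (\<forall>I. compatible I \<and> Q \<subset> I \<longrightarrow> c \<in> I)"
proof -
  obtain n x y c where b: "biorth Q n x y c" and res: "\<And>z. z \<in> A \<Longrightarrow> residual n x y c z \<in> Q"
    using exists_biorth[OF Q] by blast
  note B = biorthD[OF Q b]
  note Qp = Q_prime[OF Q] and Qi = Q_ideal[OF Q]
  have center_case: "c \<in> P" if P: "P \<in> centers" "Q \<subset> P" for P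
  proof (rule ccontr)
    assume cP: "c \<notin> P"
    note Pp = Q_prime[OF P(1)] and Pi = Q_ideal[OF P(1)]
    obtain h m where h: "\<And>i. i < m \<Longrightarrow> h i \<in> P"
      and gen: "\<And>x. x \<in> P \<Longrightarrow> \<exists>c. (\<forall>i<m. c i \<in> A) \<and> x = nsum (\<lambda>i. c i \<otimes> h i) m"
      using ideal_fg[OF Pi] by metis
    have hA: "h i \<in> A" if "i < m" for i using h[OF that] I_A[OF Pi] by blast
    have fP: "f (h k \<otimes> y i) \<in> P" if "k < m" "i < n" for k i
      using h that B I_r[OF Pi] compatible_f[OF Q_compat[OF P(1)]] by blast
    have "\<forall>k i. k < m \<longrightarrow> i < n \<longrightarrow> (\<exists>c. (\<forall>j<m. c j \<in> A) \<and> f (h k \<otimes> y i) = nsum (\<lambda>j. c j \<otimes> h j) m)"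
      using gen fP by blast
    then obtain d where d: "\<And>k i. k < m \<Longrightarrow> i < n \<Longrightarrow>
        (\<forall>j<m. d k i j \<in> A) \<and> f (h k \<otimes> y i) = nsum (\<lambda>j. d k i j \<otimes> h j) m"
      by metis
    \<comment> \<open>splitting off q - 1 factors leaves a coefficient in P, which needs q to be at least 2\<close>
    define t where "t k i = f (h k \<otimes> y i) [^] (q - 1) \<otimes> x i" for k i
    have tP: "t k i \<in> P" if "k < m" "i < n" for k i
      unfolding t_def using fP[OF that] B(3)[OF that(2)] q_gt1 by (intro I_r[OF Pi] I_pow[OF Pi])
    define C where "C k j = nsum (\<lambda>i. t k i \<otimes> d k i j) n" for k j
    have CP: "C k j \<in> P" if "k < m" "j < m" for k j
      unfolding C_def using tP d that by (intro I_nsum[OF Pi] I_r[OF Pi]) auto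
    have rel: "nsum (\<lambda>j. C k j \<otimes> h j) m = nsum (\<lambda>i. f (h k \<otimes> y i) [^] q \<otimes> x i) n" if k: "k < m" for k
    proof -
      have tc: "t k i \<in> A" if "i < n" for i using tP[OF k that] I_A[OF Pi] by blast
      have "nsum (\<lambda>j. C k j \<otimes> h j) m = nsum (\<lambda>j. nsum (\<lambda>i. t k i \<otimes> (d k i j \<otimes> h j)) n) m"
        unfolding C_def
      proof (rule nsum_cong)
        fix j assume j: "j < m"
        show "nsum (\<lambda>i. t k i \<otimes> d k i j) n \<otimes> h j = nsum (\<lambda>i. t k i \<otimes> (d k i j \<otimes> h j)) n"
          using tc d[OF k] hA[OF j] j by (subst nsum_rdistr) (auto intro!: nsum_cong simp: m_assoc)
      qed
      also have "\<dots> = nsum (\<lambda>i. nsum (\<lambda>j. t k i \<otimes> (d k i j \<otimes> h j)) m) n"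
        using tc d[OF k] hA by (intro nsum_swap) auto
      also have "\<dots> = nsum (\<lambda>i. f (h k \<otimes> y i) [^] q \<otimes> x i) n"
      proof (rule nsum_cong)
        fix i assume i: "i < n"
        have "nsum (\<lambda>j. t k i \<otimes> (d k i j \<otimes> h j)) m = t k i \<otimes> f (h k \<otimes> y i)"
          using tc[OF i] d[OF k i] hA nsum_ldistr[of "t k i" m "\<lambda>j. d k i j \<otimes> h j"] by simp
        also have "\<dots> = f (h k \<otimes> y i) [^] q \<otimes> x i"
          using hA[OF k] B(3,4)[OF i] frob_split[of "f (h k \<otimes> y i)"] by (simp add: t_def m_ac)
        finally show "nsum (\<lambda>j. t k i \<otimes> (d k i j \<otimes> h j)) m = f (h k \<otimes> y i) [^] q \<otimes> x i" .
      qed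
      finally show ?thesis .
    qed
    let ?A = "\<lambda>k j. if k = j then c [^] q \<oplus> \<ominus> C k j else \<ominus> C k j"
    have CA: "C k j \<in> A" if "k < m" "j < m" for k j using CP[OF that] I_A[OF Pi] by blast
    have cq: "c [^] q \<in> A" "c [^] q \<notin> P" using B(1) cP prime_pow[OF Pp] by auto
    have avoid_add: "a \<oplus> b \<in> A - P" if "a \<in> A - P" "b \<in> P" for a b
      using that I_add_cancel[OF Pi, of a b] I_A[OF Pi] by auto
    have "\<exists>d'::nat. \<exists>u \<in> A - P. \<forall>i<m. u \<otimes> h i \<in> Q"
    proof (rule elimination[where M = "\<lambda>_. A - P" and I = "\<lambda>_. P" and A = ?A and N = Q])
      show "A - P \<subseteq> carrier L" "P \<subseteq> carrier L" "Q \<subseteq> carrier L" "\<zero> \<in> Q"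
        using I_carr[OF Pi] I_carr[OF Qi] I_zero[OF Qi] by auto
      show "A - P \<noteq> {}" using cq by blast
      show "nsum (\<lambda>j. ?A k j \<otimes> h j) m \<in> Q" if k: "k < m" for k
      proof -
        have "nsum (\<lambda>j. ?A k j \<otimes> h j) m =
            nsum (\<lambda>j. (if j = k then c [^] q \<otimes> h k else \<zero>) \<oplus> \<ominus> (C k j \<otimes> h j)) m"
          using CA[OF k] hA B(1) by (intro nsum_cong) (auto simp: l_distr l_minus)
        also have "\<dots> = nsum (\<lambda>j. if j = k then c [^] q \<otimes> h k else \<zero>) m \<oplus> nsum (\<lambda>j. \<ominus> (C k j \<otimes> h j)) m"
          using CA[OF k] hA B(1) k by (intro nsum_add) auto
        also have "\<dots> = residual n x y c (h k)"
          using nsum_delta[OF k, of "c [^] q \<otimes> h k"] B(1) hA k CA[OF k] rel[OF k]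
          by (simp add: residual_def[OF Q] a_minus_def nsum_neg[symmetric])
        finally show ?thesis using res[OF hA[OF k]] by simp
      qed
      show "a \<otimes> b \<in> A - P" if "a \<in> A - P" "b \<in> A - P" for a b
        using that prime_mult[OF Pp] by auto
      show "a \<otimes> b \<in> P" if "a \<in> A - P" "b \<in> P" for a b using that I_l[OF Pi] by blast
      show "a \<otimes> b \<in> P" if "a \<in> P" "b \<in> P" for a b using that I_l[OF Pi] I_A[OF Pi] by blast
      show "a \<otimes> b \<in> Q" if "a \<in> (A - P) \<union> P" "b \<in> Q" for a b using that I_l[OF Qi] I_A[OF Pi] by blast
      show "?A i i \<in> A - P" if "i < m" for i
        using avoid_add[of "c [^] q" "\<ominus> C i i"] cq I_neg[OF Pi CP[OF that that]] by simp
      show "?A i j \<in> P" if "i < m" "j < m" "i \<noteq> j" for i j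
        using that I_neg[OF Pi CP[OF that(1,2)]] by simp
    qed (use avoid_add hA I_add[OF Qi] I_neg[OF Qi] I_add[OF Pi] I_neg[OF Pi] in auto)
    then obtain u where u: "u \<in> A" "u \<notin> P" "\<And>i. i < m \<Longrightarrow> u \<otimes> h i \<in> Q" by blast
    have "h i \<in> Q" if "i < m" for i
      using prime_mult[OF Qp u(1) hA[OF that] u(3)[OF that]] u(2) P(2) by blast
    then have "P \<subseteq> Q"
      using gen I_nsum[OF Qi] I_l[OF Qi] by (metis (no_types, lifting) subsetI)
    then show False using P(2) by blast
  qed
  have "c \<in> I" if I: "compatible I" "Q \<subset> I" for I
  proof (rule ccontr)
    assume "c \<notin> I"
    then obtain P where "P \<in> centers" "I \<subseteq> P" "c \<notin> P"
      using center_avoiding[OF I(1) B(1)] by blast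
    then show False using center_case[of P] I(2) by blast
  qed
  then show ?thesis using B(1,2) by blast
qed

text \<open>Noetherian induction: a compatible ideal maximal among those below infinitely many centers is prime,
  hence a center \<open>I\<close>; but all other centers above \<open>I\<close> contain its test element \<open>c \<notin> I\<close>.\<close>

lemma finite_centers: "finite centers"
proof (rule ccontr)
  assume inf: "infinite centers"
  let ?F = "{I. compatible I \<and> infinite {P \<in> centers. I \<subseteq> P}}"
  have "{P \<in> centers. {\<zero>} \<subseteq> P} = centers"
    using I_zero centersD(2) compatible_ideal by blast
  then have "{\<zero>} \<in> ?F" using inf compatible_zero by simp
  then have ne: "?F \<noteq> {}" by blast
  have idl: "?F \<subseteq> {J. is_ideal A J}" using compatible_ideal by blast
  obtain I where I: "I \<in> ?F" and mx: "\<And>J. J \<in> ?F \<Longrightarrow> I \<subseteq> J \<Longrightarrow> J = I"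
    using maximal_ideal_in[OF ne idl] by meson
  have Ic: "compatible I" and Iinf: "infinite {P \<in> centers. I \<subseteq> P}" using I by simp_all
  note Ii = compatible_ideal[OF Ic]
  have fin: "finite {P \<in> centers. J \<subseteq> P}" if "compatible J" "I \<subset> J" for J
    using mx[of J] that by blast
  have fin_elt: "finite {P \<in> centers. I \<subseteq> P \<and> u \<in> P}" if u: "u \<in> A" "u \<notin> I" for u
  proof -
    let ?J = "\<Inter>{J. compatible J \<and> I \<subseteq> J \<and> u \<in> J}"
    have "A \<in> {J. compatible J \<and> I \<subseteq> J \<and> u \<in> J}" using compatible_whole I_A[OF Ii] u by blast
    then have "compatible ?J" by (intro compatible_Inter) blast+
    moreover have "I \<subset> ?J" using u by blast
    ultimately have "finite {P \<in> centers. ?J \<subseteq> P}" by (rule fin)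
    moreover have "{P \<in> centers. I \<subseteq> P \<and> u \<in> P} \<subseteq> {P \<in> centers. ?J \<subseteq> P}"
      using centersD(2) by blast
    ultimately show ?thesis by (rule rev_finite_subset)
  qed
  have one: "\<one> \<notin> I"
  proof
    assume "\<one> \<in> I"
    then have e: "{P \<in> centers. I \<subseteq> P} = {}" using prime_one[OF centersD(1)] by blast
    show False using Iinf unfolding e by simp
  qed
  have "is_prime A I"
  proof (rule is_primeI[OF Ii one])
    fix a b assume ab: "a \<in> A" "b \<in> A" "a \<otimes> b \<in> I" "a \<notin> I" "b \<notin> I"
    have "{P \<in> centers. I \<subseteq> P} \<subseteq> {P \<in> centers. I \<subseteq> P \<and> a \<in> P} \<union> {P \<in> centers. I \<subseteq> P \<and> b \<in> P}"
      using prime_mult[OF centersD(1)] ab by blast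
    then show False using fin_elt[OF ab(1,4)] fin_elt[OF ab(2,5)] Iinf
      by (meson finite_UnI finite_subset)
  qed
  then have "I \<in> centers" using Ic by (simp add: centers_def)
  then obtain c where c: "c \<in> A" "c \<notin> I" "\<And>J. compatible J \<Longrightarrow> I \<subset> J \<Longrightarrow> c \<in> J"
    using test_element by metis
  have "{P \<in> centers. I \<subseteq> P} \<subseteq> insert I {P \<in> centers. I \<subseteq> P \<and> c \<in> P}"
    using c(3) centersD(2) by blast
  then show False using fin_elt[OF c(1,2)] Iinf by (meson finite_insert finite_subset)
qed

text \<open>An intersection of centers, hence compatible and contained in each compatible ideal not below \<open>P\<close>. It
  is itself not below the prime \<open>P\<close> because only finitely many centers are intersected.\<close>

definition test_ideal :: "'a set \<Rightarrow> 'a set" where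
  "test_ideal P = A \<inter> \<Inter>{Q \<in> centers. \<not> Q \<subseteq> P}"

lemma test_ideal_compatible: "compatible (test_ideal P)"
proof -
  have "test_ideal P = \<Inter>(insert A {Q \<in> centers. \<not> Q \<subseteq> P})" by (auto simp: test_ideal_def)
  also have "compatible \<dots>" by (rule compatible_Inter) (use compatible_whole centersD(2) in auto)
  finally show ?thesis .
qed

lemma test_ideal_not_subset:
  assumes P: "is_prime A P" shows "\<not> test_ideal P \<subseteq> P"
proof -
  have *: "\<lbrakk>finite \<F>; \<And>Q. Q \<in> \<F> \<Longrightarrow> is_ideal A Q \<and> \<not> Q \<subseteq> P\<rbrakk> \<Longrightarrow> \<exists>x\<in>A \<inter> \<Inter>\<F>. x \<notin> P" for \<F>
  proof (induction rule: finite_induct)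
    case empty
    then show ?case using prime_one[OF P] A_one by blast
  next
    case (insert Q \<F>)
    then obtain x where x: "x \<in> A" "\<And>Q. Q \<in> \<F> \<Longrightarrow> x \<in> Q" "x \<notin> P" by blast
    obtain y where y: "y \<in> Q" "y \<notin> P" and Qi: "is_ideal A Q" using insert.prems by blast
    have yA: "y \<in> A" using I_A[OF Qi y(1)] .
    have "x \<otimes> y \<in> J" if "J \<in> \<F>" for J
    proof (rule I_r)
      show "is_ideal A J" using insert.prems[of J] that by simp
    qed (use yA x(2)[OF that] in simp_all)
    then have "x \<otimes> y \<in> A \<inter> \<Inter>(insert Q \<F>)"
      using x(1) yA I_l[OF Qi x(1) y(1)] by simp
    moreover have "x \<otimes> y \<notin> P" using prime_mult[OF P x(1) yA] x(3) y(2) by blast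
    ultimately show ?case by blast
  qed
  have "\<exists>x\<in>A \<inter> \<Inter>{Q \<in> centers. \<not> Q \<subseteq> P}. x \<notin> P"
    by (rule *) (use finite_centers centersD(2) compatible_ideal in auto)
  then show ?thesis unfolding test_ideal_def by blast
qed

lemma test_ideal_least:
  assumes "compatible I" "\<not> I \<subseteq> P"
  shows "test_ideal P \<subseteq> I"
proof
  fix x assume x: "x \<in> test_ideal P"
  show "x \<in> I"
  proof (rule ccontr)
    assume "x \<notin> I"
    moreover have "x \<in> A" using x by (simp add: test_ideal_def)
    ultimately obtain Q where "Q \<in> centers" "I \<subseteq> Q" "x \<notin> Q"
      using center_avoiding[OF assms(1)] by blast
    then show False using x assms(2) unfolding test_ideal_def by blast
  qed
qed

end

context frobenius_split
begin

lemma phi_ideal_iff: "phi_ideal (L\<lparr>carrier := A\<rparr>) f I \<longleftrightarrow> compatible I"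
  unfolding phi_ideal_def compatible_def ideal_iff by auto

lemma Schpec_eq: "Schpec (L\<lparr>carrier := A\<rparr>) f = centers"
proof -
  have "\<not> f ` A \<subseteq> P" if "P \<in> centers" for P
    using f_one prime_one[OF centersD(1)[OF that]] by (metis imageI subsetD)
  then show ?thesis unfolding Schpec_def prime_iff phi_ideal_iff centers_def by auto
qed

end

context F_finite_split
begin

lemma test_ideal_along_eq:
  assumes P: "is_prime A P"
  shows "test_ideal_along (L\<lparr>carrier := A\<rparr>) f P = test_ideal P"
  unfolding test_ideal_along_def phi_ideal_iff
  by (rule Least_equality) (use test_ideal_compatible test_ideal_not_subset[OF P] test_ideal_least in auto)

end

section \<open>Coordinates and traces\<close>

context ring
begin

lemma combine_nsum:
  assumes "length ks = length us" "set ks \<subseteq> carrier R" "set us \<subseteq> carrier R"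
  shows "combine ks us = nsum (\<lambda>i. ks ! i \<otimes> us ! i) (length us)"
  using assms
proof (induction us arbitrary: ks)
  case (Cons u us)
  then obtain k ks' where ks: "ks = k # ks'" by (cases ks) auto
  have "nsum (\<lambda>i. ks ! i \<otimes> (u # us) ! i) (length (u # us)) =
      ks ! 0 \<otimes> (u # us) ! 0 \<oplus> nsum (\<lambda>i. ks ! Suc i \<otimes> (u # us) ! Suc i) (length us)"
  proof (subst length_Cons, subst nsum_shift)
    fix i assume i: "i < Suc (length us)"
    have "ks ! i \<in> set ks" using i Cons.prems(1) by (intro nth_mem) simp
    moreover have "(u # us) ! i \<in> set (u # us)" using i by (intro nth_mem) simp
    ultimately show "ks ! i \<otimes> (u # us) ! i \<in> carrier R" using Cons.prems(2,3) by blast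
  qed simp
  then show ?case using Cons ks by simp
qed simp

end

locale field_over = ambient_field +
  fixes K assumes K: "subfield K L"
begin

lemma K_carr [simp]: "k \<in> K \<Longrightarrow> k \<in> carrier L"
  using subfieldE(3)[OF K] by blast
lemma K_ring: "subring K L" using subfieldE(1)[OF K] .
lemma K_zero [simp]: "\<zero> \<in> K" and K_one [simp]: "\<one> \<in> K"
  and K_add [simp]: "x \<in> K \<Longrightarrow> y \<in> K \<Longrightarrow> x \<oplus> y \<in> K"
  and K_mult [simp]: "x \<in> K \<Longrightarrow> y \<in> K \<Longrightarrow> x \<otimes> y \<in> K"
  and K_neg [simp]: "x \<in> K \<Longrightarrow> \<ominus> x \<in> K"
  using subringE[OF K_ring] by auto
lemma K_pow [simp]: "x \<in> K \<Longrightarrow> x [^] (n::nat) \<in> K"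
  by (induction n) auto
lemma K_nsum [simp]: "(\<And>i. i < n \<Longrightarrow> f i \<in> K) \<Longrightarrow> nsum f n \<in> K"
  by (rule nsum_in) auto
lemma K_inv [simp]: "x \<in> K \<Longrightarrow> x \<noteq> \<zero> \<Longrightarrow> inv x \<in> K"
  using subfield_m_inv(1)[OF K] by simp

definition indep :: "nat \<Rightarrow> (nat \<Rightarrow> 'a) \<Rightarrow> bool" where
  "indep N U \<longleftrightarrow> (\<forall>i<N. U i \<in> carrier L) \<and>
    (\<forall>k. (\<forall>i<N. k i \<in> K) \<longrightarrow> nsum (\<lambda>i. k i \<otimes> U i) N = \<zero> \<longrightarrow> (\<forall>i<N. k i = \<zero>))"

definition basis :: "nat \<Rightarrow> (nat \<Rightarrow> 'a) \<Rightarrow> bool" where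
  "basis N U \<longleftrightarrow> indep N U \<and>
    (\<forall>x\<in>carrier L. \<exists>k. (\<forall>i<N. k i \<in> K) \<and> x = nsum (\<lambda>i. k i \<otimes> U i) N)"

text \<open>Coordinates with respect to a family indexed by an initial segment of the naturals, which need not
  be given as a list of the field; \<open>field_trace_eq\<close> connects them with \<open>coordinates\<close>.\<close>

definition co :: "nat \<Rightarrow> (nat \<Rightarrow> 'a) \<Rightarrow> 'a \<Rightarrow> nat \<Rightarrow> 'a" where
  "co N U x = (SOME k. (\<forall>i<N. k i \<in> K) \<and> x = nsum (\<lambda>i. k i \<otimes> U i) N)"

definition tr :: "nat \<Rightarrow> (nat \<Rightarrow> 'a) \<Rightarrow> 'a \<Rightarrow> 'a" where
  "tr N U x = nsum (\<lambda>i. co N U (x \<otimes> U i) i) N"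

lemma indep_unique:
  assumes U: "indep N U" and k: "\<And>i. i < N \<Longrightarrow> k i \<in> K" "\<And>i. i < N \<Longrightarrow> l i \<in> K"
    and eq: "nsum (\<lambda>i. k i \<otimes> U i) N = nsum (\<lambda>i. l i \<otimes> U i) N" and i: "i < N"
  shows "k i = l i"
proof -
  have Uc: "U i \<in> carrier L" if "i < N" for i using U that by (simp add: indep_def)
  have "nsum (\<lambda>i. (k i \<oplus> \<ominus> l i) \<otimes> U i) N = nsum (\<lambda>i. k i \<otimes> U i \<oplus> \<ominus> (l i \<otimes> U i)) N"
    using k Uc by (intro nsum_cong) (simp add: l_distr l_minus)
  also have "\<dots> = nsum (\<lambda>i. k i \<otimes> U i) N \<oplus> \<ominus> nsum (\<lambda>i. l i \<otimes> U i) N"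
    using k Uc by (simp add: nsum_add nsum_neg)
  also have "\<dots> = \<zero>" using eq k Uc by (simp add: r_neg)
  finally have z: "nsum (\<lambda>i. (k i \<oplus> \<ominus> l i) \<otimes> U i) N = \<zero>" .
  have d: "\<forall>i<N. k i \<oplus> \<ominus> l i \<in> K" using k by simp
  have "\<forall>i<N. k i \<oplus> \<ominus> l i = \<zero>"
    using U[unfolded indep_def, THEN conjunct2, THEN spec, of "\<lambda>i. k i \<oplus> \<ominus> l i"] d z by simp
  then have "(k i \<oplus> \<ominus> l i) \<oplus> l i = \<zero> \<oplus> l i" using i by simp
  moreover have "(u \<oplus> \<ominus> v) \<oplus> v = u" if "u \<in> carrier L" "v \<in> carrier L" for u v
    using that by algebra
  ultimately show ?thesis using k i by simp
qed

context
  fixes N U assumes U: "basis N U"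
begin

lemma U_carr: "i < N \<Longrightarrow> U i \<in> carrier L" and U_indep: "indep N U"
  using U by (auto simp: basis_def indep_def)

lemma co_props: "x \<in> carrier L \<Longrightarrow> (\<forall>i<N. co N U x i \<in> K) \<and> x = nsum (\<lambda>i. co N U x i \<otimes> U i) N"
proof -
  assume "x \<in> carrier L"
  then have "\<exists>k. (\<forall>i<N. k i \<in> K) \<and> x = nsum (\<lambda>i. k i \<otimes> U i) N"
    using U by (simp add: basis_def)
  from someI_ex[OF this] show ?thesis unfolding co_def[symmetric] .
qed

lemma co_K: "x \<in> carrier L \<Longrightarrow> i < N \<Longrightarrow> co N U x i \<in> K"
  by (rule co_props[THEN conjunct1, rule_format])

lemma co_sum: "x \<in> carrier L \<Longrightarrow> nsum (\<lambda>i. co N U x i \<otimes> U i) N = x"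
  by (rule co_props[THEN conjunct2, symmetric])

lemma co_unique:
  assumes "\<And>i. i < N \<Longrightarrow> k i \<in> K" "i < N"
  shows "co N U (nsum (\<lambda>i. k i \<otimes> U i) N) i = k i"
proof -
  have c: "nsum (\<lambda>i. k i \<otimes> U i) N \<in> carrier L" using assms(1) U_carr by simp
  show ?thesis
    by (rule indep_unique[OF U_indep _ _ _ assms(2)]) (use assms(1) co_K[OF c] co_sum[OF c] in auto)
qed

lemma co_add: "x \<in> carrier L \<Longrightarrow> y \<in> carrier L \<Longrightarrow> i < N \<Longrightarrow> co N U (x \<oplus> y) i = co N U x i \<oplus> co N U y i"
proof -
  assume a: "x \<in> carrier L" "y \<in> carrier L" "i < N"
  have "nsum (\<lambda>i. (co N U x i \<oplus> co N U y i) \<otimes> U i) N = nsum (\<lambda>i. co N U x i \<otimes> U i \<oplus> co N U y i \<otimes> U i) N"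
    using co_K a U_carr by (intro nsum_cong) (simp add: l_distr)
  also have "\<dots> = x \<oplus> y" using co_K a U_carr by (simp add: nsum_add co_sum)
  finally show ?thesis using co_unique[of "\<lambda>i. co N U x i \<oplus> co N U y i" i] co_K a by simp
qed

lemma co_smult: "k \<in> K \<Longrightarrow> x \<in> carrier L \<Longrightarrow> i < N \<Longrightarrow> co N U (k \<otimes> x) i = k \<otimes> co N U x i"
proof -
  assume a: "k \<in> K" "x \<in> carrier L" "i < N"
  have "nsum (\<lambda>i. (k \<otimes> co N U x i) \<otimes> U i) N = nsum (\<lambda>i. k \<otimes> (co N U x i \<otimes> U i)) N"
    using co_K a U_carr by (intro nsum_cong) (simp add: m_assoc)
  also have "\<dots> = k \<otimes> x"
    using co_K a U_carr by (subst nsum_ldistr[symmetric]) (auto simp: co_sum)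
  finally show ?thesis using co_unique[of "\<lambda>i. k \<otimes> co N U x i" i] co_K a by simp
qed

lemma co_zero: "i < N \<Longrightarrow> co N U \<zero> i = \<zero>"
  using co_smult[of \<zero> \<zero> i] co_K[of \<zero> i] by simp

lemma co_nsum:
  assumes "\<And>j. j < n \<Longrightarrow> x j \<in> carrier L" "i < N"
  shows "co N U (nsum x n) i = nsum (\<lambda>j. co N U (x j) i) n"
  by (rule nsum_map[where h = "\<lambda>x. co N U x i"]) (use assms co_zero co_add in auto)

lemma tr_K: "x \<in> carrier L \<Longrightarrow> tr N U x \<in> K"
  unfolding tr_def using co_K U_carr by (intro K_nsum) auto

lemma tr_add: "x \<in> carrier L \<Longrightarrow> y \<in> carrier L \<Longrightarrow> tr N U (x \<oplus> y) = tr N U x \<oplus> tr N U y"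
  unfolding tr_def using co_K U_carr by (simp add: l_distr co_add nsum_add cong: nsum_cong)

lemma tr_smult: "k \<in> K \<Longrightarrow> x \<in> carrier L \<Longrightarrow> tr N U (k \<otimes> x) = k \<otimes> tr N U x"
  unfolding tr_def using co_K U_carr by (simp add: m_assoc co_smult nsum_ldistr cong: nsum_cong)

end

lemma tr_invariant:
  assumes U: "basis N U" and V: "basis M V" and x: "x \<in> carrier L"
  shows "tr N U x = tr M V x"
proof -
  note Uc = U_carr[OF U] and Vc = U_carr[OF V] and cU = co_K[OF U] and cV = co_K[OF V]
  have "co M V (x \<otimes> V j) j = nsum (\<lambda>i. co M V (x \<otimes> U i) j \<otimes> co N U (V j) i) N" if j: "j < M" for j
  proof -
    have "x \<otimes> V j = x \<otimes> nsum (\<lambda>i. co N U (V j) i \<otimes> U i) N" using co_sum[OF U Vc[OF j]] by simp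
    also have "\<dots> = nsum (\<lambda>i. co N U (V j) i \<otimes> (x \<otimes> U i)) N"
      using x Uc cU[OF Vc[OF j]] by (subst nsum_ldistr) (auto intro!: nsum_cong simp: m_lcomm)
    finally have "co M V (x \<otimes> V j) j = nsum (\<lambda>i. co M V (co N U (V j) i \<otimes> (x \<otimes> U i)) j) N"
      using x Uc cU[OF Vc[OF j]] j by (simp add: co_nsum[OF V])
    also have "\<dots> = nsum (\<lambda>i. co M V (x \<otimes> U i) j \<otimes> co N U (V j) i) N"
    proof (rule nsum_cong)
      fix i assume i: "i < N"
      have "co M V (co N U (V j) i \<otimes> (x \<otimes> U i)) j = co N U (V j) i \<otimes> co M V (x \<otimes> U i) j"
        by (rule co_smult[OF V]) (use x Uc[OF i] cU[OF Vc[OF j] i] j in auto)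
      moreover have "co N U (V j) i \<in> carrier L" "co M V (x \<otimes> U i) j \<in> carrier L"
        using cU[OF Vc[OF j] i] cV[of "x \<otimes> U i" j] x Uc[OF i] j by auto
      ultimately show "co M V (co N U (V j) i \<otimes> (x \<otimes> U i)) j = co M V (x \<otimes> U i) j \<otimes> co N U (V j) i"
        by (simp add: m_comm)
    qed
    finally show ?thesis .
  qed
  then have "tr M V x = nsum (\<lambda>j. nsum (\<lambda>i. co M V (x \<otimes> U i) j \<otimes> co N U (V j) i) N) M"
    unfolding tr_def by (rule nsum_cong)
  also have "\<dots> = nsum (\<lambda>i. nsum (\<lambda>j. co M V (x \<otimes> U i) j \<otimes> co N U (V j) i) M) N"
    using x Uc Vc cU cV by (intro nsum_swap) auto
  also have "\<dots> = tr N U x"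
    unfolding tr_def
  proof (rule nsum_cong)
    fix i assume i: "i < N"
    have xU: "x \<otimes> U i \<in> carrier L" using x Uc[OF i] by simp
    have "nsum (\<lambda>j. co M V (x \<otimes> U i) j \<otimes> co N U (V j) i) M = nsum (\<lambda>j. co N U (co M V (x \<otimes> U i) j \<otimes> V j) i) M"
      using cV[OF xU] Vc i by (intro nsum_cong co_smult[OF U, symmetric]) auto
    also have "\<dots> = co N U (nsum (\<lambda>j. co M V (x \<otimes> U i) j \<otimes> V j) M) i"
      using cV[OF xU] Vc i by (intro co_nsum[OF U, symmetric]) auto
    finally show "nsum (\<lambda>j. co M V (x \<otimes> U i) j \<otimes> co N U (V j) i) M = co N U (x \<otimes> U i) i"
      using co_sum[OF V xU] by simp
  qed
  finally show ?thesis by simp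
qed

lemma is_basis_imp_basis:
  assumes "is_basis L K us"
  shows "basis (length us) (\<lambda>i. us ! i)"
proof -
  have us: "set us \<subseteq> carrier L" "independent K us" "Span K us = carrier L"
    using assms by (auto simp: is_basis_def)
  have uc: "us ! i \<in> carrier L" if "i < length us" for i using us(1) nth_mem[OF that] by blast
  show ?thesis unfolding basis_def indep_def
  proof (intro conjI ballI allI impI)
    show "us ! i \<in> carrier L" if "i < length us" for i using uc that .
    fix k i assume k: "\<forall>i<length us. k i \<in> K" "nsum (\<lambda>i. k i \<otimes> us ! i) (length us) = \<zero>" and i: "i < length us"
    let ?ks = "map k [0..<length us]"
    have kK: "set ?ks \<subseteq> K" using k(1) by auto
    have "combine ?ks us = nsum (\<lambda>i. ?ks ! i \<otimes> us ! i) (length us)"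
      using kK us(1) by (intro combine_nsum) (auto simp: subset_iff)
    also have "\<dots> = nsum (\<lambda>i. k i \<otimes> us ! i) (length us)" by (rule nsum_cong) simp
    finally have "set (take (length us) ?ks) \<subseteq> {\<zero>}"
      using independent_imp_trivial_combine[OF K us(2) kK] k(2) by simp
    then show "k i = \<zero>" using i by (auto simp: image_subset_iff)
  next
    fix x assume "x \<in> carrier L"
    then obtain ks where ks: "set ks \<subseteq> K" "length ks = length us" "x = combine ks us"
      using Span_mem_iff_length_version[OF K us(1)] us(3) by blast
    have "x = nsum (\<lambda>i. ks ! i \<otimes> us ! i) (length us)"
      unfolding ks(3) using ks us(1) by (intro combine_nsum) (auto simp: subset_iff)
    moreover have "\<forall>i<length us. ks ! i \<in> K" using ks(1,2) by (metis nth_mem subsetD)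
    ultimately show "\<exists>k. (\<forall>i<length us. k i \<in> K) \<and> x = nsum (\<lambda>i. k i \<otimes> us ! i) (length us)" by blast
  qed
qed

lemma field_trace_eq:
  assumes ex: "\<exists>us. is_basis L K us" and V: "basis M V" and x: "x \<in> carrier L"
  shows "field_trace L K x = tr M V x"
proof -
  define us where "us = (SOME us. is_basis L K us)"
  have b: "is_basis L K us" unfolding us_def using ex by (rule someI_ex)
  note B = is_basis_imp_basis[OF b]
  have us: "set us \<subseteq> carrier L" "independent K us" "Span K us = carrier L"
    using b by (auto simp: is_basis_def)
  have co: "coordinates L K us y ! i = co (length us) (\<lambda>i. us ! i) y i" if y: "y \<in> carrier L" and i: "i < length us" for y i
  proof -
    have "\<exists>!ks. set ks \<subseteq> K \<and> length ks = length us \<and> y = combine ks us"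
      using unique_decomposition[OF K us(2)] us(3) y by simp
    then have "\<exists>!ks. set ks \<subseteq> K \<and> length ks = length us \<and> combine ks us = y" by metis
    from theI'[OF this] have c: "set (coordinates L K us y) \<subseteq> K"
      "length (coordinates L K us y) = length us" "combine (coordinates L K us y) us = y"
      unfolding coordinates_def by auto
    have "y = nsum (\<lambda>i. coordinates L K us y ! i \<otimes> us ! i) (length us)"
      using combine_nsum[of "coordinates L K us y" us] c us(1) by (auto simp: subset_iff)
    moreover have "\<forall>i<length us. coordinates L K us y ! i \<in> K" using c(1,2) by (metis nth_mem subsetD)
    ultimately show ?thesis
      using co_unique[OF B, of "\<lambda>i. coordinates L K us y ! i" i] i by metis
  qed
  have uc: "us ! i \<in> carrier L" if "i < length us" for i using us(1) nth_mem[OF that] by blast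
  have "field_trace L K x = (\<Oplus>i\<in>{..<length us}. coordinates L K us (x \<otimes> us ! i) ! i)"
    unfolding field_trace_def us_def[symmetric] by (simp add: Let_def)
  also have "\<dots> = nsum (\<lambda>i. coordinates L K us (x \<otimes> us ! i) ! i) (length us)"
    using co uc x co_K[OF B] by (intro nsum_finsum) auto
  also have "\<dots> = tr (length us) (\<lambda>i. us ! i) x"
    unfolding tr_def using co uc x by (intro nsum_cong) auto
  finally show ?thesis using tr_invariant[OF B V x] by simp
qed

lemma indep_list:
  assumes "indep N V"
  shows "independent K (map V [0..<N])"
proof (rule trivial_combine_imp_independent[OF K])
  have Vc: "V i \<in> carrier L" if "i < N" for i using assms that by (simp add: indep_def)
  then show Vs: "set (map V [0..<N]) \<subseteq> carrier L" by auto
  fix Ks assume Ks: "set Ks \<subseteq> K" "combine Ks (map V [0..<N]) = \<zero>"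
  define ks where "ks = take N Ks @ replicate (N - length Ks) \<zero>"
  have l: "length ks = N" by (simp add: ks_def)
  have kK: "set ks \<subseteq> K" using Ks(1) by (auto simp: ks_def dest: in_set_takeD)
  have "combine ks (map V [0..<N]) = combine Ks (map V [0..<N])"
  proof -
    have "combine (take N Ks @ replicate (N - length Ks) \<zero>) (map V [0..<N]) = combine (take N Ks) (map V [0..<N])"
      using Vs Ks(1) by (intro combine_append_replicate) (auto dest: in_set_takeD)
    also have "\<dots> = combine Ks (map V [0..<N])"
      using combine_take[of "map V [0..<N]" Ks] Ks(1) Vs by auto
    finally show ?thesis by (simp add: ks_def)
  qed
  moreover have "combine ks (map V [0..<N]) = nsum (\<lambda>i. ks ! i \<otimes> map V [0..<N] ! i) N"
    using combine_nsum[of ks "map V [0..<N]"] l kK Vs by (auto simp: subset_iff)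
  moreover have "nsum (\<lambda>i. ks ! i \<otimes> map V [0..<N] ! i) N = nsum (\<lambda>i. ks ! i \<otimes> V i) N"
    by (rule nsum_cong) simp
  ultimately have "nsum (\<lambda>i. ks ! i \<otimes> V i) N = \<zero>" using Ks(2) by simp
  moreover have "\<forall>i<N. ks ! i \<in> K" using kK l by (metis nth_mem subsetD)
  ultimately have z: "\<forall>i<N. ks ! i = \<zero>" using assms by (simp add: indep_def)
  show "set (take (length (map V [0..<N])) Ks) \<subseteq> {\<zero>}"
  proof
    fix k assume "k \<in> set (take (length (map V [0..<N])) Ks)"
    then have "k \<in> set ks" by (simp add: ks_def)
    then show "k \<in> {\<zero>}" using z l by (metis in_set_conv_nth singletonI)
  qed
qed

lemma indep_imp_basis:
  assumes U: "basis N U" and V: "indep N V"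
  shows "basis N V"
proof -
  have list: "Span K (map W [0..<N]) = {nsum (\<lambda>i. k i \<otimes> W i) N | k. \<forall>i<N. k i \<in> K}"
    if "\<And>i. i < N \<Longrightarrow> W i \<in> carrier L" for W
  proof -
    have Ws: "set (map W [0..<N]) \<subseteq> carrier L" using that by auto
    have cb: "combine ks (map W [0..<N]) = nsum (\<lambda>i. ks ! i \<otimes> W i) N" if "length ks = N" "set ks \<subseteq> K" for ks
    proof -
      have "combine ks (map W [0..<N]) = nsum (\<lambda>i. ks ! i \<otimes> map W [0..<N] ! i) N"
        using combine_nsum[of ks "map W [0..<N]"] that Ws by (auto simp: subset_iff)
      also have "\<dots> = nsum (\<lambda>i. ks ! i \<otimes> W i) N" by (rule nsum_cong) simp
      finally show ?thesis .
    qed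
    show ?thesis
    proof (intro equalityI subsetI)
      fix a assume "a \<in> Span K (map W [0..<N])"
      then obtain ks where ks: "set ks \<subseteq> K" "length ks = N" "a = combine ks (map W [0..<N])"
        using Span_mem_iff_length_version[OF K Ws] by auto
      have "\<forall>i<N. ks ! i \<in> K" using ks by (metis nth_mem subsetD)
      then show "a \<in> {nsum (\<lambda>i. k i \<otimes> W i) N | k. \<forall>i<N. k i \<in> K}"
        using cb ks by (intro CollectI exI[of _ "\<lambda>i. ks ! i"]) simp
    next
      fix a assume "a \<in> {nsum (\<lambda>i. k i \<otimes> W i) N | k. \<forall>i<N. k i \<in> K}"
      then obtain k where k: "a = nsum (\<lambda>i. k i \<otimes> W i) N" "\<forall>i<N. k i \<in> K" by blast
      have "combine (map k [0..<N]) (map W [0..<N]) = nsum (\<lambda>i. map k [0..<N] ! i \<otimes> W i) N"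
        using k(2) by (intro cb) auto
      also have "\<dots> = a" unfolding k(1) by (rule nsum_cong) simp
      finally show "a \<in> Span K (map W [0..<N])"
        using k(2) unfolding Span_mem_iff_length_version[OF K Ws]
        by (intro exI[of _ "map k [0..<N]"]) auto
    qed
  qed
  have Uc: "U i \<in> carrier L" if "i < N" for i using U_carr[OF U that] .
  have Vc: "V i \<in> carrier L" if "i < N" for i using V that by (simp add: indep_def)
  have lU: "Span K (map U [0..<N]) = {nsum (\<lambda>i. k i \<otimes> U i) N | k. \<forall>i<N. k i \<in> K}"
    using Uc by (rule list)
  have lV: "Span K (map V [0..<N]) = {nsum (\<lambda>i. k i \<otimes> V i) N | k. \<forall>i<N. k i \<in> K}"
    using Vc by (rule list)
  have "{nsum (\<lambda>i. k i \<otimes> U i) N | k. \<forall>i<N. k i \<in> K} \<subseteq> carrier L" using Uc by auto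
  moreover have "carrier L \<subseteq> {nsum (\<lambda>i. k i \<otimes> U i) N | k. \<forall>i<N. k i \<in> K}"
    using U unfolding basis_def by blast
  ultimately have "Span K (map U [0..<N]) = carrier L" unfolding lU by (rule equalityI)
  then have dim: "dimension N K (carrier L)"
    using dimension_independent[OF indep_list[OF U_indep[OF U]]] by simp
  have "set (map V [0..<N]) \<subseteq> carrier L" using Vc by auto
  then have "Span K (map V [0..<N]) = carrier L"
    using independent_length_eq_dimension[OF K dim indep_list[OF V]] by (simp del: Span.simps)
  then show ?thesis unfolding basis_def using V unfolding lV by blast
qed

lemma exists_is_basis:
  assumes g: "\<And>i. i < n \<Longrightarrow> g i \<in> carrier L"
    and gen: "\<And>x. x \<in> carrier L \<Longrightarrow> \<exists>k. (\<forall>i<n. k i \<in> K) \<and> x = nsum (\<lambda>i. k i \<otimes> g i) n"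
  shows "\<exists>us. is_basis L K us"
proof -
  have gs: "set (map g [0..<n]) \<subseteq> carrier L" using g by auto
  have "Span K (map g [0..<n]) = carrier L"
  proof
    show "Span K (map g [0..<n]) \<subseteq> carrier L" using Span_in_carrier[OF _ gs] subfieldE(3)[OF K] by blast
    show "carrier L \<subseteq> Span K (map g [0..<n])"
    proof
      fix x assume "x \<in> carrier L"
      then obtain k where k: "\<forall>i<n. k i \<in> K" "x = nsum (\<lambda>i. k i \<otimes> g i) n" using gen by blast
      have "combine (map k [0..<n]) (map g [0..<n]) = nsum (\<lambda>i. map k [0..<n] ! i \<otimes> map g [0..<n] ! i) n"
        using combine_nsum[of "map k [0..<n]" "map g [0..<n]"] k(1) gs by (auto simp: image_subset_iff)
      also have "\<dots> = x" unfolding k(2) by (rule nsum_cong) simp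
      finally show "x \<in> Span K (map g [0..<n])"
        using k(1) unfolding Span_mem_iff_length_version[OF K gs]
        by (intro exI[of _ "map k [0..<n]"]) auto
    qed
  qed
  then show ?thesis using filter_base[OF K gs] unfolding is_basis_def by metis
qed

end

section \<open>Duality, and a criterion for the trace to be nonzero\<close>

context field_over
begin

lemma indepD:
  assumes "indep N U" "\<forall>i<N. k i \<in> K" "nsum (\<lambda>i. k i \<otimes> U i) N = \<zero>"
  shows "\<forall>i<N. k i = \<zero>"
  using assms unfolding indep_def by blast

definition functional :: "('a \<Rightarrow> 'a) \<Rightarrow> bool" where
  "functional l \<longleftrightarrow> (\<forall>x\<in>carrier L. l x \<in> K) \<and>
    (\<forall>x\<in>carrier L. \<forall>y\<in>carrier L. l (x \<oplus> y) = l x \<oplus> l y) \<and>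
    (\<forall>k\<in>K. \<forall>x\<in>carrier L. l (k \<otimes> x) = k \<otimes> l x) \<and> (\<exists>x\<in>carrier L. l x \<noteq> \<zero>)"

context
  fixes l assumes l: "functional l"
begin

lemma l_K: "x \<in> carrier L \<Longrightarrow> l x \<in> K"
  and l_add: "x \<in> carrier L \<Longrightarrow> y \<in> carrier L \<Longrightarrow> l (x \<oplus> y) = l x \<oplus> l y"
  and l_smult: "k \<in> K \<Longrightarrow> x \<in> carrier L \<Longrightarrow> l (k \<otimes> x) = k \<otimes> l x"
  using l by (auto simp: functional_def)

lemma l_zero: "l \<zero> = \<zero>"
  using l_smult[of \<zero> \<zero>] l_K[of \<zero>] by simp

lemma l_nsum: "(\<And>i. i < n \<Longrightarrow> x i \<in> carrier L) \<Longrightarrow> l (nsum x n) = nsum (\<lambda>i. l (x i)) n"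
  by (rule nsum_map) (auto simp: l_zero l_add)

lemma l_sum_scaled:
  assumes "\<And>i. i < n \<Longrightarrow> k i \<in> K" "\<And>i. i < n \<Longrightarrow> x i \<in> carrier L"
  shows "l (nsum (\<lambda>i. k i \<otimes> x i) n) = nsum (\<lambda>i. k i \<otimes> l (x i)) n"
proof -
  have "l (nsum (\<lambda>i. k i \<otimes> x i) n) = nsum (\<lambda>i. l (k i \<otimes> x i)) n"
    using assms by (intro l_nsum) auto
  also have "\<dots> = nsum (\<lambda>i. k i \<otimes> l (x i)) n"
    using assms by (intro nsum_cong l_smult) auto
  finally show ?thesis .
qed

lemma functional_nondegenerate:
  assumes y: "y \<in> carrier L" and z: "\<And>x. x \<in> carrier L \<Longrightarrow> l (y \<otimes> x) = \<zero>"
  shows "y = \<zero>"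
proof (rule ccontr)
  assume "y \<noteq> \<zero>"
  obtain x where x: "x \<in> carrier L" "l x \<noteq> \<zero>" using l by (auto simp: functional_def)
  have "y \<otimes> (inv y \<otimes> x) = x"
    using y x \<open>y \<noteq> \<zero>\<close> by (simp add: m_assoc[symmetric])
  then show False using z[of "inv y \<otimes> x"] y x \<open>y \<noteq> \<zero>\<close> by simp
qed

context
  fixes N U assumes U: "basis N U"
begin

lemma vanish_on_basis:
  assumes y: "y \<in> carrier L" and z: "\<And>i. i < N \<Longrightarrow> l (y \<otimes> U i) = \<zero>"
  shows "y = \<zero>"
proof (rule functional_nondegenerate[OF y])
  fix x assume x: "x \<in> carrier L"
  note c = co_K[OF U x]
  have "y \<otimes> x = y \<otimes> nsum (\<lambda>i. co N U x i \<otimes> U i) N" using co_sum[OF U x] by simp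
  also have "\<dots> = nsum (\<lambda>i. co N U x i \<otimes> (y \<otimes> U i)) N"
    using y c U_carr[OF U] by (subst nsum_ldistr) (auto intro!: nsum_cong simp: m_lcomm)
  finally have "l (y \<otimes> x) = nsum (\<lambda>i. co N U x i \<otimes> l (y \<otimes> U i)) N"
    using y c U_carr[OF U] by (simp add: l_sum_scaled)
  also have "\<dots> = \<zero>" using z c by (intro nsum_zero) simp
  finally show "l (y \<otimes> x) = \<zero>" .
qed

text \<open>\<open>T\<close> is the Gram matrix of the form \<open>l (x y)\<close> applied to coordinates. It is injective as the form is
  non-degenerate, so it carries \<open>U\<close> to a basis, and preimages of the \<open>U i\<close> are the dual vectors.\<close>

lemma dual_basis:
  "\<exists>v. \<forall>i<N. v i \<in> carrier L \<and> (\<forall>j<N. l (v i \<otimes> U j) = (if i = j then \<one> else \<zero>))"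
proof -
  note Uc = U_carr[OF U]
  define T where "T y = nsum (\<lambda>i. l (y \<otimes> U i) \<otimes> U i) N" for y
  have lK: "l (y \<otimes> U i) \<in> K" if "y \<in> carrier L" "i < N" for y i using l_K that Uc by simp
  have Tc: "T y \<in> carrier L" if "y \<in> carrier L" for y unfolding T_def using lK[OF that] Uc by simp
  have T_lin: "nsum (\<lambda>j. k j \<otimes> T (U j)) N = T (nsum (\<lambda>j. k j \<otimes> U j) N)"
    if k: "\<And>j. j < N \<Longrightarrow> k j \<in> K" for k
  proof -
    have "nsum (\<lambda>j. k j \<otimes> T (U j)) N = nsum (\<lambda>j. nsum (\<lambda>i. (k j \<otimes> l (U j \<otimes> U i)) \<otimes> U i) N) N"
      unfolding T_def
    proof (rule nsum_cong)
      fix j assume j: "j < N"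
      show "k j \<otimes> nsum (\<lambda>i. l (U j \<otimes> U i) \<otimes> U i) N = nsum (\<lambda>i. (k j \<otimes> l (U j \<otimes> U i)) \<otimes> U i) N"
        using k[OF j] lK[OF Uc[OF j]] Uc by (subst nsum_ldistr) (auto intro!: nsum_cong simp: m_assoc)
    qed
    also have "\<dots> = nsum (\<lambda>i. nsum (\<lambda>j. (k j \<otimes> l (U j \<otimes> U i)) \<otimes> U i) N) N"
      using k lK Uc by (intro nsum_swap) auto
    also have "\<dots> = nsum (\<lambda>i. l (nsum (\<lambda>j. k j \<otimes> U j) N \<otimes> U i) \<otimes> U i) N"
    proof (rule nsum_cong)
      fix i assume i: "i < N"
      have "nsum (\<lambda>j. k j \<otimes> U j) N \<otimes> U i = nsum (\<lambda>j. k j \<otimes> (U j \<otimes> U i)) N"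
        using k Uc i by (subst nsum_rdistr) (auto intro!: nsum_cong simp: m_assoc)
      then have "l (nsum (\<lambda>j. k j \<otimes> U j) N \<otimes> U i) = nsum (\<lambda>j. k j \<otimes> l (U j \<otimes> U i)) N"
        using k Uc i by (simp add: l_sum_scaled)
      then show "nsum (\<lambda>j. (k j \<otimes> l (U j \<otimes> U i)) \<otimes> U i) N = l (nsum (\<lambda>j. k j \<otimes> U j) N \<otimes> U i) \<otimes> U i"
        using k lK Uc i by (simp add: nsum_rdistr)
    qed
    finally show ?thesis unfolding T_def .
  qed
  have "indep N (\<lambda>j. T (U j))" unfolding indep_def
  proof (intro conjI allI impI)
    show "T (U i) \<in> carrier L" if "i < N" for i using Tc Uc that by simp
    fix k i assume k: "\<forall>i<N. k i \<in> K" "nsum (\<lambda>i. k i \<otimes> T (U i)) N = \<zero>" and i: "i < N"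
    let ?y = "nsum (\<lambda>j. k j \<otimes> U j) N"
    have y: "?y \<in> carrier L" using k(1) Uc by simp
    have kK: "k j \<in> K" if "j < N" for j using k(1) that by blast
    have "nsum (\<lambda>i. k i \<otimes> T (U i)) N = T ?y" by (rule T_lin) (rule kK)
    then have "T ?y = \<zero>" using k(2) by simp
    then have "\<forall>i<N. l (?y \<otimes> U i) = \<zero>"
      unfolding T_def by (intro indepD[OF U_indep[OF U]]) (use lK[OF y] in blast)+
    then have "?y = \<zero>" using vanish_on_basis[OF y] by blast
    then show "k i = \<zero>" using indepD[OF U_indep[OF U] k(1)] i by blast
  qed
  then have TB: "basis N (\<lambda>j. T (U j))" by (rule indep_imp_basis[OF U])
  have "\<exists>v\<in>carrier L. \<forall>j<N. l (v \<otimes> U j) = (if i = j then \<one> else \<zero>)" if i: "i < N" for i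
  proof -
    obtain k where k: "\<forall>j<N. k j \<in> K" "U i = nsum (\<lambda>j. k j \<otimes> T (U j)) N"
      using TB Uc[OF i] unfolding basis_def by blast
    define v where "v = nsum (\<lambda>j. k j \<otimes> U j) N"
    have v: "v \<in> carrier L" unfolding v_def using k(1) Uc by simp
    have "U i = T v" using T_lin[of k] k by (simp add: v_def)
    then have e: "nsum (\<lambda>j. (if j = i then \<one> else \<zero>) \<otimes> U j) N = nsum (\<lambda>j. l (v \<otimes> U j) \<otimes> U j) N"
    proof -
      have "nsum (\<lambda>j. (if j = i then \<one> else \<zero>) \<otimes> U j) N = nsum (\<lambda>j. if j = i then U i else \<zero>) N"
        using Uc by (intro nsum_cong) auto
      also have "\<dots> = U i" using Uc i by (intro nsum_delta) auto
      finally show ?thesis using \<open>U i = T v\<close> by (simp add: T_def)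
    qed
    have "l (v \<otimes> U j) = (if i = j then \<one> else \<zero>)" if j: "j < N" for j
      using indep_unique[OF U_indep[OF U] _ _ e j] lK[OF v] by auto
    then show ?thesis using v by blast
  qed
  then show ?thesis by metis
qed

context
  fixes v
  assumes v: "\<And>i. i < N \<Longrightarrow> v i \<in> carrier L"
    and dual: "\<And>i j. i < N \<Longrightarrow> j < N \<Longrightarrow> l (v i \<otimes> U j) = (if i = j then \<one> else \<zero>)"
begin

lemma co_dual:
  assumes w: "w \<in> carrier L" and i: "i < N"
  shows "co N U w i = l (w \<otimes> v i)"
proof -
  note c = co_K[OF U w] and Uc = U_carr[OF U]
  have "w \<otimes> v i = nsum (\<lambda>j. co N U w j \<otimes> U j) N \<otimes> v i" using co_sum[OF U w] by simp
  also have "\<dots> = nsum (\<lambda>j. co N U w j \<otimes> (v i \<otimes> U j)) N"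
    using c Uc v[OF i] by (subst nsum_rdistr) (auto intro!: nsum_cong simp: m_ac)
  finally have "l (w \<otimes> v i) = nsum (\<lambda>j. co N U w j \<otimes> l (v i \<otimes> U j)) N"
    using c Uc v[OF i] by (simp add: l_sum_scaled)
  also have "\<dots> = nsum (\<lambda>j. if j = i then co N U w i else \<zero>) N"
    using c dual[OF i] by (intro nsum_cong) auto
  also have "\<dots> = co N U w i" using c i by (intro nsum_delta) auto
  finally show ?thesis by simp
qed

lemma dual_expansion:
  assumes w: "w \<in> carrier L"
  shows "w = nsum (\<lambda>j. l (w \<otimes> U j) \<otimes> v j) N"
proof -
  note Uc = U_carr[OF U]
  let ?s = "nsum (\<lambda>j. l (w \<otimes> U j) \<otimes> v j) N"
  have lc: "l (w \<otimes> U j) \<in> K" if "j < N" for j using l_K w Uc[OF that] by simp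
  have s: "?s \<in> carrier L" using lc v by simp
  have ws: "w \<ominus> ?s = \<zero>"
  proof (rule vanish_on_basis)
    show "w \<ominus> ?s \<in> carrier L" using w s by simp
    fix i assume i: "i < N"
    have "?s \<otimes> U i = nsum (\<lambda>j. l (w \<otimes> U j) \<otimes> (v j \<otimes> U i)) N"
      using lc v Uc[OF i] by (subst nsum_rdistr) (auto intro!: nsum_cong simp: m_assoc)
    then have "l (?s \<otimes> U i) = nsum (\<lambda>j. l (w \<otimes> U j) \<otimes> l (v j \<otimes> U i)) N"
      using lc v Uc[OF i] by (simp add: l_sum_scaled)
    also have "\<dots> = nsum (\<lambda>j. if j = i then l (w \<otimes> U i) else \<zero>) N"
      using lc dual[OF _ i] by (intro nsum_cong) auto
    also have "\<dots> = l (w \<otimes> U i)" using lc i by (intro nsum_delta) auto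
    finally have e: "l (?s \<otimes> U i) = l (w \<otimes> U i)" .
    have "(w \<ominus> ?s) \<otimes> U i \<oplus> ?s \<otimes> U i = w \<otimes> U i"
    proof -
      have "(a \<ominus> b) \<otimes> u \<oplus> b \<otimes> u = a \<otimes> u" if "a \<in> carrier L" "b \<in> carrier L" "u \<in> carrier L" for a b u
        using that by algebra
      then show ?thesis using w s Uc[OF i] by blast
    qed
    then have "l ((w \<ominus> ?s) \<otimes> U i) \<oplus> l (?s \<otimes> U i) = l (w \<otimes> U i)"
      using l_add[of "(w \<ominus> ?s) \<otimes> U i" "?s \<otimes> U i"] w s Uc[OF i] by simp
    then have "l ((w \<ominus> ?s) \<otimes> U i) \<oplus> l (w \<otimes> U i) = \<zero> \<oplus> l (w \<otimes> U i)"
      unfolding e using lc[OF i] by simp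
    then show "l ((w \<ominus> ?s) \<otimes> U i) = \<zero>"
    proof -
      have "a = \<zero>" if "a \<in> carrier L" "b \<in> carrier L" "a \<oplus> b = \<zero> \<oplus> b" for a b
      proof -
        have "a = (a \<oplus> b) \<ominus> b" using that(1,2) by algebra
        also have "\<dots> = \<zero>" unfolding that(3) using that(2) by algebra
        finally show ?thesis .
      qed
      moreover have "l ((w \<ominus> ?s) \<otimes> U i) \<in> carrier L" using l_K w s Uc[OF i] by simp
      moreover have "l (w \<otimes> U i) \<in> carrier L" using lc[OF i] by simp
      ultimately show ?thesis using \<open>l ((w \<ominus> ?s) \<otimes> U i) \<oplus> l (w \<otimes> U i) = \<zero> \<oplus> l (w \<otimes> U i)\<close> by blast
    qed
  qed
  have "a = (a \<ominus> b) \<oplus> b" if "a \<in> carrier L" "b \<in> carrier L" for a b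
    using that by algebra
  from this[OF w s] show ?thesis unfolding ws using s by simp
qed

lemma tr_dual:
  assumes x: "x \<in> carrier L"
  shows "tr N U x = l (x \<otimes> nsum (\<lambda>i. U i \<otimes> v i) N)"
proof -
  note Uc = U_carr[OF U]
  have "tr N U x = nsum (\<lambda>i. l (x \<otimes> (U i \<otimes> v i))) N"
    unfolding tr_def using Uc x v by (intro nsum_cong) (simp add: co_dual m_assoc)
  also have "\<dots> = l (nsum (\<lambda>i. x \<otimes> (U i \<otimes> v i)) N)" using Uc x v by (simp add: l_nsum)
  also have "nsum (\<lambda>i. x \<otimes> (U i \<otimes> v i)) N = x \<otimes> nsum (\<lambda>i. U i \<otimes> v i) N"
    using Uc x v by (intro nsum_ldistr[symmetric]) auto
  finally show ?thesis .
qed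

text \<open>Summing over the last letter of a word with \<open>F a b = a l (b y)\<close> is the expansion of \<open>b y\<close> in the basis \<open>U\<close>; every
  further letter contributes a factor \<open>\<Sum> U\<^sub>i v\<^sub>i\<close>.\<close>

lemma wsum_dual:
  assumes y: "y \<in> carrier L"
  shows "a \<in> carrier L \<Longrightarrow> b \<in> carrier L \<Longrightarrow> wsum (\<lambda>a b. a \<otimes> l (b \<otimes> y)) U v N (Suc m) a b =
    a \<otimes> b \<otimes> y \<otimes> nsum (\<lambda>i. U i \<otimes> v i) N [^] m"
proof (induction m arbitrary: a b)
  case 0
  note Uc = U_carr[OF U]
  have by': "b \<otimes> y \<in> carrier L" using 0 y by simp
  have lc: "l (b \<otimes> y \<otimes> v i) \<in> K" if "i < N" for i using l_K by' v that by simp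
  have "nsum (\<lambda>i. a \<otimes> U i \<otimes> l (b \<otimes> v i \<otimes> y)) N = nsum (\<lambda>i. a \<otimes> (co N U (b \<otimes> y) i \<otimes> U i)) N"
  proof (rule nsum_cong)
    fix i assume i: "i < N"
    have "b \<otimes> v i \<otimes> y = b \<otimes> y \<otimes> v i" using 0 y v[OF i] by (simp add: m_ac)
    then show "a \<otimes> U i \<otimes> l (b \<otimes> v i \<otimes> y) = a \<otimes> (co N U (b \<otimes> y) i \<otimes> U i)"
      using co_dual[OF by' i] lc[OF i] 0 Uc[OF i] by (simp add: m_ac)
  qed
  also have "\<dots> = a \<otimes> (b \<otimes> y)"
    using 0 co_K[OF U by'] Uc by (subst nsum_ldistr[symmetric]) (auto simp: co_sum[OF U by'])
  finally show ?case using 0 y by (simp add: m_assoc)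
next
  case (Suc m)
  note Uc = U_carr[OF U]
  let ?c = "nsum (\<lambda>i. U i \<otimes> v i) N"
  have c: "?c \<in> carrier L" using Uc v by simp
  have "wsum (\<lambda>a b. a \<otimes> l (b \<otimes> y)) U v N (Suc (Suc m)) a b =
      nsum (\<lambda>i. (U i \<otimes> v i) \<otimes> (a \<otimes> b \<otimes> y \<otimes> ?c [^] m)) N"
  proof (subst wsum.simps(2), rule nsum_cong)
    fix i assume i: "i < N"
    have "wsum (\<lambda>a b. a \<otimes> l (b \<otimes> y)) U v N (Suc m) (a \<otimes> U i) (b \<otimes> v i) =
       a \<otimes> U i \<otimes> (b \<otimes> v i) \<otimes> y \<otimes> ?c [^] m"
      using Suc Uc[OF i] v[OF i] by simp
    also have "\<dots> = (U i \<otimes> v i) \<otimes> (a \<otimes> b \<otimes> y \<otimes> ?c [^] m)"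
      using Suc.prems Uc[OF i] v[OF i] y c by (simp add: m_ac)
    finally show "wsum (\<lambda>a b. a \<otimes> l (b \<otimes> y)) U v N (Suc m) (a \<otimes> U i) (b \<otimes> v i) =
       (U i \<otimes> v i) \<otimes> (a \<otimes> b \<otimes> y \<otimes> ?c [^] m)" .
  qed
  also have "\<dots> = ?c \<otimes> (a \<otimes> b \<otimes> y \<otimes> ?c [^] m)"
    using Suc.prems Uc v y c by (intro nsum_rdistr[symmetric]) auto
  finally show ?case using Suc.prems y c by (simp add: m_ac)
qed

text \<open>By \<open>tr_dual\<close>, the element \<open>c = \<Sum> U\<^sub>i v\<^sub>i\<close> represents the trace with respect to \<open>l\<close>. Evaluating \<open>wsum\<close> for \<open>F a b = a l (b y)\<close>
  and words of length \<open>p\<close> in two ways gives \<open>c\<^bsup>p - 1\<^esup> y = \<Sum> l (v\<^sub>i\<^sup>p y) U\<^sub>i\<^sup>p\<close>. If \<open>c = 0\<close>, then independence of the \<open>U\<^sub>i\<^sup>p\<close> makes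
  \<open>v\<^sub>i\<^sup>p\<close> orthogonal to everything.\<close>

lemma different_nonzero:
  assumes p: "Factorial_Ring.prime (p::nat)" and ch: "add_pow L p \<one> = \<zero>"
    and Up: "indep N (\<lambda>i. U i [^] p)"
  shows "nsum (\<lambda>i. U i \<otimes> v i) N \<noteq> \<zero>"
proof
  note Uc = U_carr[OF U]
  assume c0: "nsum (\<lambda>i. U i \<otimes> v i) N = \<zero>"
  have "N \<noteq> 0"
  proof
    assume "N = 0"
    then have "\<one> = \<zero>" using co_sum[OF U, of \<one>] by simp
    then show False by simp
  qed
  then have N: "0 < N" by simp
  obtain m where m: "p = Suc (Suc m)"
    using prime_ge_2_nat[OF p] by (metis add_2_eq_Suc le_Suc_ex)
  have "v 0 [^] p = \<zero>"
  proof (rule functional_nondegenerate)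
    show "v 0 [^] p \<in> carrier L" using v N by simp
    fix y assume y: "y \<in> carrier L"
    let ?F = "\<lambda>a b. a \<otimes> l (b \<otimes> y)"
    have F: "?F a b \<in> carrier L" if "a \<in> carrier L" "b \<in> carrier L" for a b
      using l_K[of "b \<otimes> y"] that y by simp
    have vp: "l (v i [^] p \<otimes> y) \<in> K" if "i < N" for i using l_K v that y by simp
    have "wsum ?F U v N p \<one> \<one> = nsum (\<lambda>i. ?F (\<one> \<otimes> U i [^] p) (\<one> \<otimes> v i [^] p)) N"
      by (rule wsum_prime[where n = N, OF F Uc v p ch]) auto
    also have "\<dots> = nsum (\<lambda>i. l (v i [^] p \<otimes> y) \<otimes> U i [^] p) N"
      using Uc v vp by (intro nsum_cong) (simp add: m_comm)
    finally have "nsum (\<lambda>i. l (v i [^] p \<otimes> y) \<otimes> U i [^] p) N = wsum ?F U v N p \<one> \<one>" by simp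
    also have "\<dots> = \<zero>" unfolding m wsum_dual[OF y one_closed one_closed, of "Suc m"] c0 using y by simp
    finally have "\<forall>i<N. l (v i [^] p \<otimes> y) = \<zero>"
      by (intro indepD[OF Up]) (use vp in blast)+
    then show "l (v 0 [^] p \<otimes> y) = \<zero>" using N by blast
  qed
  then have "v 0 = \<zero>" using pow_nz[OF v[OF N]] by blast
  then have "l (v 0 \<otimes> U 0) = \<zero>" using l_zero Uc[OF N] by simp
  then show False using dual[OF N N] by simp
qed

end
end
end

text \<open>This is the statement that the trace form of a separable extension is non-degenerate; separability
  enters as independence of the \<open>p\<close>-th powers of a basis, in which form it is readily available.\<close>

lemma trace_functional:
  assumes U: "basis N U" and p: "Factorial_Ring.prime (p::nat)" and ch: "add_pow L p \<one> = \<zero>"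
    and Up: "indep N (\<lambda>i. U i [^] p)"
  shows "functional (tr N U)"
proof -
  note Uc = U_carr[OF U]
  have "N \<noteq> 0"
  proof
    assume "N = 0"
    then have "\<one> = \<zero>" using co_sum[OF U, of \<one>] by simp
    then show False by simp
  qed
  then have N: "0 < N" by simp
  define l where "l = (\<lambda>x. co N U x 0)"
  have "l (U 0) = \<one>"
  proof -
    have "nsum (\<lambda>i. (if i = 0 then \<one> else \<zero>) \<otimes> U i) N = nsum (\<lambda>i. if i = 0 then U 0 else \<zero>) N"
      using Uc by (intro nsum_cong) auto
    also have "\<dots> = U 0" using Uc[OF N] N by (intro nsum_delta) auto
    finally show ?thesis using co_unique[OF U, of "\<lambda>i. if i = 0 then \<one> else \<zero>" 0] N
      by (simp add: l_def)
  qed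
  then have ex: "\<exists>x\<in>carrier L. l x \<noteq> \<zero>" using Uc[OF N] by (intro bexI[of _ "U 0"]) auto
  have l: "functional l" unfolding functional_def
    using ex co_K[OF U _ N] co_add[OF U _ _ N] co_smult[OF U _ _ N] by (auto simp: l_def)
  obtain v where v: "\<And>i. i < N \<Longrightarrow> v i \<in> carrier L"
    "\<And>i j. i < N \<Longrightarrow> j < N \<Longrightarrow> l (v i \<otimes> U j) = (if i = j then \<one> else \<zero>)"
    using dual_basis[OF l U] by blast
  let ?c = "nsum (\<lambda>i. U i \<otimes> v i) N"
  have c: "?c \<in> carrier L" "?c \<noteq> \<zero>" using Uc v different_nonzero[OF l U v p ch Up] by auto
  have "tr N U (U 0 \<otimes> inv ?c) = l (U 0 \<otimes> inv ?c \<otimes> ?c)"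
    using c Uc[OF N] by (intro tr_dual[OF l U v]) auto
  also have "\<dots> = \<one>" using c Uc[OF N] \<open>l (U 0) = \<one>\<close> by (simp add: m_assoc)
  finally have "tr N U (U 0 \<otimes> inv ?c) \<noteq> \<zero>" by simp
  moreover have "U 0 \<otimes> inv ?c \<in> carrier L" using c Uc[OF N] by simp
  ultimately have "\<exists>x\<in>carrier L. tr N U x \<noteq> \<zero>" by blast
  then show ?thesis unfolding functional_def
    using tr_K[OF U] tr_add[OF U] tr_smult[OF U] by auto
qed

end

section \<open>Fraction fields, integrality and normality\<close>

context subring_in
begin

lemma subrng_A: "subrng A"
  by (auto simp: subrng_def)

lemma subrng_ideal: "is_ideal A I \<Longrightarrow> subrng I"
  using I_carr I_zero I_add I_l I_neg I_A by (auto simp: subrng_def)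

lemma Mon_A: "x \<in> A \<Longrightarrow> m \<in> Mon x A n \<Longrightarrow> m \<in> A"
  by (induction n arbitrary: m) auto

lemma power_Mon: "x \<in> carrier L \<Longrightarrow> x [^] n \<in> Mon x A n"
proof (induction n)
  case (Suc n)
  from Mon_Suc[OF Suc.prems subrng_A Suc.IH[OF Suc.prems]] show ?case
    using Suc.prems by (simp add: m_comm del: Mon.simps)
qed simp

lemma term_Pol:
  assumes "x \<in> carrier L" "c \<in> A" "m < n"
  shows "c \<otimes> x [^] m \<in> Pol x A n"
proof (rule Pol_mono[OF assms(1) subrng_A])
  show "c \<otimes> x [^] m \<in> Pol x A (Suc m)"
    by (rule Mon_scale[OF assms(1) subrng_A assms(2) power_Mon[OF assms(1)]])
qed (use assms in simp)

lemma monic_relation: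
  assumes x: "x \<in> carrier L" and c: "\<And>j. j < k \<Longrightarrow> c j \<in> A" and m: "\<And>j. j < k \<Longrightarrow> m j < n"
    and eq: "x [^] n = nsum (\<lambda>j. c j \<otimes> x [^] m j) k"
  shows "\<zero> \<in> Mon x A n"
proof -
  let ?s = "nsum (\<lambda>j. c j \<otimes> x [^] m j) k"
  have "\<zero> \<in> Pol x A n"
    by (rule Pol_mono[OF x subrng_A, of \<zero> 0]) auto
  then have "?s \<in> Pol x A n"
    using Pol_add[OF x subrng_A] term_Pol[OF x c m] by (intro nsum_in) auto
  then have "x [^] n \<oplus> \<ominus> ?s \<in> Mon x A n"
    by (intro Mon_Pol[OF x subrng_A power_Mon[OF x]] Pol_neg[OF x subrng_A])
  moreover have "x [^] n \<oplus> \<ominus> ?s = \<zero>" using x by (simp add: eq[symmetric] r_neg)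
  ultimately show ?thesis by simp
qed

lemma frac_iff: "x \<in> fraction_field_in L A \<longleftrightarrow> (\<exists>a\<in>A. \<exists>b\<in>A. b \<noteq> \<zero> \<and> x = a \<otimes> inv b)"
  unfolding fraction_field_in_def by blast

lemma frac_iff': "x \<in> fraction_field_in L A \<longleftrightarrow> x \<in> carrier L \<and> (\<exists>b\<in>A. b \<noteq> \<zero> \<and> b \<otimes> x \<in> A)"
proof
  assume "x \<in> fraction_field_in L A"
  then obtain a b where ab: "a \<in> A" "b \<in> A" "b \<noteq> \<zero>" "x = a \<otimes> inv b" unfolding frac_iff by blast
  then have "b \<otimes> x = a" using A_carr by (simp add: m_lcomm)
  then show "x \<in> carrier L \<and> (\<exists>b\<in>A. b \<noteq> \<zero> \<and> b \<otimes> x \<in> A)" using ab by auto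
next
  assume "x \<in> carrier L \<and> (\<exists>b\<in>A. b \<noteq> \<zero> \<and> b \<otimes> x \<in> A)"
  then obtain b where b: "x \<in> carrier L" "b \<in> A" "b \<noteq> \<zero>" "b \<otimes> x \<in> A" by blast
  have "x = (b \<otimes> x) \<otimes> inv b" using b by (simp add: m_comm[of b x] m_assoc)
  then show "x \<in> fraction_field_in L A" unfolding frac_iff using b by blast
qed

lemma A_frac: "x \<in> A \<Longrightarrow> x \<in> fraction_field_in L A"
  unfolding frac_iff' by (intro conjI bexI[of _ \<one>]) auto

lemma subfield_frac: "subfield (fraction_field_in L A) L"
proof (rule subfieldI', rule subringI)
  show "fraction_field_in L A \<subseteq> carrier L" using frac_iff' by blast
  show "\<one> \<in> fraction_field_in L A" by (rule A_frac) simp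
  fix x y assume "x \<in> fraction_field_in L A"
  then obtain b where b: "x \<in> carrier L" "b \<in> A" "b \<noteq> \<zero>" "b \<otimes> x \<in> A" unfolding frac_iff' by blast
  have "b \<otimes> \<ominus> x \<in> A" using b by (simp add: r_minus)
  then show "\<ominus> x \<in> fraction_field_in L A" unfolding frac_iff' using b by auto
  assume "y \<in> fraction_field_in L A"
  then obtain c where c: "y \<in> carrier L" "c \<in> A" "c \<noteq> \<zero>" "c \<otimes> y \<in> A" unfolding frac_iff' by blast
  have bc: "b \<otimes> c \<in> A" "b \<otimes> c \<noteq> \<zero>" using b c mult_nz by auto
  have "(b \<otimes> c) \<otimes> (x \<otimes> y) = (b \<otimes> x) \<otimes> (c \<otimes> y)"
    using b c A_carr[OF b(2)] A_carr[OF c(2)] by algebra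
  then have "(b \<otimes> c) \<otimes> (x \<otimes> y) \<in> A" using b c by simp
  then show "x \<otimes> y \<in> fraction_field_in L A" unfolding frac_iff' using b c bc by blast
  have "(b \<otimes> c) \<otimes> (x \<oplus> y) = c \<otimes> (b \<otimes> x) \<oplus> b \<otimes> (c \<otimes> y)"
    using b c A_carr[OF b(2)] A_carr[OF c(2)] by algebra
  then have "(b \<otimes> c) \<otimes> (x \<oplus> y) \<in> A" using b c by simp
  then show "x \<oplus> y \<in> fraction_field_in L A" unfolding frac_iff' using b c bc by blast
next
  fix k assume k: "k \<in> fraction_field_in L A - {\<zero>}"
  then have "k \<in> fraction_field_in L A" "k \<noteq> \<zero>" by auto
  then obtain b where b: "k \<in> carrier L" "k \<noteq> \<zero>" "b \<in> A" "b \<noteq> \<zero>" "b \<otimes> k \<in> A" unfolding frac_iff' by blast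
  have "(b \<otimes> k) \<otimes> inv k = b" using b by (simp add: m_assoc)
  then show "inv k \<in> fraction_field_in L A"
    unfolding frac_iff' using b mult_nz by (intro conjI bexI[of _ "b \<otimes> k"]) auto
qed

lemma common_denominator:
  fixes k :: "nat \<Rightarrow> 'a"
  assumes "\<And>i. i < n \<Longrightarrow> k i \<in> fraction_field_in L A"
  shows "\<exists>d\<in>A. d \<noteq> \<zero> \<and> (\<forall>i<n. d \<otimes> k i \<in> A)"
  using assms
proof (induction n)
  case 0
  show ?case by (intro bexI[of _ \<one>]) auto
next
  case (Suc n)
  have "\<exists>d\<in>A. d \<noteq> \<zero> \<and> (\<forall>i<n. d \<otimes> k i \<in> A)" by (rule Suc.IH) (use Suc.prems in simp)
  then obtain d where d: "d \<in> A" "d \<noteq> \<zero>" "\<forall>i<n. d \<otimes> k i \<in> A" by blast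
  obtain b where b: "k n \<in> carrier L" "b \<in> A" "b \<noteq> \<zero>" "b \<otimes> k n \<in> A"
    using Suc.prems[of n] unfolding frac_iff' by auto
  have kc: "k i \<in> carrier L" if "i < Suc n" for i using Suc.prems[OF that] unfolding frac_iff' by blast
  have "b \<otimes> d \<otimes> k i \<in> A" if "i < Suc n" for i
  proof (cases "i = n")
    case True
    have "b \<otimes> d \<otimes> k n = d \<otimes> (b \<otimes> k n)" using A_carr[OF d(1)] A_carr[OF b(2)] b(1) by algebra
    then show ?thesis using True d(1) b(4) by simp
  next
    case False
    then have "d \<otimes> k i \<in> A" using d(3) that by simp
    moreover have "b \<otimes> d \<otimes> k i = b \<otimes> (d \<otimes> k i)" using d(1) b(2) kc[OF that] by (simp add: m_assoc)
    ultimately show ?thesis using b(2) by simp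
  qed
  then show ?case using b d mult_nz by (intro bexI[of _ "b \<otimes> d"]) auto
qed

end

locale normal_in = frobenius_field + noetherian_in +
  assumes normal: "normal_subring L A"
begin

lemma integral_mem:
  assumes x: "x \<in> fraction_field_in L A" and m: "\<zero> \<in> Mon x A n"
  shows "x \<in> A"
proof -
  have xc: "x \<in> carrier L" using x frac_iff' by blast
  obtain f where f: "set f \<subseteq> A" "\<zero> = eval (\<one> # f) x"
    using Mon_exp[OF m xc] A_carr by blast
  have "polynomial A (\<one> # f)" using f(1) by (intro polynomialI) auto
  then have "\<one> # f \<in> carrier (A [X]\<^bsub>L\<^esub>)" using univ_poly_carrier by blast
  then have "integral_over L A x"
    unfolding integral_over_def by (intro bexI[of _ "\<one> # f"]) (simp_all add: f(2)[symmetric] del: eval.simps)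
  then show ?thesis using normal x unfolding normal_subring_def by blast
qed

text \<open>In the noetherian ring \<open>A\<close> the elements \<open>d w\<^sub>k x\<^bsup>q^k\<^esup>\<close> generate a finitely generated ideal, so one of them is a combination
  of its predecessors; dividing by \<open>d\<close> gives an integral equation for \<open>w\<^sub>n x\<close>. Only exponents that are powers of \<open>q\<close> occur,
  since those are what Frobenius arguments control. The multipliers \<open>w\<close> allow for a localisation of \<open>A\<close>.\<close>

lemma almost_integral:
  assumes x: "x \<in> fraction_field_in L A" and d: "d \<in> A" "d \<noteq> \<zero>"
    and W: "W \<subseteq> A - {\<zero>}" and pw: "\<And>k. \<exists>w\<in>W. d \<otimes> w \<otimes> x [^] (q ^ k) \<in> A"
  shows "\<exists>w\<in>W. w \<otimes> x \<in> A"
proof -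
  have xc: "x \<in> carrier L" using x frac_iff' by blast
  obtain w where w: "\<And>k. w k \<in> W" "\<And>k. d \<otimes> w k \<otimes> x [^] (q ^ k) \<in> A" using pw by metis
  have wA: "w k \<in> A" "w k \<noteq> \<zero>" for k using w(1) W by auto
  define a where "a k = d \<otimes> w k \<otimes> x [^] (q ^ k)" for k
  have aA: "a k \<in> A" for k unfolding a_def by (rule w(2))
  let ?F = "range (lincombs a)"
  have ne: "?F \<noteq> {}" by blast
  have idl: "?F \<subseteq> {I. is_ideal A I}" using lincombs_ideal aA by blast
  obtain M where M: "M \<in> ?F" "\<And>J. J \<in> ?F \<Longrightarrow> M \<subseteq> J \<Longrightarrow> J = M"
    using maximal_ideal_in[OF ne idl] by meson
  obtain n where n: "M = lincombs a n" using M(1) by blast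
  have "lincombs a n \<subseteq> lincombs a (Suc n)"
  proof
    fix y assume "y \<in> lincombs a n"
    then obtain c where c: "y = nsum (\<lambda>i. c i \<otimes> a i) n" "\<forall>i<n. c i \<in> A" unfolding lincombs_def by blast
    have "nsum (\<lambda>i. (c(n := \<zero>)) i \<otimes> a i) n = y" unfolding c by (rule nsum_cong) auto
    moreover have "y \<in> carrier L" using c aA by simp
    ultimately have "y = nsum (\<lambda>i. (c(n := \<zero>)) i \<otimes> a i) (Suc n)" using aA by simp
    moreover have "\<forall>i<Suc n. (c(n := \<zero>)) i \<in> A" using c by auto
    ultimately show "y \<in> lincombs a (Suc n)" unfolding lincombs_def by blast
  qed
  then have "lincombs a (Suc n) = lincombs a n" using M(2)[of "lincombs a (Suc n)"] n by blast
  moreover have "a n \<in> lincombs a (Suc n)"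
  proof -
    let ?c = "(\<lambda>_. \<zero>)(n := \<one>)"
    have "nsum (\<lambda>i. ?c i \<otimes> a i) n = \<zero>" using aA by (intro nsum_zero) auto
    then have "a n = nsum (\<lambda>i. ?c i \<otimes> a i) (Suc n)" using aA by simp
    moreover have "\<forall>i<Suc n. ?c i \<in> A" by simp
    ultimately show ?thesis unfolding lincombs_def by blast
  qed
  ultimately obtain r where r: "\<forall>j<n. r j \<in> A" "a n = nsum (\<lambda>j. r j \<otimes> a j) n"
    unfolding lincombs_def by blast
  let ?P = "\<lambda>j. x [^] (q ^ j)"
  have "d \<otimes> (w n \<otimes> ?P n) = d \<otimes> nsum (\<lambda>j. r j \<otimes> w j \<otimes> ?P j) n"
  proof -
    have "d \<otimes> (w n \<otimes> ?P n) = a n" unfolding a_def using d wA xc by (simp add: m_assoc)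
    also have "\<dots> = nsum (\<lambda>j. r j \<otimes> a j) n" by (rule r(2))
    also have "\<dots> = nsum (\<lambda>j. d \<otimes> (r j \<otimes> w j \<otimes> ?P j)) n"
      unfolding a_def using d wA xc r(1) by (intro nsum_cong) (simp add: m_ac)
    also have "\<dots> = d \<otimes> nsum (\<lambda>j. r j \<otimes> w j \<otimes> ?P j) n"
      using d wA xc r(1) by (intro nsum_ldistr[symmetric]) auto
    finally show ?thesis .
  qed
  then have rel: "w n \<otimes> ?P n = nsum (\<lambda>j. r j \<otimes> w j \<otimes> ?P j) n"
    using d wA xc r(1) m_lcancel[of d "w n \<otimes> ?P n" "nsum (\<lambda>j. r j \<otimes> w j \<otimes> ?P j) n"] by simp
  let ?y = "w n \<otimes> x"
  have yc: "?y \<in> carrier L" using wA xc by simp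
  have lt: "q ^ j < q ^ n" if "j < n" for j using q_ge2 that by (intro power_strict_increasing) auto
  have "?y [^] (q ^ n) = w n [^] (q ^ n - 1) \<otimes> (w n \<otimes> ?P n)"
  proof -
    have "w n [^] (q ^ n) = w n [^] Suc (q ^ n - 1)" by simp
    also have "\<dots> = w n [^] (q ^ n - 1) \<otimes> w n" by (rule nat_pow_Suc)
    finally show ?thesis using wA xc by (simp add: nat_pow_distrib m_assoc)
  qed
  also have "\<dots> = nsum (\<lambda>j. w n [^] (q ^ n - 1) \<otimes> (r j \<otimes> w j \<otimes> ?P j)) n"
    unfolding rel using wA xc r(1) by (intro nsum_ldistr) auto
  also have "\<dots> = nsum (\<lambda>j. (r j \<otimes> w j \<otimes> w n [^] (q ^ n - 1 - q ^ j)) \<otimes> ?y [^] (q ^ j)) n"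
  proof (rule nsum_cong)
    fix j assume j: "j < n"
    have "w n [^] (q ^ n - 1) = w n [^] (q ^ n - 1 - q ^ j) \<otimes> w n [^] (q ^ j)"
      using wA lt[OF j] by (simp add: nat_pow_mult)
    then show "w n [^] (q ^ n - 1) \<otimes> (r j \<otimes> w j \<otimes> ?P j) =
        (r j \<otimes> w j \<otimes> w n [^] (q ^ n - 1 - q ^ j)) \<otimes> ?y [^] (q ^ j)"
      using wA xc r(1) j by (simp add: nat_pow_distrib m_ac)
  qed
  finally have "\<zero> \<in> Mon ?y A (q ^ n)"
    using yc wA r(1) lt by (intro monic_relation) auto
  moreover have "?y \<in> fraction_field_in L A"
    using subringE(6)[OF subfieldE(1)[OF subfield_frac]] A_frac wA x by blast
  ultimately show ?thesis using integral_mem w(1) by blast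
qed

lemma almost_integral':
  assumes x: "x \<in> fraction_field_in L A" and d: "d \<in> A" "d \<noteq> \<zero>"
    and pw: "\<And>k. d \<otimes> x [^] (q ^ k) \<in> A"
  shows "x \<in> A"
proof -
  have xc: "x \<in> carrier L" using x frac_iff' by blast
  have "\<exists>w\<in>{\<one>}. w \<otimes> x \<in> A"
    by (rule almost_integral[OF x d]) (use pw d in auto)
  then show ?thesis using xc by simp
qed

end

section \<open>Finite extensions of normal domains\<close>

locale finite_extension = frobenius_field +
  fixes R S K :: "'a set" and \<phi> \<psi> :: "'a \<Rightarrow> 'a"
  assumes R_split: "F_finite_split L p e q R \<phi>" and S_split: "F_finite_split L p e q S \<psi>"
    and R_normal: "normal_subring L R" and S_normal: "normal_subring L S"
    and R_S: "R \<subseteq> S" and K_eq: "K = fraction_field_in L R"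
    and L_frac: "carrier L = fraction_field_in L S"
    and fin: "\<exists>n g. (\<forall>i<n. g i \<in> S) \<and> (\<forall>s\<in>S. \<exists>c. (\<forall>i<n. c i \<in> R) \<and> s = nsum (\<lambda>i. c i \<otimes> g i) n)"
    and extends: "r \<in> R \<Longrightarrow> \<psi> r = \<phi> r"

sublocale finite_extension \<subseteq> R: F_finite_split L p e q R \<phi>
  by (rule R_split)

sublocale finite_extension \<subseteq> S: F_finite_split L p e q S \<psi>
  by (rule S_split)

sublocale finite_extension \<subseteq> R: normal_in L p e q R
  by unfold_locales (rule R_normal)

sublocale finite_extension \<subseteq> S: normal_in L p e q S
  by unfold_locales (rule S_normal)

sublocale finite_extension \<subseteq> field_over L K
  using field_over.intro[OF ambient_field_axioms field_over_axioms.intro] K_eq R.subfield_frac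
  by simp

context finite_extension
begin

lemma R_in_S [simp]: "r \<in> R \<Longrightarrow> r \<in> S" using R_S by blast
lemma R_in_K [simp]: "r \<in> R \<Longrightarrow> r \<in> K" using R.A_frac K_eq by simp
lemma K_iff: "k \<in> K \<longleftrightarrow> k \<in> carrier L \<and> (\<exists>b\<in>R. b \<noteq> \<zero> \<and> b \<otimes> k \<in> R)"
  unfolding K_eq by (rule R.frac_iff')

definition gen_n :: nat where "gen_n = (SOME n. \<exists>g. (\<forall>i<n. g i \<in> S) \<and>
    (\<forall>s\<in>S. \<exists>c. (\<forall>i<n. c i \<in> R) \<and> s = nsum (\<lambda>i. c i \<otimes> g i) n))"
definition gen :: "nat \<Rightarrow> 'a" where "gen = (SOME g. (\<forall>i<gen_n. g i \<in> S) \<and>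
    (\<forall>s\<in>S. \<exists>c. (\<forall>i<gen_n. c i \<in> R) \<and> s = nsum (\<lambda>i. c i \<otimes> g i) gen_n))"

lemma gen_props: "(\<forall>i<gen_n. gen i \<in> S) \<and>
    (\<forall>s\<in>S. \<exists>c. (\<forall>i<gen_n. c i \<in> R) \<and> s = nsum (\<lambda>i. c i \<otimes> gen i) gen_n)"
proof -
  have "\<exists>g. (\<forall>i<gen_n. g i \<in> S) \<and>
    (\<forall>s\<in>S. \<exists>c. (\<forall>i<gen_n. c i \<in> R) \<and> s = nsum (\<lambda>i. c i \<otimes> g i) gen_n)"
    unfolding gen_n_def by (rule someI_ex[OF fin])
  then show ?thesis unfolding gen_def by (rule someI_ex)
qed

lemma gen_S: "i < gen_n \<Longrightarrow> gen i \<in> S" using gen_props by blast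

lemma gen_span: assumes "s \<in> S" shows "\<exists>c. (\<forall>i<gen_n. c i \<in> R) \<and> s = nsum (\<lambda>i. c i \<otimes> gen i) gen_n"
  using gen_props assms by blast

text \<open>The ideal \<open>P S\<close>, defined inside the ambient field.\<close>

definition extended :: "'a set \<Rightarrow> 'a set" where
  "extended P = \<Inter>{I. is_ideal S I \<and> P \<subseteq> I}"

lemma extended_ideal: "P \<subseteq> S \<Longrightarrow> is_ideal S (extended P)"
  unfolding extended_def using S.is_ideal_whole by (intro S.is_ideal_Inter) auto

lemma extended_least: "is_ideal S I \<Longrightarrow> P \<subseteq> I \<Longrightarrow> extended P \<subseteq> I"
  unfolding extended_def by blast

lemma extended_base: "P \<subseteq> extended P"
  unfolding extended_def by blast

text \<open>The right-hand sides form an ideal of \<open>S\<close>, because \<open>P\<close>-combinations of module generators are stable under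
  multiplication by \<open>S\<close>.\<close>

lemma extended_gen:
  assumes P: "is_ideal R P" and y: "y \<in> extended P" and s: "s \<in> S"
  shows "\<exists>c. (\<forall>i<gen_n. c i \<in> P) \<and> y \<otimes> s = nsum (\<lambda>i. c i \<otimes> gen i) gen_n"
proof -
  let ?G = "\<lambda>z. \<exists>c. (\<forall>i<gen_n. c i \<in> P) \<and> z = nsum (\<lambda>i. c i \<otimes> gen i) gen_n"
  let ?T = "{y \<in> S. \<forall>s\<in>S. ?G (y \<otimes> s)}"
  note PR = R.I_A[OF P] and Pc = R.I_carr[OF P]
  have add: "?G (a \<oplus> b)" if "?G a" "?G b" for a b
  proof -
    obtain c where c: "\<forall>i<gen_n. c i \<in> P" "a = nsum (\<lambda>i. c i \<otimes> gen i) gen_n" using \<open>?G a\<close> by blast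
    obtain d where d: "\<forall>i<gen_n. d i \<in> P" "b = nsum (\<lambda>i. d i \<otimes> gen i) gen_n" using \<open>?G b\<close> by blast
    have "a \<oplus> b = nsum (\<lambda>i. (c i \<oplus> d i) \<otimes> gen i) gen_n"
      unfolding c d using c(1) d(1) gen_S Pc
      by (subst nsum_add[symmetric]) (auto intro!: nsum_cong simp: l_distr)
    moreover have "\<forall>i<gen_n. c i \<oplus> d i \<in> P" using c(1) d(1) R.I_add[OF P] by simp
    ultimately show ?thesis by (intro exI[of _ "\<lambda>i. c i \<oplus> d i"]) simp
  qed
  have "is_ideal S ?T"
  proof (rule S.is_idealI)
    have z: "\<zero> = nsum (\<lambda>i. \<zero> \<otimes> gen i) gen_n" using gen_S by (intro nsum_zero[symmetric]) simp
    have "?G (\<zero> \<otimes> s)" if "s \<in> S" for s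
      using z R.I_zero[OF P] that by (intro exI[of _ "\<lambda>_. \<zero>"]) simp
    then show "\<zero> \<in> ?T" by simp
    show "x \<oplus> y \<in> ?T" if x: "x \<in> ?T" and y: "y \<in> ?T" for x y
    proof -
      have "?G ((x \<oplus> y) \<otimes> s)" if "s \<in> S" for s
        using add[of "x \<otimes> s" "y \<otimes> s"] x y that by (simp add: l_distr)
      then show ?thesis using x y by simp
    qed
    show "a \<otimes> x \<in> ?T" if a: "a \<in> S" and x: "x \<in> ?T" for a x
    proof -
      have xS: "x \<in> S" using x by simp
      have "?G ((a \<otimes> x) \<otimes> s)" if "s \<in> S" for s
      proof -
        have eq: "(a \<otimes> x) \<otimes> s = x \<otimes> (a \<otimes> s)" using a xS that by (simp add: m_ac)
        have "\<forall>s\<in>S. ?G (x \<otimes> s)" using x by simp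
        then show ?thesis unfolding eq by (rule bspec) (use a that in simp)
      qed
      then show ?thesis using a xS by simp
    qed
  qed simp
  moreover have "P \<subseteq> ?T"
  proof
    fix x assume x: "x \<in> P"
    have "?G (x \<otimes> s)" if s: "s \<in> S" for s
    proof -
      obtain c where c: "\<forall>i<gen_n. c i \<in> R" "s = nsum (\<lambda>i. c i \<otimes> gen i) gen_n" using gen_span[OF s] by blast
      have "x \<otimes> s = nsum (\<lambda>i. (x \<otimes> c i) \<otimes> gen i) gen_n"
        unfolding c(2) using c(1) gen_S Pc[OF x]
        by (subst nsum_ldistr) (auto intro!: nsum_cong simp: m_assoc)
      moreover have "\<forall>i<gen_n. x \<otimes> c i \<in> P" using c(1) R.I_r[OF P _ x] by simp
      ultimately show ?thesis by (intro exI[of _ "\<lambda>i. x \<otimes> c i"]) simp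
    qed
    then show "x \<in> ?T" using PR[OF x] by simp
  qed
  ultimately have "y \<in> ?T" using extended_least[of ?T P] y by blast
  then show ?thesis using s by blast
qed

lemma integral_over_ideal:
  assumes P: "is_ideal R P" and y: "y \<in> extended P"
  shows "\<exists>d. \<zero> \<in> Mon y P d"
proof -
  have PS: "P \<subseteq> S" using R.I_A[OF P] by auto
  have yS: "y \<in> S" using S.I_A[OF extended_ideal[OF PS] y] .
  have "\<forall>i. i < gen_n \<longrightarrow> (\<exists>c. (\<forall>j<gen_n. c j \<in> P) \<and> y \<otimes> gen i = nsum (\<lambda>j. c j \<otimes> gen j) gen_n)"
    using extended_gen[OF P y] gen_S by blast
  then obtain c where c: "\<And>i. i < gen_n \<Longrightarrow> (\<forall>j<gen_n. c i j \<in> P) \<and> y \<otimes> gen i = nsum (\<lambda>j. c i j \<otimes> gen j) gen_n"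
    by metis
  have yc: "y \<in> carrier L" using yS by simp
  have "\<exists>d. \<exists>m \<in> Mon y P d. \<forall>i<gen_n. m \<otimes> gen i = \<zero>"
    by (rule Mon_elimination[OF yc R.subrng_ideal[OF P], where c = c]) (use gen_S c in auto)
  then obtain d m where m: "m \<in> Mon y P d" "\<And>i. i < gen_n \<Longrightarrow> m \<otimes> gen i = \<zero>" by blast
  have mc: "m \<in> carrier L" by (rule Mon_closed[OF yc R.subrng_ideal[OF P] m(1)])
  obtain a where a: "\<forall>i<gen_n. a i \<in> R" "\<one> = nsum (\<lambda>i. a i \<otimes> gen i) gen_n" using gen_span[of \<one>] by auto
  have "m = m \<otimes> nsum (\<lambda>i. a i \<otimes> gen i) gen_n" using mc a(2)[symmetric] by simp
  also have "\<dots> = nsum (\<lambda>i. a i \<otimes> (m \<otimes> gen i)) gen_n"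
    using mc a(1) gen_S by (subst nsum_ldistr) (auto intro!: nsum_cong simp: m_lcomm)
  also have "\<dots> = \<zero>" using a(1) m(2) by (intro nsum_zero) simp
  finally show ?thesis using m(1) by blast
qed

lemma integral: "s \<in> S \<Longrightarrow> \<exists>d. \<zero> \<in> Mon s R d"
proof -
  assume s: "s \<in> S"
  have "\<one> \<in> extended R" using extended_base[of R] R.A_one by blast
  then have "s \<otimes> \<one> \<in> extended R" by (intro S.I_l[OF extended_ideal]) (use s R_S in auto)
  then show ?thesis using integral_over_ideal[OF R.is_ideal_whole] s by simp
qed

lemma one_notin_extended:
  assumes P: "is_prime R P" shows "\<one> \<notin> extended P"
proof
  assume "\<one> \<in> extended P"
  note Pi = R.prime_ideal[OF P]
  obtain d where d: "\<zero> \<in> Mon \<one> P d" using integral_over_ideal[OF Pi \<open>\<one> \<in> extended P\<close>] by blast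
  have "m \<in> Mon \<one> P d \<Longrightarrow> m \<ominus> \<one> \<in> P" for m d
  proof (induction d arbitrary: m)
    case 0
    then show ?case using R.I_zero[OF Pi] by (simp add: a_minus_def r_neg)
  next
    case (Suc d)
    obtain m' c where e: "m = \<one> \<otimes> m' \<oplus> c" "m' \<in> Mon \<one> P d" "c \<in> P" using Suc.prems by auto
    have mc: "m' \<in> carrier L" by (rule Mon_closed[OF one_closed R.subrng_ideal[OF Pi] e(2)])
    have "m \<ominus> \<one> = (m' \<ominus> \<one>) \<oplus> c" using e(1) mc R.I_carr[OF Pi e(3)] by algebra
    then show ?case using R.I_add[OF Pi Suc.IH[OF e(2)] e(3)] by simp
  qed
  from this[OF d] have "\<ominus> (\<zero> \<ominus> \<one>) \<in> P" by (rule R.I_neg[OF Pi])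
  moreover have "\<ominus> (\<zero> \<ominus> \<one>) = \<one>" by algebra
  ultimately show False using R.prime_one[OF P] by simp
qed

lemma contract_prime: "is_prime S Q \<Longrightarrow> is_prime R (Q \<inter> R)"
proof (rule R.is_primeI)
  assume Q: "is_prime S Q"
  note Qi = S.prime_ideal[OF Q]
  show "is_ideal R (Q \<inter> R)"
    using S.I_zero[OF Qi] S.I_add[OF Qi] S.I_l[OF Qi] by (intro R.is_idealI) auto
  show "\<one> \<notin> Q \<inter> R" using S.prime_one[OF Q] by simp
  fix a b assume "a \<in> R" "b \<in> R" "a \<otimes> b \<in> Q \<inter> R" "a \<notin> Q \<inter> R" "b \<notin> Q \<inter> R"
  then show False using S.prime_mult[OF Q, of a b] by simp
qed

lemma contract_center: "Q \<in> S.centers \<Longrightarrow> Q \<inter> R \<in> R.centers"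
proof -
  assume Q: "Q \<in> S.centers"
  have "is_prime R (Q \<inter> R)" using contract_prime S.centersD(1)[OF Q] by blast
  moreover have "\<phi> x \<in> Q \<inter> R" if "x \<in> Q \<inter> R" for x
    using that S.compatible_f[OF S.centersD(2)[OF Q], of x] extends[of x] by simp
  ultimately show ?thesis
    unfolding R.centers_def R.compatible_def using R.prime_ideal by blast
qed

text \<open>For \<open>x \<in> Q2\<close> outside \<open>Q1\<close>, take a monic polynomial over \<open>R\<close> of minimal degree with value at \<open>x\<close> in \<open>Q1\<close>. Its
  constant term lies in \<open>Q2 \<inter> R \<subseteq> Q1\<close>, and cancelling \<open>x\<close> lowers the degree.\<close>

lemma incomparable:
  assumes Q1: "is_prime S Q1" and Q2: "is_prime S Q2" and le: "Q1 \<subseteq> Q2"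
    and contr: "Q2 \<inter> R \<subseteq> Q1"
  shows "Q1 = Q2"
proof (rule ccontr)
  assume "Q1 \<noteq> Q2"
  then obtain x where x: "x \<in> Q2" "x \<notin> Q1" using le by blast
  note Q1i = S.prime_ideal[OF Q1] and Q2i = S.prime_ideal[OF Q2]
  have xS: "x \<in> S" using S.I_A[OF Q2i x(1)] .
  obtain d where "\<zero> \<in> Mon x R d" using integral[OF xS] by blast
  then have "\<exists>m\<in>Mon x R d. m \<in> Q1" using S.I_zero[OF Q1i] by blast
  then have ex: "\<exists>d. \<exists>m\<in>Mon x R d. m \<in> Q1" by blast
  define n where "n = (LEAST d. \<exists>m\<in>Mon x R d. m \<in> Q1)"
  obtain m where m: "m \<in> Mon x R n" "m \<in> Q1" using LeastI_ex[OF ex] unfolding n_def by blast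
  show False
  proof (cases n)
    case 0
    then show False using m S.prime_one[OF Q1] by simp
  next
    case (Suc k)
    then obtain m' c where e: "m = x \<otimes> m' \<oplus> c" "m' \<in> Mon x R k" "c \<in> R" using m(1) by auto
    have m'S: "m' \<in> S" using S.Mon_A[OF xS] Mon_mono[OF R_S] e(2) by blast
    have xm: "x \<otimes> m' \<in> Q2" using S.I_r[OF Q2i m'S x(1)] .
    have cS: "c \<in> carrier L" using e(3) by simp
    have "c \<oplus> x \<otimes> m' \<in> Q2" using m(2) le e xS m'S cS by (simp add: a_comm subset_iff)
    then have "c \<in> Q2" by (rule S.I_add_cancel[OF Q2i cS xm])
    then have cQ: "c \<in> Q1" using contr e(3) by blast
    have "x \<otimes> m' \<in> Q1" using S.I_add_cancel[OF Q1i _ cQ] m(2) e(1) xS m'S by simp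
    then have "m' \<in> Q1" using S.prime_mult[OF Q1 xS m'S] x(2) by blast
    then have "n \<le> k" unfolding n_def using e(2) by (intro Least_le) blast
    then show False using Suc by simp
  qed
qed

text \<open>The constant term of an integral equation of minimal degree is not zero.\<close>

lemma multiple_in_R:
  assumes s: "s \<in> S" "s \<noteq> \<zero>"
  shows "\<exists>t\<in>S. s \<otimes> t \<in> R \<and> s \<otimes> t \<noteq> \<zero>"
proof -
  have ex: "\<exists>d. \<zero> \<in> Mon s R d" by (rule integral[OF s(1)])
  define n where "n = (LEAST d. \<zero> \<in> Mon s R d)"
  have n: "\<zero> \<in> Mon s R n" unfolding n_def by (rule LeastI_ex[OF ex])
  then obtain k where k: "n = Suc k" by (cases n) auto
  obtain m c where e: "\<zero> = s \<otimes> m \<oplus> c" "m \<in> Mon s R k" "c \<in> R" using n unfolding k by auto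
  have mS: "m \<in> S" using S.Mon_A[OF s(1)] Mon_mono[OF R_S] e(2) by blast
  have "m \<noteq> \<zero>"
  proof
    assume "m = \<zero>"
    then have "n \<le> k" unfolding n_def using e(2) by (intro Least_le) simp
    then show False using k by simp
  qed
  have "s \<otimes> m = \<ominus> c"
    using minus_equality[OF e(1)[symmetric]] e(3) s(1) mS by simp
  then show ?thesis using e(3) mS mult_nz[of s m] s \<open>m \<noteq> \<zero>\<close> by (intro bexI[of _ m]) auto
qed

lemma clear_denominator: "x \<in> carrier L \<Longrightarrow> \<exists>r\<in>R. r \<noteq> \<zero> \<and> r \<otimes> x \<in> S"
proof -
  assume x: "x \<in> carrier L"
  then obtain b where b: "b \<in> S" "b \<noteq> \<zero>" "b \<otimes> x \<in> S" using L_frac S.frac_iff' by blast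
  obtain t where t: "t \<in> S" "b \<otimes> t \<in> R" "b \<otimes> t \<noteq> \<zero>" using multiple_in_R[OF b(1,2)] by blast
  have "(b \<otimes> t) \<otimes> x = t \<otimes> (b \<otimes> x)" using b(1) t(1) x by (simp add: m_ac)
  then have "(b \<otimes> t) \<otimes> x \<in> S" using t(1) b(3) by simp
  then show ?thesis using t by blast
qed

lemma clear_denominators:
  "(\<And>i. i < (n::nat) \<Longrightarrow> x i \<in> carrier L) \<Longrightarrow> \<exists>r\<in>R. r \<noteq> \<zero> \<and> (\<forall>i<n. r \<otimes> x i \<in> S)"
proof (induction n)
  case 0
  show ?case by (intro bexI[of _ \<one>]) auto
next
  case (Suc n)
  have "\<exists>r\<in>R. r \<noteq> \<zero> \<and> (\<forall>i<n. r \<otimes> x i \<in> S)" by (rule Suc.IH) (use Suc.prems in simp)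
  then obtain d where d: "d \<in> R" "d \<noteq> \<zero>" "\<forall>i<n. d \<otimes> x i \<in> S" by blast
  obtain b where b: "b \<in> R" "b \<noteq> \<zero>" "b \<otimes> x n \<in> S" using clear_denominator Suc.prems by blast
  have "b \<otimes> d \<otimes> x i \<in> S" if "i < Suc n" for i
  proof (cases "i = n")
    case True
    have "b \<otimes> d \<otimes> x n = d \<otimes> (b \<otimes> x n)" using d(1) b(1) Suc.prems[of n] by (simp add: m_ac)
    then show ?thesis using True d(1) b(3) by simp
  next
    case False
    then have "d \<otimes> x i \<in> S" using d(3) that by simp
    moreover have "b \<otimes> d \<otimes> x i = b \<otimes> (d \<otimes> x i)" using d(1) b(1) Suc.prems[OF that] by (simp add: m_assoc)
    ultimately show ?thesis using b(1) by simp
  qed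
  then show ?case using b d mult_nz by (intro bexI[of _ "b \<otimes> d"]) auto
qed

lemma ex_is_basis: "\<exists>us. is_basis L K us"
proof (rule exists_is_basis)
  show "gen i \<in> carrier L" if "i < gen_n" for i using gen_S[OF that] by simp
  fix x assume x: "x \<in> carrier L"
  obtain r where r: "r \<in> R" "r \<noteq> \<zero>" "r \<otimes> x \<in> S" using clear_denominator[OF x] by blast
  obtain c where c: "\<forall>i<gen_n. c i \<in> R" "r \<otimes> x = nsum (\<lambda>i. c i \<otimes> gen i) gen_n" using gen_span[OF r(3)] by blast
  have "x = inv r \<otimes> (r \<otimes> x)" using r x by (simp add: m_assoc[symmetric])
  also have "\<dots> = nsum (\<lambda>i. (inv r \<otimes> c i) \<otimes> gen i) gen_n"
    unfolding c(2) using c(1) r gen_S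
    by (subst nsum_ldistr) (auto intro!: nsum_cong simp: m_assoc)
  finally have "x = nsum (\<lambda>i. (inv r \<otimes> c i) \<otimes> gen i) gen_n" .
  moreover have "\<forall>i<gen_n. inv r \<otimes> c i \<in> K" using c(1) r by simp
  ultimately show "\<exists>k. (\<forall>i<gen_n. k i \<in> K) \<and> x = nsum (\<lambda>i. k i \<otimes> gen i) gen_n"
    by (intro exI[of _ "\<lambda>i. inv r \<otimes> c i"]) simp
qed

definition us :: "'a list" where "us = (SOME us. is_basis L K us)"
definition N :: nat where "N = length us"
definition U :: "nat \<Rightarrow> 'a" where "U i = us ! i"

lemma U_basis: "basis N U"
proof -
  have "is_basis L K us" unfolding us_def by (rule someI_ex[OF ex_is_basis])
  from is_basis_imp_basis[OF this] show ?thesis unfolding N_def U_def[abs_def] .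
qed

lemmas Uc = U_carr[OF U_basis] and co_in_K = co_K[OF U_basis] and co_expand = co_sum[OF U_basis]

abbreviation Tr :: "'a \<Rightarrow> 'a" where "Tr \<equiv> field_trace L K"

lemma Tr_eq: "basis M V \<Longrightarrow> x \<in> carrier L \<Longrightarrow> Tr x = tr M V x"
  by (rule field_trace_eq[OF ex_is_basis])

lemma Tr_K [simp]: "x \<in> carrier L \<Longrightarrow> Tr x \<in> K"
  using Tr_eq[OF U_basis] tr_K[OF U_basis] by simp
lemma Tr_add: "x \<in> carrier L \<Longrightarrow> y \<in> carrier L \<Longrightarrow> Tr (x \<oplus> y) = Tr x \<oplus> Tr y"
  using Tr_eq[OF U_basis] tr_add[OF U_basis] by simp
lemma Tr_smult: "k \<in> K \<Longrightarrow> x \<in> carrier L \<Longrightarrow> Tr (k \<otimes> x) = k \<otimes> Tr x"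
  using Tr_eq[OF U_basis] tr_smult[OF U_basis] by simp
lemma Tr_zero [simp]: "Tr \<zero> = \<zero>"
  using Tr_smult[of \<zero> \<zero>] by simp

text \<open>A common denominator \<open>D\<close> sandwiches \<open>S\<close> between two free \<open>R\<close>-modules of rank \<open>[L : K]\<close>, which turns statements about
  elements of \<open>S\<close> into statements about coordinates in \<open>K\<close>, up to the bounded factor \<open>D\<close>.\<close>

lemma bounded_coords:
  "\<exists>D\<in>R. D \<noteq> \<zero> \<and> (\<forall>s\<in>S. \<forall>i<N. D \<otimes> co N U s i \<in> R) \<and> (\<forall>i<N. D \<otimes> U i \<in> S)"
proof -
  have gc: "gen j \<in> carrier L" if "j < gen_n" for j using gen_S[OF that] by simp
  have "\<forall>j. j < gen_n \<longrightarrow> (\<exists>d\<in>R. d \<noteq> \<zero> \<and> (\<forall>i<N. d \<otimes> co N U (gen j) i \<in> R))"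
    using R.common_denominator co_in_K gc K_eq by metis
  then obtain d where d: "\<And>j. j < gen_n \<Longrightarrow> d j \<in> R \<and> d j \<noteq> \<zero> \<and> (\<forall>i<N. d j \<otimes> co N U (gen j) i \<in> R)"
    by metis
  have "n \<le> gen_n \<Longrightarrow> \<exists>D\<in>R. D \<noteq> \<zero> \<and> (\<forall>j<n. \<forall>i<N. D \<otimes> co N U (gen j) i \<in> R)" for n
  proof (induction n)
    case 0
    show ?case by (intro bexI[of _ \<one>]) auto
  next
    case (Suc n)
    obtain D where D: "D \<in> R" "D \<noteq> \<zero>" "\<forall>j<n. \<forall>i<N. D \<otimes> co N U (gen j) i \<in> R" using Suc by auto
    have dn: "d n \<in> R" "d n \<noteq> \<zero>" "\<forall>i<N. d n \<otimes> co N U (gen n) i \<in> R" using d[of n] Suc.prems by auto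
    have "D \<otimes> d n \<otimes> co N U (gen j) i \<in> R" if j: "j < Suc n" and i: "i < N" for i j
    proof (cases "j = n")
      case True
      have "D \<otimes> d n \<otimes> co N U (gen n) i = D \<otimes> (d n \<otimes> co N U (gen n) i)"
        using D dn co_in_K[OF gc i] Suc.prems by (simp add: m_assoc)
      then show ?thesis using True D dn i by simp
    next
      case False
      then have "D \<otimes> d n \<otimes> co N U (gen j) i = d n \<otimes> (D \<otimes> co N U (gen j) i)"
        using D dn co_in_K[OF gc i] Suc.prems j by (simp add: m_ac)
      then show ?thesis using False j D dn i by simp
    qed
    then show ?case using D dn mult_nz by (intro bexI[of _ "D \<otimes> d n"]) auto
  qed
  then obtain D where D: "D \<in> R" "D \<noteq> \<zero>" "\<forall>j<gen_n. \<forall>i<N. D \<otimes> co N U (gen j) i \<in> R" by blast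
  obtain E where E: "E \<in> R" "E \<noteq> \<zero>" "\<forall>i<N. E \<otimes> U i \<in> S" using clear_denominators[of N U] Uc by blast
  have "E \<otimes> D \<otimes> co N U s i \<in> R" if s: "s \<in> S" and i: "i < N" for s i
  proof -
    obtain c where c: "\<forall>j<gen_n. c j \<in> R" "s = nsum (\<lambda>j. c j \<otimes> gen j) gen_n" using gen_span[OF s] by blast
    have "co N U s i = nsum (\<lambda>j. co N U (c j \<otimes> gen j) i) gen_n"
      unfolding c(2) using c(1) gc i by (intro co_nsum[OF U_basis]) auto
    also have "\<dots> = nsum (\<lambda>j. c j \<otimes> co N U (gen j) i) gen_n"
      using c(1) gc i by (intro nsum_cong co_smult[OF U_basis]) auto
    finally have "D \<otimes> co N U s i = nsum (\<lambda>j. c j \<otimes> (D \<otimes> co N U (gen j) i)) gen_n"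
      using D(1) c(1) co_in_K[OF gc i] by (simp add: nsum_ldistr m_lcomm cong: nsum_cong)
    then have "D \<otimes> co N U s i \<in> R" using D(3) c(1) i by simp
    then show ?thesis using E(1) D(1) co_in_K[OF _ i, of s] s by (simp add: m_assoc)
  qed
  moreover have "E \<otimes> D \<otimes> U i \<in> S" if "i < N" for i
  proof -
    have "E \<otimes> D \<otimes> U i = D \<otimes> (E \<otimes> U i)" using E(1) D(1) Uc[OF that] by (simp add: m_ac)
    then show ?thesis using E(3) D(1) that by simp
  qed
  ultimately show ?thesis using E D mult_nz by (intro bexI[of _ "E \<otimes> D"]) auto
qed

end

section \<open>Separability, and the trace commutes with the Frobenius splittings\<close>

context finite_extension
begin

text \<open>The extension of \<open>\<psi>\<close> to \<open>L\<close>, determined by \<open>\<Psi> (z\<^sup>q x) = z \<Psi> x\<close>; \<open>Psi_eq\<close> is independence of the denominator \<open>b\<close>.\<close>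

definition \<Psi> :: "'a \<Rightarrow> 'a" where
  "\<Psi> x = (let b = (SOME b. b \<in> R \<and> b \<noteq> \<zero> \<and> b [^] q \<otimes> x \<in> S) in inv b \<otimes> \<psi> (b [^] q \<otimes> x))"

lemma Psi_eq:
  assumes x: "x \<in> carrier L" and b: "b \<in> S" "b \<noteq> \<zero>" "b [^] q \<otimes> x \<in> S"
  shows "\<Psi> x = inv b \<otimes> \<psi> (b [^] q \<otimes> x)"
proof -
  obtain r where r: "r \<in> R" "r \<noteq> \<zero>" "r \<otimes> x \<in> S" using clear_denominator[OF x] by blast
  have "r [^] q \<otimes> x = r [^] (q - 1) \<otimes> (r \<otimes> x)"
    using frob_split[of r] r(1) x by (simp add: m_ac)
  then have ex: "\<exists>b. b \<in> R \<and> b \<noteq> \<zero> \<and> b [^] q \<otimes> x \<in> S" using r by auto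
  define c where "c = (SOME b. b \<in> R \<and> b \<noteq> \<zero> \<and> b [^] q \<otimes> x \<in> S)"
  have c: "c \<in> R" "c \<noteq> \<zero>" "c [^] q \<otimes> x \<in> S" using someI_ex[OF ex] unfolding c_def by auto
  have cL: "c \<in> carrier L" using c(1) by simp
  have bL: "b \<in> carrier L" using b(1) by simp
  have "c \<otimes> \<psi> (b [^] q \<otimes> x) = \<psi> (c [^] q \<otimes> (b [^] q \<otimes> x))" using S.f_lin[of c "b [^] q \<otimes> x"] c b by simp
  also have "c [^] q \<otimes> (b [^] q \<otimes> x) = b [^] q \<otimes> (c [^] q \<otimes> x)" using cL bL x by (simp add: m_lcomm)
  also have "\<psi> \<dots> = b \<otimes> \<psi> (c [^] q \<otimes> x)" using S.f_lin[of b "c [^] q \<otimes> x"] c b by simp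
  finally have e: "c \<otimes> \<psi> (b [^] q \<otimes> x) = b \<otimes> \<psi> (c [^] q \<otimes> x)" .
  have p1: "\<psi> (b [^] q \<otimes> x) \<in> carrier L" and p2: "\<psi> (c [^] q \<otimes> x) \<in> carrier L"
    using S.f_closed[OF b(3)] S.f_closed[OF c(3)] by simp_all
  have "inv c \<otimes> \<psi> (c [^] q \<otimes> x) = (inv b \<otimes> inv c) \<otimes> (b \<otimes> \<psi> (c [^] q \<otimes> x))"
  proof -
    have "(inv b \<otimes> inv c) \<otimes> (b \<otimes> \<psi> (c [^] q \<otimes> x)) = (inv b \<otimes> b) \<otimes> (inv c \<otimes> \<psi> (c [^] q \<otimes> x))"
      using inv_nz[OF bL b(2)] inv_nz[OF cL c(2)] bL p2 by (simp only: m_ac m_closed)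
    then show ?thesis using inv_nz[OF cL c(2)] inv_l[OF bL b(2)] p2 by simp
  qed
  also have "\<dots> = inv b \<otimes> \<psi> (b [^] q \<otimes> x)"
  proof -
    have "(inv b \<otimes> inv c) \<otimes> (c \<otimes> \<psi> (b [^] q \<otimes> x)) = (inv c \<otimes> c) \<otimes> (inv b \<otimes> \<psi> (b [^] q \<otimes> x))"
      using inv_nz[OF bL b(2)] inv_nz[OF cL c(2)] cL p1 by (simp only: m_ac m_closed)
    then show ?thesis unfolding e using inv_nz[OF bL b(2)] inv_l[OF cL c(2)] p1 by simp
  qed
  finally show ?thesis unfolding \<Psi>_def Let_def c_def[symmetric] .
qed

lemma Psi_S: "s \<in> S \<Longrightarrow> \<Psi> s = \<psi> s"
  using Psi_eq[of s \<one>] S.f_closed[of s] by simp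

lemma Psi_R: "r \<in> R \<Longrightarrow> \<Psi> r = \<phi> r"
  using Psi_S extends by simp

lemma scale_S: "x \<in> carrier L \<Longrightarrow> \<exists>b\<in>R. b \<noteq> \<zero> \<and> b \<otimes> x \<in> S \<and> b [^] q \<otimes> x \<in> S"
proof -
  assume x: "x \<in> carrier L"
  obtain r where r: "r \<in> R" "r \<noteq> \<zero>" "r \<otimes> x \<in> S" using clear_denominator[OF x] by blast
  have "r [^] q \<otimes> x = r [^] (q - 1) \<otimes> (r \<otimes> x)"
    using frob_split[of r] r(1) x by (simp add: m_ac)
  then show ?thesis using r by auto
qed

lemma Psi_closed [simp]: "x \<in> carrier L \<Longrightarrow> \<Psi> x \<in> carrier L"
proof -
  assume x: "x \<in> carrier L"
  obtain b where b: "b \<in> R" "b \<noteq> \<zero>" "b [^] q \<otimes> x \<in> S" using scale_S[OF x] by blast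
  then show ?thesis using Psi_eq[OF x _ b(2,3)] S.f_closed[OF b(3)] by simp
qed

lemma Psi_lin: "z \<in> carrier L \<Longrightarrow> x \<in> carrier L \<Longrightarrow> \<Psi> (z [^] q \<otimes> x) = z \<otimes> \<Psi> x"
proof -
  assume z: "z \<in> carrier L" and x: "x \<in> carrier L"
  obtain b where b: "b \<in> R" "b \<noteq> \<zero>" "b \<otimes> z \<in> S" using clear_denominator[OF z] by blast
  obtain c where c: "c \<in> R" "c \<noteq> \<zero>" "c [^] q \<otimes> x \<in> S" using scale_S[OF x] by blast
  have bL: "b \<in> carrier L" and cL: "c \<in> carrier L" using b(1) c(1) by simp_all
  have bc: "b \<otimes> c \<in> S" "b \<otimes> c \<noteq> \<zero>" using b c mult_nz by simp_all
  have e: "(b \<otimes> c) [^] q \<otimes> (z [^] q \<otimes> x) = (b \<otimes> z) [^] q \<otimes> (c [^] q \<otimes> x)"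
    using bL cL z x by (simp add: frob_mult m_ac)
  have "\<Psi> (z [^] q \<otimes> x) = inv (b \<otimes> c) \<otimes> \<psi> ((b \<otimes> c) [^] q \<otimes> (z [^] q \<otimes> x))"
    using bc z x e b(3) c(3) by (intro Psi_eq) auto
  also have "\<dots> = inv (b \<otimes> c) \<otimes> ((b \<otimes> z) \<otimes> \<psi> (c [^] q \<otimes> x))"
    unfolding e using S.f_lin[OF b(3) c(3)] by simp
  also have "\<psi> (c [^] q \<otimes> x) = c \<otimes> \<Psi> x"
    using Psi_eq[OF x _ c(2,3)] c(1) cL S.f_closed[OF c(3)] c(2) by (simp add: m_assoc[symmetric])
  also have "inv (b \<otimes> c) \<otimes> ((b \<otimes> z) \<otimes> (c \<otimes> \<Psi> x)) = (inv (b \<otimes> c) \<otimes> (b \<otimes> c)) \<otimes> (z \<otimes> \<Psi> x)"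
  proof -
    have "inv (b \<otimes> c) \<in> carrier L" using bc by simp
    then show ?thesis using bL cL z Psi_closed[OF x] by (simp only: m_ac m_closed)
  qed
  also have "\<dots> = z \<otimes> \<Psi> x" using bc z Psi_closed[OF x] by simp
  finally show ?thesis .
qed

lemma Psi_add: "x \<in> carrier L \<Longrightarrow> y \<in> carrier L \<Longrightarrow> \<Psi> (x \<oplus> y) = \<Psi> x \<oplus> \<Psi> y"
proof -
  assume x: "x \<in> carrier L" and y: "y \<in> carrier L"
  have "\<exists>r\<in>R. r \<noteq> \<zero> \<and> (\<forall>i<2::nat. r \<otimes> (if i = 0 then x else y) \<in> S)"
    by (rule clear_denominators) (use x y in simp)
  then obtain b where b: "b \<in> R" "b \<noteq> \<zero>" and b3: "\<forall>i<2::nat. b \<otimes> (if i = 0 then x else y) \<in> S"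
    by blast
  have bL: "b \<in> carrier L" using b(1) by simp
  have bxy: "b \<otimes> x \<in> S" "b \<otimes> y \<in> S" using b3[THEN spec, of 0] b3[THEN spec, of 1] by auto
  have "b [^] q \<otimes> x = b [^] (q - 1) \<otimes> (b \<otimes> x)" "b [^] q \<otimes> y = b [^] (q - 1) \<otimes> (b \<otimes> y)"
    using frob_split[of b] bL x y by (simp_all add: m_ac)
  then have bq: "b [^] q \<otimes> x \<in> S" "b [^] q \<otimes> y \<in> S" using bxy b(1) by simp_all
  have e: "b [^] q \<otimes> (x \<oplus> y) = b [^] q \<otimes> x \<oplus> b [^] q \<otimes> y" using bL x y by (simp add: r_distr)
  have "\<Psi> (x \<oplus> y) = inv b \<otimes> \<psi> (b [^] q \<otimes> (x \<oplus> y))"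
    using x y b bq e by (intro Psi_eq) auto
  also have "\<dots> = inv b \<otimes> (\<psi> (b [^] q \<otimes> x) \<oplus> \<psi> (b [^] q \<otimes> y))"
    unfolding e using S.f_add[OF bq] by simp
  also have "\<dots> = \<Psi> x \<oplus> \<Psi> y"
    using Psi_eq[OF x _ b(2) bq(1)] Psi_eq[OF y _ b(2) bq(2)] b(1,2) bL
      S.f_closed[OF bq(1)] S.f_closed[OF bq(2)] by (simp add: r_distr)
  finally show ?thesis .
qed

lemma Psi_zero [simp]: "\<Psi> \<zero> = \<zero>"
  using Psi_S[of \<zero>] by simp

lemma Psi_nsum: "(\<And>i. i < n \<Longrightarrow> x i \<in> carrier L) \<Longrightarrow> \<Psi> (nsum x n) = nsum (\<lambda>i. \<Psi> (x i)) n"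
  by (rule nsum_map) (auto simp: Psi_add)

lemma Psi_K: "k \<in> K \<Longrightarrow> \<Psi> k \<in> K"
proof -
  assume k: "k \<in> K"
  then obtain b where b: "b \<in> R" "b \<noteq> \<zero>" "b \<otimes> k \<in> R" unfolding K_iff by blast
  have bL: "b \<in> carrier L" using b(1) by simp
  have "b [^] q \<otimes> k = b [^] (q - 1) \<otimes> (b \<otimes> k)" using frob_split[of b] bL k by (simp add: m_ac)
  then have bk: "b [^] q \<otimes> k \<in> R" using b by simp
  then have "\<Psi> k = inv b \<otimes> \<phi> (b [^] q \<otimes> k)"
    using Psi_eq[of k b] k b extends by simp
  then show ?thesis using b R.f_closed[OF bk] by simp
qed

lemma Psi_combination:
  assumes k: "\<And>i. i < n \<Longrightarrow> k i \<in> carrier L" and u: "\<And>i. i < n \<Longrightarrow> u i \<in> carrier L"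
  shows "\<Psi> (nsum (\<lambda>i. k i \<otimes> u i [^] q) n) = nsum (\<lambda>i. \<Psi> (k i) \<otimes> u i) n"
proof -
  have "\<Psi> (nsum (\<lambda>i. k i \<otimes> u i [^] q) n) = nsum (\<lambda>i. \<Psi> (k i \<otimes> u i [^] q)) n"
    using k u by (intro Psi_nsum) auto
  also have "\<dots> = nsum (\<lambda>i. \<Psi> (k i) \<otimes> u i) n"
  proof (rule nsum_cong)
    fix i assume i: "i < n"
    have "k i \<otimes> u i [^] q = u i [^] q \<otimes> k i" using k[OF i] u[OF i] by (intro m_comm) auto
    then show "\<Psi> (k i \<otimes> u i [^] q) = \<Psi> (k i) \<otimes> u i"
      using Psi_lin[OF u[OF i] k[OF i]] m_comm[OF u[OF i] Psi_closed[OF k[OF i]]] by simp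
  qed
  finally show ?thesis .
qed

text \<open>Separability of \<open>L/K\<close>, which the existence of \<open>\<psi>\<close> forces. Applying \<open>\<Psi>\<close> to the \<open>b\<close>-fold of a relation \<open>\<Sum> k\<^sub>i u\<^sub>i\<^sup>q = 0\<close> gives
  \<open>\<Sum> \<Psi> (b k\<^sub>i) u\<^sub>i = 0\<close> with coefficients in \<open>K\<close>, as \<open>\<Psi>\<close> extends \<open>\<phi>\<close>. So \<open>\<Psi>\<close> vanishes on \<open>K k\<^sub>i\<close>, and \<open>\<phi> \<noteq> 0\<close> leaves only \<open>k\<^sub>i = 0\<close>.\<close>

lemma indep_frobenius:
  assumes u: "indep n u"
  shows "indep n (\<lambda>i. u i [^] q)"
  unfolding indep_def
proof (intro conjI allI impI)
  have uc: "u i \<in> carrier L" if "i < n" for i using u that by (simp add: indep_def)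
  then show "u i [^] q \<in> carrier L" if "i < n" for i using that by simp
  fix k i assume k: "\<forall>i<n. k i \<in> K" "nsum (\<lambda>i. k i \<otimes> u i [^] q) n = \<zero>" and i: "i < n"
  have vanish: "\<Psi> (b \<otimes> k i) = \<zero>" if b: "b \<in> K" for b
  proof -
    have "nsum (\<lambda>i. (b \<otimes> k i) \<otimes> u i [^] q) n = b \<otimes> nsum (\<lambda>i. k i \<otimes> u i [^] q) n"
      using b k(1) uc by (subst nsum_ldistr) (auto intro!: nsum_cong simp: m_assoc)
    also have "\<dots> = \<zero>" using k(2) b by simp
    finally have "\<Psi> (nsum (\<lambda>i. (b \<otimes> k i) \<otimes> u i [^] q) n) = \<zero>" by simp
    moreover have "\<Psi> (nsum (\<lambda>i. (b \<otimes> k i) \<otimes> u i [^] q) n) = nsum (\<lambda>i. \<Psi> (b \<otimes> k i) \<otimes> u i) n"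
      using b k(1) uc by (intro Psi_combination) auto
    ultimately have "nsum (\<lambda>i. \<Psi> (b \<otimes> k i) \<otimes> u i) n = \<zero>" by simp
    moreover have "\<forall>i<n. \<Psi> (b \<otimes> k i) \<in> K" using b k(1) Psi_K by simp
    ultimately have "\<forall>i<n. \<Psi> (b \<otimes> k i) = \<zero>" using indepD[OF u, of "\<lambda>i. \<Psi> (b \<otimes> k i)"] by blast
    then show ?thesis using i by blast
  qed
  show "k i = \<zero>"
  proof (rule ccontr)
    assume nz: "k i \<noteq> \<zero>"
    have kK: "k i \<in> K" using k(1) i by blast
    obtain r where r: "r \<in> R" "\<phi> r = \<one>" using R.f_one by blast
    have "r \<otimes> inv (k i) \<otimes> k i = r" using r(1) kK nz by (simp add: m_assoc)
    moreover have "r \<otimes> inv (k i) \<in> K" using r(1) kK nz by simp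
    ultimately have "\<Psi> r = \<zero>" using vanish[of "r \<otimes> inv (k i)"] by simp
    then show False using r Psi_R[OF r(1)] by simp
  qed
qed

lemma indep_power_p:
  assumes u: "indep n u"
  shows "indep n (\<lambda>i. u i [^] p)"
  unfolding indep_def
proof (intro conjI allI impI)
  have uc: "u i \<in> carrier L" if "i < n" for i using u that by (simp add: indep_def)
  then show "u i [^] p \<in> carrier L" if "i < n" for i using that by simp
  fix k i assume k: "\<forall>i<n. k i \<in> K" "nsum (\<lambda>i. k i \<otimes> u i [^] p) n = \<zero>" and i: "i < n"
  let ?q = "p ^ (e - 1)"
  have q': "q = p * ?q" using q e by (metis le_add_diff_inverse plus_1_eq_Suc power_Suc)
  have pos: "0 < ?q" using prime_gt_0_nat[OF p] by simp
  have "nsum (\<lambda>i. k i [^] ?q \<otimes> u i [^] q) n = nsum (\<lambda>i. (k i \<otimes> u i [^] p) [^] ?q) n"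
  proof (rule nsum_cong)
    fix i assume i: "i < n"
    have "u i [^] q = (u i [^] p) [^] ?q" unfolding q' using uc[OF i] by (simp add: nat_pow_pow)
    then show "k i [^] ?q \<otimes> u i [^] q = (k i \<otimes> u i [^] p) [^] ?q"
      using uc[OF i] k(1) i by (simp add: nat_pow_distrib)
  qed
  also have "\<dots> = nsum (\<lambda>i. k i \<otimes> u i [^] p) n [^] ?q"
    using uc k(1) by (intro power_p_nsum[symmetric]) auto
  also have "\<dots> = \<zero>"
  proof -
    obtain m where "?q = Suc m" using pos gr0_conv_Suc by blast
    then show ?thesis unfolding k(2) by simp
  qed
  finally have "nsum (\<lambda>i. k i [^] ?q \<otimes> u i [^] q) n = \<zero>" .
  then have "\<forall>i<n. k i [^] ?q = \<zero>" by (intro indepD[OF indep_frobenius[OF u]]) (use k(1) in simp)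
  then have "k i [^] ?q = \<zero>" using i by blast
  then show "k i = \<zero>" using pow_nz[of "k i" ?q] k(1) i by auto
qed

lemma Tr_functional: "functional Tr"
proof -
  have f: "functional (tr N U)"
    by (rule trace_functional[OF U_basis p ch indep_power_p[OF U_indep[OF U_basis]]])
  then show ?thesis unfolding functional_def using Tr_eq[OF U_basis] by simp
qed

lemma Uq_basis: "basis N (\<lambda>i. U i [^] q)"
  by (rule indep_imp_basis[OF U_basis indep_frobenius[OF U_indep[OF U_basis]]])

text \<open>The \<open>q\<close>-th powers of the basis form a basis, too. If \<open>m\<close> is the matrix of multiplication by \<open>x\<close> in that basis, then by
  \<open>\<Psi> (U\<^sub>j\<^sup>q x) = U\<^sub>j \<Psi> x\<close> the matrix of multiplication by \<open>\<Psi> x\<close> in the basis \<open>U\<close> is \<open>\<Psi> m\<close>, taken entrywise.\<close>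

lemma Psi_Tr: "x \<in> carrier L \<Longrightarrow> \<Psi> (Tr x) = Tr (\<Psi> x)"
proof -
  assume x: "x \<in> carrier L"
  let ?V = "\<lambda>i. U i [^] q"
  have xV: "x \<otimes> ?V j \<in> carrier L" if "j < N" for j using x Uc that by simp
  note cV = co_K[OF Uq_basis xV]
  have "co N U (\<Psi> x \<otimes> U j) j = \<Psi> (co N ?V (x \<otimes> ?V j) j)" if j: "j < N" for j
  proof -
    have "\<Psi> x \<otimes> U j = \<Psi> (?V j \<otimes> x)" using Psi_lin[OF Uc[OF j] x] Uc[OF j] Psi_closed[OF x] by (simp add: m_comm)
    also have "?V j \<otimes> x = nsum (\<lambda>i. co N ?V (x \<otimes> ?V j) i \<otimes> ?V i) N"
      using co_sum[OF Uq_basis xV[OF j]] x Uc[OF j] by (simp add: m_comm)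
    also have "\<Psi> \<dots> = nsum (\<lambda>i. \<Psi> (co N ?V (x \<otimes> ?V j) i) \<otimes> U i) N"
      using cV[OF j] Uc by (intro Psi_combination) auto
    finally have "\<Psi> x \<otimes> U j = nsum (\<lambda>i. \<Psi> (co N ?V (x \<otimes> ?V j) i) \<otimes> U i) N" .
    then show ?thesis
      using co_unique[OF U_basis, of "\<lambda>i. \<Psi> (co N ?V (x \<otimes> ?V j) i)" j] j Psi_K cV[OF j] by simp
  qed
  then have "Tr (\<Psi> x) = nsum (\<lambda>j. \<Psi> (co N ?V (x \<otimes> ?V j) j)) N"
    unfolding Tr_eq[OF U_basis Psi_closed[OF x]] tr_def by (intro nsum_cong)
  also have "\<dots> = \<Psi> (nsum (\<lambda>j. co N ?V (x \<otimes> ?V j) j) N)"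
    using cV by (intro Psi_nsum[symmetric]) auto
  also have "\<dots> = \<Psi> (Tr x)" unfolding Tr_eq[OF Uq_basis x] tr_def by simp
  finally show ?thesis by simp
qed

text \<open>The matrix of \<open>x\<^sup>q\<close> in the basis \<open>U\<^sup>q\<close> is the entrywise \<open>q\<close>-th power of the matrix of \<open>x\<close> in the basis \<open>U\<close>.\<close>

lemma Tr_frobenius: "x \<in> carrier L \<Longrightarrow> Tr (x [^] q) = Tr x [^] q"
proof -
  assume x: "x \<in> carrier L"
  let ?V = "\<lambda>i. U i [^] q"
  have xU: "x \<otimes> U j \<in> carrier L" if "j < N" for j using x Uc that by simp
  note cU = co_in_K[OF xU]
  have "co N ?V (x [^] q \<otimes> ?V j) j = co N U (x \<otimes> U j) j [^] q" if j: "j < N" for j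
  proof -
    have "x [^] q \<otimes> ?V j = (x \<otimes> U j) [^] q" using x Uc[OF j] by (simp add: frob_mult)
    also have "\<dots> = nsum (\<lambda>i. co N U (x \<otimes> U j) i \<otimes> U i) N [^] q" using co_expand[OF xU[OF j]] by simp
    also have "\<dots> = nsum (\<lambda>i. (co N U (x \<otimes> U j) i \<otimes> U i) [^] q) N"
      using cU[OF j] Uc by (intro frob_nsum) auto
    also have "\<dots> = nsum (\<lambda>i. co N U (x \<otimes> U j) i [^] q \<otimes> ?V i) N"
      using cU[OF j] Uc by (intro nsum_cong) (simp add: frob_mult)
    finally have "x [^] q \<otimes> ?V j = nsum (\<lambda>i. co N U (x \<otimes> U j) i [^] q \<otimes> ?V i) N" .
    then show ?thesis
      using co_unique[OF Uq_basis, of "\<lambda>i. co N U (x \<otimes> U j) i [^] q" j] j cU[OF j] by simp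
  qed
  then have "Tr (x [^] q) = nsum (\<lambda>j. co N U (x \<otimes> U j) j [^] q) N"
    using Tr_eq[OF Uq_basis, of "x [^] q"] x unfolding tr_def by (simp cong: nsum_cong)
  also have "\<dots> = Tr x [^] q"
    unfolding Tr_eq[OF U_basis x] tr_def using cU by (intro frob_nsum[symmetric]) auto
  finally show ?thesis .
qed

text \<open>By \<open>bounded_coords\<close> the traces of elements of \<open>S\<close> have a common denominator. It also serves for all \<open>(Tr s)\<^bsup>q^k\<^esup> = Tr (s\<^bsup>q^k\<^esup>)\<close>,
  so \<open>Tr s\<close> is almost integral over the normal ring \<open>R\<close>.\<close>

lemma Tr_S [simp]: assumes s: "s \<in> S" shows "Tr s \<in> R"
proof -
  obtain D where D: "D \<in> R" "D \<noteq> \<zero>" "\<And>s i. s \<in> S \<Longrightarrow> i < N \<Longrightarrow> D \<otimes> co N U s i \<in> R"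
    "\<And>i. i < N \<Longrightarrow> D \<otimes> U i \<in> S" using bounded_coords by blast
  have bd: "D \<otimes> D \<otimes> Tr t \<in> R" if t: "t \<in> S" for t
  proof -
    have "D \<otimes> D \<otimes> co N U (t \<otimes> U i) i \<in> R" if i: "i < N" for i
    proof -
      have tU: "t \<otimes> U i \<in> carrier L" using t Uc[OF i] by simp
      have "D \<otimes> (t \<otimes> U i) = t \<otimes> (D \<otimes> U i)" using t D(1) Uc[OF i] by (simp add: m_lcomm)
      then have "D \<otimes> (t \<otimes> U i) \<in> S" using t D(4)[OF i] by simp
      from D(3)[OF this i] have "D \<otimes> (D \<otimes> co N U (t \<otimes> U i) i) \<in> R"
        using co_smult[OF U_basis, of D "t \<otimes> U i" i] D(1) tU i by simp
      then show ?thesis using D(1) co_in_K[OF tU i] by (simp add: m_assoc)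
    qed
    moreover have "D \<otimes> D \<otimes> Tr t = nsum (\<lambda>i. D \<otimes> D \<otimes> co N U (t \<otimes> U i) i) N"
      using Tr_eq[OF U_basis, of t] t D(1) co_in_K Uc unfolding tr_def by (simp add: nsum_ldistr)
    ultimately show ?thesis by simp
  qed
  have pw: "Tr (s [^] (q ^ k)) = Tr s [^] (q ^ k)" for k
  proof (induction k)
    case (Suc k)
    have "s [^] (q ^ Suc k) = (s [^] (q ^ k)) [^] q" using s by (simp add: nat_pow_pow mult.commute)
    then have "Tr (s [^] (q ^ Suc k)) = Tr (s [^] (q ^ k)) [^] q" using s Tr_frobenius by simp
    also have "\<dots> = Tr s [^] (q ^ Suc k)" using Suc s by (simp add: nat_pow_pow mult.commute)
    finally show ?case .
  qed (use s in simp)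
  show ?thesis
  proof (rule R.almost_integral')
    show "Tr s \<in> fraction_field_in L R" using Tr_K[of s] s K_eq by simp
    show "D \<otimes> D \<in> R" "D \<otimes> D \<noteq> \<zero>" using D(1,2) mult_nz by simp_all
    show "D \<otimes> D \<otimes> Tr s [^] (q ^ k) \<in> R" for k using bd[of "s [^] (q ^ k)"] pw s by simp
  qed
qed

section \<open>The trace of compatible ideals\<close>

text \<open>The ideal \<open>P\<^sup>T\<^sup>r\<close>.\<close>

definition trace_colon :: "'a set \<Rightarrow> 'a set" where
  "trace_colon P = {s \<in> S. \<forall>t\<in>S. Tr (s \<otimes> t) \<in> P}"

lemma psi_Tr: "s \<in> S \<Longrightarrow> Tr (\<psi> s) = \<phi> (Tr s)"
  using Psi_Tr[of s] Psi_S[of s] Psi_R[of "Tr s"] by simp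

lemma trace_colon_ideal:
  assumes P: "is_ideal R P" shows "is_ideal S (trace_colon P)"
proof (rule S.is_idealI)
  show "trace_colon P \<subseteq> S" by (auto simp: trace_colon_def)
  show "\<zero> \<in> trace_colon P" using R.I_zero[OF P] by (simp add: trace_colon_def)
  show "x \<oplus> y \<in> trace_colon P" if "x \<in> trace_colon P" "y \<in> trace_colon P" for x y
    using that R.I_add[OF P] by (simp add: trace_colon_def l_distr Tr_add)
  show "a \<otimes> x \<in> trace_colon P" if a: "a \<in> S" and x: "x \<in> trace_colon P" for a x
  proof -
    have "Tr (a \<otimes> x \<otimes> t) \<in> P" if "t \<in> S" for t
    proof -
      have "a \<otimes> x \<otimes> t = x \<otimes> (a \<otimes> t)" using a x that by (simp add: trace_colon_def m_ac)
      then show ?thesis using a x that by (simp add: trace_colon_def)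
    qed
    then show ?thesis using a x by (simp add: trace_colon_def)
  qed
qed

text \<open>\<open>Tr (\<psi> s t) = Tr (\<psi> (s t\<^sup>q)) = \<phi> (Tr (s t\<^sup>q))\<close>.\<close>

lemma trace_colon_compatible:
  assumes P: "R.compatible P" shows "S.compatible (trace_colon P)"
  unfolding S.compatible_def
proof (intro conjI ballI)
  note Pi = R.compatible_ideal[OF P]
  show "is_ideal S (trace_colon P)" by (rule trace_colon_ideal[OF Pi])
  fix s assume s: "s \<in> trace_colon P"
  then have sS: "s \<in> S" by (simp add: trace_colon_def)
  have "Tr (\<psi> s \<otimes> t) \<in> P" if t: "t \<in> S" for t
  proof -
    have "\<psi> s \<otimes> t = \<psi> (t [^] q \<otimes> s)" using S.f_lin[OF t sS] S.f_closed[OF sS] t by (simp add: m_comm)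
    then have "Tr (\<psi> s \<otimes> t) = \<phi> (Tr (t [^] q \<otimes> s))" using psi_Tr t sS by simp
    also have "Tr (t [^] q \<otimes> s) = Tr (s \<otimes> t [^] q)" using t sS by (simp add: m_comm)
    finally show ?thesis using R.compatible_f[OF P] s t by (simp add: trace_colon_def)
  qed
  then show "\<psi> s \<in> trace_colon P" using S.f_closed[OF sS] by (simp add: trace_colon_def)
qed

lemma base_trace_colon:
  assumes P: "is_ideal R P" shows "P \<subseteq> trace_colon P"
proof
  fix x assume x: "x \<in> P"
  have "Tr (x \<otimes> t) \<in> P" if t: "t \<in> S" for t
    using Tr_smult[of x t] R.I_A[OF P x] t R.I_r[OF P _ x, of "Tr t"] by simp
  then show "x \<in> trace_colon P" using R.I_A[OF P x] by (simp add: trace_colon_def)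
qed

lemma trace_image_compatible:
  assumes I: "S.compatible I" shows "R.compatible (Tr ` I)"
  unfolding R.compatible_def
proof (intro conjI ballI)
  note Ii = S.compatible_ideal[OF I]
  note IS = S.I_A[OF Ii] and Ic = S.I_carr[OF Ii]
  show "is_ideal R (Tr ` I)"
  proof (rule R.is_idealI)
    show "Tr ` I \<subseteq> R" using IS by auto
    show "\<zero> \<in> Tr ` I" using S.I_zero[OF Ii] Tr_zero by (metis imageI)
    fix x y assume "x \<in> Tr ` I" "y \<in> Tr ` I"
    then obtain s t where "s \<in> I" "t \<in> I" "x = Tr s" "y = Tr t" by blast
    then show "x \<oplus> y \<in> Tr ` I" using Tr_add[of s t] S.I_add[OF Ii, of s t] Ic by (metis imageI)
  next
    fix a x assume a: "a \<in> R" and "x \<in> Tr ` I"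
    then obtain s where "s \<in> I" "x = Tr s" by blast
    then show "a \<otimes> x \<in> Tr ` I" using Tr_smult[of a s] S.I_l[OF Ii, of a s] Ic a by (metis R_in_K R_in_S imageI)
  qed
  fix x assume "x \<in> Tr ` I"
  then obtain s where s: "s \<in> I" "x = Tr s" by blast
  then show "\<phi> x \<in> Tr ` I" using psi_Tr[OF IS[OF s(1)]] S.compatible_f[OF I s(1)] by (metis imageI)
qed

text \<open>One half of tameness is automatic: \<open>P\<^sup>T\<^sup>r\<close> contains \<open>P S\<close>, and it is radical because it is compatible.\<close>

lemma radical_subset_trace_colon:
  assumes P: "R.compatible P" and x: "x \<in> S" "x [^] (n::nat) \<in> extended P"
  shows "x \<in> trace_colon P"
proof -
  note Pi = R.compatible_ideal[OF P]
  have "extended P \<subseteq> trace_colon P"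
    by (rule extended_least[OF trace_colon_ideal[OF Pi] base_trace_colon[OF Pi]])
  then show ?thesis using S.compatible_radical[OF trace_colon_compatible[OF P] x(1)] x(2) by blast
qed

lemma center_over_trace_colon:
  assumes P: "P \<in> R.centers" and s: "s \<in> S" "s \<notin> trace_colon P"
  shows "\<exists>Q\<in>S.centers. P \<subseteq> Q \<and> s \<notin> Q"
proof -
  have c: "S.compatible (trace_colon P)" by (rule trace_colon_compatible[OF R.centersD(2)[OF P]])
  obtain Q where "Q \<in> S.centers" "trace_colon P \<subseteq> Q" "s \<notin> Q"
    using S.center_avoiding[OF c s] by blast
  then show ?thesis using base_trace_colon[OF R.prime_ideal[OF R.centersD(1)[OF P]]] by blast
qed

text \<open>If \<open>Tr s\<close> is not in some center \<open>P\<close>, then \<open>s \<notin> P\<^sup>T\<^sup>r\<close>, so \<open>s\<close> avoids a center of \<open>S\<close> above \<open>P\<close>; by construction the elements of a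
  test ideal avoid no center that is not below \<open>Q\<close>.\<close>

lemma trace_test_ideal_subset:
  assumes Q: "Q \<in> S.centers"
  shows "Tr ` S.test_ideal Q \<subseteq> R.test_ideal (Q \<inter> R)"
proof
  fix x assume "x \<in> Tr ` S.test_ideal Q"
  then obtain s where s: "s \<in> S.test_ideal Q" "x = Tr s" by blast
  have sS: "s \<in> S" using s(1) by (simp add: S.test_ideal_def)
  have "x \<in> P" if P: "P \<in> R.centers" "\<not> P \<subseteq> Q \<inter> R" for P
  proof (rule ccontr)
    assume "x \<notin> P"
    then have "s \<notin> trace_colon P"
      using s(2) sS S.A_one by (auto simp: trace_colon_def intro!: bexI[of _ \<one>])
    then obtain Q' where Q': "Q' \<in> S.centers" "P \<subseteq> Q'" "s \<notin> Q'"
      using center_over_trace_colon[OF P(1) sS] by blast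
    have "P \<subseteq> R" using R.I_A[OF R.prime_ideal[OF R.centersD(1)[OF P(1)]]] by blast
    then have "\<not> Q' \<subseteq> Q" using P(2) Q'(2) by blast
    then show False using s(1) Q' by (auto simp: S.test_ideal_def)
  qed
  then show "x \<in> R.test_ideal (Q \<inter> R)" using s(2) sS by (simp add: R.test_ideal_def)
qed

end

section \<open>Minimal polynomials\<close>

context cring
begin

text \<open>Polynomials are coefficient functions here, lowest degree first, so that rescaling coefficients by
  powers of their index needs no list manipulation.\<close>

definition monic :: "nat \<Rightarrow> (nat \<Rightarrow> 'a) \<Rightarrow> bool" where
  "monic n c \<longleftrightarrow> c n = \<one> \<and> (\<forall>i>n. c i = \<zero>)"

definition peval :: "(nat \<Rightarrow> 'a) \<Rightarrow> nat \<Rightarrow> 'a \<Rightarrow> 'a" where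
  "peval c n x = nsum (\<lambda>i. c i \<otimes> x [^] i) (Suc n)"

definition conv :: "(nat \<Rightarrow> 'a) \<Rightarrow> (nat \<Rightarrow> 'a) \<Rightarrow> nat \<Rightarrow> 'a" where
  "conv f g k = nsum (\<lambda>i. f i \<otimes> g (k - i)) (Suc k)"

lemma Mon_peval:
  assumes "m \<in> Mon x C n" "x \<in> carrier R" "C \<subseteq> carrier R"
  shows "\<exists>c. monic n c \<and> (\<forall>i<n. c i \<in> C) \<and> m = peval c n x"
  using assms(1)
proof (induction n arbitrary: m)
  case 0
  then show ?case by (intro exI[of _ "\<lambda>i. if i = 0 then \<one> else \<zero>"]) (simp add: monic_def peval_def)
next
  case (Suc n)
  obtain m' d where e: "m = x \<otimes> m' \<oplus> d" "m' \<in> Mon x C n" "d \<in> C" using Suc.prems by auto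
  obtain c where c: "monic n c" "\<forall>i<n. c i \<in> C" "m' = peval c n x" using Suc.IH[OF e(2)] by blast
  have cc: "c i \<in> carrier R" if "i < Suc n" for i
    using c(1,2) that assms(3) less_antisym[of i n] by (cases "i = n") (auto simp: monic_def)
  have dc: "d \<in> carrier R" using e(3) assms(3) by blast
  let ?c = "\<lambda>i. case i of 0 \<Rightarrow> d | Suc j \<Rightarrow> c j"
  have ccS: "?c i \<in> carrier R" if "i < Suc (Suc n)" for i
    using that dc cc by (cases i) auto
  have "peval ?c (Suc n) x = ?c 0 \<otimes> x [^] (0::nat) \<oplus> nsum (\<lambda>i. ?c (Suc i) \<otimes> x [^] Suc i) (Suc n)"
    unfolding peval_def using ccS assms(2) by (intro nsum_shift) auto
  also have "nsum (\<lambda>i. ?c (Suc i) \<otimes> x [^] Suc i) (Suc n) = nsum (\<lambda>i. x \<otimes> (c i \<otimes> x [^] i)) (Suc n)"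
    using cc assms(2) by (intro nsum_cong) (simp add: m_ac)
  also have "\<dots> = x \<otimes> m'"
    unfolding c(3) peval_def using cc assms(2) by (intro nsum_ldistr[symmetric]) auto
  finally have "m = peval ?c (Suc n) x"
    using e(1) dc assms(2) c(3) cc by (simp add: a_comm peval_def)
  moreover have "monic (Suc n) ?c" using c(1) by (auto simp: monic_def split: nat.split)
  moreover have "\<forall>i<Suc n. ?c i \<in> C" using c(2) e(3) by (auto split: nat.split)
  ultimately show ?case by blast
qed

lemma eval_coeff:
  "set p \<subseteq> carrier R \<Longrightarrow> x \<in> carrier R \<Longrightarrow> eval p x = nsum (\<lambda>i. coeff p i \<otimes> x [^] i) (length p)"
proof (induction p)
  case (Cons a p)
  have "nsum (\<lambda>i. coeff (a # p) i \<otimes> x [^] i) (length p) = nsum (\<lambda>i. coeff p i \<otimes> x [^] i) (length p)"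
    by (rule nsum_cong) simp
  moreover have "nsum (\<lambda>i. coeff p i \<otimes> x [^] i) (length p) \<in> carrier R"
    using Cons.prems by (intro nsum_closed) auto
  ultimately show ?case using Cons by (simp add: a_comm)
qed simp

lemma coeff_map_rev: "i < n \<Longrightarrow> coeff (map c (rev [0..<n])) i = c i"
  by (induction n) auto

lemma conv_top:
  assumes f: "\<And>i. f i \<in> carrier R" "\<And>i. m < i \<Longrightarrow> f i = \<zero>"
    and g: "\<And>i. g i \<in> carrier R" "\<And>i. l < i \<Longrightarrow> g i = \<zero>"
  shows "conv f g (m + l) = f m \<otimes> g l"
proof -
  have "conv f g (m + l) = nsum (\<lambda>i. if i = m then f m \<otimes> g l else \<zero>) (Suc (m + l))"
    unfolding conv_def
  proof (rule nsum_cong)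
    fix i assume "i < Suc (m + l)"
    consider "i = m" | "m < i" | "l < m + l - i" by linarith
    then show "f i \<otimes> g (m + l - i) = (if i = m then f m \<otimes> g l else \<zero>)"
      using f g by cases auto
  qed
  also have "\<dots> = f m \<otimes> g l" using f g by (intro nsum_delta) auto
  finally show ?thesis .
qed

lemma conv_above:
  assumes f: "\<And>i. f i \<in> carrier R" "\<And>i. m < i \<Longrightarrow> f i = \<zero>"
    and g: "\<And>i. g i \<in> carrier R" "\<And>i. l < i \<Longrightarrow> g i = \<zero>" and k: "m + l < k"
  shows "conv f g k = \<zero>"
  unfolding conv_def
proof (rule nsum_zero)
  fix i assume "i < Suc k"
  consider "m < i" | "l < k - i" using k by linarith
  then show "f i \<otimes> g (k - i) = \<zero>" using f g by cases auto
qed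

end

context field_over
begin

text \<open>The minimal polynomial of \<open>x\<close>, with divisibility stated for coefficient functions through \<open>conv\<close>.\<close>

lemma minimal_polynomial:
  assumes x: "x \<in> carrier L" and ex: "monic n0 c0" "\<And>i. c0 i \<in> K" "peval c0 n0 x = \<zero>"
  shows "\<exists>m f. monic m f \<and> (\<forall>i. f i \<in> K) \<and> peval f m x = \<zero> \<and>
    (\<forall>n F. monic n F \<longrightarrow> (\<forall>i. F i \<in> K) \<longrightarrow> peval F n x = \<zero> \<longrightarrow>
      (\<exists>l g. monic l g \<and> (\<forall>i. g i \<in> K) \<and> n = m + l \<and> (\<forall>k. F k = conv f g k)))"
proof -
  have KL: "K \<subseteq> carrier L" by auto
  have list: "\<exists>P\<in>carrier (K[X]). P \<noteq> [] \<and> eval P x = \<zero> \<and> (\<forall>i. coeff P i = F i)"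
    if F: "monic n F" "\<And>i. F i \<in> K" "peval F n x = \<zero>" for n F
  proof -
    let ?P = "map F (rev [0..<Suc n])"
    have l: "lead_coeff ?P = \<one>" using F(1) by (simp add: monic_def)
    have K: "set ?P \<subseteq> K" using F(2) by auto
    have "polynomial K ?P" using l K by (intro polynomialI) auto
    then have 1: "?P \<in> carrier (K[X])" using univ_poly_carrier by blast
    have "eval ?P x = nsum (\<lambda>i. coeff ?P i \<otimes> x [^] i) (length ?P)"
      using K KL x by (intro eval_coeff) auto
    also have "\<dots> = nsum (\<lambda>i. F i \<otimes> x [^] i) (Suc n)"
      by (simp only: length_map length_rev length_upt minus_nat.diff_0) (rule nsum_cong, simp only: coeff_map_rev)
    also have "\<dots> = \<zero>" using F(3) by (simp only: peval_def)
    finally have 2: "eval ?P x = \<zero>" .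
    have "coeff ?P i = F i" for i
    proof (cases "i < Suc n")
      case True
      then show ?thesis by (rule coeff_map_rev)
    next
      case False
      then have "coeff ?P i = \<zero>" by (intro coeff_length) simp
      then show ?thesis using F(1) False by (simp add: monic_def)
    qed
    then show ?thesis using 1 2 by (intro bexI[of _ ?P]) auto
  qed
  obtain P0 where P0: "P0 \<in> carrier (K[X])" "P0 \<noteq> []" "eval P0 x = \<zero>" using list[OF ex] by blast
  have alg: "(algebraic over K) x" by (rule algebraicI[OF P0])
  let ?I = "Irr K x"
  note I = IrrE[OF K x alg]
  have Iset: "set ?I \<subseteq> K" using I(1) univ_poly_carrier polynomial_incl by blast
  have Ine: "?I \<noteq> []"
  proof
    assume n: "?I = []"
    have "\<not> pirreducible K []" using pirreducible_degree[OF K, of "[]"]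
      by (metis I(1) I(2) K carrier_polynomial_shell list.size(3) n not_one_le_zero diff_0_eq_0 subfieldE(1))
    then show False using I(2) n by simp
  qed
  define m where "m = degree ?I"
  define f where "f = coeff ?I"
  have len: "length ?I = Suc m" using Ine by (cases ?I) (auto simp: m_def)
  have coeff_in: "coeff p i \<in> K" if "set p \<subseteq> K" for p i
    using that by (induction p) auto
  have f: "monic m f" "\<And>i. f i \<in> K"
    unfolding monic_def f_def m_def using I(3) lead_coeff_simp[OF Ine] coeff_degree coeff_in[OF Iset] by auto
  have "peval f m x = \<zero>"
    using eval_coeff[of ?I x] Iset KL x I(4) unfolding peval_def f_def len by auto
  moreover have "\<exists>l g. monic l g \<and> (\<forall>i. g i \<in> K) \<and> n = m + l \<and> (\<forall>k. F k = conv f g k)"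
    if F: "monic n F" "\<forall>i. F i \<in> K" "peval F n x = \<zero>" for n F
  proof -
    obtain P where P: "P \<in> carrier (K[X])" "P \<noteq> []" "eval P x = \<zero>" "\<forall>i. coeff P i = F i"
      using list[OF F(1) _ F(3)] F(2) by blast
    have "?I pdivides P" by (rule Irr_minimal[OF K x alg P(1,3)])
    then have "?I divides\<^bsub>K[X]\<^esub> P" using pdivides_iff_shell[OF K I(1) P(1)] by simp
    then obtain Q where Q: "Q \<in> carrier (K[X])" "P = poly_mult ?I Q"
      unfolding factor_def univ_poly_mult by blast
    have Qset: "set Q \<subseteq> K" using Q(1) univ_poly_carrier polynomial_incl by blast
    define g where "g = coeff Q"
    have gK: "g i \<in> K" for i unfolding g_def by (rule coeff_in[OF Qset])
    have Fk: "F k = conv f g k" for k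
    proof -
      have "F k = coeff (poly_mult ?I Q) k" using P(4) Q(2) by simp
      also have "\<dots> = (\<Oplus>i\<in>{..k}. f i \<otimes> g (k - i))"
        using poly_mult_coeff[of ?I Q] Iset Qset KL unfolding f_def g_def by auto
      also have "\<dots> = (\<Oplus>i\<in>{..<Suc k}. f i \<otimes> g (k - i))" by (simp only: lessThan_Suc_atMost)
      also have "\<dots> = conv f g k" unfolding conv_def using f(2) gK by (intro nsum_finsum) auto
      finally show ?thesis .
    qed
    have Qne: "Q \<noteq> []"
    proof
      assume "Q = []"
      then have "P = []" using Q(2) poly_mult_zero[of ?I] Iset KL by auto
      then show False using P(2) by simp
    qed
    define l where "l = degree Q"
    have gl: "g l = lead_coeff Q" unfolding g_def l_def by (rule lead_coeff_simp[OF Qne])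
    have glnz: "g l \<noteq> \<zero>"
      using Q(1) Qne gl unfolding univ_poly_carrier[symmetric] polynomial_def by auto
    have gabove: "g i = \<zero>" if "l < i" for i using that coeff_degree unfolding g_def l_def by blast
    have fabove: "f i = \<zero>" if "m < i" for i using that f(1) unfolding monic_def by blast
    have fc: "f i \<in> carrier L" and gc: "g i \<in> carrier L" for i using f(2) gK by auto
    have top: "F (m + l) = g l"
      using Fk[of "m + l"] conv_top[OF fc fabove gc gabove] f(1) gc by (simp add: monic_def)
    have "m + l \<le> n"
    proof (rule ccontr)
      assume "\<not> m + l \<le> n"
      then show False using top glnz F(1) by (simp add: monic_def)
    qed
    moreover have "n \<le> m + l"
    proof (rule ccontr)
      assume "\<not> n \<le> m + l"
      then have "conv f g n = \<zero>"
        by (intro conv_above[where m = m and l = l]) (use fc gc fabove gabove in auto)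
      then have "F n = \<zero>" using Fk by simp
      then show False using F(1) by (simp add: monic_def)
    qed
    ultimately have n: "n = m + l" by simp
    then have "monic l g" using top F(1) gabove by (simp add: monic_def)
    then show ?thesis using gK n Fk by blast
  qed
  ultimately show ?thesis using f by blast
qed

end

section \<open>Primes with a nontrivial inverse, and valuation rings\<close>

context normal_in
begin

text \<open>If \<open>y \<notin> A\<close> satisfies \<open>P y \<subseteq> A\<close>, then \<open>A\<^sub>P\<close> is a discrete valuation ring in which \<open>y\<close> is the inverse of a uniformizer. The
  three conclusions express this without localising: \<open>t y\<close> is a unit at \<open>P\<close> for some \<open>t \<in> P\<close>, the denominators of \<open>y\<close> are exactly
  \<open>P\<close>, and every nonzero \<open>a\<close> becomes a unit at \<open>P\<close> after multiplication by a power of \<open>y\<close>. In each case the contrary makes \<open>y\<close>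
  almost integral, or contradicts the first conclusion.\<close>

lemma divisorial:
  assumes P: "is_prime A P" and nz: "P \<noteq> {\<zero>}" and y: "y \<in> fraction_field_in L A" "y \<notin> A"
    and yP_all: "\<forall>r\<in>P. r \<otimes> y \<in> A"
  shows "\<exists>t\<in>P. t \<otimes> y \<notin> P"
    and "\<And>r. r \<in> A \<Longrightarrow> r \<otimes> y \<in> A \<Longrightarrow> r \<in> P"
    and "\<And>a. a \<in> A \<Longrightarrow> a \<noteq> \<zero> \<Longrightarrow> \<exists>i. a \<otimes> y [^] (i::nat) \<in> A - P"
proof -
  note Pi = prime_ideal[OF P]
  have yP: "r \<otimes> y \<in> A" if "r \<in> P" for r using yP_all that by blast
  have yc: "y \<in> carrier L" using y(1) frac_iff' by blast
  show t: "\<exists>t\<in>P. t \<otimes> y \<notin> P"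
  proof (rule ccontr)
    assume "\<not> ?thesis"
    then have stable: "t \<otimes> y \<in> P" if "t \<in> P" for t using that by blast
    obtain d where d: "d \<in> P" "d \<noteq> \<zero>" using nz I_zero[OF Pi] by blast
    have dA: "d \<in> A" using I_A[OF Pi d(1)] .
    have "d \<otimes> y [^] (k::nat) \<in> P" for k
    proof (induction k)
      case (Suc k)
      have "d \<otimes> y [^] Suc k = (d \<otimes> y [^] k) \<otimes> y" using dA yc by (simp add: m_assoc)
      then show ?case using stable[OF Suc] by simp
    qed (use d dA in simp)
    then have "d \<otimes> y [^] (q ^ k) \<in> A" for k using I_A[OF Pi] by blast
    then have "y \<in> A" by (rule almost_integral'[OF y(1) dA d(2)])
    then show False using y(2) by simp
  qed
  show conv: "r \<in> P" if r: "r \<in> A" "r \<otimes> y \<in> A" for r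
  proof (rule ccontr)
    assume rP: "r \<notin> P"
    obtain t where t: "t \<in> P" "t \<otimes> y \<notin> P" using t by blast
    have tA: "t \<in> A" using I_A[OF Pi t(1)] .
    have "r \<otimes> (t \<otimes> y) = (r \<otimes> y) \<otimes> t" using r(1) tA yc by (simp add: m_ac)
    then have "r \<otimes> (t \<otimes> y) \<in> P" using I_l[OF Pi r(2) t(1)] by simp
    then show False using prime_mult[OF P r(1) yP[OF t(1)]] rP t(2) by blast
  qed
  show "\<exists>i. a \<otimes> y [^] (i::nat) \<in> A - P" if a: "a \<in> A" "a \<noteq> \<zero>" for a
  proof -
    have "\<exists>k::nat. a \<otimes> y [^] k \<notin> A"
    proof (rule ccontr)
      assume "\<not> ?thesis"
      then have "a \<otimes> y [^] (q ^ k) \<in> A" for k by blast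
      then have "y \<in> A" by (rule almost_integral'[OF y(1) a])
      then show False using y(2) by simp
    qed
    then obtain k :: nat where k: "a \<otimes> y [^] k \<notin> A" "\<And>i. i < k \<Longrightarrow> a \<otimes> y [^] i \<in> A"
      using exists_least_iff[of "\<lambda>k. a \<otimes> y [^] (k::nat) \<notin> A"] by blast
    have "k \<noteq> 0"
    proof
      assume "k = 0"
      then show False using k(1) a by simp
    qed
    then obtain i where i: "k = Suc i" using not0_implies_Suc by blast
    have ai: "a \<otimes> y [^] i \<in> A" using k(2) i by simp
    have "(a \<otimes> y [^] i) \<otimes> y = a \<otimes> y [^] k" using i a yc by (simp add: m_assoc)
    then have "a \<otimes> y [^] i \<notin> P" using yP k(1) by metis
    then show ?thesis using ai by blast
  qed
qed

text \<open>A denominator ideal maximal among those of the multiples of \<open>z\<close> outside \<open>A\<close> is prime.\<close>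

lemma conductor_prime:
  assumes z: "z \<in> fraction_field_in L A" "z \<notin> A"
  shows "\<exists>c\<in>A. c \<otimes> z \<notin> A \<and> is_prime A {r \<in> A. r \<otimes> (c \<otimes> z) \<in> A}"
proof -
  have zc: "z \<in> carrier L" using z(1) frac_iff' by blast
  let ?den = "\<lambda>c. {r \<in> A. r \<otimes> (c \<otimes> z) \<in> A}"
  let ?F = "{?den c | c. c \<in> A \<and> c \<otimes> z \<notin> A}"
  have "\<one> \<otimes> z \<notin> A" using z zc by simp
  then have ne: "?F \<noteq> {}" using A_one by blast
  have den_ideal: "is_ideal A (?den c)" if "c \<in> A" for c
    using that zc by (intro is_idealI) (auto simp: l_distr m_assoc)
  have idl: "?F \<subseteq> {I. is_ideal A I}" using den_ideal by blast
  obtain P where P: "P \<in> ?F" and mx: "\<And>J. J \<in> ?F \<Longrightarrow> P \<subseteq> J \<Longrightarrow> J = P"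
    using maximal_ideal_in[OF ne idl] by meson
  obtain c where c: "c \<in> A" "c \<otimes> z \<notin> A" "P = ?den c" using P by blast
  let ?y = "c \<otimes> z"
  have yc: "?y \<in> carrier L" using c(1) zc by simp
  have Pi: "is_ideal A P" unfolding c(3) by (rule den_ideal[OF c(1)])
  have Pp: "is_prime A P"
  proof (rule is_primeI[OF Pi])
    show "\<one> \<notin> P" using c yc by simp
    fix a b assume ab: "a \<in> A" "b \<in> A" "a \<otimes> b \<in> P" "a \<notin> P" "b \<notin> P"
    have eq: "r \<otimes> ((c \<otimes> b) \<otimes> z) = r \<otimes> b \<otimes> (c \<otimes> z)" if "r \<in> A" for r
      using that ab c(1) zc by (simp add: m_ac)
    have "(c \<otimes> b) \<otimes> z = b \<otimes> (c \<otimes> z)" using ab c(1) zc by (simp add: m_ac)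
    then have nb: "(c \<otimes> b) \<otimes> z \<notin> A" using ab(2,5) c(3) by simp
    have "c \<otimes> b \<in> A" using c(1) ab(2) by simp
    then have "?den (c \<otimes> b) \<in> ?F" using nb by (intro CollectI exI[of _ "c \<otimes> b"] conjI refl)
    moreover have "P \<subseteq> ?den (c \<otimes> b)"
    proof
      fix r assume r: "r \<in> P"
      then have rA: "r \<in> A" and "r \<otimes> (c \<otimes> z) \<in> A" using c(3) by auto
      then have "b \<otimes> (r \<otimes> (c \<otimes> z)) \<in> A" using ab(2) by simp
      moreover have "b \<otimes> (r \<otimes> (c \<otimes> z)) = r \<otimes> ((c \<otimes> b) \<otimes> z)" using rA ab c(1) zc by (simp add: m_ac)
      ultimately show "r \<in> ?den (c \<otimes> b)" using rA by simp
    qed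
    ultimately have "?den (c \<otimes> b) = P" by (rule mx)
    moreover have "a \<in> ?den (c \<otimes> b)" using eq[OF ab(1)] ab(1,3) c(3) by simp
    ultimately show False using ab(4) by simp
  qed
  then show ?thesis using c by blast
qed

text \<open>For \<open>P\<close> the prime of \<open>conductor_prime\<close>, the localisation \<open>A\<^sub>P\<close> is a valuation ring by \<open>divisorial\<close>, and \<open>z \<notin> A\<^sub>P\<close> since the
  denominators of \<open>c z\<close> lie in \<open>P\<close>. So a normal noetherian domain is an intersection of valuation rings.\<close>

lemma valuation_ring_avoiding:
  assumes z: "z \<in> fraction_field_in L A" "z \<notin> A"
  shows "\<exists>V. subring V L \<and> A \<subseteq> V \<and> z \<notin> V \<and>
    (\<forall>x\<in>fraction_field_in L A. x \<noteq> \<zero> \<longrightarrow> x \<in> V \<or> inv x \<in> V)"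
proof -
  have zc: "z \<in> carrier L" using z(1) frac_iff' by blast
  obtain c where c0: "c \<in> A" "c \<otimes> z \<notin> A" "is_prime A {r \<in> A. r \<otimes> (c \<otimes> z) \<in> A}"
    using conductor_prime[OF z] by blast
  define P where "P = {r \<in> A. r \<otimes> (c \<otimes> z) \<in> A}"
  note c = c0(1,2) P_def
  let ?y = "c \<otimes> z"
  have yc: "?y \<in> carrier L" using c(1) zc by simp
  have yf: "?y \<in> fraction_field_in L A"
    using subringE(6)[OF subfieldE(1)[OF subfield_frac]] A_frac c(1) z(1) by blast
  have Pp: "is_prime A P" using c0(3) unfolding P_def .
  have Pi: "is_ideal A P" by (rule prime_ideal[OF Pp])
  have yP: "\<forall>r\<in>P. r \<otimes> ?y \<in> A" using c(3) by simp
  have nz: "P \<noteq> {\<zero>}"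
  proof -
    obtain b where b: "b \<in> A" "b \<noteq> \<zero>" "b \<otimes> z \<in> A" using z(1) frac_iff' by blast
    have "b \<otimes> (c \<otimes> z) = c \<otimes> (b \<otimes> z)" using b(1) c(1) zc by (simp add: m_lcomm)
    then have "b \<in> P" using b c by simp
    then show ?thesis using b(2) by blast
  qed
  note div = divisorial[OF Pp nz yf c(2) yP]
  obtain t where t: "t \<in> P" "t \<otimes> ?y \<notin> P" using div(1) by blast
  have tA: "t \<in> A" and uA: "t \<otimes> ?y \<in> A" using I_A[OF Pi t(1)] bspec[OF yP t(1)] by auto
  let ?O = "{x \<in> carrier L. \<exists>w\<in>A - P. w \<otimes> x \<in> A}"
  have wmult: "v \<otimes> w \<in> A - P" if "v \<in> A - P" "w \<in> A - P" for v w
    using that prime_mult[OF Pp] by auto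
  have sub: "subring ?O L"
  proof (rule subringI)
    show "?O \<subseteq> carrier L" by blast
    show "\<one> \<in> ?O" using prime_one[OF Pp] by (intro CollectI conjI bexI[of _ \<one>]) auto
    fix x x' assume "x \<in> ?O"
    then obtain v where v: "x \<in> carrier L" "v \<in> A - P" "v \<otimes> x \<in> A" by blast
    have "v \<otimes> \<ominus> x \<in> A" using v by (simp add: r_minus)
    then show "\<ominus> x \<in> ?O" using v by blast
    assume "x' \<in> ?O"
    then obtain w where w: "x' \<in> carrier L" "w \<in> A - P" "w \<otimes> x' \<in> A" by blast
    have vc: "v \<in> carrier L" and wc: "w \<in> carrier L" using v w by auto
    have "(v \<otimes> w) \<otimes> (x \<otimes> x') = (v \<otimes> x) \<otimes> (w \<otimes> x')" using v(1) w(1) vc wc by (simp add: m_ac)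
    then have "(v \<otimes> w) \<otimes> (x \<otimes> x') \<in> A" using v w by simp
    then show "x \<otimes> x' \<in> ?O" using v w wmult by blast
    have "(v \<otimes> w) \<otimes> (x \<oplus> x') = w \<otimes> (v \<otimes> x) \<oplus> v \<otimes> (w \<otimes> x')" using v(1) w(1) vc wc by (simp add: m_ac r_distr)
    then have "(v \<otimes> w) \<otimes> (x \<oplus> x') \<in> A" using v w by simp
    then show "x \<oplus> x' \<in> ?O" using v w wmult by blast
  qed
  have AO: "A \<subseteq> ?O"
  proof
    fix a assume "a \<in> A"
    then show "a \<in> ?O" using prime_one[OF Pp] by (intro CollectI conjI bexI[of _ \<one>]) auto
  qed
  have zO: "z \<notin> ?O"
  proof
    assume "z \<in> ?O"
    then obtain w where w: "w \<in> A" "w \<notin> P" "w \<otimes> z \<in> A" by blast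
    have "w \<otimes> (c \<otimes> z) = c \<otimes> (w \<otimes> z)" using w(1) c(1) zc by (simp add: m_lcomm)
    then show False using w c by simp
  qed
  have key: "x \<in> ?O" if x: "x \<in> carrier L" and ab: "a \<in> A" "b \<in> A" "b \<otimes> x = a"
    and i: "a \<otimes> ?y [^] (i::nat) \<in> A" and j: "b \<otimes> ?y [^] (j::nat) \<in> A - P" and le: "j \<le> i" for x a b i j
  proof -
    let ?w = "(b \<otimes> ?y [^] j) \<otimes> (t \<otimes> ?y) [^] (i - j)"
    have tp: "(t \<otimes> ?y) [^] n \<in> A - P" for n :: nat
      using prime_pow[OF Pp uA] t(2) uA by auto
    have w: "?w \<in> A - P" using wmult j tp by blast
    have tc: "t \<in> carrier L" using tA by simp
    have yi: "?y [^] i = ?y [^] j \<otimes> ?y [^] (i - j)" using yc le by (simp add: nat_pow_mult)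
    have "?w \<otimes> x = (a \<otimes> ?y [^] i) \<otimes> t [^] (i - j)"
    proof -
      have "?w = (b \<otimes> Y) \<otimes> (t [^] (i - j) \<otimes> Z)" if "Y = ?y [^] j" "Z = ?y [^] (i - j)" for Y Z
        unfolding that using tc yc by (simp add: nat_pow_distrib)
      moreover have "(b \<otimes> Y) \<otimes> (T \<otimes> Z) \<otimes> x = (b \<otimes> x) \<otimes> (Y \<otimes> Z) \<otimes> T"
        if "Y \<in> carrier L" "Z \<in> carrier L" "T \<in> carrier L" for Y Z T
        using that A_carr[OF ab(2)] x by (simp add: m_ac)
      ultimately show ?thesis unfolding yi ab(3)[symmetric] using tc yc by simp
    qed
    then have "?w \<otimes> x \<in> A" using i tA by simp
    then show ?thesis using x w by blast
  qed
  have "x \<in> ?O \<or> inv x \<in> ?O" if x: "x \<in> fraction_field_in L A" "x \<noteq> \<zero>" for x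
  proof -
    obtain b where b: "x \<in> carrier L" "b \<in> A" "b \<noteq> \<zero>" "b \<otimes> x \<in> A" using x(1) frac_iff' by blast
    have a: "b \<otimes> x \<noteq> \<zero>" using b x(2) mult_nz by simp
    obtain i where i: "(b \<otimes> x) \<otimes> ?y [^] (i::nat) \<in> A - P" using div(3)[OF b(4) a] by blast
    obtain j where j: "b \<otimes> ?y [^] (j::nat) \<in> A - P" using div(3)[OF b(2,3)] by blast
    have e: "(b \<otimes> x) \<otimes> inv x = b" using b x(2) by (simp add: m_assoc)
    show ?thesis
    proof (cases "j \<le> i")
      case True
      then have "x \<in> ?O" using key[OF b(1) b(4) b(2) refl _ j] i by blast
      then show ?thesis by blast
    next
      case False
      have "inv x \<in> ?O"
        using key[OF inv_nz[OF b(1) x(2)] b(2) b(4) e _ i, of j] j False by simp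
      then show ?thesis by blast
    qed
  qed
  then show ?thesis using sub AO zO by blast
qed

end

section \<open>The lemma of Gauss, and going down\<close>

context subring_in
begin

definition nonunits :: "'a set" where
  "nonunits = {x \<in> A. x = \<zero> \<or> inv x \<notin> A}"

lemma nonunits_mult:
  assumes x: "x \<in> nonunits" and a: "a \<in> A" shows "a \<otimes> x \<in> nonunits"
proof (cases "a \<otimes> x = \<zero>")
  case True
  then show ?thesis by (simp add: nonunits_def)
next
  case False
  have xA: "x \<in> A" using x by (simp add: nonunits_def)
  have nz: "x \<noteq> \<zero>" "a \<noteq> \<zero>" using False a xA by auto
  have "inv (a \<otimes> x) \<notin> A"
  proof
    assume i: "inv (a \<otimes> x) \<in> A"
    have "a \<otimes> inv (a \<otimes> x) = inv x"
    proof -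
      have "a \<otimes> inv (a \<otimes> x) = a \<otimes> inv (a \<otimes> x) \<otimes> (x \<otimes> inv x)" using a i xA nz by simp
      also have "\<dots> = ((a \<otimes> x) \<otimes> inv (a \<otimes> x)) \<otimes> inv x"
        using A_carr[OF a] A_carr[OF i] A_carr[OF xA] inv_nz[OF A_carr[OF xA] nz(1)] by (simp only: m_ac m_closed)
      also have "\<dots> = inv x" using a xA False nz by simp
      finally show ?thesis .
    qed
    then have "inv x \<in> A" using A_mult[OF a i] by simp
    then show False using x nz by (simp add: nonunits_def)
  qed
  then show ?thesis using a xA by (simp add: nonunits_def)
qed

context
  fixes F assumes F: "subfield F L" and val: "\<And>x. x \<in> F \<Longrightarrow> x \<noteq> \<zero> \<Longrightarrow> x \<in> A \<or> inv x \<in> A"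
begin

lemma F_carr: "x \<in> F \<Longrightarrow> x \<in> carrier L" using subfieldE(3)[OF F] by blast
lemma F_mult: "x \<in> F \<Longrightarrow> y \<in> F \<Longrightarrow> x \<otimes> y \<in> F"
  and F_add: "x \<in> F \<Longrightarrow> y \<in> F \<Longrightarrow> x \<oplus> y \<in> F" and F_neg: "x \<in> F \<Longrightarrow> \<ominus> x \<in> F"
  and F_one: "\<one> \<in> F" and F_zero: "\<zero> \<in> F"
  using subringE[OF subfieldE(1)[OF F]] by auto
lemma F_inv: "x \<in> F \<Longrightarrow> x \<noteq> \<zero> \<Longrightarrow> inv x \<in> F"
  using subfield_m_inv(1)[OF F] by simp

text \<open>In a valuation ring the non-units form an ideal, since one of \<open>x, y\<close> divides the other.\<close>

lemma nonunits_add_aux: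
  assumes x: "x \<in> nonunits" "x \<in> F" and y: "y \<in> nonunits" "y \<in> F" "y \<noteq> \<zero>" and q: "x \<otimes> inv y \<in> A"
  shows "x \<oplus> y \<in> nonunits"
proof -
  have yc: "y \<in> carrier L" and xc: "x \<in> carrier L" using x y F_carr by auto
  have "(x \<otimes> inv y \<oplus> \<one>) \<otimes> y = x \<otimes> (inv y \<otimes> y) \<oplus> y"
    using xc yc inv_nz[OF yc y(3)] by (simp add: l_distr m_assoc del: inv_l)
  then have "x \<oplus> y = (x \<otimes> inv y \<oplus> \<one>) \<otimes> y" using xc yc y(3) by simp
  then show ?thesis using nonunits_mult[OF y(1)] q by simp
qed

lemma nonunits_add:
  assumes x: "x \<in> nonunits" "x \<in> F" and y: "y \<in> nonunits" "y \<in> F"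
  shows "x \<oplus> y \<in> nonunits"
proof -
  have yc: "y \<in> carrier L" and xc: "x \<in> carrier L" using x y F_carr by auto
  consider "x = \<zero>" | "y = \<zero>" | "x \<noteq> \<zero>" "y \<noteq> \<zero>" by blast
  then show ?thesis
  proof cases
    case 3
    have xy: "x \<otimes> inv y \<in> F" "x \<otimes> inv y \<noteq> \<zero>"
      using F_mult[OF x(2) F_inv[OF y(2) 3(2)]] mult_nz[OF xc inv_nz[OF yc 3(2)] 3(1) inv_not_zero[OF yc 3(2)]] by auto
    have "inv (x \<otimes> inv y) = y \<otimes> inv x"
    proof (rule comm_inv_char)
      show "x \<otimes> inv y \<in> carrier L" "y \<otimes> inv x \<in> carrier L" using xc yc 3 by simp_all
      have "x \<otimes> inv y \<otimes> (y \<otimes> inv x) = (x \<otimes> inv x) \<otimes> (inv y \<otimes> y)"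
        using xc yc inv_nz[OF xc 3(1)] inv_nz[OF yc 3(2)] by (simp only: m_ac m_closed)
      then show "x \<otimes> inv y \<otimes> (y \<otimes> inv x) = \<one>" using xc yc 3 by simp
    qed
    then have "x \<otimes> inv y \<in> A \<or> y \<otimes> inv x \<in> A" using val[OF xy] by simp
    then show ?thesis
      using nonunits_add_aux[OF x y 3(2)] nonunits_add_aux[OF y x 3(1)] xc yc a_comm by auto
  qed (use x y xc yc in simp_all)
qed

lemma one_plus_nonunit:
  assumes x: "x \<in> nonunits" "x \<in> F"
  shows "\<one> \<oplus> x \<noteq> \<zero>" and "inv (\<one> \<oplus> x) \<in> A"
proof -
  have xA: "x \<in> A" using x by (simp add: nonunits_def)
  have xc: "x \<in> carrier L" using xA by simp
  have one: "\<one> \<notin> nonunits" using A_one by (simp add: nonunits_def)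
  have mx: "\<ominus> x \<in> nonunits" using nonunits_mult[OF x(1), of "\<ominus> \<one>"] xc by (simp add: l_minus)
  have e: "(\<one> \<oplus> x) \<oplus> \<ominus> x = \<one>" using xc by algebra
  show nz: "\<one> \<oplus> x \<noteq> \<zero>"
  proof
    assume "\<one> \<oplus> x = \<zero>"
    then have "\<ominus> x = \<one>" using e xc by simp
    then show False using mx one by simp
  qed
  show "inv (\<one> \<oplus> x) \<in> A"
  proof (rule ccontr)
    assume "inv (\<one> \<oplus> x) \<notin> A"
    then have "\<one> \<oplus> x \<in> nonunits" using xA by (simp add: nonunits_def)
    then have "(\<one> \<oplus> x) \<oplus> \<ominus> x \<in> nonunits"
      using nonunits_add[of "\<one> \<oplus> x" "\<ominus> x"] mx F_add[OF F_one x(2)] F_neg[OF x(2)] by simp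
    then show False using e one by simp
  qed
qed

lemma dominant_index:
  fixes f :: "nat \<Rightarrow> 'a"
  assumes f: "\<And>i. f i \<in> F"
  shows "(\<exists>i\<le>n. f i \<noteq> \<zero>) \<Longrightarrow> \<exists>a\<le>n. f a \<noteq> \<zero> \<and> (\<forall>i\<le>n. f i \<otimes> inv (f a) \<in> A)"
proof (induction n)
  case 0
  then show ?case using F_carr[OF f] by (intro exI[of _ 0]) auto
next
  case (Suc n)
  have fc: "f i \<in> carrier L" for i using F_carr[OF f] .
  show ?case
  proof (cases "\<exists>i\<le>n. f i \<noteq> \<zero>")
    case False
    then have z: "f i = \<zero>" if "i \<le> n" for i using that by blast
    then have nz: "f (Suc n) \<noteq> \<zero>" using Suc.prems le_Suc_eq by auto
    then show ?thesis using z fc by (intro exI[of _ "Suc n"]) (auto simp: le_Suc_eq)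
  next
    case True
    then obtain a where a: "a \<le> n" "f a \<noteq> \<zero>" "\<forall>i\<le>n. f i \<otimes> inv (f a) \<in> A" using Suc.IH by blast
    show ?thesis
    proof (cases "f (Suc n) \<otimes> inv (f a) \<in> A")
      case True
      then show ?thesis using a by (intro exI[of _ a]) (auto simp: le_Suc_eq)
    next
      case False
      have nz: "f (Suc n) \<noteq> \<zero>"
      proof
        assume "f (Suc n) = \<zero>"
        then show False using False fc a(2) by simp
      qed
      have rF: "f (Suc n) \<otimes> inv (f a) \<in> F" "f (Suc n) \<otimes> inv (f a) \<noteq> \<zero>"
        using F_mult[OF f F_inv[OF f a(2)]] mult_nz[OF fc inv_nz[OF fc a(2)] nz inv_not_zero[OF fc a(2)]] by auto
      have "inv (f (Suc n) \<otimes> inv (f a)) = f a \<otimes> inv (f (Suc n))"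
      proof (rule comm_inv_char)
        have "f (Suc n) \<otimes> inv (f a) \<otimes> (f a \<otimes> inv (f (Suc n))) = (f (Suc n) \<otimes> inv (f (Suc n))) \<otimes> (inv (f a) \<otimes> f a)"
          using fc inv_nz[OF fc a(2)] inv_nz[OF fc nz] by (simp only: m_ac m_closed)
        then show "f (Suc n) \<otimes> inv (f a) \<otimes> (f a \<otimes> inv (f (Suc n))) = \<one>" using fc a(2) nz by simp
      qed (use fc a(2) nz in simp_all)
      then have s: "f a \<otimes> inv (f (Suc n)) \<in> A" using val[OF rF] False by simp
      have "f i \<otimes> inv (f (Suc n)) \<in> A" if "i \<le> Suc n" for i
      proof (cases "i = Suc n")
        case True
        then show ?thesis using fc nz by simp
      next
        case False
        then have "(f i \<otimes> inv (f a)) \<otimes> (f a \<otimes> inv (f (Suc n))) \<in> A" using a(3) that s by simp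
        moreover have "(f i \<otimes> inv (f a)) \<otimes> (f a \<otimes> inv (f (Suc n))) = f i \<otimes> (inv (f a) \<otimes> f a) \<otimes> inv (f (Suc n))"
          using fc inv_nz[OF fc a(2)] inv_nz[OF fc nz] by (simp only: m_ac m_closed)
        ultimately show ?thesis using fc a(2) nz by simp
      qed
      then show ?thesis using nz by blast
    qed
  qed
qed

text \<open>An index at which the coefficient has minimal valuation, and the first such.\<close>

lemma first_dominant:
  assumes f: "\<And>i. f i \<in> F" and m: "monic m f"
  shows "\<exists>a\<le>m. f a \<noteq> \<zero> \<and> (\<forall>i. f i \<otimes> inv (f a) \<in> A) \<and> (\<forall>i<a. f i \<otimes> inv (f a) \<in> nonunits)"
proof -
  have fc: "f i \<in> carrier L" for i using F_carr[OF f] .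
  let ?D = "\<lambda>a. f a \<noteq> \<zero> \<and> (\<forall>i. f i \<otimes> inv (f a) \<in> A)"
  have "\<exists>i\<le>m. f i \<noteq> \<zero>" using m by (intro exI[of _ m]) (auto simp: monic_def)
  then obtain a0 where a0: "a0 \<le> m" "f a0 \<noteq> \<zero>" "\<forall>i\<le>m. f i \<otimes> inv (f a0) \<in> A"
    using dominant_index[of f m, OF f] by blast
  have "f i \<otimes> inv (f a0) \<in> A" for i
  proof (cases "i \<le> m")
    case False
    then show ?thesis using m fc a0(2) by (simp add: monic_def)
  qed (use a0 in blast)
  then have D0: "?D a0" using a0 by blast
  define a where "a = (LEAST a. ?D a)"
  have D: "?D a" unfolding a_def by (rule LeastI[of ?D, OF D0])
  have le: "a \<le> m" using Least_le[of ?D, OF D0] a0(1) unfolding a_def by simp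
  have "f i \<otimes> inv (f a) \<in> nonunits" if i: "i < a" for i
  proof (rule ccontr)
    assume no: "f i \<otimes> inv (f a) \<notin> nonunits"
    have nz: "f i \<otimes> inv (f a) \<noteq> \<zero>" "inv (f i \<otimes> inv (f a)) \<in> A"
      using no D by (auto simp: nonunits_def)
    have fi: "f i \<noteq> \<zero>" using nz(1) fc D by auto
    have ia: "inv (f a) \<in> carrier L" and ii: "inv (f i) \<in> carrier L" using D fi fc by auto
    have "inv (f i \<otimes> inv (f a)) = f a \<otimes> inv (f i)"
    proof (rule comm_inv_char)
      have "f i \<otimes> inv (f a) \<otimes> (f a \<otimes> inv (f i)) = (f i \<otimes> inv (f i)) \<otimes> (inv (f a) \<otimes> f a)"
        using fc ia ii by (simp only: m_ac m_closed)
      then show "f i \<otimes> inv (f a) \<otimes> (f a \<otimes> inv (f i)) = \<one>" using fc D fi by simp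
    qed (use fc ia ii in simp_all)
    then have ai: "f a \<otimes> inv (f i) \<in> A" using nz(2) by simp
    have "f j \<otimes> inv (f i) \<in> A" for j
    proof -
      have "(f j \<otimes> inv (f a)) \<otimes> (f a \<otimes> inv (f i)) = f j \<otimes> (inv (f a) \<otimes> f a) \<otimes> inv (f i)"
        using fc ia ii by (simp only: m_ac m_closed)
      then have "(f j \<otimes> inv (f a)) \<otimes> (f a \<otimes> inv (f i)) = f j \<otimes> inv (f i)" using fc D by simp
      then show ?thesis using A_mult[OF _ ai, of "f j \<otimes> inv (f a)"] D by simp
    qed
    then have "a \<le> i" unfolding a_def using fi by (intro Least_le) blast
    then show False using i by simp
  qed
  then show ?thesis using D le by blast
qed

text \<open>Divide \<open>f\<close> and \<open>g\<close> by their first dominant coefficients, at \<open>a\<close> and \<open>b\<close>. In the coefficient \<open>a + b\<close> of the product the term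
  \<open>f a g b\<close> then becomes \<open>1\<close> and all others become non-units, so that \<open>f a g b\<close> lies in \<open>A\<close> along with that coefficient. As the
  leading coefficients are \<open>1\<close>, the elements \<open>f a\<close> and \<open>g b\<close> have inverses in \<open>A\<close>; hence both lie in \<open>A\<close>.\<close>

lemma gauss_valuation:
  assumes f: "\<And>i. f i \<in> F" "monic m f" and g: "\<And>i. g i \<in> F" "monic l g"
    and h: "\<And>k. conv f g k \<in> A"
  shows "f i \<in> A" and "g i \<in> A"
proof -
  have fc: "f i \<in> carrier L" and gc: "g i \<in> carrier L" for i using F_carr f(1) g(1) by auto
  obtain a where a: "f a \<noteq> \<zero>" "\<And>i. f i \<otimes> inv (f a) \<in> A" "\<And>i. i < a \<Longrightarrow> f i \<otimes> inv (f a) \<in> nonunits"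
    using first_dominant[OF f] by blast
  obtain b where b: "g b \<noteq> \<zero>" "\<And>i. g i \<otimes> inv (g b) \<in> A" "\<And>i. i < b \<Longrightarrow> g i \<otimes> inv (g b) \<in> nonunits"
    using first_dominant[OF g] by blast
  have ia: "inv (f a) \<in> carrier L" "inv (f a) \<in> F" using a(1) fc f(1) F_inv by auto
  have ib: "inv (g b) \<in> carrier L" "inv (g b) \<in> F" using b(1) gc g(1) F_inv by auto
  let ?t = "\<lambda>i. (f i \<otimes> inv (f a)) \<otimes> (g (a + b - i) \<otimes> inv (g b))"
  let ?u = "\<lambda>i. if i = a then \<zero> else ?t i"
  have tF: "?t i \<in> F" for i using F_mult f(1) g(1) ia(2) ib(2) by blast
  have tc: "?t i \<in> carrier L" for i using F_carr[OF tF] .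
  have ta: "?t a = \<one>" using a(1) b(1) fc gc by simp
  have "nsum ?t (Suc (a + b)) = nsum (\<lambda>i. (if i = a then \<one> else \<zero>) \<oplus> ?u i) (Suc (a + b))"
    using tc ta by (intro nsum_cong) auto
  also have "\<dots> = nsum (\<lambda>i. if i = a then \<one> else \<zero>) (Suc (a + b)) \<oplus> nsum ?u (Suc (a + b))"
    using tc by (intro nsum_add) auto
  also have "nsum (\<lambda>i. if i = a then \<one> else \<zero>) (Suc (a + b)) = \<one>" by (rule nsum_delta) auto
  finally have s: "nsum ?t (Suc (a + b)) = \<one> \<oplus> nsum ?u (Suc (a + b))" .
  have un: "?u i \<in> nonunits \<inter> F" if "i < Suc (a + b)" for i
  proof -
    consider "i = a" | "i < a" | "a + b - i < b" using \<open>i < Suc (a + b)\<close> by linarith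
    then have "?u i \<in> nonunits"
    proof cases
      case 1
      then show ?thesis by (simp add: nonunits_def)
    next
      case 2
      then have "(g (a + b - i) \<otimes> inv (g b)) \<otimes> (f i \<otimes> inv (f a)) \<in> nonunits"
        by (intro nonunits_mult a(3) b(2))
      then have "?t i \<in> nonunits" using fc gc ia ib by (simp add: m_ac)
      then show ?thesis using 2 by simp
    next
      case 3
      then have "?t i \<in> nonunits" by (intro nonunits_mult a(2) b(3))
      then show ?thesis by (simp add: nonunits_def)
    qed
    then show ?thesis using tF F_zero by simp
  qed
  have "nsum ?u (Suc (a + b)) \<in> nonunits \<inter> F"
  proof (rule nsum_in)
    show "\<zero> \<in> nonunits \<inter> F" using F_zero by (simp add: nonunits_def)
    show "x \<oplus> y \<in> nonunits \<inter> F" if "x \<in> nonunits \<inter> F" "y \<in> nonunits \<inter> F" for x y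
      using that nonunits_add F_add by blast
  qed (use un in blast)
  then have u: "nsum ?u (Suc (a + b)) \<in> nonunits" "nsum ?u (Suc (a + b)) \<in> F" by blast+
  let ?x = "nsum ?t (Suc (a + b))"
  have x: "?x \<noteq> \<zero>" "inv ?x \<in> A" using one_plus_nonunit[OF u] unfolding s by auto
  have xc: "?x \<in> carrier L" using tc by (intro nsum_closed)
  have "(f a \<otimes> g b) \<otimes> ?x = nsum (\<lambda>i. (f a \<otimes> g b) \<otimes> ?t i) (Suc (a + b))"
    using fc gc tc by (intro nsum_ldistr) auto
  also have "\<dots> = conv f g (a + b)" unfolding conv_def
  proof (rule nsum_cong)
    fix i
    have "(f a \<otimes> g b) \<otimes> ?t i = (f a \<otimes> inv (f a)) \<otimes> (g b \<otimes> inv (g b)) \<otimes> (f i \<otimes> g (a + b - i))"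
      using fc gc ia(1) ib(1) by (simp only: m_ac m_closed)
    then show "(f a \<otimes> g b) \<otimes> ?t i = f i \<otimes> g (a + b - i)" using fc gc a(1) b(1) by simp
  qed
  finally have c: "(f a \<otimes> g b) \<otimes> ?x \<in> A" using h by simp
  have "(f a \<otimes> g b) \<otimes> ?x \<otimes> inv ?x = f a \<otimes> g b" using fc gc xc x(1) by (simp add: m_assoc)
  then have ab: "f a \<otimes> g b \<in> A" using A_mult[OF c x(2)] by simp
  have "inv (f a) \<in> A" using a(2)[of m] f(2) ia by (simp add: monic_def)
  then have "inv (f a) \<otimes> (f a \<otimes> g b) \<in> A" using ab by simp
  moreover have "inv (f a) \<otimes> (f a \<otimes> g b) = g b" using fc gc ia(1) a(1) by (simp add: m_assoc[symmetric])
  ultimately have gb: "g b \<in> A" by simp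
  have "inv (g b) \<in> A" using b(2)[of l] g(2) ib by (simp add: monic_def)
  then have "(f a \<otimes> g b) \<otimes> inv (g b) \<in> A" using ab by simp
  moreover have "(f a \<otimes> g b) \<otimes> inv (g b) = f a" using fc gc ib(1) b(1) by (simp add: m_assoc)
  ultimately have fa: "f a \<in> A" by simp
  have "(f i \<otimes> inv (f a)) \<otimes> f a = f i" using fc ia(1) a(1) by (simp add: m_assoc)
  then show "f i \<in> A" using A_mult[OF a(2)[of i] fa] by simp
  have "(g i \<otimes> inv (g b)) \<otimes> g b = g i" using gc ib(1) b(1) by (simp add: m_assoc)
  then show "g i \<in> A" using A_mult[OF b(2)[of i] gb] by simp
qed

end

text \<open>Modulo \<open>P\<close> the product is \<open>X\<^bsup>m + l\<^esup>\<close>, so the lowest nonzero coefficients of the factors must be the leading ones.\<close>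

lemma monic_factor_of_power:
  assumes P: "is_prime A P" and f: "\<And>i. f i \<in> A" "monic m f" and g: "\<And>i. g i \<in> A" "monic l g"
    and h: "\<And>k. k < m + l \<Longrightarrow> conv f g k \<in> P" and i: "i < m"
  shows "f i \<in> P"
proof -
  note Pi = prime_ideal[OF P]
  define a where "a = (LEAST a. f a \<notin> P)"
  define b where "b = (LEAST b. g b \<notin> P)"
  have fm: "f m \<notin> P" and gl: "g l \<notin> P" using f(2) g(2) prime_one[OF P] by (auto simp: monic_def)
  have fa: "f a \<notin> P" unfolding a_def by (rule LeastI[of "\<lambda>a. f a \<notin> P", OF fm])
  have gb: "g b \<notin> P" unfolding b_def by (rule LeastI[of "\<lambda>b. g b \<notin> P", OF gl])
  have am: "a \<le> m" unfolding a_def by (rule Least_le[of "\<lambda>a. f a \<notin> P", OF fm])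
  have bl: "b \<le> l" unfolding b_def by (rule Least_le[of "\<lambda>b. g b \<notin> P", OF gl])
  have fl: "f j \<in> P" if "j < a" for j using not_less_Least[of j "\<lambda>a. f a \<notin> P"] that unfolding a_def by blast
  have gl': "g j \<in> P" if "j < b" for j using not_less_Least[of j "\<lambda>b. g b \<notin> P"] that unfolding b_def by blast
  let ?t = "\<lambda>i. f i \<otimes> g (a + b - i)"
  let ?u = "\<lambda>i. if i = a then \<zero> else ?t i"
  have "conv f g (a + b) = nsum (\<lambda>i. (if i = a then f a \<otimes> g b else \<zero>) \<oplus> ?u i) (Suc (a + b))"
    unfolding conv_def using f(1) g(1) by (intro nsum_cong) auto
  also have "\<dots> = nsum (\<lambda>i. if i = a then f a \<otimes> g b else \<zero>) (Suc (a + b)) \<oplus> nsum ?u (Suc (a + b))"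
    using f(1) g(1) by (intro nsum_add) auto
  also have "nsum (\<lambda>i. if i = a then f a \<otimes> g b else \<zero>) (Suc (a + b)) = f a \<otimes> g b"
    using f(1) g(1) by (intro nsum_delta) auto
  finally have s: "conv f g (a + b) = f a \<otimes> g b \<oplus> nsum ?u (Suc (a + b))" .
  have u: "nsum ?u (Suc (a + b)) \<in> P"
  proof (rule I_nsum[OF Pi])
    fix i assume "i < Suc (a + b)"
    then consider "i = a" | "i < a" | "a + b - i < b" by linarith
    then show "?u i \<in> P"
      using I_zero[OF Pi] I_r[OF Pi g(1) fl, of i] I_l[OF Pi f(1) gl', of "a + b - i" i] by cases auto
  qed
  have "f a \<otimes> g b \<notin> P" using prime_mult[OF P f(1)[of a] g(1)[of b]] fa gb by blast
  moreover have "f a \<otimes> g b \<in> P" if "conv f g (a + b) \<in> P"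
    using that unfolding s by (rule I_add_cancel[OF Pi _ u, rotated]) (use f(1) g(1) in simp)
  ultimately have "conv f g (a + b) \<notin> P" by blast
  then have "m + l \<le> a + b" using h not_less by blast
  then have "a = m" using am bl by linarith
  then show ?thesis using fl i by simp
qed

end

context normal_in
begin

lemma gauss:
  assumes f: "\<And>i. f i \<in> fraction_field_in L A" "monic m f"
    and g: "\<And>i. g i \<in> fraction_field_in L A" "monic l g" and h: "\<And>k. conv f g k \<in> A"
  shows "f i \<in> A" and "g i \<in> A"
proof -
  have key: "z \<in> A" if z: "z \<in> fraction_field_in L A" and zin: "z = f i \<or> z = g i" for z
  proof (rule ccontr)
    assume "z \<notin> A"
    obtain V where V: "subring V L" "A \<subseteq> V" "z \<notin> V"
      "\<And>x. x \<in> fraction_field_in L A \<Longrightarrow> x \<noteq> \<zero> \<Longrightarrow> x \<in> V \<or> inv x \<in> V"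
      using valuation_ring_avoiding[OF z \<open>z \<notin> A\<close>] by blast
    interpret V: subring_in L V
      by (rule subring_in.intro[OF ambient_field_axioms subring_in_axioms.intro[OF V(1)]])
    have hV: "conv f g k \<in> V" for k using h V(2) by blast
    have "f i \<in> V" by (rule V.gauss_valuation(1)[OF subfield_frac V(4) f g hV])
    moreover have "g i \<in> V" by (rule V.gauss_valuation(2)[OF subfield_frac V(4) f g hV])
    ultimately show False using zin V(3) by blast
  qed
  show "f i \<in> A" using key[OF f(1)[of i]] by blast
  show "g i \<in> A" using key[OF g(1)[of i]] by blast
qed

end

context finite_extension
begin

text \<open>Here normality of \<open>R\<close> enters. The minimal polynomial \<open>f\<close> of \<open>x\<close> has coefficients in \<open>R\<close> by Gauss, and so has that of \<open>w x\<close>, whose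
  coefficients are the \<open>f i w\<^bsup>m - i\<^esup>\<close>. The latter divides a monic polynomial with lower coefficients in \<open>P\<close>, so its own lower
  coefficients lie in \<open>P\<close>. Since \<open>w \<notin> P\<close>, the same holds for \<open>f\<close>, and \<open>f x = 0\<close> gives \<open>x\<^sup>m \<in> P S\<close>.\<close>

lemma going_down_radical:
  assumes P: "is_prime R P" and x: "x \<in> S" and w: "w \<in> R" "w \<notin> P" and wx: "w \<otimes> x \<in> extended P"
  shows "\<exists>n::nat. x [^] n \<in> extended P"
proof -
  note Pi = R.prime_ideal[OF P]
  note PR = R.I_A[OF Pi]
  have xc: "x \<in> carrier L" and wc: "w \<in> carrier L" using x w by auto
  have wnz: "w \<noteq> \<zero>" using w(2) R.I_zero[OF Pi] by blast
  have iw: "inv w \<in> K" "inv w \<in> carrier L" using w(1) wnz by auto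
  have RL: "R \<subseteq> carrier L" and PL: "P \<subseteq> carrier L" using PR by auto
  obtain n0 where "\<zero> \<in> Mon x R n0" using integral[OF x] by blast
  then obtain G where G: "monic n0 G" "\<forall>i<n0. G i \<in> R" "\<zero> = peval G n0 x" using Mon_peval[OF _ xc RL] by blast
  have GR: "G i \<in> R" for i
    using G(1,2) by (cases "i < n0"; cases "i = n0") (auto simp: monic_def)
  obtain d where "\<zero> \<in> Mon (w \<otimes> x) P d" using integral_over_ideal[OF Pi wx] by blast
  then obtain c where c: "monic d c" "\<forall>i<d. c i \<in> P" "\<zero> = peval c d (w \<otimes> x)"
    using Mon_peval[OF _ _ PL, of \<zero> "w \<otimes> x" d] xc wc by auto
  have cR: "c i \<in> R" for i
    using c(1,2) PR by (cases "i < d"; cases "i = d") (auto simp: monic_def)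
  \<comment> \<open>the monic polynomial of x obtained from c, the one of w x, by rescaling\<close>
  define F where "F i = c i \<otimes> inv w [^] (d - i)" for i
  have FK: "F i \<in> K" for i unfolding F_def using cR iw by simp
  have Fm: "monic d F" using c(1) iw by (auto simp: monic_def F_def)
  have winv: "inv w [^] n \<otimes> w [^] n = \<one>" for n :: nat
    using wc iw wnz by (simp add: nat_pow_distrib[symmetric] nat_pow_one)
  have "peval F d x = nsum (\<lambda>i. inv w [^] d \<otimes> (c i \<otimes> (w \<otimes> x) [^] i)) (Suc d)"
    unfolding peval_def
  proof (rule nsum_cong)
    fix i assume i: "i < Suc d"
    have cc: "c i \<in> carrier L" using cR by simp
    have "inv w [^] d = inv w [^] (d - i) \<otimes> inv w [^] i" using iw i by (simp add: nat_pow_mult)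
    moreover have "A \<otimes> B \<otimes> (c i \<otimes> (C \<otimes> D)) = c i \<otimes> A \<otimes> D \<otimes> (B \<otimes> C)"
      if "A \<in> carrier L" "B \<in> carrier L" "C \<in> carrier L" "D \<in> carrier L" for A B C D
      using that cc by (simp only: m_ac m_closed)
    ultimately show "F i \<otimes> x [^] i = inv w [^] d \<otimes> (c i \<otimes> (w \<otimes> x) [^] i)"
      unfolding F_def using iw wc xc cc winv[of i] by (simp add: nat_pow_distrib)
  qed
  also have "\<dots> = inv w [^] d \<otimes> peval c d (w \<otimes> x)"
    unfolding peval_def using iw cR wc xc by (intro nsum_ldistr[symmetric]) auto
  also have "\<dots> = \<zero>" unfolding c(3)[symmetric] using iw by simp
  finally have Fx: "peval F d x = \<zero>" .
  have GK: "G i \<in> K" for i using GR by simp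
  obtain m f where f: "monic m f" "\<forall>i. f i \<in> K" "peval f m x = \<zero>"
    and div: "\<And>n F. monic n F \<Longrightarrow> \<forall>i. F i \<in> K \<Longrightarrow> peval F n x = \<zero> \<Longrightarrow>
      \<exists>l g. monic l g \<and> (\<forall>i. g i \<in> K) \<and> n = m + l \<and> (\<forall>k. F k = conv f g k)"
    using minimal_polynomial[OF xc G(1) GK G(3)[symmetric]] by blast
  have fK: "f i \<in> fraction_field_in L R" for i using f(2) K_eq by simp
  obtain l1 g1 where g1: "monic l1 g1" "\<forall>i. g1 i \<in> K" "\<And>k. G k = conv f g1 k"
    using div[OF G(1) _ G(3)[symmetric]] GK by blast
  have g1K: "g1 i \<in> fraction_field_in L R" for i using g1(2) K_eq by simp
  have fR: "f i \<in> R" for i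
    by (rule R.gauss(1)[OF fK f(1) g1K g1(1)]) (use g1(3) GR in metis)
  obtain l g where g: "monic l g" "\<forall>i. g i \<in> K" "d = m + l" "\<And>k. F k = conv f g k"
    using div[OF Fm _ Fx] FK by blast
  \<comment> \<open>rescaled back, f' and g' factor c\<close>
  define f' where "f' i = f i \<otimes> w [^] (m - i)" for i
  define g' where "g' i = g i \<otimes> w [^] (l - i)" for i
  have f'm: "monic m f'" and g'm: "monic l g'"
    using f(1) g(1) wc by (auto simp: monic_def f'_def g'_def)
  have f'K: "f' i \<in> fraction_field_in L R" and g'K: "g' i \<in> fraction_field_in L R" for i
    using f(2) g(2) w(1) K_eq unfolding f'_def g'_def by (metis K_mult K_pow R_in_K)+
  have fL: "f i \<in> carrier L" and gL: "g i \<in> carrier L" for i using f(2) g(2) by auto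
  have f'L: "f' i \<in> carrier L" and g'L: "g' i \<in> carrier L" for i using fL gL wc by (auto simp: f'_def g'_def)
  have above: "f i = \<zero>" if "m < i" for i using that f(1) by (simp add: monic_def)
  have gabove: "g i = \<zero>" if "l < i" for i using that g(1) by (simp add: monic_def)
  have cv: "conv f' g' k = c k" for k
  proof (cases "k \<le> d")
    case True
    have "conv f' g' k = nsum (\<lambda>i. (f i \<otimes> g (k - i)) \<otimes> w [^] (d - k)) (Suc k)"
      unfolding conv_def
    proof (rule nsum_cong)
      fix i assume i: "i < Suc k"
      consider "m < i" | "l < k - i" | "i \<le> m" "k - i \<le> l" by linarith
      then show "f' i \<otimes> g' (k - i) = (f i \<otimes> g (k - i)) \<otimes> w [^] (d - k)"
      proof cases
        case 3
        have ex: "d - k = (m - i) + (l - (k - i))" using 3 i g(3) by linarith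
        have "w [^] (d - k) = w [^] (m - i) \<otimes> w [^] (l - (k - i))"
          unfolding ex using wc by (simp add: nat_pow_mult)
        then show ?thesis using fL[of i] gL[of "k - i"] wc by (simp add: f'_def g'_def m_ac)
      qed (use above gabove fL gL wc in \<open>simp_all add: f'_def g'_def\<close>)
    qed
    also have "\<dots> = conv f g k \<otimes> w [^] (d - k)"
      unfolding conv_def using fL gL wc by (intro nsum_rdistr[symmetric]) auto
    also have "\<dots> = c k \<otimes> (inv w [^] (d - k) \<otimes> w [^] (d - k))"
      unfolding g(4)[symmetric] F_def using cR[of k] iw wc by (simp add: m_assoc)
    also have "\<dots> = c k" unfolding winv using cR[of k] by simp
    finally show ?thesis .
  next
    case False
    have "conv f' g' k = \<zero>"
      by (rule conv_above[where m = m and l = l])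
        (use f'L g'L f'm g'm False g(3) in \<open>auto simp: monic_def\<close>)
    then show ?thesis using c(1) False by (simp add: monic_def)
  qed
  have f'R: "f' i \<in> R" and g'R: "g' i \<in> R" for i
    using R.gauss[OF f'K f'm g'K g'm, of i] cv cR by simp_all
  have fP: "f i \<in> P" if i: "i < m" for i
  proof -
    have "f' i \<in> P"
      by (rule R.monic_factor_of_power[OF P f'R f'm g'R g'm _ i]) (use cv c(2) g(3) in simp)
    then show ?thesis
      using R.prime_mult[OF P fR, of "w [^] (m - i)" i] R.prime_pow[OF P w(1)] w unfolding f'_def by auto
  qed
  have fS: "f i \<otimes> x [^] i \<in> extended P" if "i < m" for i
    using S.I_r[OF extended_ideal[of P], of "x [^] i" "f i"] fP[OF that] extended_base PR x by (metis R_in_S S.A_pow subsetD subsetI)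
  have PS: "P \<subseteq> S" using PR by auto
  have s: "nsum (\<lambda>i. f i \<otimes> x [^] i) m \<in> extended P"
    by (rule S.I_nsum[OF extended_ideal[OF PS]]) (rule fS)
  have "nsum (\<lambda>i. f i \<otimes> x [^] i) m \<oplus> x [^] m = \<zero>"
    using f(1,3) xc by (simp add: peval_def monic_def)
  then have "x [^] m \<oplus> nsum (\<lambda>i. f i \<otimes> x [^] i) m \<in> extended P"
    using S.I_zero[OF extended_ideal[OF PS]] S.I_carr[OF extended_ideal[OF PS] s] xc by (simp add: a_comm)
  then have "x [^] m \<in> extended P" by (rule S.I_add_cancel[OF extended_ideal[OF PS] _ s, rotated]) (use xc in simp)
  then show ?thesis by blast
qed

text \<open>The radical of \<open>P S\<close> is the intersection of the primes of \<open>S\<close> over \<open>P\<close>, without any other primes containing \<open>P\<close>. If no element \<open>w x\<^sup>n\<close>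
  with \<open>w \<in> R - P\<close> were in \<open>P S\<close>, then some prime would avoid them all; it lies over \<open>P\<close> and misses \<open>x\<close>. The factor \<open>w\<close> is
  removed by \<open>going_down_radical\<close>.\<close>

lemma radical_of_extended:
  assumes P: "is_prime R P" and x: "x \<in> S"
    and all: "\<And>Q. is_prime S Q \<Longrightarrow> Q \<inter> R = P \<Longrightarrow> x \<in> Q"
  shows "\<exists>n::nat. x [^] n \<in> extended P"
proof -
  note Pi = R.prime_ideal[OF P]
  have PS: "P \<subseteq> S" using R.I_A[OF Pi] by auto
  let ?W = "{w \<otimes> x [^] (n::nat) | w n. w \<in> R \<and> w \<notin> P}"
  have "\<exists>w n. w \<in> R \<and> w \<notin> P \<and> w \<otimes> x [^] (n::nat) \<in> extended P"
  proof (rule ccontr)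
    assume "\<not> ?thesis"
    then have disj: "extended P \<inter> ?W = {}" by blast
    have "\<one> = \<one> \<otimes> x [^] (0::nat)" by simp
    then have W1: "\<one> \<in> ?W" using R.prime_one[OF P] R.A_one by blast
    have W2: "a \<otimes> b \<in> ?W" if "a \<in> ?W" "b \<in> ?W" for a b
    proof -
      obtain v m where v: "a = v \<otimes> x [^] (m::nat)" "v \<in> R" "v \<notin> P" using \<open>a \<in> ?W\<close> by blast
      obtain w n where w: "b = w \<otimes> x [^] (n::nat)" "w \<in> R" "w \<notin> P" using \<open>b \<in> ?W\<close> by blast
      have "a \<otimes> b = (v \<otimes> w) \<otimes> x [^] (m + n)"
        unfolding v w using v(2) w(2) x by (simp add: nat_pow_mult[symmetric] m_ac)
      moreover have "v \<otimes> w \<in> R" "v \<otimes> w \<notin> P" using v w R.prime_mult[OF P] by auto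
      ultimately show ?thesis by blast
    qed
    obtain Q where Q: "is_prime S Q" "extended P \<subseteq> Q" "Q \<inter> ?W = {}"
      using S.prime_avoiding[OF extended_ideal[OF PS] disj W1 W2] by blast
    have "Q \<inter> R \<subseteq> P"
    proof
      fix w assume "w \<in> Q \<inter> R"
      then have "w \<in> R" "w \<in> Q" by auto
      moreover have "w = w \<otimes> x [^] (0::nat)" using \<open>w \<in> R\<close> by simp
      ultimately show "w \<in> P" using Q(3) by blast
    qed
    then have "Q \<inter> R = P" using Q(2) extended_base R.I_A[OF Pi] by blast
    then have "x \<in> Q" by (rule all[OF Q(1)])
    moreover have "x = \<one> \<otimes> x [^] (1::nat)" using x by simp
    ultimately show False using Q(3) R.prime_one[OF P] R.A_one by blast
  qed
  then obtain w n where w: "w \<in> R" "w \<notin> P" "w \<otimes> x [^] (n::nat) \<in> extended P" by blast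
  obtain k :: nat where "(x [^] n) [^] k \<in> extended P"
    using going_down_radical[OF P _ w] x by auto
  then show ?thesis using x by (auto simp: nat_pow_pow)
qed

end

section \<open>Ramification at primes of height one\<close>

context normal_in
begin

text \<open>If only elements of \<open>A\<close> are multiplied into \<open>A\<close> by \<open>I\<close>, then the same holds for the powers: otherwise a multiple of \<open>z\<close> has a
  prime denominator ideal, which contains powers of the elements of \<open>I\<close> and thus \<open>I\<close>.\<close>

lemma trivial_inverse_depth:
  assumes triv: "\<And>y. y \<in> fraction_field_in L A \<Longrightarrow> \<forall>r\<in>I. r \<otimes> y \<in> A \<Longrightarrow> y \<in> A"
    and I: "I \<subseteq> A" and z: "z \<in> fraction_field_in L A"
    and pw: "\<And>x. x \<in> I \<Longrightarrow> \<exists>n::nat. x [^] n \<otimes> z \<in> A"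
  shows "z \<in> A"
proof (rule ccontr)
  assume zA: "z \<notin> A"
  have zc: "z \<in> carrier L" using z frac_iff' by blast
  obtain c where c: "c \<in> A" "c \<otimes> z \<notin> A" and P: "is_prime A {r \<in> A. r \<otimes> (c \<otimes> z) \<in> A}"
    using conductor_prime[OF z zA] by blast
  have "x \<otimes> (c \<otimes> z) \<in> A" if x: "x \<in> I" for x
  proof -
    have xA: "x \<in> A" using I x by blast
    obtain n :: nat where n: "x [^] n \<otimes> z \<in> A" using pw[OF x] by blast
    have "x [^] n \<otimes> (c \<otimes> z) = c \<otimes> (x [^] n \<otimes> z)" using xA c(1) zc by (simp add: m_lcomm)
    then have "x [^] n \<in> {r \<in> A. r \<otimes> (c \<otimes> z) \<in> A}" using c(1) n xA by simp
    from prime_pow[OF P xA this] show ?thesis by simp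
  qed
  moreover have "c \<otimes> z \<in> fraction_field_in L A"
    using subringE(6)[OF subfieldE(1)[OF subfield_frac]] A_frac c(1) z by blast
  ultimately have "c \<otimes> z \<in> A" using triv by blast
  then show False using c(2) by simp
qed

text \<open>At a prime \<open>Q\<close> of height one the radical of \<open>(a)\<close> is \<open>Q\<close>. A single \<open>d\<close> works for all elements because the colon ideals of
  \<open>(a)\<close> by elements outside \<open>Q\<close> have a largest member.\<close>

lemma minimal_over_principal:
  assumes Q: "is_prime A Q" and min: "\<And>Q'. is_prime A Q' \<Longrightarrow> Q' \<subseteq> Q \<Longrightarrow> Q' \<noteq> {\<zero>} \<Longrightarrow> Q' = Q"
    and a: "a \<in> Q" "a \<noteq> \<zero>"
  shows "\<exists>d\<in>A - Q. \<forall>x\<in>Q. \<exists>n::nat. \<exists>s\<in>A. d \<otimes> x [^] n = a \<otimes> s"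
proof -
  note Qi = prime_ideal[OF Q]
  have aA: "a \<in> A" using I_A[OF Qi a(1)] .
  define aA' where "aA' = {a \<otimes> s | s. s \<in> A}"
  have aAI: "a \<otimes> s \<in> aA'" if "s \<in> A" for s
    unfolding aA'_def using that by (intro CollectI exI[of _ s] conjI refl)
  have aAE: "\<exists>s. x = a \<otimes> s \<and> s \<in> A" if "x \<in> aA'" for x
    using that by (simp only: aA'_def mem_Collect_eq)
  have aA_ideal: "is_ideal A aA'"
  proof (rule is_idealI)
    show "aA' \<subseteq> A" using aA aAE by fastforce
    show "\<zero> \<in> aA'" using aAI[OF A_zero] aA by simp
    fix x assume "x \<in> aA'"
    then obtain s where s: "x = a \<otimes> s" "s \<in> A" using aAE by meson
    show "b \<otimes> x \<in> aA'" if b: "b \<in> A" for b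
    proof -
      have "b \<otimes> x = a \<otimes> (b \<otimes> s)" unfolding s(1) using b s(2) aA by (simp add: m_lcomm)
      then show ?thesis using aAI[of "b \<otimes> s"] b s(2) by simp
    qed
    fix y assume "y \<in> aA'"
    then obtain t where t: "y = a \<otimes> t" "t \<in> A" using aAE by meson
    show "x \<oplus> y \<in> aA'"
    proof -
      have "x \<oplus> y = a \<otimes> (s \<oplus> t)" unfolding s(1) t(1) using t(2) s(2) aA by (simp add: r_distr)
      then show ?thesis using aAI[of "s \<oplus> t"] t(2) s(2) by simp
    qed
  qed
  let ?F = "{colon aA' d | d. d \<in> A - Q}"
  have "colon aA' \<one> \<in> ?F" using prime_one[OF Q] by (intro CollectI exI[of _ \<one>]) simp
  then have ne: "?F \<noteq> {}" by blast
  have idl: "?F \<subseteq> {I. is_ideal A I}" using colon_ideal[OF aA_ideal] by blast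
  obtain M where M: "M \<in> ?F" and mx: "\<And>J. J \<in> ?F \<Longrightarrow> M \<subseteq> J \<Longrightarrow> J = M"
    using maximal_ideal_in[OF ne idl] by meson
  obtain d where d: "d \<in> A" "d \<notin> Q" "M = colon aA' d" using M by blast
  have absorb: "x \<in> M" if x: "x \<in> A" and d': "d' \<in> A" "d' \<notin> Q" "x \<otimes> d' \<in> aA'" for x d'
  proof -
    have dd: "d \<otimes> d' \<in> A - Q" using d d' prime_mult[OF Q] by auto
    have "colon aA' (d \<otimes> d') \<in> ?F" using dd by (intro CollectI exI[of _ "d \<otimes> d'"] conjI refl)
    moreover have "M \<subseteq> colon aA' (d \<otimes> d')"
    proof
      fix z assume "z \<in> M"
      then have z: "z \<in> A" "z \<otimes> d \<in> aA'" unfolding d(3) colon_def by simp_all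
      have "d' \<otimes> (z \<otimes> d) \<in> aA'" by (rule I_l[OF aA_ideal d'(1) z(2)])
      moreover have "d' \<otimes> (z \<otimes> d) = z \<otimes> (d \<otimes> d')" using z(1) d(1) d'(1) by (simp add: m_ac)
      ultimately show "z \<in> colon aA' (d \<otimes> d')" using z(1) unfolding colon_def by simp
    qed
    ultimately have eq: "colon aA' (d \<otimes> d') = M" by (rule mx)
    have "d \<otimes> (x \<otimes> d') \<in> aA'" by (rule I_l[OF aA_ideal d(1) d'(3)])
    moreover have "d \<otimes> (x \<otimes> d') = x \<otimes> (d \<otimes> d')" using x d(1) d'(1) by (simp add: m_ac)
    ultimately have "x \<in> colon aA' (d \<otimes> d')" using x unfolding colon_def by simp
    then show ?thesis unfolding eq .
  qed
  have "\<exists>n::nat. \<exists>s\<in>A. d \<otimes> x [^] n = a \<otimes> s" if x: "x \<in> Q" for x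
  proof -
    have xA: "x \<in> A" using I_A[OF Qi x] .
    have "\<exists>n::nat. \<exists>d'\<in>A - Q. x [^] n \<otimes> d' \<in> aA'"
    proof (rule ccontr)
      assume no: "\<not> ?thesis"
      define W where "W = {w \<otimes> x [^] (n::nat) | w n. w \<in> A - Q}"
      have WI: "w \<otimes> x [^] n \<in> W" if "w \<in> A - Q" for w and n :: nat
        unfolding W_def using that by (intro CollectI exI[of _ w] exI[of _ n] conjI refl)
      have WE: "\<exists>w. \<exists>n::nat. y = w \<otimes> x [^] n \<and> w \<in> A - Q" if "y \<in> W" for y
        using that by (simp only: W_def mem_Collect_eq)
      have disj: "aA' \<inter> W = {}"
      proof (rule ccontr)
        assume "aA' \<inter> W \<noteq> {}"
        then obtain y where y: "y \<in> aA'" "y \<in> W" by (meson disjoint_iff)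
        obtain w and n :: nat where w': "y = w \<otimes> x [^] n" "w \<in> A - Q" using WE[OF y(2)] by blast
        then have w: "w \<in> A - Q" "w \<otimes> x [^] n \<in> aA'" using y(1) by simp_all
        have "w \<otimes> x [^] n = x [^] n \<otimes> w" using w(1) xA by (intro m_comm) auto
        then have "x [^] n \<otimes> w \<in> aA'" using w(2) by simp
        then show False using no w(1) by meson
      qed
      have memW: "w \<in> W" if "w \<in> A - Q" for w
        using WI[OF that, of 0] that by simp
      have W1: "\<one> \<in> W" by (rule memW) (use prime_one[OF Q] in simp)
      have W2: "a \<otimes> b \<in> W" if "a \<in> W" "b \<in> W" for a b
      proof -
        obtain v m where v: "a = v \<otimes> x [^] (m::nat)" "v \<in> A - Q" using WE[OF \<open>a \<in> W\<close>] by blast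
        obtain w n where w: "b = w \<otimes> x [^] (n::nat)" "w \<in> A - Q" using WE[OF \<open>b \<in> W\<close>] by blast
        have "a \<otimes> b = (v \<otimes> w) \<otimes> x [^] (m + n)"
          unfolding v w using v(2) w(2) xA by (simp add: nat_pow_mult[symmetric] m_ac)
        moreover have "v \<otimes> w \<in> A - Q" using v w prime_mult[OF Q] by auto
        ultimately show ?thesis using WI[of "v \<otimes> w" "m + n"] by simp
      qed
      obtain Q' where Q': "is_prime A Q'" "aA' \<subseteq> Q'" "Q' \<inter> W = {}"
        using prime_avoiding[OF aA_ideal disj W1 W2] by blast
      have le: "Q' \<subseteq> Q"
      proof
        fix w assume w: "w \<in> Q'"
        then have "w \<in> A" "w \<notin> W" using I_A[OF prime_ideal[OF Q'(1)]] Q'(3) by blast+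
        then show "w \<in> Q" using memW[of w] by blast
      qed
      have "a \<in> aA'" using aAI[OF A_one] aA by simp
      then have "a \<in> Q'" using Q'(2) by (rule set_mp[rotated])
      then have "Q' = Q" using min[OF Q'(1) le] a(2) by blast
      have "x \<in> W" using WI[of \<one> 1] prime_one[OF Q] xA by simp
      then have "x \<notin> Q'" using Q'(3) by (meson disjoint_iff)
      then show False using \<open>Q' = Q\<close> x by simp
    qed
    then obtain n :: nat and d' where d': "d' \<in> A" "d' \<notin> Q" "x [^] n \<otimes> d' \<in> aA'" by (elim exE bexE DiffE)
    have "x [^] n \<in> M" by (rule absorb[OF _ d']) (use xA in simp)
    then have "x [^] n \<otimes> d \<in> aA'" unfolding d(3) colon_def by simp
    then obtain s where "x [^] n \<otimes> d = a \<otimes> s" "s \<in> A" using aAE by meson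
    then show ?thesis using xA d(1) by (metis A_carr A_pow m_comm)
  qed
  then show ?thesis using d by blast
qed

end

context finite_extension
begin

context
  fixes P Q
  assumes P: "P \<in> R.centers" and Q: "Q \<in> S.centers" and QP: "Q \<inter> R = P"
    and min: "\<And>Q'. is_prime S Q' \<Longrightarrow> Q' \<subseteq> Q \<Longrightarrow> Q' \<noteq> {\<zero>} \<Longrightarrow> Q' = Q"
    and Pnz: "P \<noteq> {\<zero>}"
begin

lemma Pp: "is_prime R P" and Pi: "is_ideal R P" and Qp: "is_prime S Q" and Qi: "is_ideal S Q"
  using R.centersD(1)[OF P] S.centersD(1)[OF Q] R.prime_ideal S.prime_ideal by auto

lemma P_Q: "x \<in> P \<Longrightarrow> x \<in> Q" using QP by blast

text \<open>Suppose no such \<open>y\<close> exists. With \<open>a \<in> P\<close> and \<open>d\<close> from \<open>minimal_over_principal\<close>, the element \<open>z = d / a\<close> and its powers are multiplied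
  into \<open>S\<close> by powers of each element of \<open>P\<close>. By \<open>trivial_inverse_depth\<close> the coordinates of all powers of \<open>z\<close> then have a common
  denominator, so \<open>z\<close> is integral and \<open>d = a z \<in> Q\<close>. Working with coordinates avoids having to show that \<open>P\<close> has height one.\<close>

lemma base_inverse: "\<exists>y\<in>fraction_field_in L R. y \<notin> R \<and> (\<forall>r\<in>P. r \<otimes> y \<in> R)"
proof (rule ccontr)
  assume "\<not> ?thesis"
  then have triv: "y \<in> R" if "y \<in> fraction_field_in L R" "\<forall>r\<in>P. r \<otimes> y \<in> R" for y using that by blast
  obtain a where a: "a \<in> P" "a \<noteq> \<zero>" using Pnz R.I_zero[OF Pi] by blast
  have aR: "a \<in> R" using R.I_A[OF Pi a(1)] .
  have ac: "a \<in> carrier L" using aR by simp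
  obtain d where d: "d \<in> S" "d \<notin> Q" "\<forall>x\<in>Q. \<exists>n::nat. \<exists>s\<in>S. d \<otimes> x [^] n = a \<otimes> s"
    using S.minimal_over_principal[OF Qp min P_Q[OF a(1)] a(2)] by blast
  define z where "z = inv a \<otimes> d"
  have zc: "z \<in> carrier L" unfolding z_def using ac a(2) d(1) by simp
  have az: "a \<otimes> z = d" unfolding z_def using ac a(2) d(1) by (simp add: m_assoc[symmetric])
  obtain D where D: "D \<in> R" "D \<noteq> \<zero>" "\<And>s i. s \<in> S \<Longrightarrow> i < N \<Longrightarrow> D \<otimes> co N U s i \<in> R"
    "\<And>i. i < N \<Longrightarrow> D \<otimes> U i \<in> S" using bounded_coords by blast
  have co_R: "D \<otimes> co N U (z [^] k) i \<in> R" if i: "i < N" for k :: nat and i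
  proof (rule R.trivial_inverse_depth[OF triv])
    have cK: "co N U (z [^] k) i \<in> K" using co_in_K i zc by simp
    show "D \<otimes> co N U (z [^] k) i \<in> fraction_field_in L R"
      using cK D(1) K_eq K_mult R_in_K by blast
    show "P \<subseteq> R" using R.I_A[OF Pi] by blast
    fix x assume x: "x \<in> P"
    have xR: "x \<in> R" using R.I_A[OF Pi x] .
    obtain n :: nat and s where n: "s \<in> S" "d \<otimes> x [^] n = a \<otimes> s" using d(3) P_Q[OF x] by blast
    have xc: "x \<in> carrier L" using xR by simp
    have "a \<otimes> (z \<otimes> x [^] n) = a \<otimes> s" using az n(2) ac zc xc by (simp add: m_assoc[symmetric])
    then have zx: "z \<otimes> x [^] n = s" using m_lcancel[OF a(2) ac, of "z \<otimes> x [^] n" s] zc xc n(1) by simp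
    have "x [^] (n * k) \<otimes> z [^] k = s [^] k"
      unfolding zx[symmetric] using zc xc by (simp add: nat_pow_distrib nat_pow_pow m_comm)
    then have "x [^] (n * k) \<otimes> z [^] k \<in> S" using n(1) by simp
    from D(3)[OF this i] have "D \<otimes> (x [^] (n * k) \<otimes> co N U (z [^] k) i) \<in> R"
      using co_smult[OF U_basis, of "x [^] (n * k)" "z [^] k" i] xR zc i by simp
    then have "x [^] (n * k) \<otimes> (D \<otimes> co N U (z [^] k) i) \<in> R"
      using D(1) xc cK by (simp add: m_lcomm)
    then show "\<exists>n::nat. x [^] n \<otimes> (D \<otimes> co N U (z [^] k) i) \<in> R" by blast
  qed
  have zS: "z \<in> S"
  proof (rule S.almost_integral')
    show "z \<in> fraction_field_in L S" using zc L_frac by simp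
    show "D \<otimes> D \<in> S" "D \<otimes> D \<noteq> \<zero>" using D(1,2) mult_nz by simp_all
    fix k
    have zk: "z [^] (q ^ k) \<in> carrier L" using zc by simp
    have "D \<otimes> D \<otimes> z [^] (q ^ k) = D \<otimes> D \<otimes> nsum (\<lambda>i. co N U (z [^] (q ^ k)) i \<otimes> U i) N"
      using co_expand[OF zk] by simp
    also have "\<dots> = nsum (\<lambda>i. (D \<otimes> co N U (z [^] (q ^ k)) i) \<otimes> (D \<otimes> U i)) N"
      using D(1) co_in_K[OF zk] Uc by (subst nsum_ldistr) (auto intro!: nsum_cong simp: m_ac)
    also have "\<dots> \<in> S" using co_R D(4) by (intro S.A_nsum) simp
    finally show "D \<otimes> D \<otimes> z [^] (q ^ k) \<in> S" .
  qed
  then have "d \<in> Q" using S.I_r[OF Qi zS P_Q[OF a(1)]] az by simp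
  then show False using d(2) by simp
qed

lemma top_inverse: "\<exists>b\<in>carrier L. b \<notin> S \<and> (\<forall>r\<in>Q. r \<otimes> b \<in> S)"
proof (rule ccontr)
  assume "\<not> ?thesis"
  then have triv: "y \<in> S" if "y \<in> fraction_field_in L S" "\<forall>r\<in>Q. r \<otimes> y \<in> S" for y
    using that L_frac by blast
  obtain a where a: "a \<in> P" "a \<noteq> \<zero>" using Pnz R.I_zero[OF Pi] by blast
  have aR: "a \<in> R" using R.I_A[OF Pi a(1)] .
  have ac: "a \<in> carrier L" using aR by simp
  obtain d where d: "d \<in> S" "d \<notin> Q" "\<forall>x\<in>Q. \<exists>n::nat. \<exists>s\<in>S. d \<otimes> x [^] n = a \<otimes> s"
    using S.minimal_over_principal[OF Qp min P_Q[OF a(1)] a(2)] by blast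
  define z where "z = inv a \<otimes> d"
  have zc: "z \<in> carrier L" unfolding z_def using ac a(2) d(1) by simp
  have az: "a \<otimes> z = d" unfolding z_def using ac a(2) d(1) by (simp add: m_assoc[symmetric])
  have zS: "z \<in> S"
  proof (rule S.trivial_inverse_depth[OF triv])
    show "Q \<subseteq> S" using S.I_A[OF Qi] by blast
    show "z \<in> fraction_field_in L S" using zc L_frac by simp
    fix x assume x: "x \<in> Q"
    have xc: "x \<in> carrier L" using S.I_carr[OF Qi x] .
    obtain n :: nat and s where n: "s \<in> S" "d \<otimes> x [^] n = a \<otimes> s" using d(3) x by blast
    have "a \<otimes> (x [^] n \<otimes> z) = a \<otimes> s"
      using az[symmetric] n(2) ac zc xc by (simp add: m_ac)
    then have "x [^] n \<otimes> z = s" using m_lcancel[OF a(2) ac, of "x [^] n \<otimes> z" s] zc xc n(1) by simp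
    then show "\<exists>n::nat. x [^] n \<otimes> z \<in> S" using n(1) by blast
  qed
  then have "d \<in> Q" using S.I_r[OF Qi zS P_Q[OF a(1)]] az by simp
  then show False using d(2) by simp
qed

text \<open>The localisation of \<open>R\<close> at \<open>P\<close>, inside \<open>K\<close>.\<close>

definition RP :: "'a set" where "RP = {k \<in> K. \<exists>w\<in>R - P. w \<otimes> k \<in> R}"

lemma complement_mult: "v \<in> R - P \<Longrightarrow> w \<in> R - P \<Longrightarrow> v \<otimes> w \<in> R - P"
  using R.prime_mult[OF Pp] by auto

lemma complement_pow: "v \<in> R - P \<Longrightarrow> v [^] (n::nat) \<in> R - P"
  using R.prime_pow[OF Pp] by auto

lemma R_RP: "r \<in> R \<Longrightarrow> r \<in> RP"
  unfolding RP_def using R.prime_one[OF Pp] by (intro CollectI conjI bexI[of _ \<one>]) auto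

lemma common_complement:
  "(\<And>j. j < (n::nat) \<Longrightarrow> k j \<in> RP) \<Longrightarrow> \<exists>w\<in>R - P. \<forall>j<n. w \<otimes> k j \<in> R"
proof (induction n)
  case 0
  show ?case using R.prime_one[OF Pp] by (intro bexI[of _ \<one>]) auto
next
  case (Suc n)
  have "\<exists>w\<in>R - P. \<forall>j<n. w \<otimes> k j \<in> R" by (rule Suc.IH) (use Suc.prems in simp)
  then obtain v where v: "v \<in> R - P" "\<forall>j<n. v \<otimes> k j \<in> R" by blast
  obtain w where w: "w \<in> R - P" "w \<otimes> k n \<in> R" using Suc.prems[of n] unfolding RP_def by blast
  have kc: "k j \<in> carrier L" if "j < Suc n" for j using Suc.prems[OF that] unfolding RP_def by auto
  have "w \<otimes> v \<otimes> k j \<in> R" if j: "j < Suc n" for j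
  proof (cases "j = n")
    case True
    have "w \<otimes> v \<otimes> k n = v \<otimes> (w \<otimes> k n)" using v w kc[of n] by (simp add: m_ac)
    then show ?thesis using True v w by simp
  next
    case False
    have "w \<otimes> v \<otimes> k j = w \<otimes> (v \<otimes> k j)" using v w kc[OF j] by (simp add: m_assoc)
    then show ?thesis using False v w j by simp
  qed
  then show ?case using complement_mult[OF w(1) v(1)] by blast
qed

text \<open>Here \<open>y\<close> is the inverse of a uniformizer of \<open>R\<^sub>P\<close> by \<open>divisorial\<close>. If \<open>c\<close> had a pole of order at least \<open>q\<close> along \<open>P\<close>, then some
  multiple \<open>c r\<close> with \<open>r \<in> R\<close> would be \<open>y\<^sup>q a\<^sup>q \<rho>\<close> with \<open>a\<close> a unit at \<open>P\<close> and \<open>\<phi> \<rho> = 1\<close>. Its image under \<open>\<Psi>\<close> is \<open>y a\<close>, which has a pole.\<close>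

lemma pole_order_bound:
  assumes y: "y \<in> fraction_field_in L R" "y \<notin> R" "\<forall>r\<in>P. r \<otimes> y \<in> R"
    and c: "c \<in> K" "\<And>r. r \<in> R \<Longrightarrow> \<Psi> (c \<otimes> r) \<in> RP"
  shows "inv y [^] (q - 1) \<otimes> c \<in> RP"
proof -
  note div = R.divisorial[OF Pp Pnz y]
  have yK: "y \<in> K" using y(1) K_eq by simp
  have yc: "y \<in> carrier L" using yK by simp
  have ynz: "y \<noteq> \<zero>" using y(2) R.A_zero by blast
  have iy: "inv y \<in> K" "inv y \<in> carrier L" using yK ynz yc by auto
  have iyy: "inv y [^] n \<otimes> y [^] n = \<one>" for n :: nat
    using yc ynz iy by (simp add: nat_pow_distrib[symmetric] nat_pow_one)
  have cc: "c \<in> carrier L" using c(1) by simp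
  have resK: "inv y [^] (q - 1) \<otimes> c \<in> K" using iy c(1) by simp
  show ?thesis
  proof (cases "c = \<zero>")
    case True
    then show ?thesis using iy R_RP[OF R.A_zero] by simp
  next
    case False
    obtain b0 where b0: "b0 \<in> R" "b0 \<noteq> \<zero>" "b0 \<otimes> c \<in> R" using c(1) unfolding K_iff by blast
    define a0 where "a0 = b0 \<otimes> c"
    have a0: "a0 \<in> R" "a0 \<noteq> \<zero>" using b0 mult_nz[of b0 c] False cc by (auto simp: a0_def)
    obtain i where i: "a0 \<otimes> y [^] (i::nat) \<in> R - P" using div(3)[OF a0] by blast
    obtain j where j: "b0 \<otimes> y [^] (j::nat) \<in> R - P" using div(3)[OF b0(1,2)] by blast
    obtain t where t: "t \<in> P" "t \<otimes> y \<notin> P" using div(1) by blast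
    have tR: "t \<in> R" using R.I_A[OF Pi t(1)] .
    have tc: "t \<in> carrier L" and b0c: "b0 \<in> carrier L" and a0c: "a0 \<in> carrier L" using tR b0 a0 by auto
    have u: "t \<otimes> y \<in> R - P" using t y(3) by blast
    have un: "(t \<otimes> y) [^] n = t [^] n \<otimes> y [^] n" for n :: nat using tc yc by (rule nat_pow_distrib)
    show ?thesis
    proof (cases "j \<le> i + (q - 1)")
      case True
      define n where "n = i + (q - 1) - j"
      let ?w = "(b0 \<otimes> y [^] j) \<otimes> (t \<otimes> y) [^] n"
      have w: "?w \<in> R - P" by (rule complement_mult[OF j complement_pow[OF u]])
      have "y [^] i \<otimes> y [^] (q - 1) = y [^] j \<otimes> y [^] n"
        using yc True by (simp add: nat_pow_mult n_def)
      then have "y [^] j \<otimes> y [^] n \<otimes> inv y [^] (q - 1) = (y [^] i \<otimes> y [^] (q - 1)) \<otimes> inv y [^] (q - 1)" by argo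
      also have "\<dots> = y [^] i \<otimes> (inv y [^] (q - 1) \<otimes> y [^] (q - 1))"
      proof -
        have "(a \<otimes> b) \<otimes> c = a \<otimes> (c \<otimes> b)" if "a \<in> carrier L" "b \<in> carrier L" "c \<in> carrier L" for a b c
          using that by (simp only: m_ac m_closed)
        then show ?thesis using yc iy(2) by simp
      qed
      finally have "y [^] j \<otimes> y [^] n \<otimes> inv y [^] (q - 1) = y [^] i \<otimes> (inv y [^] (q - 1) \<otimes> y [^] (q - 1))" .
      then have yy: "y [^] j \<otimes> y [^] n \<otimes> inv y [^] (q - 1) = y [^] i" using iyy yc by simp
      have "?w \<otimes> (inv y [^] (q - 1) \<otimes> c) = (b0 \<otimes> c) \<otimes> t [^] n \<otimes> (y [^] j \<otimes> y [^] n \<otimes> inv y [^] (q - 1))"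
      proof -
        have "(b0 \<otimes> A) \<otimes> (T \<otimes> B) \<otimes> (C \<otimes> c) = (b0 \<otimes> c) \<otimes> T \<otimes> (A \<otimes> B \<otimes> C)"
          if "A \<in> carrier L" "B \<in> carrier L" "C \<in> carrier L" "T \<in> carrier L" for A B C T
          using that b0c cc by (simp only: m_ac m_closed)
        then show ?thesis unfolding un using yc iy tc by simp
      qed
      also have "\<dots> = (a0 \<otimes> y [^] i) \<otimes> t [^] n"
        unfolding yy a0_def[symmetric] using a0c tc yc by (simp add: m_ac)
      finally have "?w \<otimes> (inv y [^] (q - 1) \<otimes> c) \<in> R" using i tR by simp
      then show ?thesis using w resK unfolding RP_def by blast
    next
      case False
      define n where "n = j - i - q"
      have jn: "j = i + q + n" using False q_pos unfolding n_def by linarith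
      let ?a = "(a0 \<otimes> y [^] i) \<otimes> (t \<otimes> y) [^] n"
      have a: "?a \<in> R - P" by (rule complement_mult[OF i complement_pow[OF u]])
      obtain \<rho> where \<rho>: "\<rho> \<in> R" "\<phi> \<rho> = \<one>" using R.f_one by blast
      have ac: "?a \<in> carrier L" and \<rho>c: "\<rho> \<in> carrier L" using a \<rho> by auto
      let ?r = "(b0 \<otimes> y [^] j) \<otimes> t [^] n \<otimes> (?a [^] (q - 1) \<otimes> \<rho>)"
      have rR: "?r \<in> R" using j tR a \<rho> by simp
      have yj: "y [^] j = y [^] i \<otimes> y [^] q \<otimes> y [^] n" unfolding jn using yc by (simp add: nat_pow_mult)
      have "c \<otimes> ?r = (y \<otimes> ?a) [^] q \<otimes> \<rho>"
      proof -
        have "c \<otimes> ((b0 \<otimes> (A \<otimes> B \<otimes> C)) \<otimes> T \<otimes> (E \<otimes> \<rho>)) = B \<otimes> (((b0 \<otimes> c) \<otimes> A) \<otimes> (T \<otimes> C) \<otimes> E) \<otimes> \<rho>"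
          if "A \<in> carrier L" "B \<in> carrier L" "C \<in> carrier L" "T \<in> carrier L" "E \<in> carrier L" for A B C T E
          using that b0c cc \<rho>c by (simp only: m_ac m_closed)
        then have "c \<otimes> ?r = y [^] q \<otimes> (?a \<otimes> ?a [^] (q - 1)) \<otimes> \<rho>"
          unfolding yj a0_def[symmetric] un[symmetric] using yc tc ac by (simp add: un a0_def[symmetric])
        also have "?a \<otimes> ?a [^] (q - 1) = ?a [^] q" by (rule frob_split[OF ac, symmetric])
        finally show ?thesis using yc ac by (simp add: frob_mult)
      qed
      then have "\<Psi> (c \<otimes> ?r) = (y \<otimes> ?a) \<otimes> \<Psi> \<rho>" using Psi_lin[of "y \<otimes> ?a" \<rho>] yc ac \<rho>c by simp
      also have "\<dots> = y \<otimes> ?a" using Psi_R[OF \<rho>(1)] \<rho>(2) yc ac by simp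
      finally have "y \<otimes> ?a \<in> RP" using c(2)[OF rR] by simp
      then obtain w where w: "w \<in> R - P" "w \<otimes> (y \<otimes> ?a) \<in> R" unfolding RP_def by blast
      have "(w \<otimes> ?a) \<otimes> y = w \<otimes> (y \<otimes> ?a)" using w(1) ac yc by (simp add: m_ac)
      then have "(w \<otimes> ?a) \<otimes> y \<in> R" using w(2) by simp
      then have "w \<otimes> ?a \<in> P" using div(2)[of "w \<otimes> ?a"] complement_mult[OF w(1) a] by blast
      then show ?thesis using complement_mult[OF w(1) a] by blast
    qed
  qed
qed

text \<open>The dual of \<open>S\<close> under the trace form has bounded denominators, by expansion in the dual basis of \<open>U\<close>.\<close>

lemma bounded_dual:
  "\<exists>D\<in>R. D \<noteq> \<zero> \<and> (\<forall>z\<in>carrier L. (\<forall>x\<in>S. Tr (z \<otimes> x) \<in> RP) \<longrightarrow> (\<exists>w\<in>R - P. w \<otimes> (D \<otimes> z) \<in> S))"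
proof -
  obtain v where v: "\<And>i. i < N \<Longrightarrow> v i \<in> carrier L"
    and dual: "\<And>i j. i < N \<Longrightarrow> j < N \<Longrightarrow> Tr (v i \<otimes> U j) = (if i = j then \<one> else \<zero>)"
    using dual_basis[OF Tr_functional U_basis] by blast
  obtain E where E: "E \<in> R" "E \<noteq> \<zero>" "\<forall>i<N. E \<otimes> v i \<in> S" using clear_denominators[of N v] v by blast
  obtain D where D: "D \<in> R" "D \<noteq> \<zero>" "\<And>i. i < N \<Longrightarrow> D \<otimes> U i \<in> S" using bounded_coords by blast
  have "\<exists>w\<in>R - P. w \<otimes> (D \<otimes> E \<otimes> z) \<in> S" if z: "z \<in> carrier L" and tz: "\<forall>x\<in>S. Tr (z \<otimes> x) \<in> RP" for z
  proof -
    have "Tr (z \<otimes> (D \<otimes> U j)) \<in> RP" if "j < N" for j using tz D(3)[OF that] by blast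
    then obtain w where w: "w \<in> R - P" "\<forall>j<N. w \<otimes> Tr (z \<otimes> (D \<otimes> U j)) \<in> R"
      using common_complement[of N "\<lambda>j. Tr (z \<otimes> (D \<otimes> U j))"] by blast
    have wc: "w \<in> carrier L" and Dc: "D \<in> carrier L" and Ec: "E \<in> carrier L" using w(1) D(1) E(1) by auto
    have tK: "Tr (z \<otimes> U j) \<in> carrier L" if "j < N" for j using z Uc[OF that] by simp
    have tD: "Tr (z \<otimes> (D \<otimes> U j)) = D \<otimes> Tr (z \<otimes> U j)" if "j < N" for j
      using Tr_smult[of D "z \<otimes> U j"] z Uc[OF that] D(1) by (simp add: m_lcomm)
    have "w \<otimes> (D \<otimes> E \<otimes> z) = w \<otimes> (D \<otimes> E \<otimes> nsum (\<lambda>j. Tr (z \<otimes> U j) \<otimes> v j) N)"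
      using dual_expansion[OF Tr_functional U_basis v dual z] by simp
    also have "\<dots> = (w \<otimes> (D \<otimes> E)) \<otimes> nsum (\<lambda>j. Tr (z \<otimes> U j) \<otimes> v j) N"
      using wc Dc Ec tK v by (simp add: m_assoc)
    also have "\<dots> = nsum (\<lambda>j. (w \<otimes> Tr (z \<otimes> (D \<otimes> U j))) \<otimes> (E \<otimes> v j)) N"
      using wc Dc Ec tK v by (subst nsum_ldistr) (auto intro!: nsum_cong simp: tD m_ac)
    also have "\<dots> \<in> S" using w(2) E(3) by (intro S.A_nsum) simp
    finally show ?thesis using w(1) by blast
  qed
  then show ?thesis using D(1,2) E(1,2) mult_nz by (intro bexI[of _ "D \<otimes> E"]) auto
qed

text \<open>Let \<open>y\<close> and \<open>b\<close> be inverse uniformizers at \<open>P\<close> and \<open>Q\<close>, and let \<open>I\<close> be the dual of \<open>S\<close> at \<open>P\<close> under the trace form. In terms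
  of divisors at \<open>Q\<close>, \<open>I\<close> is the inverse different, and the claim for all \<open>s\<close> is that its pole order is less than the
  ramification index. Since \<open>\<psi>\<close> preserves \<open>Q\<close> and \<open>pole_order_bound\<close> controls \<open>\<phi>\<close>, the set \<open>I\<close> is stable under
  \<open>z \<mapsto> y\<^bsup>1 - q\<^esup> b\<^bsup>q - 1\<^esup> z\<^sup>q\<close>, up to a factor \<open>d\<close> that is a unit at \<open>Q\<close>. Starting from \<open>y s = y b\<^sup>-\<^sup>1 (b s)\<close>, iteration produces
  \<open>y b\<^sup>-\<^sup>1 (b s)\<^bsup>q^k\<^esup>\<close>, again up to powers of \<open>d\<close>. As \<open>I\<close> is bounded, \<open>b s d\<close> is almost integral at \<open>P\<close>, that is, \<open>s\<close> is divisible by the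
  uniformizer at \<open>Q\<close>.\<close>

lemma trace_colon_height_one:
  assumes s: "s \<in> trace_colon P" shows "s \<in> Q"
proof -
  have sS: "s \<in> S" and Trs: "\<And>x. x \<in> S \<Longrightarrow> Tr (s \<otimes> x) \<in> P" using s by (auto simp: trace_colon_def)
  obtain y where y: "y \<in> fraction_field_in L R" "y \<notin> R" "\<forall>r\<in>P. r \<otimes> y \<in> R" using base_inverse by blast
  have yK: "y \<in> K" using y(1) K_eq by simp
  have yc: "y \<in> carrier L" using yK by simp
  have ynz: "y \<noteq> \<zero>" using y(2) R.A_zero by blast
  have iy: "inv y \<in> K" "inv y \<in> carrier L" using yK ynz yc by auto
  obtain b where b: "b \<in> carrier L" "b \<notin> S" "\<forall>r\<in>Q. r \<otimes> b \<in> S" using top_inverse by blast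
  have bnz: "b \<noteq> \<zero>" using b(2) S.A_zero by blast
  have ib: "inv b \<in> carrier L" using b(1) bnz by simp
  have Qnz: "Q \<noteq> {\<zero>}" using Pnz P_Q R.I_zero[OF Pi] by blast
  have "b \<in> fraction_field_in L S" using b(1) L_frac by simp
  then obtain t where t: "t \<in> Q" "t \<otimes> b \<notin> Q" using S.divisorial(1)[OF Qp Qnz _ b(2,3)] by blast
  have tS: "t \<in> S" using S.I_A[OF Qi t(1)] .
  define d where "d = t \<otimes> b"
  have d: "d \<in> S" "d \<notin> Q" using t b(3) by (auto simp: d_def)
  have sc: "s \<in> carrier L" and tc: "t \<in> carrier L" and dc: "d \<in> carrier L" using sS tS d by auto
  define I where "I = {z \<in> carrier L. \<forall>x\<in>S. Tr (z \<otimes> x) \<in> RP}"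
  have I_S: "x \<otimes> z \<in> I" if "x \<in> S" "z \<in> I" for x z
  proof -
    have zc: "z \<in> carrier L" using that by (simp add: I_def)
    have "x \<otimes> z \<otimes> x' = z \<otimes> (x \<otimes> x')" if "x' \<in> S" for x' using \<open>x \<in> S\<close> that zc by (simp add: m_ac)
    then show ?thesis using that zc by (auto simp: I_def)
  qed
  have step: "inv y [^] (q - 1) \<otimes> (b [^] (q - 1) \<otimes> d \<otimes> z [^] q) \<in> I" if z: "z \<in> I" for z
  proof -
    have zc: "z \<in> carrier L" using z by (simp add: I_def)
    let ?c = "\<lambda>x. Tr (b [^] (q - 1) \<otimes> d \<otimes> z [^] q \<otimes> x)"
    have "inv y [^] (q - 1) \<otimes> ?c x \<in> RP" if x: "x \<in> S" for x
    proof (rule pole_order_bound[OF y])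
      have xc: "x \<in> carrier L" using x by simp
      show "?c x \<in> K" using b(1) dc zc xc by simp
      fix r assume r: "r \<in> R"
      have rc: "r \<in> carrier L" using r by simp
      have txr: "t \<otimes> x \<otimes> r \<in> Q" using S.I_r[OF Qi _ S.I_r[OF Qi x t(1)], of r] r by simp
      have bq: "b [^] q = b [^] (q - 1) \<otimes> b" using frob_split[OF b(1)] b(1) by (simp add: m_comm)
      have rE: "r \<otimes> (b [^] (q - 1) \<otimes> d \<otimes> z [^] q \<otimes> x) = (b \<otimes> z) [^] q \<otimes> (t \<otimes> x \<otimes> r)"
      proof -
        have "r \<otimes> (B \<otimes> (t \<otimes> b) \<otimes> Z \<otimes> x) = (B \<otimes> b) \<otimes> Z \<otimes> (t \<otimes> x \<otimes> r)"
          if "B \<in> carrier L" "Z \<in> carrier L" for B Z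
          using that rc tc b(1) xc by (simp only: m_ac m_closed)
        then show ?thesis unfolding d_def using b(1) zc by (simp add: frob_mult bq)
      qed
      have Ec: "b [^] (q - 1) \<otimes> d \<otimes> z [^] q \<otimes> x \<in> carrier L" using b(1) dc zc xc by simp
      have Fc: "(b \<otimes> z) [^] q \<otimes> (t \<otimes> x \<otimes> r) \<in> carrier L" using b(1) zc tc xc rc by simp
      have TE: "Tr (b [^] (q - 1) \<otimes> d \<otimes> z [^] q \<otimes> x) \<in> carrier L"
        using Tr_K[OF Ec] by simp
      have rK: "r \<in> K" using R.A_frac r K_eq by blast
      have "?c x \<otimes> r = Tr ((b \<otimes> z) [^] q \<otimes> (t \<otimes> x \<otimes> r))"
        unfolding rE[symmetric] Tr_smult[OF rK Ec] by (rule m_comm[OF TE rc])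
      then have "\<Psi> (?c x \<otimes> r) = Tr (\<Psi> ((b \<otimes> z) [^] q \<otimes> (t \<otimes> x \<otimes> r)))"
        using Psi_Tr[OF Fc] by argo
      also have "\<Psi> ((b \<otimes> z) [^] q \<otimes> (t \<otimes> x \<otimes> r)) = (b \<otimes> z) \<otimes> \<psi> (t \<otimes> x \<otimes> r)"
        using Psi_lin[of "b \<otimes> z" "t \<otimes> x \<otimes> r"] Psi_S[of "t \<otimes> x \<otimes> r"] S.I_A[OF Qi txr] S.I_carr[OF Qi txr] b(1) zc
        by simp
      also have "\<dots> = z \<otimes> (\<psi> (t \<otimes> x \<otimes> r) \<otimes> b)"
        using S.f_closed[OF S.I_A[OF Qi txr]] b(1) zc by (simp add: m_ac)
      also have "Tr \<dots> \<in> RP"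
        using z b(3) S.compatible_f[OF S.centersD(2)[OF Q] txr] by (simp add: I_def)
      finally show "\<Psi> (?c x \<otimes> r) \<in> RP" .
    qed
    moreover have "Tr (inv y [^] (q - 1) \<otimes> (b [^] (q - 1) \<otimes> d \<otimes> z [^] q) \<otimes> x) = inv y [^] (q - 1) \<otimes> ?c x"
      if "x \<in> S" for x
      using Tr_smult[of "inv y [^] (q - 1)" "b [^] (q - 1) \<otimes> d \<otimes> z [^] q \<otimes> x"] iy b(1) dc zc that
      by (simp add: m_assoc)
    ultimately show ?thesis using iy b(1) dc zc by (simp add: I_def)
  qed
  define g where "g = b \<otimes> s"
  have gc: "g \<in> carrier L" using b(1) sc by (simp add: g_def)
  have inI: "y \<otimes> inv b \<otimes> g [^] (q ^ k) \<otimes> d [^] (q ^ k - 1) \<in> I" for k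
  proof (induction k)
    case 0
    have e: "y \<otimes> inv b \<otimes> g [^] (q ^ 0) \<otimes> d [^] (q ^ 0 - 1) = y \<otimes> s"
    proof -
      have "y \<otimes> inv b \<otimes> (b \<otimes> s) = y \<otimes> (inv b \<otimes> b) \<otimes> s" using yc ib b(1) sc by (simp only: m_ac m_closed)
      then show ?thesis using yc ib b(1) bnz sc by (simp add: g_def)
    qed
    have "Tr (y \<otimes> s \<otimes> x) \<in> RP" if x: "x \<in> S" for x
    proof -
      have "Tr (y \<otimes> s \<otimes> x) = y \<otimes> Tr (s \<otimes> x)" using Tr_smult[OF yK, of "s \<otimes> x"] yc sc x by (simp add: m_assoc)
      also have "\<dots> = Tr (s \<otimes> x) \<otimes> y" using yc sc x by (simp add: m_comm)
      finally show ?thesis using R_RP y(3) Trs[OF x] by simp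
    qed
    then show ?case unfolding e using yc sc by (simp add: I_def)
  next
    case (Suc k)
    let ?Q = "q ^ k"
    have Qpos: "1 \<le> ?Q" using one_le_power[of q k] q_pos by linarith
    \<comment> \<open>multiplying by d^(q - 2) brings the exponent of d to the expected value\<close>
    have exp: "(q - 2) + (1 + (?Q - 1) * q) = q ^ Suc k - 1"
    proof -
      have "(?Q - 1) * q + q = q ^ Suc k" using Qpos by (metis le_add_diff_inverse2 mult.commute mult_Suc power_Suc add.commute plus_1_eq_Suc)
      then show ?thesis using q_ge2 by linarith
    qed
    have "d [^] (q - 2) \<otimes> (inv y [^] (q - 1) \<otimes> (b [^] (q - 1) \<otimes> d \<otimes> (y \<otimes> inv b \<otimes> g [^] ?Q \<otimes> d [^] (?Q - 1)) [^] q)) \<in> I"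
      by (rule I_S[OF _ step[OF Suc]]) (use d in simp)
    moreover have "d [^] (q - 2) \<otimes> (inv y [^] (q - 1) \<otimes> (b [^] (q - 1) \<otimes> d \<otimes> (y \<otimes> inv b \<otimes> g [^] ?Q \<otimes> d [^] (?Q - 1)) [^] q))
      = y \<otimes> inv b \<otimes> g [^] (q ^ Suc k) \<otimes> d [^] (q ^ Suc k - 1)"
    proof -
      have "(y \<otimes> inv b \<otimes> g [^] ?Q \<otimes> d [^] (?Q - 1)) [^] q =
          (y \<otimes> y [^] (q - 1)) \<otimes> (inv b \<otimes> inv b [^] (q - 1)) \<otimes> g [^] (q ^ Suc k) \<otimes> d [^] ((?Q - 1) * q)"
        using yc ib gc dc by (simp add: frob_mult nat_pow_pow mult.commute frob_split[of y] frob_split[of "inv b"])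
      moreover have "E \<otimes> (A \<otimes> (B \<otimes> d \<otimes> ((y \<otimes> A') \<otimes> (inv b \<otimes> B') \<otimes> G \<otimes> F))) =
          (A \<otimes> A') \<otimes> (B' \<otimes> B) \<otimes> (y \<otimes> inv b \<otimes> G \<otimes> (E \<otimes> (d \<otimes> F)))"
        if "A \<in> carrier L" "B \<in> carrier L" "A' \<in> carrier L" "B' \<in> carrier L" "E \<in> carrier L" "F \<in> carrier L" "G \<in> carrier L"
        for A B A' B' E F G
        using that yc ib dc by (simp only: m_ac m_closed)
      moreover have "inv y [^] (q - 1) \<otimes> y [^] (q - 1) = \<one>"
        using yc ynz iy by (simp add: nat_pow_distrib[symmetric] nat_pow_one)
      moreover have "inv b [^] (q - 1) \<otimes> b [^] (q - 1) = \<one>"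
        using b(1) bnz ib by (simp add: nat_pow_distrib[symmetric] nat_pow_one)
      moreover have "d [^] (q - 2) \<otimes> (d \<otimes> d [^] ((?Q - 1) * q)) = d [^] (q ^ Suc k - 1)"
      proof -
        have "d \<otimes> d [^] ((?Q - 1) * q) = d [^] (1 + (?Q - 1) * q)"
          using nat_pow_mult[OF dc, of 1 "(?Q - 1) * q"] dc by simp
        then show ?thesis unfolding exp[symmetric] using dc by (simp only: nat_pow_mult)
      qed
      ultimately show ?thesis using yc ib iy gc dc b(1) by simp
    qed
    ultimately show ?case by simp
  qed
  obtain D where D: "D \<in> R" "D \<noteq> \<zero>"
    and bd: "\<And>z. z \<in> I \<Longrightarrow> \<exists>w\<in>R - P. w \<otimes> (D \<otimes> z) \<in> S"
    using bounded_dual unfolding I_def by blast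
  have ybd: "inv y \<otimes> b \<otimes> d \<in> carrier L" using iy b(1) dc by simp
  obtain h where h: "h \<in> R" "h \<noteq> \<zero>" "h \<otimes> (inv y \<otimes> b \<otimes> d) \<in> S" using clear_denominator[OF ybd] by blast
  have hc: "h \<in> carrier L" and Dc: "D \<in> carrier L" using h D by auto
  have "\<exists>w\<in>R - P. w \<otimes> (g \<otimes> d) \<in> S"
  proof (rule S.almost_integral)
    show "g \<otimes> d \<in> fraction_field_in L S" using gc dc L_frac[symmetric] by simp
    show "D \<otimes> h \<in> S" "D \<otimes> h \<noteq> \<zero>" using D h mult_nz by simp_all
    show "R - P \<subseteq> S - {\<zero>}" using R.I_zero[OF Pi] R_S by blast
    fix k
    let ?z = "y \<otimes> inv b \<otimes> g [^] (q ^ k) \<otimes> d [^] (q ^ k - 1)"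
    have zc: "?z \<in> carrier L" using yc ib gc dc by simp
    obtain w where w: "w \<in> R - P" "w \<otimes> (D \<otimes> ?z) \<in> S" using bd[OF inI] by blast
    have wc: "w \<in> carrier L" using w(1) by simp
    have "(g \<otimes> d) [^] (q ^ k) = (inv y \<otimes> b \<otimes> d) \<otimes> ?z"
    proof -
      have Qpos: "q ^ k = Suc (q ^ k - 1)" using one_le_power[of q k] q_pos by linarith
      have "d [^] (q ^ k) = d [^] Suc (q ^ k - 1)" using Qpos by simp
      also have "\<dots> = d [^] (q ^ k - 1) \<otimes> d" by (rule nat_pow_Suc)
      finally have dq: "d [^] (q ^ k) = d [^] (q ^ k - 1) \<otimes> d" .
      have "(inv y \<otimes> b \<otimes> d) \<otimes> (y \<otimes> inv b \<otimes> G \<otimes> E) = (inv y \<otimes> y) \<otimes> (b \<otimes> inv b) \<otimes> (G \<otimes> (E \<otimes> d))"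
        if "G \<in> carrier L" "E \<in> carrier L" for G E
        using that yc iy(2) ib b(1) dc by (simp only: m_ac m_closed)
      then show ?thesis using yc ynz ib b(1) bnz gc dc by (simp add: nat_pow_distrib dq)
    qed
    moreover have "D \<otimes> h \<otimes> w \<otimes> (Y \<otimes> Z) = (h \<otimes> Y) \<otimes> (w \<otimes> (D \<otimes> Z))"
      if "Y \<in> carrier L" "Z \<in> carrier L" for Y Z
      using that Dc hc wc by (simp only: m_ac m_closed)
    ultimately have "D \<otimes> h \<otimes> w \<otimes> (g \<otimes> d) [^] (q ^ k) = (h \<otimes> (inv y \<otimes> b \<otimes> d)) \<otimes> (w \<otimes> (D \<otimes> ?z))"
      using ybd zc by simp
    then have "D \<otimes> h \<otimes> w \<otimes> (g \<otimes> d) [^] (q ^ k) \<in> S" using h(3) w(2) by simp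
    then show "\<exists>w\<in>R - P. D \<otimes> h \<otimes> w \<otimes> (g \<otimes> d) [^] (q ^ k) \<in> S" using w(1) by blast
  qed
  then obtain w where w: "w \<in> R" "w \<notin> P" "w \<otimes> (g \<otimes> d) \<in> S" by blast
  have wQ: "w \<notin> Q" using w QP by blast
  have wc: "w \<in> carrier L" using w(1) by simp
  have "t \<otimes> (w \<otimes> (g \<otimes> d)) = (w \<otimes> (d \<otimes> d)) \<otimes> s"
    unfolding g_def using wc tc b(1) sc dc by (simp add: d_def m_ac)
  moreover have "t \<otimes> (w \<otimes> (g \<otimes> d)) \<in> Q" by (rule S.I_r[OF Qi w(3) t(1)])
  ultimately have "(w \<otimes> (d \<otimes> d)) \<otimes> s \<in> Q" by simp
  then show ?thesis
    using S.prime_mult[OF Qp, of "w \<otimes> (d \<otimes> d)" s] S.prime_mult[OF Qp, of w "d \<otimes> d"] S.prime_mult[OF Qp, of d d]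
      w(1) wQ d sS by auto
qed

end
end

section \<open>Tameness, fibers and test ideals\<close>

context finite_extension
begin

text \<open>Tameness over \<open>P\<close> means \<open>P\<^sup>T\<^sup>r \<subseteq> Q\<close> for all primes \<open>Q\<close> over \<open>P\<close>, by \<open>radical_subset_trace_colon\<close> and \<open>radical_of_extended\<close>.\<close>

definition tame :: "'a set \<Rightarrow> bool" where
  "tame P \<longleftrightarrow> trace_colon P = {x \<in> S. \<exists>n::nat. x [^] n \<in> extended P}"

definition fibers :: bool where
  "fibers \<longleftrightarrow> S.centers = {Q. is_prime S Q \<and> Q \<inter> R \<in> R.centers}"

lemma tame_fiber:
  assumes t: "tame P" and Q: "is_prime S Q" "Q \<inter> R = P"
  shows "trace_colon P \<subseteq> Q"
proof
  fix x assume "x \<in> trace_colon P"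
  then obtain n :: nat where x: "x \<in> S" "x [^] n \<in> extended P" using t unfolding tame_def by blast
  have "extended P \<subseteq> Q" by (rule extended_least[OF S.prime_ideal[OF Q(1)]]) (use Q in blast)
  then have "x [^] n \<in> Q" using x by blast
  then show "x \<in> Q" by (rule S.prime_pow[OF Q(1) x(1)])
qed

text \<open>Between \<open>P\<^sup>T\<^sup>r\<close> and a prime \<open>Q\<close> over \<open>P\<close> there is a center of \<open>S\<close>. It contains \<open>P\<close>, so it equals \<open>Q\<close> by incomparability.\<close>

lemma tame_imp_fibers:
  assumes t: "\<And>P. P \<in> R.centers \<Longrightarrow> tame P"
  shows fibers
  unfolding fibers_def
proof (intro equalityI subsetI CollectI conjI)
  fix Q assume Q: "Q \<in> S.centers"
  show "is_prime S Q" by (rule S.centersD(1)[OF Q])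
  show "Q \<inter> R \<in> R.centers" by (rule contract_center[OF Q])
next
  fix Q assume "Q \<in> {Q. is_prime S Q \<and> Q \<inter> R \<in> R.centers}"
  then have Q: "is_prime S Q" "Q \<inter> R \<in> R.centers" by auto
  let ?P = "Q \<inter> R"
  have le: "trace_colon ?P \<subseteq> Q" by (rule tame_fiber[OF t[OF Q(2)] Q(1) refl])
  obtain Q' where Q': "Q' \<in> S.centers" "trace_colon ?P \<subseteq> Q'" "Q' \<subseteq> Q"
    using S.center_between[OF trace_colon_compatible[OF R.centersD(2)[OF Q(2)]] Q(1) le] by blast
  have "?P \<subseteq> Q'" using base_trace_colon[OF R.prime_ideal[OF R.centersD(1)[OF Q(2)]]] Q'(2) by blast
  then have "Q' = Q" by (rule incomparable[OF S.centersD(1)[OF Q'(1)] Q(1) Q'(3)])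
  then show "Q \<in> S.centers" using Q'(1) by simp
qed

text \<open>As \<open>P\<^sup>T\<^sup>r \<subseteq> Q\<close> does not contain the test ideal of \<open>Q\<close>, the trace of the latter is a compatible ideal not inside \<open>P\<close>; the test
  ideal of \<open>P\<close> is the smallest such.\<close>

lemma tame_imp_trace:
  assumes Q: "Q \<in> S.centers" and t: "tame (Q \<inter> R)"
  shows "Tr ` S.test_ideal Q = R.test_ideal (Q \<inter> R)"
proof (rule equalityI[OF trace_test_ideal_subset[OF Q]], rule R.test_ideal_least)
  show "R.compatible (Tr ` S.test_ideal Q)" by (rule trace_image_compatible[OF S.test_ideal_compatible])
  obtain s where s: "s \<in> S.test_ideal Q" "s \<notin> Q" using S.test_ideal_not_subset[OF S.centersD(1)[OF Q]] by blast
  note Ti = S.compatible_ideal[OF S.test_ideal_compatible[of Q]]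
  have sS: "s \<in> S" by (rule S.I_A[OF Ti s(1)])
  have "s \<notin> trace_colon (Q \<inter> R)" using tame_fiber[OF t S.centersD(1)[OF Q] refl] s(2) by blast
  then obtain x where x: "x \<in> S" "Tr (s \<otimes> x) \<notin> Q \<inter> R" using sS unfolding trace_colon_def by blast
  have "s \<otimes> x \<in> S.test_ideal Q" by (rule S.I_r[OF Ti x(1) s(1)])
  then have "Tr (s \<otimes> x) \<in> Tr ` S.test_ideal Q" by (rule imageI)
  then show "\<not> Tr ` S.test_ideal Q \<subseteq> Q \<inter> R" using x(2) by (meson subsetD)
qed

lemma trace_colon_zero:
  assumes s: "s \<in> trace_colon {\<zero>}" shows "s = \<zero>"
proof -
  have sS: "s \<in> S" and z: "\<And>x. x \<in> S \<Longrightarrow> Tr (s \<otimes> x) = \<zero>" using s by (auto simp: trace_colon_def)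
  have sc: "s \<in> carrier L" using sS by simp
  show ?thesis
  proof (rule functional_nondegenerate[OF Tr_functional sc])
    fix x assume x: "x \<in> carrier L"
    obtain r where r: "r \<in> R" "r \<noteq> \<zero>" "r \<otimes> x \<in> S" using clear_denominator[OF x] by blast
    have rc: "r \<in> carrier L" using r(1) by simp
    have "s \<otimes> (r \<otimes> x) = r \<otimes> (s \<otimes> x)" using sc rc x by (rule m_lcomm)
    then have "r \<otimes> Tr (s \<otimes> x) = \<zero>" using z[OF r(3)] Tr_smult[of r "s \<otimes> x"] r(1) sc x by simp
    then show "Tr (s \<otimes> x) = \<zero>" using r(2) rc sc x integral_iff[of r "Tr (s \<otimes> x)"] by simp
  qed
qed

text \<open>This is why (c) implies (a): at height at most one, being a center already controls the trace. For height zero the claim is that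
  the trace form is non-degenerate.\<close>

lemma low_height_fiber:
  assumes P: "P \<in> R.centers" and Q: "Q \<in> S.centers" and QP: "Q \<inter> R = P"
    and min: "\<And>Q'. is_prime S Q' \<Longrightarrow> Q' \<subseteq> Q \<Longrightarrow> Q' \<noteq> {\<zero>} \<Longrightarrow> Q' = Q"
  shows "trace_colon P \<subseteq> Q"
proof
  fix s assume s: "s \<in> trace_colon P"
  show "s \<in> Q"
  proof (cases "P = {\<zero>}")
    case True
    then have "s = \<zero>" using trace_colon_zero s by simp
    then show ?thesis using S.I_zero[OF S.prime_ideal[OF S.centersD(1)[OF Q]]] by simp
  next
    case False
    show ?thesis by (rule trace_colon_height_one[OF P Q QP min False s])
  qed
qed

text \<open>If \<open>P\<^sup>T\<^sup>r\<close> were not inside \<open>Q\<close>, it would contain the test ideal of \<open>Q\<close>, whose trace would lie in \<open>P\<close>. But the test ideal of \<open>P\<close>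
  does not.\<close>

lemma trace_fiber:
  assumes Q: "Q \<in> S.centers" and t: "Tr ` S.test_ideal Q = R.test_ideal (Q \<inter> R)"
  shows "trace_colon (Q \<inter> R) \<subseteq> Q"
proof (rule ccontr)
  assume n: "\<not> ?thesis"
  have P: "Q \<inter> R \<in> R.centers" by (rule contract_center[OF Q])
  have le: "S.test_ideal Q \<subseteq> trace_colon (Q \<inter> R)"
    by (rule S.test_ideal_least[OF trace_colon_compatible[OF R.centersD(2)[OF P]] n])
  have "Tr s \<in> Q \<inter> R" if "s \<in> S.test_ideal Q" for s
  proof -
    have "s \<in> trace_colon (Q \<inter> R)" using le that by blast
    then have s: "s \<in> S" "\<forall>t\<in>S. Tr (s \<otimes> t) \<in> Q \<inter> R" unfolding trace_colon_def by blast+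
    have "Tr (s \<otimes> \<one>) \<in> Q \<inter> R" by (rule s(2)[rule_format, OF S.A_one])
    then show ?thesis using s(1) by simp
  qed
  then have "R.test_ideal (Q \<inter> R) \<subseteq> Q \<inter> R" unfolding t[symmetric] by (rule image_subsetI)
  then show False using R.test_ideal_not_subset[OF R.centersD(1)[OF P]] by simp
qed

lemma fibers_imp_tame:
  assumes f: fibers and P: "P \<in> R.centers"
    and tr: "\<And>Q. Q \<in> S.centers \<Longrightarrow> Q \<inter> R = P \<Longrightarrow>
      (\<exists>Q'. is_prime S Q' \<and> Q' \<subset> Q \<and> Q' \<noteq> {\<zero>}) \<Longrightarrow> Tr ` S.test_ideal Q = R.test_ideal P"
  shows "tame P"
  unfolding tame_def
proof (intro equalityI subsetI CollectI conjI)
  fix s assume s: "s \<in> trace_colon P"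
  then show sS: "s \<in> S" by (simp add: trace_colon_def)
  show "\<exists>n::nat. s [^] n \<in> extended P"
  proof (rule radical_of_extended[OF R.centersD(1)[OF P] sS])
    fix Q assume Q: "is_prime S Q" "Q \<inter> R = P"
    then have Qc: "Q \<in> S.centers" using f P unfolding fibers_def by blast
    have "trace_colon P \<subseteq> Q"
    proof (cases "\<exists>Q'. is_prime S Q' \<and> Q' \<subset> Q \<and> Q' \<noteq> {\<zero>}")
      case True
      then show ?thesis using trace_fiber[OF Qc] tr[OF Qc Q(2)] Q(2) by simp
    next
      case False
      show ?thesis by (rule low_height_fiber[OF P Qc Q(2)]) (use False in blast)
    qed
    then show "s \<in> Q" using s by blast
  qed
next
  fix x assume "x \<in> {x \<in> S. \<exists>n::nat. x [^] n \<in> extended P}"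
  then obtain n :: nat where "x \<in> S" "x [^] n \<in> extended P" by blast
  then show "x \<in> trace_colon P" by (rule radical_subset_trace_colon[OF R.centersD(2)[OF P]])
qed

text \<open>A center \<open>P\<close> containing the compatible ideal \<open>Tr(S)\<close> would have \<open>1 \<in> P\<^sup>T\<^sup>r\<close>.\<close>

lemma tame_imp_trace_surjective:
  assumes t: "\<And>P. P \<in> R.centers \<Longrightarrow> tame P"
  shows "Tr ` S = R"
proof (rule ccontr)
  assume n: "Tr ` S \<noteq> R"
  have c: "R.compatible (Tr ` S)" by (rule trace_image_compatible[OF S.compatible_whole])
  note ci = R.compatible_ideal[OF c]
  have "\<one> \<notin> Tr ` S"
  proof
    assume o: "\<one> \<in> Tr ` S"
    have "r \<in> Tr ` S" if r: "r \<in> R" for r using R.I_l[OF ci r o] r by simp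
    then have "R \<subseteq> Tr ` S" by blast
    moreover have "Tr ` S \<subseteq> R" using R.I_A[OF ci] by blast
    ultimately show False using n by simp
  qed
  then obtain P where P: "P \<in> R.centers" "Tr ` S \<subseteq> P" using R.center_avoiding[OF c R.A_one] by blast
  have "\<one> \<in> trace_colon P" using P(2) unfolding trace_colon_def by auto
  then obtain n :: nat where "\<one> [^] n \<in> extended P" using t[OF P(1)] unfolding tame_def by blast
  then show False using one_notin_extended[OF R.centersD(1)[OF P(1)]] by simp
qed

end

section \<open>Galois extensions\<close>

context ambient_field
begin

text \<open>The coefficients, lowest first, of the monic polynomial with the given roots. As a function of a list
  it is defined by recursion; \<open>root_coeff_mset\<close> is invariance under permutations of the roots.\<close>

primrec root_coeff :: "'a list \<Rightarrow> nat \<Rightarrow> 'a" where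
  "root_coeff [] = (\<lambda>k. if k = 0 then \<one> else \<zero>)"
| "root_coeff (y # ys) = (\<lambda>k. (case k of 0 \<Rightarrow> \<zero> | Suc j \<Rightarrow> root_coeff ys j) \<oplus> \<ominus> y \<otimes> root_coeff ys k)"

lemma root_coeff_closed [simp]: "set ys \<subseteq> carrier L \<Longrightarrow> root_coeff ys k \<in> carrier L"
  by (induction ys arbitrary: k) (auto split: nat.split)

lemma root_coeff_above: "set ys \<subseteq> carrier L \<Longrightarrow> length ys < k \<Longrightarrow> root_coeff ys k = \<zero>"
  by (induction ys arbitrary: k) (auto split: nat.split)

lemma root_coeff_top: "set ys \<subseteq> carrier L \<Longrightarrow> root_coeff ys (length ys) = \<one>"
  by (induction ys) (auto simp: root_coeff_above)

lemma root_coeff_swap: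
  assumes "x \<in> carrier L" "y \<in> carrier L" "set ys \<subseteq> carrier L"
  shows "root_coeff (x # y # ys) k = root_coeff (y # x # ys) k"
proof -
  have "(u \<oplus> \<ominus> y \<otimes> v) \<oplus> \<ominus> x \<otimes> (v \<oplus> \<ominus> y \<otimes> w) = (u \<oplus> \<ominus> x \<otimes> v) \<oplus> \<ominus> y \<otimes> (v \<oplus> \<ominus> x \<otimes> w)"
    if "u \<in> carrier L" "v \<in> carrier L" "w \<in> carrier L" for u v w
    using that assms(1,2) by algebra
  moreover have "\<zero> \<oplus> \<ominus> x \<otimes> (\<zero> \<oplus> \<ominus> y \<otimes> w) = \<zero> \<oplus> \<ominus> y \<otimes> (\<zero> \<oplus> \<ominus> x \<otimes> w)"
    if "w \<in> carrier L" for w using that assms(1,2) by algebra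
  ultimately show ?thesis using assms by (cases k) (simp_all split: nat.split)
qed

lemma root_coeff_cong: "root_coeff xs = root_coeff ys \<Longrightarrow> root_coeff (x # xs) = root_coeff (x # ys)"
  by (simp only: root_coeff.simps)

lemma root_coeff_move:
  "x \<in> carrier L \<Longrightarrow> set us \<subseteq> carrier L \<Longrightarrow> set vs \<subseteq> carrier L \<Longrightarrow>
    root_coeff (us @ x # vs) = root_coeff (x # us @ vs)"
proof (induction us)
  case (Cons u us)
  then have "root_coeff (u # us @ x # vs) = root_coeff (u # x # us @ vs)"
    by (intro root_coeff_cong) auto
  also have "\<dots> = root_coeff (x # u # us @ vs)"
    using Cons.prems by (intro ext root_coeff_swap) auto
  finally show ?case by (simp only: append_Cons)
qed simp

lemma root_coeff_mset: "mset xs = mset ys \<Longrightarrow> set xs \<subseteq> carrier L \<Longrightarrow> root_coeff xs = root_coeff ys"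
proof (induction xs arbitrary: ys)
  case (Cons x xs)
  have "x \<in> set ys" using Cons.prems(1) by (metis list.set_intros(1) mset_eq_setD)
  then obtain us vs where ys: "ys = us @ x # vs" using split_list by metis
  have m: "mset xs = mset (us @ vs)" using Cons.prems(1) by (simp add: ys)
  have s: "set us \<subseteq> carrier L" "set vs \<subseteq> carrier L" using mset_eq_setD[OF m] Cons.prems(2) by auto
  have "root_coeff xs = root_coeff (us @ vs)" using Cons.IH[OF m] Cons.prems(2) by simp
  then have "root_coeff (x # xs) = root_coeff (x # us @ vs)" by (rule root_coeff_cong)
  also have "\<dots> = root_coeff ys"
    unfolding ys using Cons.prems(2) s by (intro root_coeff_move[symmetric]) auto
  finally show ?case .
qed simp

lemma root_coeff_step:
  assumes "y \<in> carrier L" "set ys \<subseteq> carrier L" "z \<in> carrier L"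
  shows "nsum (\<lambda>k. root_coeff (y # ys) k \<otimes> z [^] k) (Suc (Suc (length ys))) =
    (z \<oplus> \<ominus> y) \<otimes> nsum (\<lambda>k. root_coeff ys k \<otimes> z [^] k) (Suc (length ys))"
proof -
  let ?n = "Suc (length ys)"
  let ?u = "\<lambda>k. (case k of 0 \<Rightarrow> \<zero> | Suc j \<Rightarrow> root_coeff ys j)"
  let ?S = "nsum (\<lambda>k. root_coeff ys k \<otimes> z [^] k) ?n"
  have u: "?u k \<in> carrier L" for k using assms by (simp split: nat.split)
  have Sc: "?S \<in> carrier L" using assms by (intro nsum_closed) simp
  have "nsum (\<lambda>k. root_coeff (y # ys) k \<otimes> z [^] k) (Suc ?n) =
      nsum (\<lambda>k. ?u k \<otimes> z [^] k \<oplus> \<ominus> y \<otimes> (root_coeff ys k \<otimes> z [^] k)) (Suc ?n)"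
    using u assms by (intro nsum_cong) (simp add: l_distr m_assoc)
  also have "\<dots> = nsum (\<lambda>k. ?u k \<otimes> z [^] k) (Suc ?n) \<oplus>
      nsum (\<lambda>k. \<ominus> y \<otimes> (root_coeff ys k \<otimes> z [^] k)) (Suc ?n)"
    using u assms by (intro nsum_add) simp_all
  also have "nsum (\<lambda>k. ?u k \<otimes> z [^] k) (Suc ?n) = nsum (\<lambda>k. z \<otimes> (root_coeff ys k \<otimes> z [^] k)) ?n"
  proof -
    have "nsum (\<lambda>k. ?u k \<otimes> z [^] k) (Suc ?n) = ?u 0 \<otimes> z [^] (0::nat) \<oplus> nsum (\<lambda>k. ?u (Suc k) \<otimes> z [^] Suc k) ?n"
      using u assms by (intro nsum_shift) simp
    also have "\<dots> = nsum (\<lambda>k. root_coeff ys k \<otimes> z [^] Suc k) ?n"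
      using assms by (simp del: nsum.simps nat_pow_Suc)
    also have "\<dots> = nsum (\<lambda>k. z \<otimes> (root_coeff ys k \<otimes> z [^] k)) ?n"
      using assms by (intro nsum_cong) (simp add: m_ac)
    finally show ?thesis .
  qed
  also have "\<dots> = z \<otimes> ?S" using assms by (intro nsum_ldistr[symmetric]) simp_all
  also have "nsum (\<lambda>k. \<ominus> y \<otimes> (root_coeff ys k \<otimes> z [^] k)) (Suc ?n) =
      \<ominus> y \<otimes> nsum (\<lambda>k. root_coeff ys k \<otimes> z [^] k) (Suc ?n)"
    using assms by (intro nsum_ldistr[symmetric]) simp_all
  also have "nsum (\<lambda>k. root_coeff ys k \<otimes> z [^] k) (Suc ?n) = ?S"
    using assms Sc by (simp add: root_coeff_above)
  also have "z \<otimes> ?S \<oplus> \<ominus> y \<otimes> ?S = (z \<oplus> \<ominus> y) \<otimes> ?S" using assms Sc by (simp add: l_distr)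
  finally show ?thesis .
qed

lemma root_coeff_root:
  "set ys \<subseteq> carrier L \<Longrightarrow> z \<in> set ys \<Longrightarrow>
    nsum (\<lambda>k. root_coeff ys k \<otimes> z [^] k) (Suc (length ys)) = \<zero>"
proof (induction ys)
  case (Cons y ys)
  have c: "y \<in> carrier L" "set ys \<subseteq> carrier L" "z \<in> carrier L" using Cons.prems by auto
  let ?S = "nsum (\<lambda>k. root_coeff ys k \<otimes> z [^] k) (Suc (length ys))"
  have Sc: "?S \<in> carrier L" using c by (intro nsum_closed) simp
  have "(z \<oplus> \<ominus> y) \<otimes> ?S = \<zero>"
  proof (cases "z = y")
    case True
    have "z \<oplus> \<ominus> y = \<zero>" unfolding True by (rule r_neg[OF c(1)])
    then show ?thesis using Sc by (simp del: nsum.simps)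
  next
    case False
    then have "?S = \<zero>" using Cons by simp
    then show ?thesis using c by (simp del: nsum.simps)
  qed
  then show ?case using root_coeff_step[OF c] by (simp only: length_Cons)
qed simp

lemma root_coeff_hom:
  assumes "\<And>x. x \<in> carrier L \<Longrightarrow> h x \<in> carrier L" "h \<one> = \<one>" "h \<zero> = \<zero>"
    and "\<And>x y. x \<in> carrier L \<Longrightarrow> y \<in> carrier L \<Longrightarrow> h (x \<otimes> y) = h x \<otimes> h y"
    and "\<And>x y. x \<in> carrier L \<Longrightarrow> y \<in> carrier L \<Longrightarrow> h (x \<oplus> y) = h x \<oplus> h y"
    and "\<And>x. x \<in> carrier L \<Longrightarrow> h (\<ominus> x) = \<ominus> h x"
  shows "set ys \<subseteq> carrier L \<Longrightarrow> h (root_coeff ys k) = root_coeff (map h ys) k"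
proof (induction ys arbitrary: k)
  case (Cons y ys)
  have "set (map h ys) \<subseteq> carrier L" using Cons.prems assms(1) by auto
  then have "root_coeff (map h ys) i \<in> carrier L" for i by (rule root_coeff_closed)
  then show ?case using Cons assms by (cases k) simp_all
qed (use assms in auto)

end

context subring_in
begin

lemma root_coeff_ideal:
  assumes J: "is_ideal A J"
  shows "set ys \<subseteq> J \<Longrightarrow> k < length ys \<Longrightarrow> root_coeff ys k \<in> J"
proof (induction ys arbitrary: k)
  case (Cons y ys)
  have y: "y \<in> J" and ys: "set ys \<subseteq> J" using Cons.prems by auto
  have A: "set ys \<subseteq> A" using ys I_A[OF J] by blast
  then have "root_coeff ys i \<in> A" for i
    by (induction ys arbitrary: i) (auto split: nat.split)
  then have "\<ominus> y \<otimes> root_coeff ys k \<in> J" by (intro I_r[OF J _ I_neg[OF J y]])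
  moreover have "(case k of 0 \<Rightarrow> \<zero> | Suc j \<Rightarrow> root_coeff ys j) \<in> J"
    using Cons.IH[OF ys] Cons.prems(2) I_zero[OF J] by (simp split: nat.split)
  ultimately show ?case using I_add[OF J] by simp
qed simp

end

context finite_extension
begin

definition automorphism :: "('a \<Rightarrow> 'a) \<Rightarrow> bool" where
  "automorphism h \<longleftrightarrow> h \<in> ring_iso L L \<and> (\<forall>k\<in>K. h k = k)"

definition orbit :: "'a \<Rightarrow> 'a set" where "orbit x = {h x | h. automorphism h}"

lemma orbitI: "automorphism h \<Longrightarrow> h x \<in> orbit x"
  unfolding orbit_def by (intro CollectI exI[of _ h] conjI refl)

lemma orbitE: "y \<in> orbit x \<Longrightarrow> \<exists>h. automorphism h \<and> y = h x"
  unfolding orbit_def by blast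

lemma orbit_self: "x \<in> orbit x"
proof -
  have "automorphism id" unfolding automorphism_def using ring_iso_set_refl by simp
  from orbitI[OF this, of x] show ?thesis by simp
qed

context
  fixes h assumes h: "automorphism h"
begin

lemma aut_iso: "h \<in> ring_iso L L" and aut_K [simp]: "k \<in> K \<Longrightarrow> h k = k"
  using h by (auto simp: automorphism_def)

lemma aut_closed [simp]: "x \<in> carrier L \<Longrightarrow> h x \<in> carrier L"
  and aut_mult: "x \<in> carrier L \<Longrightarrow> y \<in> carrier L \<Longrightarrow> h (x \<otimes> y) = h x \<otimes> h y"
  and aut_add: "x \<in> carrier L \<Longrightarrow> y \<in> carrier L \<Longrightarrow> h (x \<oplus> y) = h x \<oplus> h y"
  and aut_bij: "bij_betw h (carrier L) (carrier L)"
  using ring_iso_memE[OF aut_iso] by auto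

lemma aut_one: "h \<one> = \<one>" and aut_zero: "h \<zero> = \<zero>"
  using aut_K[OF R_in_K[OF R.A_one]] aut_K[OF R_in_K[OF R.A_zero]] by auto

lemma aut_inj: "x \<in> carrier L \<Longrightarrow> y \<in> carrier L \<Longrightarrow> h x = h y \<Longrightarrow> x = y"
  using aut_bij unfolding bij_betw_def inj_on_def by blast

lemma aut_neg: assumes x: "x \<in> carrier L" shows "h (\<ominus> x) = \<ominus> h x"
proof -
  have "h (\<ominus> x) \<oplus> h x = \<zero>" using x aut_add[of "\<ominus> x" x] by (simp add: l_neg aut_zero)
  then show ?thesis using x minus_equality by simp
qed

lemma aut_nsum: "(\<And>i. i < n \<Longrightarrow> u i \<in> carrier L) \<Longrightarrow> h (nsum u n) = nsum (\<lambda>i. h (u i)) n"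
  by (induction n) (auto simp: aut_zero aut_add)

lemma aut_Mon: "x \<in> carrier L \<Longrightarrow> m \<in> Mon x R n \<Longrightarrow> h m \<in> Mon (h x) R n"
proof (induction n arbitrary: m)
  case 0
  then show ?case by (simp add: aut_one)
next
  case (Suc n)
  obtain m' c where m: "m' \<in> Mon x R n" "c \<in> R" "m = x \<otimes> m' \<oplus> c" using Suc.prems(2) by auto
  have m'c: "m' \<in> carrier L" by (rule Mon_closed[OF Suc.prems(1) R.subrng_A m(1)])
  have "h m = h x \<otimes> h m' \<oplus> c" unfolding m(3) using m(2) m'c Suc.prems(1) by (simp add: aut_add aut_mult)
  moreover have "h x \<otimes> h m' \<oplus> c \<in> Mon (h x) R (Suc n)" by (rule MonI[OF Suc.IH[OF Suc.prems(1) m(1)] m(2)])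
  ultimately show ?case by simp
qed

text \<open>Conjugates of integral elements are integral, and \<open>S\<close> is the integral closure of \<open>R\<close> in \<open>L\<close>.\<close>

lemma aut_S: assumes s: "s \<in> S" shows "h s \<in> S"
proof -
  have sc: "s \<in> carrier L" using s by simp
  obtain d where d: "\<zero> \<in> Mon s R d" using integral[OF s] by blast
  have "\<zero> \<in> Mon (h s) R d" using aut_Mon[OF sc d] by (simp add: aut_zero)
  then have "\<zero> \<in> Mon (h s) S d" using Mon_mono[OF R_S] by blast
  then show ?thesis using S.integral_mem[of "h s" d] sc L_frac[symmetric] by simp
qed

lemma aut_eval: "x \<in> carrier L \<Longrightarrow> set f \<subseteq> K \<Longrightarrow> h (eval f x) = eval f (h x)"
proof (induction f)
  case Nil
  then show ?case by (simp add: aut_zero)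
next
  case (Cons c f)
  have pw: "h (x [^] (n::nat)) = h x [^] n" for n
    using Cons.prems(1) by (induction n) (auto simp: aut_one aut_mult)
  have fc: "set f \<subseteq> carrier L" using Cons.prems(2) by auto
  have "eval f x \<in> carrier L" by (rule eval_in_carrier[OF fc Cons.prems(1)])
  then show ?case using Cons by (simp add: aut_add aut_mult pw)
qed

lemma aut_orbit: assumes "y \<in> orbit x" shows "h y \<in> orbit x"
proof -
  obtain g where t: "automorphism g" "y = g x" using orbitE[OF assms] by blast
  have "automorphism (h \<circ> g)" unfolding automorphism_def
    using ring_iso_set_trans[of g L L h L] aut_iso t(1) unfolding automorphism_def by auto
  from orbitI[OF this, of x] show ?thesis by (simp add: t(2))
qed

lemma Tr_aut: assumes x: "x \<in> carrier L" shows "Tr (h x) = Tr x"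
proof -
  let ?V = "\<lambda>i. h (U i)"
  have lin: "h (nsum (\<lambda>i. k i \<otimes> U i) N) = nsum (\<lambda>i. k i \<otimes> ?V i) N" if k: "\<forall>i<N. k i \<in> K" for k
  proof -
    have "h (nsum (\<lambda>i. k i \<otimes> U i) N) = nsum (\<lambda>i. h (k i \<otimes> U i)) N"
      using k Uc by (intro aut_nsum) simp
    also have "\<dots> = nsum (\<lambda>i. k i \<otimes> ?V i) N" using k Uc by (intro nsum_cong) (simp add: aut_mult)
    finally show ?thesis .
  qed
  have "indep N ?V" unfolding indep_def
  proof (intro conjI allI impI)
    fix i k assume i: "i < N" and k: "\<forall>i<N. k i \<in> K" and z: "nsum (\<lambda>i. k i \<otimes> ?V i) N = \<zero>"
    have "h (nsum (\<lambda>i. k i \<otimes> U i) N) = h \<zero>" using lin[OF k] z by (simp add: aut_zero)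
    then have "nsum (\<lambda>i. k i \<otimes> U i) N = \<zero>" by (rule aut_inj[rotated 2]) (use k Uc in simp_all)
    then show "k i = \<zero>" using U_indep[OF U_basis] k i unfolding indep_def by blast
  qed (use Uc in simp)
  then have V: "basis N ?V" by (rule indep_imp_basis[OF U_basis])
  have "co N ?V (h x \<otimes> ?V i) i = co N U (x \<otimes> U i) i" if i: "i < N" for i
  proof -
    have xU: "x \<otimes> U i \<in> carrier L" using x Uc[OF i] by simp
    have k: "\<forall>j<N. co N U (x \<otimes> U i) j \<in> K" using co_in_K[OF xU] by blast
    have "h x \<otimes> ?V i = h (x \<otimes> U i)" using aut_mult[OF x Uc[OF i]] by simp
    also have "\<dots> = h (nsum (\<lambda>j. co N U (x \<otimes> U i) j \<otimes> U j) N)" using co_expand[OF xU] by simp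
    also have "\<dots> = nsum (\<lambda>j. co N U (x \<otimes> U i) j \<otimes> ?V j) N" by (rule lin[OF k])
    finally have e: "h x \<otimes> ?V i = nsum (\<lambda>j. co N U (x \<otimes> U i) j \<otimes> ?V j) N" .
    show ?thesis unfolding e by (rule co_unique[OF V _ i]) (use k in simp)
  qed
  then have "tr N ?V (h x) = tr N U x" unfolding tr_def by (intro nsum_cong) simp
  then show ?thesis using Tr_eq[OF V] Tr_eq[OF U_basis] x by simp
qed

end

lemma finite_orbit:
  assumes fd: "finite_dimension K (carrier L)" and x: "x \<in> carrier L"
  shows "finite (orbit x)"
proof -
  have "(algebraic over K) x"
    by (rule finite_dimension_imp_algebraic[OF K carrier_is_subring fd x])
  then obtain f where f: "f \<in> carrier (K[X])" "f \<noteq> []" "eval f x = \<zero>"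
    using algebraicE[OF subfieldE(1)[OF K] x] by blast
  have pf: "polynomial K f" using f(1) by (simp add: univ_poly_carrier)
  have fK: "set f \<subseteq> K" using polynomial_incl[OF pf] .
  have "polynomial (carrier L) f" by (rule carrier_polynomial[OF subfieldE(1)[OF K] pf])
  then have "f \<in> carrier (poly_ring L)" by (simp add: univ_poly_carrier)
  then have fin: "finite {y. is_root f y}" by (rule finite_number_of_roots)
  have "orbit x \<subseteq> {y. is_root f y}"
  proof
    fix y assume "y \<in> orbit x"
    then obtain h where s: "automorphism h" "y = h x" using orbitE by blast
    have "eval f y = \<zero>" using aut_eval[OF s(1) x fK] f(3) aut_zero[OF s(1)] s(2) by simp
    then show "y \<in> {y. is_root f y}" unfolding is_root_def using aut_closed[OF s(1) x] s(2) f(2) by simp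
  qed
  then show ?thesis using fin finite_subset by blast
qed

lemma orbit_carrier: "x \<in> carrier L \<Longrightarrow> orbit x \<subseteq> carrier L"
  using orbitE aut_closed by (metis subsetI)

text \<open>An injective map of a finite set to itself is onto; in this way no inverse automorphisms are needed.\<close>

lemma orbit_image:
  assumes fd: "finite_dimension K (carrier L)" and x: "x \<in> carrier L" and s: "automorphism h"
  shows "h ` orbit x = orbit x"
proof (rule endo_inj_surj[OF finite_orbit[OF fd x]])
  show "h ` orbit x \<subseteq> orbit x" using aut_orbit[OF s] by (intro image_subsetI)
  show "inj_on h (orbit x)" by (rule inj_onI, rule aut_inj[OF s]) (use orbit_carrier[OF x] in auto)
qed

lemma trace_colon_aut:
  assumes fd: "finite_dimension K (carrier L)" and s: "s \<in> trace_colon P" and a: "automorphism h"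
  shows "h s \<in> trace_colon P"
proof -
  have sS: "s \<in> S" and T: "\<And>t. t \<in> S \<Longrightarrow> Tr (s \<otimes> t) \<in> P" using s by (auto simp: trace_colon_def)
  have sc: "s \<in> carrier L" using sS by simp
  have "Tr (h s \<otimes> t) \<in> P" if t: "t \<in> S" for t
  proof -
    have tc: "t \<in> carrier L" using t by simp
    have "t \<in> h ` orbit t" unfolding orbit_image[OF fd tc a] by (rule orbit_self)
    then obtain t' where t': "t' \<in> orbit t" "t = h t'" by blast
    then obtain g where "automorphism g" "t' = g t" using orbitE by blast
    then have t'S: "t' \<in> S" using aut_S t by blast
    have t'c: "t' \<in> carrier L" using t'S by simp
    have "h s \<otimes> t = h (s \<otimes> t')" unfolding t'(2) using aut_mult[OF a sc t'c] by simp
    then have "Tr (h s \<otimes> t) = Tr (s \<otimes> t')" using Tr_aut[OF a, of "s \<otimes> t'"] sc t'c by simp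
    then show ?thesis using T[OF t'S] by simp
  qed
  then show ?thesis using aut_S[OF a sS] by (simp add: trace_colon_def)
qed

text \<open>The ideal \<open>P\<^sup>T\<^sup>r\<close> is stable under the Galois group, and \<open>P\<^sup>T\<^sup>r \<inter> K = P\<close>: if \<open>Tr u = 1\<close> then \<open>Tr (c u) = c\<close> for \<open>c \<in> K\<close>. For \<open>s \<in> P\<^sup>T\<^sup>r\<close>
  the polynomial whose roots are the conjugates of \<open>s\<close> has its lower coefficients in \<open>P\<^sup>T\<^sup>r\<close> and, being invariant, in \<open>K\<close>. So they lie in
  \<open>P\<close>, and the polynomial shows that a power of \<open>s\<close> is in \<open>P S\<close>.\<close>

lemma galois_tame:
  assumes G: "finite_galois L K" and onto: "Tr ` S = R" and P: "P \<in> R.centers"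
  shows "tame P"
  unfolding tame_def
proof (intro equalityI subsetI CollectI conjI)
  note Pi = R.compatible_ideal[OF R.centersD(2)[OF P]]
  note J = trace_colon_ideal[OF Pi]
  have fd: "finite_dimension K (carrier L)" using G by (simp add: finite_galois_def)
  fix s assume s: "s \<in> trace_colon P"
  then show sS: "s \<in> S" by (simp add: trace_colon_def)
  have sc: "s \<in> carrier L" using sS by simp
  obtain xs where xs: "set xs = orbit s" "distinct xs"
    using finite_distinct_list[OF finite_orbit[OF fd sc]] by blast
  have xsc: "set xs \<subseteq> carrier L" using orbit_carrier[OF sc] xs(1) by simp
  have xsJ: "set xs \<subseteq> trace_colon P"
  proof
    fix y assume "y \<in> set xs"
    then obtain h where "automorphism h" "y = h s" using orbitE xs(1) by blast
    then show "y \<in> trace_colon P" using trace_colon_aut[OF fd s] by simp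
  qed
  have fixed: "h (root_coeff xs k) = root_coeff xs k" if a: "automorphism h" for h k
  proof -
    have "inj_on h (set xs)" by (rule inj_onI, rule aut_inj[OF a]) (use xsc in auto)
    then have "distinct (map h xs)" using xs(2) by (simp add: distinct_map)
    moreover have "set (map h xs) = set xs" using orbit_image[OF fd sc a] xs(1) by simp
    ultimately have m: "mset (map h xs) = mset xs" using xs(2) set_eq_iff_mset_eq_distinct by blast
    have "h (root_coeff xs k) = root_coeff (map h xs) k"
      by (rule root_coeff_hom[OF _ aut_one[OF a] aut_zero[OF a] _ _ _ xsc])
        (simp_all add: aut_closed[OF a] aut_mult[OF a] aut_add[OF a] aut_neg[OF a])
    also have "root_coeff (map h xs) = root_coeff xs"
      by (rule root_coeff_mset[OF m]) (use xsc aut_closed[OF a] in auto)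
    finally show ?thesis .
  qed
  have inP: "root_coeff xs k \<in> P" if k: "k < length xs" for k
  proof -
    let ?c = "root_coeff xs k"
    have cc: "?c \<in> carrier L" using xsc by simp
    have cJ: "?c \<in> trace_colon P" by (rule S.root_coeff_ideal[OF J xsJ k])
    then have cS: "?c \<in> S" and cT: "\<And>t. t \<in> S \<Longrightarrow> Tr (?c \<otimes> t) \<in> P" by (auto simp: trace_colon_def)
    have "?c \<in> {x \<in> carrier L. \<forall>h \<in> ring_iso L L. (\<forall>k\<in>K. h k = k) \<longrightarrow> h x = x}"
      using cc fixed unfolding automorphism_def by blast
    then have cK: "?c \<in> K" using G unfolding finite_galois_def by blast
    obtain u where u: "u \<in> S" "Tr u = \<one>" using onto R.A_one by (metis imageE)
    have "Tr (?c \<otimes> u) = ?c" using Tr_smult[OF cK, of u] u cc by simp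
    then show ?thesis using cT[OF u(1)] by simp
  qed
  have PS: "P \<subseteq> S" using R.I_A[OF Pi] R_S by blast
  note E = extended_ideal[OF PS]
  let ?low = "nsum (\<lambda>k. root_coeff xs k \<otimes> s [^] k) (length xs)"
  have low: "?low \<in> extended P"
  proof (rule S.I_nsum[OF E])
    fix k assume "k < length xs"
    then have "root_coeff xs k \<in> extended P" using inP extended_base by blast
    then show "root_coeff xs k \<otimes> s [^] k \<in> extended P" by (rule S.I_r[OF E S.A_pow[OF sS]])
  qed
  have "s \<in> set xs" using xs(1) orbit_self by simp
  from root_coeff_root[OF xsc this] have "?low \<oplus> s [^] length xs = \<zero>"
    using root_coeff_top[OF xsc] sc by simp
  then have "s [^] length xs \<oplus> ?low = \<zero>" using sc S.I_carr[OF E low] by (simp add: a_comm)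
  then have "s [^] length xs \<in> extended P"
    using S.I_add_cancel[OF E _ low, of "s [^] length xs"] S.I_zero[OF E] sc by simp
  then show "\<exists>n::nat. s [^] n \<in> extended P" by blast
next
  fix x assume "x \<in> {x \<in> S. \<exists>n::nat. x [^] n \<in> extended P}"
  then obtain n :: nat where "x \<in> S" "x [^] n \<in> extended P" by blast
  then show "x \<in> trace_colon P" by (rule radical_subset_trace_colon[OF R.centersD(2)[OF P]])
qed

end

section \<open>The equivalences\<close>

context finite_extension
begin

lemma tamely_ramified_over_iff: "tamely_ramified_over (L\<lparr>carrier := S\<rparr>) Tr P \<longleftrightarrow> tame P"
proof -
  have "Idl\<^bsub>L\<lparr>carrier := S\<rparr>\<^esub> P = extended P" by (simp add: genideal_def extended_def S.ideal_iff)
  then show ?thesis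
    by (simp add: tamely_ramified_over_def trace_ideal_def radical_def tame_def trace_colon_def S.A_npow)
qed

lemma fibered_iff: "fibered (L\<lparr>carrier := R\<rparr>) \<phi> (L\<lparr>carrier := S\<rparr>) \<psi> \<longleftrightarrow> fibers"
  by (simp add: fibered_def R.Schpec_eq S.Schpec_eq S.prime_iff fibers_def)

text \<open>As \<open>S\<close> is a domain, the zero ideal starts the chain of length two.\<close>

lemma height_ge2:
  assumes Q: "is_prime S Q" and Q': "is_prime S Q'" "Q' \<subset> Q" "Q' \<noteq> {\<zero>}"
  shows "2 \<le> height (L\<lparr>carrier := S\<rparr>) Q"
proof -
  define c :: "nat \<Rightarrow> 'a set" where "c i = (if i = 0 then {\<zero>} else if i = 1 then Q' else Q)" for i
  have "\<forall>i\<le>2. is_prime S (c i)" using Q Q'(1) S.zero_prime by (simp add: c_def)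
  moreover have "\<forall>i<2. c i \<subset> c (Suc i)"
  proof (intro allI impI)
    fix i :: nat assume "i < 2"
    then consider "i = 0" | "i = 1" by linarith
    then show "c i \<subset> c (Suc i)"
      using Q' S.I_zero[OF S.prime_ideal[OF Q'(1)]] by cases (auto simp: c_def)
  qed
  moreover have "c 2 = Q" by (simp add: c_def)
  ultimately have "\<exists>c. (\<forall>i\<le>2. primeideal (c i) (L\<lparr>carrier := S\<rparr>)) \<and> (\<forall>i<2. c i \<subset> c (Suc i)) \<and> c (2::nat) = Q"
    unfolding S.prime_iff by (intro exI[of _ c] conjI)
  then have "enat 2 \<le> height (L\<lparr>carrier := S\<rparr>) Q"
    unfolding height_def by (intro Sup_upper CollectI exI[of _ 2] conjI refl)
  then show ?thesis by (simp add: numeral_eq_enat)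
qed

lemma equivalences:
  defines "a \<equiv> \<forall>P \<in> Schpec (L\<lparr>carrier := R\<rparr>) \<phi>. tamely_ramified_over (L\<lparr>carrier := S\<rparr>) Tr P"
    and "t \<equiv> \<lambda>Q. Tr ` test_ideal_along (L\<lparr>carrier := S\<rparr>) \<psi> Q = test_ideal_along (L\<lparr>carrier := R\<rparr>) \<phi> (Q \<inter> R)"
    and "f \<equiv> fibered (L\<lparr>carrier := R\<rparr>) \<phi> (L\<lparr>carrier := S\<rparr>) \<psi>"
  shows "a \<longleftrightarrow> f \<and> (\<forall>Q \<in> Schpec (L\<lparr>carrier := S\<rparr>) \<psi>. t Q)"
    and "a \<longleftrightarrow> f \<and> (\<forall>Q \<in> Schpec (L\<lparr>carrier := S\<rparr>) \<psi>. 2 \<le> height (L\<lparr>carrier := S\<rparr>) Q \<longrightarrow> t Q)"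
    and "a \<Longrightarrow> Tr ` S = R"
    and "finite_galois L K \<Longrightarrow> Tr ` S = R \<Longrightarrow> a"
proof -
  have a: "a \<longleftrightarrow> (\<forall>P\<in>R.centers. tame P)"
    unfolding a_def R.Schpec_eq tamely_ramified_over_iff ..
  have f: "f \<longleftrightarrow> fibers" unfolding f_def by (rule fibered_iff)
  have t: "t Q \<longleftrightarrow> Tr ` S.test_ideal Q = R.test_ideal (Q \<inter> R)" if Q: "Q \<in> S.centers" for Q
    unfolding t_def S.test_ideal_along_eq[OF S.centersD(1)[OF Q]]
      R.test_ideal_along_eq[OF R.centersD(1)[OF contract_center[OF Q]]] ..
  have ab: "f \<and> (\<forall>Q\<in>S.centers. t Q)" if a
  proof (intro conjI ballI)
    show f unfolding f by (rule tame_imp_fibers) (use \<open>a\<close> in \<open>simp add: a\<close>)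
    fix Q assume Q: "Q \<in> S.centers"
    show "t Q" unfolding t[OF Q] by (rule tame_imp_trace[OF Q]) (use \<open>a\<close> contract_center[OF Q] in \<open>simp add: a\<close>)
  qed
  have ca: a if c: "f" "\<forall>Q\<in>S.centers. 2 \<le> height (L\<lparr>carrier := S\<rparr>) Q \<longrightarrow> t Q"
    unfolding a
  proof
    fix P assume P: "P \<in> R.centers"
    show "tame P"
    proof (rule fibers_imp_tame[OF _ P])
      show fibers using c(1) f by simp
      fix Q assume Q: "Q \<in> S.centers" "Q \<inter> R = P" "\<exists>Q'. is_prime S Q' \<and> Q' \<subset> Q \<and> Q' \<noteq> {\<zero>}"
      then have "2 \<le> height (L\<lparr>carrier := S\<rparr>) Q" using height_ge2[OF S.centersD(1)[OF Q(1)]] by blast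
      then have "t Q" using c(2) Q(1) by blast
      then show "Tr ` S.test_ideal Q = R.test_ideal P" using t[OF Q(1)] Q(2) by simp
    qed
  qed
  show "a \<longleftrightarrow> f \<and> (\<forall>Q \<in> Schpec (L\<lparr>carrier := S\<rparr>) \<psi>. t Q)"
    unfolding S.Schpec_eq using ab ca by blast
  show "a \<longleftrightarrow> f \<and> (\<forall>Q \<in> Schpec (L\<lparr>carrier := S\<rparr>) \<psi>. 2 \<le> height (L\<lparr>carrier := S\<rparr>) Q \<longrightarrow> t Q)"
    unfolding S.Schpec_eq using ab ca by blast
  show "Tr ` S = R" if a by (rule tame_imp_trace_surjective) (use \<open>a\<close> in \<open>simp add: a\<close>)
  show a if "finite_galois L K" "Tr ` S = R" unfolding a using galois_tame[OF that] by blast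
qed

end

section \<open>Generators of iterated Frobenius modules\<close>

context ring
begin

lemma nsum_append:
  "(\<And>i. i < m + n \<Longrightarrow> F i \<in> carrier R) \<Longrightarrow> nsum F (m + n) = nsum F m \<oplus> nsum (\<lambda>j. F (m + j)) n"
  by (induction n) (simp_all add: a_assoc)

lemma nsum_nsum:
  assumes "0 < m" "\<And>i j. i < n \<Longrightarrow> j < m \<Longrightarrow> F i j \<in> carrier R"
  shows "nsum (\<lambda>i. nsum (F i) m) n = nsum (\<lambda>k. F (k div m) (k mod m)) (n * m)"
  using assms(2)
proof (induction n)
  case (Suc n)
  have c: "F (k div m) (k mod m) \<in> carrier R" if "k < n * m + m" for k
  proof (rule Suc.prems)
    show "k div m < Suc n" using that assms(1) by (simp add: less_mult_imp_div_less)
  qed (use assms(1) in simp)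
  have "nsum (\<lambda>k. F (k div m) (k mod m)) (Suc n * m) = nsum (\<lambda>k. F (k div m) (k mod m)) (n * m + m)"
    by (simp add: add.commute)
  also have "\<dots> = nsum (\<lambda>k. F (k div m) (k mod m)) (n * m) \<oplus>
      nsum (\<lambda>j. F ((n * m + j) div m) ((n * m + j) mod m)) m" by (rule nsum_append[OF c])
  also have "nsum (\<lambda>j. F ((n * m + j) div m) ((n * m + j) mod m)) m = nsum (F n) m"
    by (rule nsum_cong) simp
  finally show ?case using Suc by simp
qed simp

lemma generators_compose:
  fixes T :: "'a \<Rightarrow> 'a" and n m :: nat
  assumes T: "\<And>u. u \<in> B \<Longrightarrow> T u \<in> carrier R" and B: "b \<in> B"
    and g: "\<And>i. i < n \<Longrightarrow> g i \<in> carrier R" and h: "\<And>j. j < m \<Longrightarrow> h j \<in> carrier R"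
    and y: "\<And>i. i < n \<Longrightarrow> \<exists>u. (\<forall>j<m. u j \<in> B) \<and> y i = nsum (\<lambda>j. T (u j) \<otimes> h j) m"
  shows "\<exists>w. (\<forall>k<n * m. w k \<in> B) \<and>
    nsum (\<lambda>i. y i \<otimes> g i) n = nsum (\<lambda>k. T (w k) \<otimes> (h (k mod m) \<otimes> g (k div m))) (n * m)"
proof (cases "m = 0")
  case True
  then have "y i = \<zero>" if "i < n" for i using y[OF that] by auto
  then show ?thesis using True g by simp
next
  case False
  have "\<forall>i. i < n \<longrightarrow> (\<exists>u. (\<forall>j<m. u j \<in> B) \<and> y i = nsum (\<lambda>j. T (u j) \<otimes> h j) m)" using y by blast
  then obtain u where u: "\<And>i. i < n \<Longrightarrow> (\<forall>j<m. u i j \<in> B) \<and> y i = nsum (\<lambda>j. T (u i j) \<otimes> h j) m"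
    by metis
  have Tu: "T (u i j) \<in> carrier R" if "i < n" "j < m" for i j using T u that by blast
  have "nsum (\<lambda>i. y i \<otimes> g i) n = nsum (\<lambda>i. nsum (\<lambda>j. T (u i j) \<otimes> (h j \<otimes> g i)) m) n"
  proof (rule nsum_cong)
    fix i assume i: "i < n"
    have "y i \<otimes> g i = nsum (\<lambda>j. T (u i j) \<otimes> h j) m \<otimes> g i" using u[OF i] by simp
    also have "\<dots> = nsum (\<lambda>j. T (u i j) \<otimes> h j \<otimes> g i) m" using Tu[OF i] h g[OF i] by (intro nsum_rdistr) simp_all
    also have "\<dots> = nsum (\<lambda>j. T (u i j) \<otimes> (h j \<otimes> g i)) m"
      using Tu[OF i] h g[OF i] by (intro nsum_cong) (simp add: m_assoc)
    finally show "y i \<otimes> g i = nsum (\<lambda>j. T (u i j) \<otimes> (h j \<otimes> g i)) m" .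
  qed
  also have "\<dots> = nsum (\<lambda>k. T (u (k div m) (k mod m)) \<otimes> (h (k mod m) \<otimes> g (k div m))) (n * m)"
    using False Tu h g by (intro nsum_nsum) simp_all
  finally have e: "nsum (\<lambda>i. y i \<otimes> g i) n =
    nsum (\<lambda>k. T (u (k div m) (k mod m)) \<otimes> (h (k mod m) \<otimes> g (k div m))) (n * m)" .
  have "u (k div m) (k mod m) \<in> B" if "k < n * m" for k
    using u[of "k div m"] that False by (simp add: less_mult_imp_div_less)
  then show ?thesis using e by (intro exI[of _ "\<lambda>k. u (k div m) (k mod m)"] conjI allI impI)
qed

end

context subring_in
begin

text \<open>The module structures in question share their additive group with the subring, so a sum in them is a sum in
  the ambient field.\<close>

lemma finsum_nsum:
  fixes M :: "('r, 'a) module"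
  assumes M: "carrier M = A" "add M = add L" "ring.zero M = \<zero>"
  shows "distinct xs \<Longrightarrow> (\<And>x. x \<in> set xs \<Longrightarrow> v x \<in> A) \<Longrightarrow>
    finsum M v (set xs) = nsum (\<lambda>i. v (xs ! i)) (length xs)"
proof (induction xs rule: rev_induct)
  interpret M: abelian_monoid M
    by (rule abelian_monoidI) (auto simp: M a_assoc intro: a_comm)
  case Nil
  then show ?case by (simp add: M)
next
  interpret M: abelian_monoid M
    by (rule abelian_monoidI) (auto simp: M a_assoc intro: a_comm)
  case (snoc x xs)
  have vA: "v y \<in> A" if "y \<in> set xs" for y using snoc.prems(2) that by simp
  have "finsum M v (set (xs @ [x])) = finsum M v (insert x (set xs))" by simp
  also have "\<dots> = v x \<oplus> finsum M v (set xs)"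
  proof -
    have "finsum M v (insert x (set xs)) = v x \<oplus>\<^bsub>M\<^esub> finsum M v (set xs)"
      using snoc.prems M(1) by (intro M.finsum_insert) auto
    then show ?thesis by (simp add: M)
  qed
  also have "\<dots> = v x \<oplus> nsum (\<lambda>i. v (xs ! i)) (length xs)" using snoc.IH snoc.prems by simp
  also have "\<dots> = nsum (\<lambda>i. v (xs ! i)) (length xs) \<oplus> v x"
    using vA snoc.prems(2)[of x] by (intro a_comm nsum_closed) simp_all
  also have "nsum (\<lambda>i. v (xs ! i)) (length xs) = nsum (\<lambda>i. v ((xs @ [x]) ! i)) (length xs)"
    by (rule nsum_cong) (simp add: nth_append)
  finally show ?case by simp
qed

lemma finitely_generated_nsum:
  fixes M :: "('a, 'a) module"
  assumes M: "carrier M = A" "add M = add L" "ring.zero M = \<zero>"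
    and sm: "\<And>c x. c \<in> B \<Longrightarrow> x \<in> A \<Longrightarrow> c \<odot>\<^bsub>M\<^esub> x \<in> A"
    and fg: "finitely_generated_module (L\<lparr>carrier := B\<rparr>) M"
  shows "\<exists>n g. (\<forall>i<n. g i \<in> A) \<and>
    (\<forall>x\<in>A. \<exists>c. (\<forall>i<n. c i \<in> B) \<and> x = nsum (\<lambda>i. c i \<odot>\<^bsub>M\<^esub> g i) n)"
proof -
  obtain G where G: "G \<subseteq> A" "finite G"
    and span: "A = {finsum M (\<lambda>x. c x \<odot>\<^bsub>M\<^esub> x) G | c. c \<in> G \<rightarrow> B}"
    using fg unfolding finitely_generated_module_def M(1) by auto
  obtain xs where xs: "set xs = G" "distinct xs" using finite_distinct_list[OF G(2)] by blast
  have "\<exists>c. (\<forall>i<length xs. c i \<in> B) \<and> x = nsum (\<lambda>i. c i \<odot>\<^bsub>M\<^esub> (xs ! i)) (length xs)" if x: "x \<in> A" for x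
  proof -
    have "\<exists>c. x = finsum M (\<lambda>x. c x \<odot>\<^bsub>M\<^esub> x) G \<and> c \<in> G \<rightarrow> B"
      using x by (subst (asm) span) (simp only: mem_Collect_eq)
    then obtain c where c: "x = finsum M (\<lambda>x. c x \<odot>\<^bsub>M\<^esub> x) G" "c \<in> G \<rightarrow> B" by blast
    have "finsum M (\<lambda>x. c x \<odot>\<^bsub>M\<^esub> x) (set xs) = nsum (\<lambda>i. c (xs ! i) \<odot>\<^bsub>M\<^esub> (xs ! i)) (length xs)"
      by (rule finsum_nsum[OF M xs(2)]) (use c(2) G(1) xs(1) sm in blast)
    then have "x = nsum (\<lambda>i. c (xs ! i) \<odot>\<^bsub>M\<^esub> (xs ! i)) (length xs)" using c(1) xs(1) by simp
    moreover have "\<forall>i<length xs. c (xs ! i) \<in> B" using c(2) xs(1) by auto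
    ultimately show ?thesis by (intro exI[of _ "\<lambda>i. c (xs ! i)"] conjI)
  qed
  note span' = this
  have gens: "xs ! i \<in> A" if "i < length xs" for i using xs(1) G(1) that by auto
  show ?thesis
    by (rule exI[of _ "length xs"], rule exI[of _ "\<lambda>i. xs ! i"], intro conjI ballI allI impI, erule gens, erule span')
qed

text \<open>\<open>F\<^bsup>k + 1\<^esup>\<^sub>*A\<close> is generated by the products of the generators of \<open>F\<^sup>k\<^sub>*A\<close> and the \<open>p\<^sup>k\<close>-th powers of those of \<open>F\<^sub>*A\<close>.\<close>

lemma iterated_frobenius_generators:
  assumes p: "Factorial_Ring.prime (p::nat)" and ch: "add_pow L p \<one> = \<zero>"
    and gen: "\<exists>n g. (\<forall>i<n. g i \<in> A) \<and>
      (\<forall>x\<in>A. \<exists>a. (\<forall>i<n. a i \<in> A) \<and> x = nsum (\<lambda>i. a i [^] p \<otimes> g i) n)"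
  shows "\<exists>n g. (\<forall>i<n. g i \<in> A) \<and>
      (\<forall>x\<in>A. \<exists>a. (\<forall>i<n. a i \<in> A) \<and> x = nsum (\<lambda>i. a i [^] (p ^ k) \<otimes> g i) n)"
proof (induction k)
  case 0
  have "\<exists>a. (\<forall>i<(1::nat). a i \<in> A) \<and> x = nsum (\<lambda>i. a i [^] (p ^ 0) \<otimes> \<one>) 1" if "x \<in> A" for x
    using that by (intro exI[of _ "\<lambda>_. x"]) (simp add: nat_pow_eone)
  then show ?case by (intro exI[of _ 1] exI[of _ "\<lambda>_. \<one>"]) simp
next
  case (Suc k)
  interpret F: frobenius_field L p 1 p
    by (intro frobenius_field.intro ambient_field_axioms frobenius_field_axioms.intro p ch) simp_all
  obtain m h where h: "\<forall>j<m. h j \<in> A"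
    and hs: "\<forall>x\<in>A. \<exists>a. (\<forall>j<m. a j \<in> A) \<and> x = nsum (\<lambda>j. a j [^] p \<otimes> h j) m" using gen by blast
  obtain n g where g: "\<forall>i<n. g i \<in> A"
    and gs: "\<forall>x\<in>A. \<exists>a. (\<forall>i<n. a i \<in> A) \<and> x = nsum (\<lambda>i. a i [^] (p ^ k) \<otimes> g i) n" using Suc by blast
  have "\<exists>w. (\<forall>i<n * m. w i \<in> A) \<and>
      x = nsum (\<lambda>i. w i [^] (p ^ Suc k) \<otimes> (h (i mod m) [^] (p ^ k) \<otimes> g (i div m))) (n * m)" if x: "x \<in> A" for x
  proof -
    obtain a where a: "\<forall>i<n. a i \<in> A" "x = nsum (\<lambda>i. a i [^] (p ^ k) \<otimes> g i) n" using gs x by blast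
    have "\<exists>u. (\<forall>j<m. u j \<in> A) \<and> a i [^] (p ^ k) = nsum (\<lambda>j. u j [^] (p ^ Suc k) \<otimes> h j [^] (p ^ k)) m"
      if i: "i < n" for i
    proof -
      obtain u where u: "\<forall>j<m. u j \<in> A" "a i = nsum (\<lambda>j. u j [^] p \<otimes> h j) m" using hs a(1) i by blast
      have "a i [^] (p ^ k) = nsum (\<lambda>j. (u j [^] p \<otimes> h j) [^] (p ^ k)) m"
        unfolding u(2) using u(1) h by (intro F.power_p_nsum) simp
      also have "\<dots> = nsum (\<lambda>j. u j [^] (p ^ Suc k) \<otimes> h j [^] (p ^ k)) m"
        using u(1) h by (intro nsum_cong) (simp add: nat_pow_distrib nat_pow_pow)
      finally show ?thesis using u(1) by blast
    qed
    then show ?thesis unfolding a(2)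
      using generators_compose[of A "\<lambda>u. u [^] (p ^ Suc k)" \<zero> n g m "\<lambda>j. h j [^] (p ^ k)" "\<lambda>i. a i [^] (p ^ k)"]
        g h by simp
  qed
  note span = this
  have gens: "h (i mod m) [^] (p ^ k) \<otimes> g (i div m) \<in> A" if "i < n * m" for i
  proof -
    have "0 < m" using that by (cases m) auto
    then show ?thesis using g h that by (simp add: less_mult_imp_div_less)
  qed
  show ?case
    by (rule exI[of _ "n * m"], rule exI[of _ "\<lambda>i. h (i mod m) [^] (p ^ k) \<otimes> g (i div m)"],
        intro conjI ballI allI impI, erule gens, erule span)
qed

lemma linear_map_split:
  fixes f :: "'a \<Rightarrow> 'a"
  assumes f: "f \<in> linear_maps (L\<lparr>carrier := A\<rparr>) (frobenius_pushforward q (L\<lparr>carrier := A\<rparr>)) (mult_module (L\<lparr>carrier := A\<rparr>))"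
  shows "x \<in> A \<Longrightarrow> f x \<in> A"
    and "x \<in> A \<Longrightarrow> y \<in> A \<Longrightarrow> f (x \<oplus> y) = f x \<oplus> f y"
    and "r \<in> A \<Longrightarrow> x \<in> A \<Longrightarrow> f (r [^] q \<otimes> x) = r \<otimes> f x"
  using f unfolding linear_maps_def frobenius_pushforward_def mult_module_def by (auto simp: A_npow)

end

theorem mainTheorem3:
  fixes L :: "('a, 'm) ring_scheme"
    and R S K :: "'a set"
    and \<phi> \<psi> Tr :: "'a \<Rightarrow> 'a"
    and p e q :: nat
  assumes p: "Factorial_Ring.prime p" and e: "1 \<le> e" and q: "q = p ^ e"
    and L: "field L"
    and R: "subring R L" "noetherian_domain (L\<lparr>carrier := R\<rparr>)" "normal_subring L R"
    and R_char: "[p] \<cdot>\<^bsub>L\<^esub> \<one>\<^bsub>L\<^esub> = \<zero>\<^bsub>L\<^esub>"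
    and R_F_finite: "F_finite p (L\<lparr>carrier := R\<rparr>)"
    and K: "K = fraction_field_in L R"
    and \<phi>: "\<phi> \<in> linear_maps (L\<lparr>carrier := R\<rparr>)
               (frobenius_pushforward q (L\<lparr>carrier := R\<rparr>)) (mult_module (L\<lparr>carrier := R\<rparr>))"
    and \<phi>_surj: "\<phi> ` R = R"
    and S: "subring S L" "noetherian_domain (L\<lparr>carrier := S\<rparr>)" "normal_subring L S"
    and R_S: "R \<subseteq> S"
    and finite_ext:
      "finitely_generated_module (L\<lparr>carrier := R\<rparr>) (mult_module (L\<lparr>carrier := S\<rparr>))"
    and L_frac: "carrier L = fraction_field_in L S"
    and \<psi>: "\<psi> \<in> linear_maps (L\<lparr>carrier := S\<rparr>)
               (frobenius_pushforward q (L\<lparr>carrier := S\<rparr>)) (mult_module (L\<lparr>carrier := S\<rparr>))"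
    and extends: "\<forall>r\<in>R. \<psi> r = \<phi> r"
    and Tr: "Tr = field_trace L K"
  shows
    "let A = L\<lparr>carrier := R\<rparr>;
         B = L\<lparr>carrier := S\<rparr>;
         a = (\<forall>\<pp> \<in> Schpec A \<phi>. tamely_ramified_over B Tr \<pp>);
         b = (fibered A \<phi> B \<psi> \<and>
              (\<forall>\<qq> \<in> Schpec B \<psi>.
                 Tr ` test_ideal_along B \<psi> \<qq> = test_ideal_along A \<phi> (\<qq> \<inter> R)));
         c = (fibered A \<phi> B \<psi> \<and>
              (\<forall>\<qq> \<in> Schpec B \<psi>. 2 \<le> height B \<qq> \<longrightarrow>
                 Tr ` test_ideal_along B \<psi> \<qq> = test_ideal_along A \<phi> (\<qq> \<inter> R)))
     in (a \<longleftrightarrow> b) \<and> (b \<longleftrightarrow> c) \<and>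
        (a \<longrightarrow> Tr ` S = R) \<and>
        (finite_galois L K \<longrightarrow> Tr ` S = R \<longrightarrow> a)"
proof -
  interpret L: ambient_field L using L by (rule ambient_field.intro)
  interpret L: frobenius_field L p e q
    by (intro frobenius_field.intro L.ambient_field_axioms frobenius_field_axioms.intro p e q R_char)
  interpret R: subring_in L R
    by (intro subring_in.intro L.ambient_field_axioms subring_in_axioms.intro R(1))
  interpret S: subring_in L S
    by (intro subring_in.intro L.ambient_field_axioms subring_in_axioms.intro S(1))
  interpret R: noetherian_in L R
    by (intro noetherian_in.intro R.subring_in_axioms noetherian_in_axioms.intro noetherian_domain.axioms(1)[OF R(2)])
  interpret S: noetherian_in L S
    by (intro noetherian_in.intro S.subring_in_axioms noetherian_in_axioms.intro noetherian_domain.axioms(1)[OF S(2)])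
  have RS: "r \<in> S" if "r \<in> R" for r using R_S that by blast
  obtain x1 where x1: "x1 \<in> R" "\<phi> x1 = \<one>\<^bsub>L\<^esub>" using \<phi>_surj R.A_one by (metis imageE)
  have R_sp: "frobenius_split L p e q R \<phi>"
    by (intro frobenius_split.intro frobenius_split_axioms.intro L.frobenius_field_axioms R.noetherian_in_axioms
        R.linear_map_split[OF \<phi>]) (use x1 in blast)+
  have S_sp: "frobenius_split L p e q S \<psi>"
    by (intro frobenius_split.intro frobenius_split_axioms.intro L.frobenius_field_axioms S.noetherian_in_axioms
        S.linear_map_split[OF \<psi>]) (use x1 extends RS in force)+
  have "\<exists>n g. (\<forall>i<n. g i \<in> R) \<and> (\<forall>x\<in>R. \<exists>c. (\<forall>i<n. c i \<in> R) \<and>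
      x = L.nsum (\<lambda>i. c i \<odot>\<^bsub>frobenius_pushforward p (L\<lparr>carrier := R\<rparr>)\<^esub> g i) n)"
    by (rule R.finitely_generated_nsum)
      (use R_F_finite in \<open>simp_all add: F_finite_def\<close>, simp_all add: frobenius_pushforward_def R.A_npow)
  then have Rp: "\<exists>n g. (\<forall>i<n. g i \<in> R) \<and> (\<forall>x\<in>R. \<exists>c. (\<forall>i<n. c i \<in> R) \<and>
      x = L.nsum (\<lambda>i. c i [^]\<^bsub>L\<^esub> p \<otimes>\<^bsub>L\<^esub> g i) n)"
    by (simp add: frobenius_pushforward_def R.A_npow)
  have Rq: "\<exists>n g. (\<forall>i<n. g i \<in> R) \<and> (\<forall>x\<in>R. \<exists>c. (\<forall>i<n. c i \<in> R) \<and>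
      x = L.nsum (\<lambda>i. c i [^]\<^bsub>L\<^esub> q \<otimes>\<^bsub>L\<^esub> g i) n)"
    unfolding q by (rule R.iterated_frobenius_generators[OF p R_char Rp])
  have "\<exists>n g. (\<forall>i<n. g i \<in> S) \<and> (\<forall>x\<in>S. \<exists>c. (\<forall>i<n. c i \<in> R) \<and>
      x = L.nsum (\<lambda>i. c i \<odot>\<^bsub>mult_module (L\<lparr>carrier := S\<rparr>)\<^esub> g i) n)"
    by (rule S.finitely_generated_nsum) (use finite_ext RS in \<open>simp_all add: mult_module_def\<close>)
  then have fin: "\<exists>n g. (\<forall>i<n. g i \<in> S) \<and> (\<forall>x\<in>S. \<exists>c. (\<forall>i<n. c i \<in> R) \<and>
      x = L.nsum (\<lambda>i. c i \<otimes>\<^bsub>L\<^esub> g i) n)"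
    by (simp add: mult_module_def)
  have Sq: "\<exists>n g. (\<forall>i<n. g i \<in> S) \<and> (\<forall>x\<in>S. \<exists>c. (\<forall>i<n. c i \<in> S) \<and>
      x = L.nsum (\<lambda>i. c i [^]\<^bsub>L\<^esub> q \<otimes>\<^bsub>L\<^esub> g i) n)"
  proof -
    obtain m h where h: "\<forall>j<m. h j \<in> R"
      and hs: "\<forall>x\<in>R. \<exists>a. (\<forall>j<m. a j \<in> R) \<and> x = L.nsum (\<lambda>j. a j [^]\<^bsub>L\<^esub> q \<otimes>\<^bsub>L\<^esub> h j) m" using Rq by blast
    obtain n g where g: "\<forall>i<n. g i \<in> S"
      and gs: "\<forall>x\<in>S. \<exists>a. (\<forall>i<n. a i \<in> R) \<and> x = L.nsum (\<lambda>i. a i \<otimes>\<^bsub>L\<^esub> g i) n" using fin by blast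
    have "\<exists>w. (\<forall>i<n * m. w i \<in> R) \<and>
        x = L.nsum (\<lambda>i. w i [^]\<^bsub>L\<^esub> q \<otimes>\<^bsub>L\<^esub> (h (i mod m) \<otimes>\<^bsub>L\<^esub> g (i div m))) (n * m)" if x: "x \<in> S" for x
    proof -
      obtain a where a: "\<forall>i<n. a i \<in> R" "x = L.nsum (\<lambda>i. a i \<otimes>\<^bsub>L\<^esub> g i) n" using gs x by blast
      show ?thesis unfolding a(2)
        by (rule L.generators_compose[of R "\<lambda>u. u [^]\<^bsub>L\<^esub> q" "\<zero>\<^bsub>L\<^esub>"]) (use a(1) hs g h in simp_all)
    qed
    then have "\<exists>w. (\<forall>i<n * m. w i \<in> S) \<and>
        x = L.nsum (\<lambda>i. w i [^]\<^bsub>L\<^esub> q \<otimes>\<^bsub>L\<^esub> (h (i mod m) \<otimes>\<^bsub>L\<^esub> g (i div m))) (n * m)" if "x \<in> S" for x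
      using RS that by meson
    note span = this
    have gens: "h (i mod m) \<otimes>\<^bsub>L\<^esub> g (i div m) \<in> S" if "i < n * m" for i
    proof -
      have "0 < m" using that by (cases m) auto
      then show ?thesis using g h RS that by (simp add: less_mult_imp_div_less)
    qed
    show ?thesis
      by (rule exI[of _ "n * m"], rule exI[of _ "\<lambda>i. h (i mod m) \<otimes>\<^bsub>L\<^esub> g (i div m)"],
          intro conjI ballI allI impI, erule gens, erule span)
  qed
  have fe: "finite_extension L p e q R S K \<phi> \<psi>"
    by (intro finite_extension.intro finite_extension_axioms.intro L.frobenius_field_axioms
        F_finite_split.intro F_finite_split_axioms.intro R_sp S_sp Rq Sq R(3) S(3) R_S K L_frac fin)
      (use extends in blast)
  show ?thesis
    unfolding Let_def Tr using finite_extension.equivalences[OF fe] by blast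
qed

end
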